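(* Let $B$ be a finite simple skew brace such that $(B,\cdot)$ is nilpotent. Then $B\simeq \operatorname{Triv}(C_p)$ for some prime $p$.
   Context: A skew brace is a triple $B=(B,+,\cdot)$ such that $(B,+)$ and $(B,\cdot)$ are groups (neither assumed abelian) on the same underlying set and $a\cdot(b+c)=a\cdot b-a+a\cdot c$ for all $a,b,c\in B$. The two identity elements coincide and are denoted by $0$. For $a\in B$, $\lambda_a(b)=-a+a\cdot b$ defines an automorphism of $(B,+)$. A left ideal of $B$ is a subgroup $I\leq (B,+)$ with $\lambda_b(I)=I$ for every $b\in B$. An ideal of $B$ is a left ideal that is normal in both $(B,+)$ and $(B,\cdot)$. A skew brace $B$ is simple if $|B|>1$ and its only ideals are $0$ and $B$. For a group $G$, $\operatorname{Triv}(G)$ is the skew brace on $G$ whose two operations both equal the operation of $G$. $C_p$ is the cyclic group of order $p$. Isomorphisms of skew braces are bijections preserving both operations. *)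

theory Defs
  imports
    "HOL-Algebra.Elementary_Groups"
    "HOL-Algebra.Ring"
    "HOL-Computational_Algebra.Primes"
begin

section \<open>Skew braces\<close>

text \<open>
  The record type of rings is reused as a signature: a carrier with two operations and their
  identity elements. The multiplicative group is \<open>B\<close> itself, the additive one is
  \<open>add_monoid B\<close>, and neither is assumed commutative. That the two identity elements
  coincide is a consequence, see \<open>one_eq_zero\<close> below.
\<close>

locale skew_brace = add: group "add_monoid B" + mult: group B for B (structure) +
  assumes brace_distrib:
    "\<lbrakk>a \<in> carrier B; b \<in> carrier B; c \<in> carrier B\<rbrakk>
      \<Longrightarrow> a \<otimes> (b \<oplus> c) = ((a \<otimes> b) \<oplus> (\<ominus> a)) \<oplus> (a \<otimes> c)"

definition brace_lambda :: "('a, 'm) ring_scheme \<Rightarrow> 'a \<Rightarrow> 'a \<Rightarrow> 'a" where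
  "brace_lambda B a b = (\<ominus>\<^bsub>B\<^esub> a) \<oplus>\<^bsub>B\<^esub> (a \<otimes>\<^bsub>B\<^esub> b)"

definition brace_left_ideal :: "'a set \<Rightarrow> ('a, 'm) ring_scheme \<Rightarrow> bool" where
  "brace_left_ideal I B \<longleftrightarrow>
     subgroup I (add_monoid B) \<and> (\<forall>b\<in>carrier B. brace_lambda B b ` I = I)"

definition brace_ideal :: "'a set \<Rightarrow> ('a, 'm) ring_scheme \<Rightarrow> bool" where
  "brace_ideal I B \<longleftrightarrow> brace_left_ideal I B \<and> I \<lhd> add_monoid B \<and> I \<lhd> B"

text \<open>
  The condition \<open>|B| > 1\<close> is written without \<open>card\<close>, which is \<open>0\<close> on infinite sets.
\<close>

definition simple_skew_brace :: "('a, 'm) ring_scheme \<Rightarrow> bool" where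
  "simple_skew_brace B \<longleftrightarrow>
     skew_brace B \<and> carrier B \<noteq> {\<zero>\<^bsub>B\<^esub>} \<and>
     (\<forall>I. brace_ideal I B \<longrightarrow> I = {\<zero>\<^bsub>B\<^esub>} \<or> I = carrier B)"

definition Triv :: "('a, 'm) monoid_scheme \<Rightarrow> 'a ring" where
  "Triv G = \<lparr>carrier = carrier G, monoid.mult = monoid.mult G, one = \<one>\<^bsub>G\<^esub>,
             zero = \<one>\<^bsub>G\<^esub>, add = monoid.mult G\<rparr>"

definition brace_iso :: "('a, 'm) ring_scheme \<Rightarrow> ('b, 'n) ring_scheme \<Rightarrow> ('a \<Rightarrow> 'b) set" where
  "brace_iso B C = iso (add_monoid B) (add_monoid C) \<inter> iso B C"

definition brace_isomorphic :: "('a, 'm) ring_scheme \<Rightarrow> ('b, 'n) ring_scheme \<Rightarrow> bool" where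
  "brace_isomorphic B C \<longleftrightarrow> brace_iso B C \<noteq> {}"


section \<open>Nilpotent groups\<close>

fun lower_central_series :: "('a, 'm) monoid_scheme \<Rightarrow> nat \<Rightarrow> 'a set" where
  "lower_central_series G 0 = carrier G"
| "lower_central_series G (Suc n) =
     generate G (\<Union>x\<in>lower_central_series G n. \<Union>y\<in>carrier G.
       {x \<otimes>\<^bsub>G\<^esub> y \<otimes>\<^bsub>G\<^esub> inv\<^bsub>G\<^esub> x \<otimes>\<^bsub>G\<^esub> inv\<^bsub>G\<^esub> y})"

definition nilpotent_group :: "('a, 'm) monoid_scheme \<Rightarrow> bool" where
  "nilpotent_group G \<longleftrightarrow> group G \<and> (\<exists>n. lower_central_series G n = {\<one>\<^bsub>G\<^esub>})"


section \<open>Basic consistency facts\<close>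

lemma (in skew_brace) one_eq_zero: "\<one> = \<zero>"
proof -
  have z: "\<zero> \<in> carrier B" using add.one_closed by simp
  have e: "\<one> \<in> carrier B" by (rule mult.one_closed)
  have m: "\<ominus> \<one> \<in> carrier B" using add.inv_closed e by (simp add: a_inv_def)
  have zz: "\<zero> \<oplus> \<zero> = \<zero>" using add.r_one[of "\<zero>"] z by simp
  have "\<zero> = (\<zero> \<oplus> (\<ominus> \<one>)) \<oplus> \<zero>"
    using brace_distrib[OF e z z] zz z by simp
  also have "\<dots> = \<ominus> \<one>" using add.l_one[of "\<ominus> \<one>"] add.r_one[of "\<ominus> \<one>"] m by simp
  finally have "\<ominus> \<one> = \<zero>" by simp
  then have "inv\<^bsub>add_monoid B\<^esub> \<one> = \<one>\<^bsub>add_monoid B\<^esub>" by (simp add: a_inv_def)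
  then show ?thesis using add.inv_eq_1_iff[of "\<one>"] e by simp
qed

lemma skew_brace_Triv:
  assumes "group G"
  shows "skew_brace (Triv G)"
proof -
  interpret G: group G by fact
  have eq: "add_monoid (Triv G) = \<lparr>carrier = carrier G, monoid.mult = monoid.mult G, one = \<one>\<^bsub>G\<^esub>\<rparr>"
    by (simp add: Triv_def)
  have a: "group (add_monoid (Triv G))"
    unfolding eq by (rule groupI) (auto simp: G.m_assoc intro: G.l_inv_ex)
  have m: "group (Triv G)"
    by (rule groupI) (auto simp: Triv_def G.m_assoc intro: G.l_inv_ex)
  have inv: "\<ominus>\<^bsub>Triv G\<^esub> x = inv\<^bsub>G\<^esub> x" if "x \<in> carrier G" for x
    unfolding a_inv_def by (rule group.inv_equality[OF a]) (use that in \<open>auto simp: Triv_def\<close>)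
  show ?thesis
  proof (intro skew_brace.intro skew_brace_axioms.intro a m)
    fix x y z assume "x \<in> carrier (Triv G)" "y \<in> carrier (Triv G)" "z \<in> carrier (Triv G)"
    then have "x \<in> carrier G" "y \<in> carrier G" "z \<in> carrier G" by (simp_all add: Triv_def)
    moreover from this have "inv\<^bsub>G\<^esub> x \<otimes>\<^bsub>G\<^esub> (x \<otimes>\<^bsub>G\<^esub> z) = z"
      by (simp add: G.m_assoc[symmetric])
    ultimately show "x \<otimes>\<^bsub>Triv G\<^esub> (y \<oplus>\<^bsub>Triv G\<^esub> z) =
        ((x \<otimes>\<^bsub>Triv G\<^esub> y) \<oplus>\<^bsub>Triv G\<^esub> (\<ominus>\<^bsub>Triv G\<^esub> x)) \<oplus>\<^bsub>Triv G\<^esub> (x \<otimes>\<^bsub>Triv G\<^esub> z)"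
      using inv by (simp add: Triv_def G.m_assoc)
  qed
qed

end

theory Submission
  imports Defs "HOL-Algebra.Sylow" "HOL-Algebra.Multiplicative_Group" "HOL-Number_Theory.Cong"
    "Jordan_Normal_Form.Schur_Decomposition"
begin

text \<open>
  The additive left translations \<open>t b\<close> and the automorphisms \<open>l b\<close> (that is, \<open>\<lambda>\<^sub>b\<close>) of \<open>B\<close> generate a
  group of permutations in which the \<open>t b\<close> form a normal subgroup \<open>A\<close>. The multiplicative left
  translations are \<open>d b = t b * l b\<close>, so this group is the product of the nilpotent groups of all \<open>d b\<close> and of
  all \<open>l b\<close>. By the theorem of Kegel and Wielandt it is solvable. Let \<open>R\<close> be maximal among the proper
  \<open>\<lambda>\<close>-invariant subgroups of \<open>A\<close> that contain the derived subgroup; its index is a power of a prime \<open>q\<close>.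
  The multiplicative \<open>q'\<close>-elements lie in \<open>R\<close> and act trivially modulo \<open>R\<close>, because they commute with the
  \<open>q\<close>-elements, and the \<open>q\<close>-elements have a common nontrivial fixed point modulo \<open>R\<close>. Hence the whole action
  modulo \<open>R\<close> is trivial and \<open>R\<close> is an ideal. So \<open>R\<close> is trivial, the two operations agree and are
  commutative, and every subgroup is an ideal.

  A minimal counterexample to the theorem of Kegel and Wielandt is simple with factors of coprime orders
  by an argument of Kegel. If one of the factors has prime power order, some conjugacy class has prime power
  size, which Burnside's argument excludes; here it is carried out with the eigenvalues of the class sum and
  their multiplicities in place of characters. Otherwise each factor lies in a unique maximal subgroup, and
  the transfer and a count of Sylow subgroups show that each factor is at least as large as the other.
\<close>

text \<open>The Kegel-Wielandt theorem is proved by an induction through subgroups and quotients,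
  and a HOL type cannot vary during an induction. Groups are therefore finite subsets of one type,
  and each quotient is realized again inside the type \<open>gperm\<close> of permutations of the
  natural numbers. Nilpotency and solvability are used as \<open>nil\<close> (elements of prime
  power orders for different primes commute) and \<open>solv\<close> (no nontrivial perfect
  subgroup), which pass to subgroups without argument. The solvability of \<open>A\<close> serves
  the brace argument only by making \<open>der A\<close> proper. In terms of characters, the class
  sum of the class C of z acts on the part of the group algebra belonging to \<chi> by e = |C|
  \<chi>(z) / \<chi>(1), with multiplicity \<chi>(1)^2. If m is the total multiplicity of e, then m
  e / |C| is the sum of \<chi>(1) \<chi>(z), and m (e / |C|)^2 the sum of \<chi>(z)^2, over the
  \<chi> with this scalar. Burnside's argument needs both numbers to be algebraic integers, which is
  read off from traces of the class sum composed with translations.\<close>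

class mgroup = monoid_mult + inverse +
  assumes left_inv: "inverse x * x = 1"

lemma inv_cancel_left: "inverse x * (x * y) = (y::'a::mgroup)"
  by (simp only: mult.assoc[symmetric] left_inv mult_1_left)

lemma right_inv: "(x::'a::mgroup) * inverse x = 1"
proof -
  have "x * inverse x = inverse (inverse x) * (inverse x * (x * inverse x))"
    by (rule inv_cancel_left[symmetric])
  also have "\<dots> = inverse (inverse x) * inverse x" by (simp only: inv_cancel_left)
  finally show ?thesis by (simp only: left_inv)
qed

lemma cancel_inv_left: "(x::'a::mgroup) * (inverse x * y) = y"
  by (simp add: mult.assoc[symmetric] right_inv)

lemma inv_inv: "inverse (inverse (x::'a::mgroup)) = x"
  by (metis inv_cancel_left left_inv mult_1_right)

lemma mul_left_cancel: "(x::'a::mgroup) * y = x * z \<longleftrightarrow> y = z"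
  by (metis inv_cancel_left)

lemma mul_right_cancel: "(y::'a::mgroup) * x = z * x \<longleftrightarrow> y = z"
  by (metis mult.assoc right_inv mult_1_right)

lemma inv_mult: "inverse (x * y) = inverse y * inverse (x::'a::mgroup)"
proof -
  have "(x * y) * inverse (x * y) = (x * y) * (inverse y * inverse x)"
    by (simp only: right_inv) (simp add: mult.assoc cancel_inv_left right_inv)
  then show ?thesis by (simp only: mul_left_cancel)
qed

lemma inv_one: "inverse 1 = (1::'a::mgroup)"
  by (metis left_inv mult_1_right)

lemmas grp = mult.assoc left_inv right_inv inv_cancel_left cancel_inv_left inv_inv inv_mult inv_one

section \<open>Finite subgroups, products, conjugation, normalizers and centralizers\<close>

definition sgrp :: "'a::mgroup set \<Rightarrow> bool" where
  "sgrp H \<longleftrightarrow> finite H \<and> 1 \<in> H \<and> (\<forall>x\<in>H. \<forall>y\<in>H. x * y \<in> H) \<and> (\<forall>x\<in>H. inverse x \<in> H)"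

lemma sgrpD:
  assumes "sgrp H"
  shows "finite H" "1 \<in> H" "x \<in> H \<Longrightarrow> y \<in> H \<Longrightarrow> x * y \<in> H" "x \<in> H \<Longrightarrow> inverse x \<in> H"
  using assms by (auto simp: sgrp_def)

lemma sgrp_pow: "sgrp H \<Longrightarrow> x \<in> H \<Longrightarrow> x ^ n \<in> H"
  by (induction n) (auto simp: sgrp_def)

lemma sgrp_Int: "sgrp H \<Longrightarrow> sgrp K \<Longrightarrow> sgrp (H \<inter> K)"
  by (auto simp: sgrp_def)

lemma sgrp_one: "sgrp {1}"
  by (simp add: sgrp_def inv_one)

lemma sgrp_card_pos: "sgrp H \<Longrightarrow> card H > 0"
  by (auto simp: sgrp_def card_gt_0_iff)

lemma sgrp_card_1: "sgrp H \<Longrightarrow> card H = 1 \<Longrightarrow> H = {1}"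
  by (metis card_1_singletonE sgrpD(2) singletonD)

lemma sgrp_Inter: "H \<in> F \<Longrightarrow> (\<And>K. K \<in> F \<Longrightarrow> sgrp K) \<Longrightarrow> sgrp (\<Inter>F)"
  unfolding sgrp_def by (auto intro: finite_subset[of "\<Inter>F" H])

lemma sgrp_mult_iff:
  assumes H: "sgrp H" "x \<in> H" shows "x * y \<in> H \<longleftrightarrow> y \<in> H" "y * x \<in> H \<longleftrightarrow> y \<in> H"
proof -
  have "inverse x * (x * y) \<in> H" if "x * y \<in> H" using sgrpD(3,4)[OF H(1)] that H(2) by blast
  then show "x * y \<in> H \<longleftrightarrow> y \<in> H" using sgrpD(3)[OF H(1)] H(2) by (auto simp: inv_cancel_left)
  have "(y * x) * inverse x \<in> H" if "y * x \<in> H" using sgrpD(3,4)[OF H(1)] that H(2) by blast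
  then show "y * x \<in> H \<longleftrightarrow> y \<in> H" using sgrpD(3)[OF H(1)] H(2) by (auto simp: mult.assoc right_inv)
qed

lemma sgrp_inv_iff: "sgrp H \<Longrightarrow> inverse x \<in> H \<longleftrightarrow> x \<in> H"
  by (metis inv_inv sgrpD(4))

text \<open>The bridge to HOL-Algebra. It imports Lagrange's theorem, the fact that x to the group
  order is 1, and the existence of Sylow subgroups.\<close>

definition gr :: "'a::mgroup set \<Rightarrow> 'a monoid" where
  "gr H = \<lparr>carrier = H, monoid.mult = (*), one = 1\<rparr>"

lemma gr_simps [simp]: "carrier (gr H) = H" "monoid.mult (gr H) = (*)" "one (gr H) = 1"
  by (simp_all add: gr_def)

lemma group_gr: "sgrp H \<Longrightarrow> group (gr H)"
  by (rule groupI) (auto simp: sgrp_def mult.assoc intro!: bexI[of _ "inverse _"] left_inv)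

lemma gr_inv: assumes "sgrp H" "x \<in> H" shows "inv\<^bsub>gr H\<^esub> x = inverse x"
  by (rule group.inv_equality[OF group_gr]) (use assms in \<open>auto simp: left_inv sgrp_def\<close>)

lemma subgroup_gr: "sgrp H \<Longrightarrow> subgroup K (gr H) \<longleftrightarrow> sgrp K \<and> K \<subseteq> H"
  by (auto simp: subgroup_def sgrp_def gr_inv[unfolded sgrp_def] finite_subset subsetD)

lemma sgrp_card_dvd: "sgrp K \<Longrightarrow> sgrp H \<Longrightarrow> K \<subseteq> H \<Longrightarrow> card K dvd card H"
  using group.lagrange[OF group_gr, of H K] subgroup_gr[of H K] unfolding Coset.order_def gr_simps by (metis dvd_triv_right)

lemma pow_card: "sgrp H \<Longrightarrow> x \<in> H \<Longrightarrow> x ^ card H = 1"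
proof -
  assume H: "sgrp H" "x \<in> H"
  have "x [^]\<^bsub>gr H\<^esub> n = x ^ n" for n :: nat
    by (induction n) (simp_all add: power_Suc2 del: power_Suc)
  then show ?thesis
    using group.pow_order_eq_1[OF group_gr[OF H(1)], of x] H by (simp add: Coset.order_def)
qed

lemma card_fibres:
  assumes "finite A" "\<And>y. y \<in> f ` A \<Longrightarrow> card {x\<in>A. f x = y} = k"
  shows "card A = card (f ` A) * k"
proof -
  have "card A = (\<Sum>y\<in>f ` A. card {x\<in>A. f x = y})"
    using sum.image_gen[OF assms(1), of "\<lambda>_. 1::nat" f] by simp
  also have "\<dots> = card (f ` A) * k" using assms(2) by simp
  finally show ?thesis .
qed

definition sprod :: "'a::mgroup set \<Rightarrow> 'a set \<Rightarrow> 'a set" where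
  "sprod H K = (\<lambda>(h, k). h * k) ` (H \<times> K)"

lemma sprodI: "h \<in> H \<Longrightarrow> k \<in> K \<Longrightarrow> h * k \<in> sprod H K"
  by (auto simp: sprod_def)

lemma sprodE: "x \<in> sprod H K \<Longrightarrow> (\<And>h k. h \<in> H \<Longrightarrow> k \<in> K \<Longrightarrow> x = h * k \<Longrightarrow> P) \<Longrightarrow> P"
  by (auto simp: sprod_def)

lemma sprod_left: "1 \<in> K \<Longrightarrow> H \<subseteq> sprod H K"
  using sprodI[of _ H 1 K] by auto

lemma sprod_right: "1 \<in> H \<Longrightarrow> K \<subseteq> sprod H K"
  using sprodI[of 1 H _ K] by auto

lemma card_sprod:
  assumes H: "sgrp H" and K: "sgrp K"
  shows "card (sprod H K) * card (H \<inter> K) = card H * card K"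
proof -
  have "card (H \<times> K) = card ((\<lambda>(h, k). h * k) ` (H \<times> K)) * card (H \<inter> K)"
  proof (rule card_fibres)
    show "finite (H \<times> K)" using H K by (auto simp: sgrp_def)
    fix y assume "y \<in> (\<lambda>(h, k). h * k) ` (H \<times> K)"
    then obtain h k where hk: "h \<in> H" "k \<in> K" "y = h * k" by auto
    have "bij_betw (\<lambda>u. (h * u, inverse u * k)) (H \<inter> K) {x \<in> H \<times> K. (case x of (h, k) \<Rightarrow> h * k) = y}"
    proof (rule bij_betw_imageI)
      show "inj_on (\<lambda>u. (h * u, inverse u * k)) (H \<inter> K)"
        by (simp add: inj_on_def mul_left_cancel)
      have "(a, b) \<in> (\<lambda>u. (h * u, inverse u * k)) ` (H \<inter> K)" if ab: "a \<in> H" "b \<in> K" "a * b = y" for a b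
      proof -
        have e: "a * b = h * k" using ab(3) hk(3) by simp
        have u: "inverse h * a \<in> H" using sgrpD(3,4)[OF H] ab(1) hk(1) by blast
        have "inverse h * a = inverse h * (a * b) * inverse b" by (simp add: grp)
        also have "\<dots> = k * inverse b" unfolding e by (simp add: grp)
        finally have v: "inverse h * a = k * inverse b" .
        have "inverse h * a \<in> K" unfolding v using sgrpD(3,4)[OF K] ab(2) hk(2) by blast
        moreover have "a = h * (inverse h * a)" by (simp add: grp)
        moreover have "b = inverse (inverse h * a) * k" unfolding v by (simp add: grp)
        ultimately show ?thesis using u by blast
      qed
      moreover have "(h * u) * (inverse u * k) = y" for u unfolding hk(3) by (simp add: grp)
      ultimately show "(\<lambda>u. (h * u, inverse u * k)) ` (H \<inter> K) = {x \<in> H \<times> K. (case x of (h, k) \<Rightarrow> h * k) = y}"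
        using sgrpD(3,4)[OF H] sgrpD(3,4)[OF K] hk(1,2) by auto
    qed
    then show "card {x \<in> H \<times> K. (case x of (h, k) \<Rightarrow> h * k) = y} = card (H \<inter> K)"
      by (simp add: bij_betw_same_card)
  qed
  then show ?thesis by (simp add: sprod_def card_cartesian_product)
qed

lemma finite_sprod: "finite H \<Longrightarrow> finite K \<Longrightarrow> finite (sprod H K)"
  by (simp add: sprod_def)

definition cj :: "'a::mgroup \<Rightarrow> 'a \<Rightarrow> 'a" where
  "cj g x = g * x * inverse g"

lemma cj_mult: "cj g (x * y) = cj g x * cj g y" by (simp add: cj_def grp)
lemma cj_one: "cj g 1 = 1" "cj 1 x = x" by (simp_all add: cj_def grp)
lemma cj_cj: "cj g (cj h x) = cj (g * h) x" by (simp add: cj_def grp)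
lemma cj_inv: "cj g (inverse x) = inverse (cj g x)" by (simp add: cj_def grp)
lemma cj_cancel: "cj (inverse g) (cj g x) = x" "cj g (cj (inverse g) x) = x" by (simp_all add: cj_def grp)
lemma cj_pow: "cj g (x ^ n) = cj g x ^ n" by (induction n) (simp_all add: cj_one cj_mult)
lemma cj_inj: "cj g x = cj g y \<longleftrightarrow> x = y" by (metis cj_cancel(1))
lemma inj_cj: "inj_on (cj g) X" by (simp add: inj_on_def cj_inj)
lemma card_cj: "card (cj g ` X) = card X" by (simp add: card_image inj_cj)
lemma cj_fix_iff: "cj g x = x \<longleftrightarrow> g * x = x * g"
proof -
  have "g * x = cj g x * g" by (simp add: cj_def grp)
  then show ?thesis by (simp add: mul_right_cancel)
qed
lemma cj_one_iff: "cj g x = 1 \<longleftrightarrow> x = 1" by (metis cj_inj cj_one(1))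
lemma cj_image_cj: "cj g ` cj h ` X = cj (g * h) ` X" by (simp add: image_image cj_cj)
lemma cj_image_one: "cj 1 ` X = X" by (simp add: cj_one)
lemma cj_in_image: "cj g x \<in> cj g ` X \<longleftrightarrow> x \<in> X" by (auto simp: cj_inj)
lemma in_cj_image: "x \<in> cj g ` X \<longleftrightarrow> cj (inverse g) x \<in> X"
  by (metis cj_cancel cj_in_image)

lemma cj_image_inv: "cj g ` X = X \<Longrightarrow> cj (inverse g) ` X = X"
  by (metis cj_image_cj cj_image_one left_inv)

lemma cj_image_eqI: "finite X \<Longrightarrow> (\<And>x. x \<in> X \<Longrightarrow> cj g x \<in> X) \<Longrightarrow> cj g ` X = X"
  by (simp add: card_cj card_subset_eq image_subsetI)

lemma sgrp_cj: "sgrp H \<Longrightarrow> sgrp (cj g ` H)"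
  unfolding sgrp_def by (auto simp: cj_mult[symmetric] cj_inv[symmetric] in_cj_image cj_cancel cj_one)

lemma cj_in: "sgrp H \<Longrightarrow> g \<in> H \<Longrightarrow> x \<in> H \<Longrightarrow> cj g x \<in> H"
  by (simp add: cj_def sgrp_def)

lemma cj_image_self: "sgrp H \<Longrightarrow> g \<in> H \<Longrightarrow> cj g ` H = H"
  by (intro cj_image_eqI) (auto simp: cj_in sgrpD)

definition Nz :: "'a::mgroup set \<Rightarrow> 'a set \<Rightarrow> 'a set" where
  "Nz G X = {g \<in> G. cj g ` X = X}"

definition Cz :: "'a::mgroup set \<Rightarrow> 'a set \<Rightarrow> 'a set" where
  "Cz G X = {g \<in> G. \<forall>x\<in>X. g * x = x * g}"

definition nrml :: "'a::mgroup set \<Rightarrow> 'a set \<Rightarrow> bool" where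
  "nrml N G \<longleftrightarrow> sgrp N \<and> N \<subseteq> G \<and> (\<forall>g\<in>G. cj g ` N = N)"

lemma nrmlD:
  assumes "nrml N G" shows "sgrp N" "N \<subseteq> G" "g \<in> G \<Longrightarrow> cj g ` N = N" "g \<in> G \<Longrightarrow> x \<in> N \<Longrightarrow> cj g x \<in> N"
  using assms by (auto simp: nrml_def)

lemma nrmlI: "sgrp N \<Longrightarrow> N \<subseteq> G \<Longrightarrow> (\<And>g x. g \<in> G \<Longrightarrow> x \<in> N \<Longrightarrow> cj g x \<in> N) \<Longrightarrow> nrml N G"
  by (simp add: nrml_def cj_image_eqI sgrpD)

lemma sgrp_Nz: assumes "sgrp G" shows "sgrp (Nz G X)"
  unfolding sgrp_def
proof (intro conjI ballI)
  show "finite (Nz G X)" "1 \<in> Nz G X"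
    using assms by (simp_all add: Nz_def sgrp_def cj_image_one)
next
  fix x y assume "x \<in> Nz G X" "y \<in> Nz G X"
  then show "x * y \<in> Nz G X"
    using assms by (simp add: Nz_def sgrp_def cj_image_cj[symmetric])
next
  fix x assume "x \<in> Nz G X"
  then show "inverse x \<in> Nz G X"
    using assms cj_image_inv[of x X] by (simp add: Nz_def sgrp_def)
qed

lemma Cz_fix: "Cz G X = {g \<in> G. \<forall>x\<in>X. cj g x = x}"
  by (auto simp: Cz_def cj_fix_iff)

lemma sgrp_Cz: assumes "sgrp G" shows "sgrp (Cz G X)"
  unfolding sgrp_def
proof (intro conjI ballI)
  show "finite (Cz G X)" "1 \<in> Cz G X"
    using assms by (simp_all add: Cz_def sgrp_def)
next
  fix x y assume "x \<in> Cz G X" "y \<in> Cz G X"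
  then show "x * y \<in> Cz G X"
    using assms by (simp add: Cz_fix sgrp_def cj_cj[symmetric])
next
  fix x assume x: "x \<in> Cz G X"
  have "cj (inverse x) y = y" if "y \<in> X" for y
    using x that cj_cancel(1)[of x y] by (simp add: Cz_fix)
  then show "inverse x \<in> Cz G X"
    using assms x by (simp add: Cz_fix sgrp_def)
qed

lemma Nz_sub: "Nz G X \<subseteq> G" and Cz_sub: "Cz G X \<subseteq> G"
  by (auto simp: Nz_def Cz_def)

lemma Cz_sub_Nz: "Cz G X \<subseteq> Nz G X"
  by (auto simp: Cz_fix Nz_def)

lemma nrml_Nz: "sgrp G \<Longrightarrow> sgrp N \<Longrightarrow> N \<subseteq> G \<Longrightarrow> nrml N (Nz G N)"
  unfolding nrml_def by (auto simp: Nz_def cj_in cj_image_self)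

lemma nrml_iff_Nz: "sgrp N \<Longrightarrow> N \<subseteq> G \<Longrightarrow> nrml N G \<longleftrightarrow> Nz G N = G"
  by (auto simp: nrml_def Nz_def)

lemma nrml_self: "sgrp G \<Longrightarrow> nrml G G"
  by (simp add: nrml_def cj_image_self)

lemma nrml_Int2: "nrml N G \<Longrightarrow> nrml K G \<Longrightarrow> nrml (N \<inter> K) G"
  by (rule nrmlI) (auto simp: sgrp_Int nrmlD dest: nrmlD(2))

lemma nrml_mono: "nrml N G \<Longrightarrow> N \<subseteq> H \<Longrightarrow> H \<subseteq> G \<Longrightarrow> nrml N H"
  unfolding nrml_def by blast

lemma nrml_Cz: assumes "sgrp G" "nrml N G" shows "nrml (Cz G N) G"
proof (rule nrmlI)
  fix g x assume g: "g \<in> G" and x: "x \<in> Cz G N"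
  have "cj (cj g x) n = n" if "n \<in> N" for n
  proof -
    have "cj (inverse g) n \<in> N" using that g assms by (simp add: nrmlD sgrpD)
    then have "cj x (cj (inverse g) n) = cj (inverse g) n" using x by (simp add: Cz_fix)
    then show ?thesis by (metis cj_cj cj_cancel(2) cj_def)
  qed
  then show "cj g x \<in> Cz G N" using g x assms by (simp add: Cz_fix cj_in)
qed (use assms in \<open>auto simp: sgrp_Cz Cz_sub\<close>)

lemma sgrp_sprod:
  assumes "sgrp H" "sgrp N" "\<And>h. h \<in> H \<Longrightarrow> cj h ` N = N" shows "sgrp (sprod H N)"
proof -
  have fin: "finite (sprod H N)" using assms finite_sprod by (auto simp: sgrp_def)
  have one: "1 \<in> sprod H N" using sprodI[of 1 H 1 N] assms by (simp add: sgrpD)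
  have m: "x * y \<in> sprod H N" if xy: "x \<in> sprod H N" "y \<in> sprod H N" for x y
  proof -
    obtain h n k m where *: "x = h * n" "y = k * m" "h \<in> H" "k \<in> H" "n \<in> N" "m \<in> N"
      using xy by (metis sprodE)
    have "cj (inverse k) n \<in> N" using * assms by (metis cj_image_inv imageI)
    then have "(h * k) * (cj (inverse k) n * m) \<in> sprod H N" using * assms by (intro sprodI) (auto simp: sgrpD)
    then show ?thesis by (simp add: * cj_def grp)
  qed
  have i: "inverse x \<in> sprod H N" if x: "x \<in> sprod H N" for x
  proof -
    obtain h n where *: "x = h * n" "h \<in> H" "n \<in> N" using x by (metis sprodE)
    have "cj h (inverse n) \<in> N" using * assms by (metis imageI sgrpD(4))
    then have "inverse h * cj h (inverse n) \<in> sprod H N" using * assms by (intro sprodI) (auto simp: sgrpD)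
    then show ?thesis by (simp add: * cj_def grp)
  qed
  show ?thesis using fin one m i by (simp add: sgrp_def)
qed

lemma sprod_sub: "sgrp G \<Longrightarrow> H \<subseteq> G \<Longrightarrow> K \<subseteq> G \<Longrightarrow> sprod H K \<subseteq> G"
  by (auto simp: sprod_def sgrp_def)

text \<open>Only finite subgroups enter the intersection. If none of them contains \<open>X\<close>,
  the result is the whole type, so the lemmas about \<open>gen\<close> ask for an ambient finite
  group.\<close>

definition gen :: "'a::mgroup set \<Rightarrow> 'a set" where
  "gen X = \<Inter>{H. sgrp H \<and> X \<subseteq> H}"

lemma gen_sup: "X \<subseteq> gen X" by (auto simp: gen_def)

lemma gen_least: "sgrp H \<Longrightarrow> X \<subseteq> H \<Longrightarrow> gen X \<subseteq> H" by (auto simp: gen_def)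

lemma sgrp_gen: "sgrp H \<Longrightarrow> X \<subseteq> H \<Longrightarrow> sgrp (gen X)"
  unfolding gen_def by (rule sgrp_Inter[of H]) auto

lemma gen_cj:
  assumes "sgrp H" "X \<subseteq> H" "cj g ` X = X" shows "cj g ` gen X = gen X"
proof -
  have "X \<subseteq> cj g ` gen X" using assms(3) gen_sup by (metis image_mono)
  then have "gen X \<subseteq> cj g ` gen X" using gen_least sgrp_cj sgrp_gen[OF assms(1,2)] by blast
  moreover have "finite (cj g ` gen X)" using sgrp_gen[OF assms(1,2)] by (simp add: sgrpD)
  ultimately show ?thesis by (metis card_cj card_subset_eq)
qed

lemma nrml_gen:
  assumes "sgrp G" "X \<subseteq> G" "\<And>g. g \<in> G \<Longrightarrow> cj g ` X = X" shows "nrml (gen X) G"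
  using assms by (auto simp: nrml_def sgrp_gen gen_least gen_cj dest: subsetD[OF gen_least])

lemma gen_commute:
  assumes "sgrp G" "X \<subseteq> G" "\<And>x. x \<in> X \<Longrightarrow> g * x = x * g" "g \<in> G" "x \<in> gen X"
  shows "g * x = x * g"
proof -
  have "X \<subseteq> Cz G {g}" using assms by (auto simp: Cz_def)
  then have "x \<in> Cz G {g}" using gen_least[OF sgrp_Cz[OF assms(1)]] assms(5) by blast
  then show ?thesis by (simp add: Cz_def)
qed

section \<open>Actions of groups of prime power order\<close>

definition pgp :: "nat \<Rightarrow> 'a::mgroup set \<Rightarrow> bool" where
  "pgp p H \<longleftrightarrow> sgrp H \<and> (\<exists>k. card H = p ^ k)"

lemma pgp_sub: "prime p \<Longrightarrow> pgp p H \<Longrightarrow> sgrp K \<Longrightarrow> K \<subseteq> H \<Longrightarrow> pgp p K"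
  unfolding pgp_def by (metis divides_primepow_nat sgrp_card_dvd)

lemma pgp_cj: "pgp p H \<Longrightarrow> pgp p (cj g ` H)"
  by (simp add: pgp_def sgrp_cj card_cj)

lemma orbit_card:
  assumes P: "sgrp P" and act: "\<And>g h. g \<in> P \<Longrightarrow> h \<in> P \<Longrightarrow> act (g * h) x = act g (act h x)" "act 1 x = x"
  shows "card P = card ((\<lambda>g. act g x) ` P) * card {g \<in> P. act g x = x}"
proof (rule card_fibres)
  show "finite P" using P by (simp add: sgrpD)
  fix y assume "y \<in> (\<lambda>g. act g x) ` P"
  then obtain g where g: "g \<in> P" "y = act g x" by auto
  have inv: "act (inverse g) (act g x) = x" using act(1)[of "inverse g" g] act(2) g P by (simp add: left_inv sgrpD)
  have "bij_betw (\<lambda>h. g * h) {h \<in> P. act h x = x} {h \<in> P. act h x = y}"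
    by (rule bij_betwI[where g = "\<lambda>h. inverse g * h"])
       (use g act inv P in \<open>auto simp: sgrpD grp\<close>)
  then show "card {h \<in> P. act h x = y} = card {h \<in> P. act h x = x}"
    by (simp add: bij_betw_same_card)
qed

text \<open>The orbit of a point that is moved has p-power size greater than 1, hence size divisible
  by p. Removing one such orbit leaves an invariant set with the same fixed points, which gives the
  induction.\<close>

lemma pgp_fixed_points:
  assumes p: "prime p" and P: "pgp p P" and fin: "finite S"
    and closed: "\<And>g x. g \<in> P \<Longrightarrow> x \<in> S \<Longrightarrow> act g x \<in> S"
    and act: "\<And>g h x. g \<in> P \<Longrightarrow> h \<in> P \<Longrightarrow> x \<in> S \<Longrightarrow> act (g * h) x = act g (act h x)"
       "\<And>x. x \<in> S \<Longrightarrow> act 1 x = x"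
  shows "[card S = card {x \<in> S. \<forall>g\<in>P. act g x = x}] (mod p)"
  using fin closed act
proof (induction "card S" arbitrary: S rule: less_induct)
  case less
  have sP: "sgrp P" using P by (simp add: pgp_def)
  show ?case
  proof (cases "\<forall>x\<in>S. \<forall>g\<in>P. act g x = x")
    case True
    then have "{x \<in> S. \<forall>g\<in>P. act g x = x} = S" by auto
    then show ?thesis by simp
  next
    case False
    then obtain x g0 where x: "x \<in> S" "g0 \<in> P" "act g0 x \<noteq> x" by auto
    define Ob where "Ob = (\<lambda>g. act g x) ` P"
    have ObS: "Ob \<subseteq> S" using less.prems(2) x by (auto simp: Ob_def)
    have xO: "x \<in> Ob" using less.prems(4)[OF x(1)] sP by (metis Ob_def image_eqI sgrpD(2))
    have Oinv: "act g y \<in> Ob" if g: "g \<in> P" and y: "y \<in> Ob" for g y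
    proof -
      obtain h where h: "h \<in> P" "y = act h x" using y by (auto simp: Ob_def)
      have "act g y = act (g * h) x" using g h less.prems(3) x by simp
      then show ?thesis using g h sP by (auto simp: Ob_def sgrpD)
    qed
    have inv: "act (inverse g) (act g y) = y" if "g \<in> P" "y \<in> S" for g y
      using less.prems(3)[of "inverse g" g y] less.prems(4)[of y] that sP by (simp add: left_inv sgrpD)
    have nO: "act g y \<in> S - Ob" if g: "g \<in> P" and y: "y \<in> S - Ob" for g y
      using Oinv[of "inverse g" "act g y"] g y inv sP less.prems(2) by (auto simp: sgrpD)
    have "card Ob dvd card P"
      using orbit_card[OF sP, of act x] less.prems(3,4) x by (metis Ob_def dvd_triv_left)
    moreover obtain k where "card P = p ^ k" using P by (auto simp: pgp_def)
    ultimately obtain j where j: "card Ob = p ^ j" using p by (metis divides_primepow_nat)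
    have "j \<noteq> 0"
    proof
      assume "j = 0"
      then have "card Ob = 1" using j by simp
      then have "Ob = {x}" using xO by (metis card_1_singletonE singletonD)
      then show False using x by (auto simp: Ob_def)
    qed
    then have dv: "p dvd card Ob" using j by (simp add: dvd_power)
    have fO: "finite Ob" using ObS less.prems(1) finite_subset by blast
    have lt: "card (S - Ob) < card S" using less.prems(1) xO x(1) by (metis DiffD2 Diff_subset psubsetI psubset_card_mono)
    have "[card (S - Ob) = card {y \<in> S - Ob. \<forall>g\<in>P. act g y = y}] (mod p)"
      by (rule less.hyps[OF lt]) (use less.prems nO in auto)
    moreover have "{y \<in> S - Ob. \<forall>g\<in>P. act g y = y} = {y \<in> S. \<forall>g\<in>P. act g y = y}"
    proof -
      have False if y: "y \<in> Ob" "\<forall>g\<in>P. act g y = y" for y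
      proof -
        obtain h where h: "h \<in> P" "y = act h x" using y by (auto simp: Ob_def)
        have "y = x" using y(2) h inv[OF h(1) x(1)] sP by (metis sgrpD(4))
        then show False using y(2) x by auto
      qed
      then show ?thesis by auto
    qed
    moreover have "card S = card (S - Ob) + card Ob"
      using ObS fO less.prems(1) by (metis card_Diff_subset card_mono le_add_diff_inverse2)
    moreover have "(card (S - Ob) + card Ob) mod p = card (S - Ob) mod p"
      using dv by (metis mod_add_right_eq dvd_imp_mod_0 add_0_right)
    ultimately show ?thesis by (simp add: cong_def)
  qed
qed

section \<open>Sylow subgroups\<close>

definition lcos :: "'a::mgroup \<Rightarrow> 'a set \<Rightarrow> 'a set" where
  "lcos x Q = (\<lambda>q. x * q) ` Q"

lemma lcos_lcos: "(\<lambda>y. g * y) ` lcos x Q = lcos (g * x) Q"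
  by (auto simp: lcos_def image_image mult.assoc)

lemma in_lcos: "y \<in> lcos x Q \<longleftrightarrow> inverse x * y \<in> Q"
proof
  assume "inverse x * y \<in> Q"
  then have "x * (inverse x * y) \<in> lcos x Q" by (simp add: lcos_def)
  then show "y \<in> lcos x Q" by (simp add: grp)
qed (auto simp: lcos_def grp)

lemma lcos_eq_iff:
  assumes "sgrp Q" shows "lcos x Q = lcos y Q \<longleftrightarrow> inverse x * y \<in> Q"
proof
  assume "lcos x Q = lcos y Q"
  moreover have "y \<in> lcos y Q" using assms by (simp add: in_lcos left_inv sgrpD)
  ultimately show "inverse x * y \<in> Q" by (simp add: in_lcos[symmetric])
next
  assume a: "inverse x * y \<in> Q"
  have "inverse x * z \<in> Q \<longleftrightarrow> inverse y * z \<in> Q" for z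
  proof -
    have "inverse x * z = (inverse x * y) * (inverse y * z)" by (simp add: grp)
    then show ?thesis using sgrp_mult_iff(1)[OF assms a, of "inverse y * z"] by simp
  qed
  then show "lcos x Q = lcos y Q" by (auto simp: in_lcos)
qed

lemma card_lcos_set:
  assumes G: "sgrp G" and Q: "sgrp Q" "Q \<subseteq> G"
  shows "card ((\<lambda>x. lcos x Q) ` G) * card Q = card G"
proof (rule card_fibres[symmetric])
  show "finite G" using G by (simp add: sgrpD)
  fix y assume "y \<in> (\<lambda>x. lcos x Q) ` G"
  then obtain x where x: "x \<in> G" "y = lcos x Q" by auto
  have "{z \<in> G. lcos z Q = y} = lcos x Q"
  proof -
    have "z \<in> G" if "inverse x * z \<in> Q" for z
      using that Q(2) sgrp_mult_iff(1)[OF G, of "inverse x" z] x(1) G by (auto simp: sgrpD)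
    moreover have "lcos z Q = y \<longleftrightarrow> inverse x * z \<in> Q" for z
      using lcos_eq_iff[OF Q(1), of x z] x(2) by metis
    ultimately show ?thesis by (auto simp: in_lcos)
  qed
  then show "card {z \<in> G. lcos z Q = y} = card Q"
    by (simp add: lcos_def card_image inj_on_def mul_left_cancel)
qed

lemma lcos_fixed:
  assumes P: "prime p" "pgp p P" "P \<subseteq> G" and G: "sgrp G" and Q: "sgrp Q" "Q \<subseteq> G"
  shows "[card ((\<lambda>x. lcos x Q) ` G) = card {C \<in> (\<lambda>x. lcos x Q) ` G. \<forall>g\<in>P. (\<lambda>y. g * y) ` C = C}] (mod p)"
proof (rule pgp_fixed_points[OF P(1,2)])
  show "finite ((\<lambda>x. lcos x Q) ` G)" using G by (simp add: sgrpD)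
next
  fix g C assume "g \<in> P" "C \<in> (\<lambda>x. lcos x Q) ` G"
  then show "(\<lambda>y. g * y) ` C \<in> (\<lambda>x. lcos x Q) ` G"
    using P(3) G by (auto simp: lcos_lcos sgrpD)
qed (auto simp: lcos_lcos mult.assoc)

lemma lcos_fixed_iff:
  assumes "sgrp Q" shows "(\<lambda>y. g * y) ` lcos x Q = lcos x Q \<longleftrightarrow> g \<in> cj x ` Q"
proof -
  have "(\<lambda>y. g * y) ` lcos x Q = lcos x Q \<longleftrightarrow> inverse x * (g * x) \<in> Q"
    by (metis lcos_eq_iff[OF assms] lcos_lcos)
  then show ?thesis by (simp only: in_cj_image) (simp add: cj_def grp)
qed

definition syl :: "nat \<Rightarrow> 'a::mgroup set \<Rightarrow> 'a set \<Rightarrow> bool" where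
  "syl p S G \<longleftrightarrow> sgrp S \<and> S \<subseteq> G \<and> card S = p ^ multiplicity p (card G)"

lemma sylD: assumes "syl p S G" shows "sgrp S" "S \<subseteq> G" "pgp p S" "card S = p ^ multiplicity p (card G)"
  using assms by (auto simp: syl_def pgp_def)

lemma syl_exists:
  assumes "prime p" "sgrp G" obtains S where "syl p S G"
proof -
  define a where "a = multiplicity p (card G)"
  have "p ^ a dvd card G" by (simp add: a_def multiplicity_dvd)
  then obtain m where m: "card G = p ^ a * m" by (elim dvdE)
  obtain H where "subgroup H (gr G)" "card H = p ^ a"
    using sylow_thm[OF assms(1) group_gr[OF assms(2)], of a m] m sgrpD(1)[OF assms(2)]
    by (auto simp: Coset.order_def)
  then show ?thesis using that[of H] by (simp add: syl_def subgroup_gr[OF assms(2)] a_def)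
qed

text \<open>\<open>P\<close> acts on the left cosets of \<open>S\<close>, whose number is prime to
  p, so it fixes some coset. The stabilizer of the coset of x is the conjugate of \<open>S\<close>
  by x.\<close>

lemma syl_conj_sub:
  assumes p: "prime p" and G: "sgrp G" and S: "syl p S G" and P: "pgp p P" "P \<subseteq> G"
  obtains g where "g \<in> G" "P \<subseteq> cj g ` S"
proof -
  note sS = sylD[OF S]
  let ?C = "(\<lambda>x. lcos x S) ` G"
  have c: "card ?C * p ^ multiplicity p (card G) = card G"
    using card_lcos_set[OF G sS(1,2)] sS(4) by simp
  have "\<not> p dvd card ?C"
  proof
    assume "p dvd card ?C"
    then have "p * p ^ multiplicity p (card G) dvd card G" using c by (metis dvd_refl mult_dvd_mono)
    then have "p ^ Suc (multiplicity p (card G)) dvd card G" by simp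
    then have "Suc (multiplicity p (card G)) \<le> multiplicity p (card G)"
      using p sgrp_card_pos[OF G] by (intro multiplicity_geI) (auto simp: prime_gt_1_nat)
    then show False by simp
  qed
  moreover have "[card ?C = card {C \<in> ?C. \<forall>g\<in>P. (\<lambda>y. g * y) ` C = C}] (mod p)"
    by (rule lcos_fixed[OF p P G sS(1,2)])
  ultimately have "card {C \<in> ?C. \<forall>g\<in>P. (\<lambda>y. g * y) ` C = C} \<noteq> 0"
    by (metis cong_0_iff)
  then have "{C \<in> ?C. \<forall>g\<in>P. (\<lambda>y. g * y) ` C = C} \<noteq> {}" by (metis card.empty)
  then obtain x where "x \<in> G" "\<forall>g\<in>P. (\<lambda>y. g * y) ` lcos x S = lcos x S" by auto
  then show ?thesis using that[of x] by (auto simp: lcos_fixed_iff[OF sS(1)])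
qed

lemma syl_conj:
  assumes p: "prime p" and G: "sgrp G" and S: "syl p S G" and P: "syl p P G"
  obtains g where "g \<in> G" "P = cj g ` S"
proof -
  obtain g where g: "g \<in> G" "P \<subseteq> cj g ` S"
    using syl_conj_sub[OF p G S sylD(3,2)[OF P]] by metis
  then have "P = cj g ` S" using S P
    by (intro card_subset_eq) (auto simp: card_cj syl_def sgrp_def)
  then show ?thesis using that g by blast
qed

lemma syl_cj:
  assumes "sgrp G" "syl p S G" "g \<in> G" shows "syl p (cj g ` S) G"
  using assms by (auto simp: syl_def sgrp_cj card_cj cj_in)

lemma syl_mono: "syl p S G \<Longrightarrow> sgrp H \<Longrightarrow> sgrp G \<Longrightarrow> S \<subseteq> H \<Longrightarrow> H \<subseteq> G \<Longrightarrow> prime p \<Longrightarrow> syl p S H"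
proof -
  assume a: "syl p S G" "sgrp H" "sgrp G" "S \<subseteq> H" "H \<subseteq> G" "prime p"
  have "card S dvd card H" using a(2,4) sgrp_card_dvd sylD(1)[OF a(1)] by blast
  then have "multiplicity p (card G) \<le> multiplicity p (card H)"
    using a sgrp_card_pos[OF a(2)] by (intro multiplicity_geI) (auto simp: syl_def prime_gt_1_nat)
  moreover have "multiplicity p (card H) \<le> multiplicity p (card G)"
    using a sgrp_card_pos[OF a(3)] by (intro dvd_imp_multiplicity_le sgrp_card_dvd) auto
  ultimately show ?thesis using a by (simp add: syl_def)
qed

lemma pgp_sub_card: "prime p \<Longrightarrow> pgp p P \<Longrightarrow> P \<subseteq> G \<Longrightarrow> sgrp G \<Longrightarrow> card P dvd p ^ multiplicity p (card G)"
proof -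
  assume a: "prime p" "pgp p P" "P \<subseteq> G" "sgrp G"
  obtain k where k: "card P = p ^ k" using a by (auto simp: pgp_def)
  have "card P dvd card G" using a by (simp add: pgp_def sgrp_card_dvd)
  then have "k \<le> multiplicity p (card G)" using a k sgrp_card_pos[OF a(4)]
    by (intro multiplicity_geI) (auto simp: prime_gt_1_nat)
  then show ?thesis using k by (simp add: le_imp_power_dvd)
qed

text \<open>The order of \<open>K\<close> has at least the multiplicity of every prime in the order
  of \<open>H\<close>. Statements about nilpotent groups are reduced with this to one prime at a
  time.\<close>

lemma syl_subset_all:
  assumes "sgrp K" "sgrp H" "K \<subseteq> H" "\<And>p. prime p \<Longrightarrow> \<exists>S. syl p S H \<and> S \<subseteq> K"
  shows "K = H"
proof -
  have "card H dvd card K"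
  proof (rule multiplicity_le_imp_dvd)
    show "card H \<noteq> 0" using sgrp_card_pos[OF assms(2)] by simp
    fix p :: nat assume p: "prime p"
    obtain S where S: "syl p S H" "S \<subseteq> K" using assms(4)[OF p] by auto
    have "card S dvd card K" using S(2) assms(1) sgrp_card_dvd sylD(1)[OF S(1)] by blast
    then show "multiplicity p (card H) \<le> multiplicity p (card K)"
      using S p sgrp_card_pos[OF assms(1)] by (intro multiplicity_geI) (auto simp: syl_def prime_gt_1_nat)
  qed
  then show ?thesis using assms sgrp_card_pos
    by (metis card_subset_eq card_mono dvd_imp_le le_antisym sgrpD(1))
qed

lemma prime_power_ne_one_dvd: "(n::nat) = p ^ j \<Longrightarrow> n \<noteq> 1 \<Longrightarrow> p dvd n"
  by (cases j) auto

text \<open>\<open>Q\<close> acts on its own left cosets in \<open>P\<close>. Their number is a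
  multiple of p, hence so is the number of fixed ones. The coset \<open>Q\<close> is fixed, so there
  is another fixed one, and its representative normalizes \<open>Q\<close>.\<close>

lemma pgp_normalizer_grows:
  assumes p: "prime p" and P: "pgp p P" and Q: "sgrp Q" "Q \<subseteq> P" "Q \<noteq> P"
  obtains x where "x \<in> P" "x \<notin> Q" "cj x ` Q = Q"
proof -
  have sP: "sgrp P" and fP: "finite P" using P by (auto simp: pgp_def sgrpD)
  have pQ: "pgp p Q" using pgp_sub[OF p P Q(1,2)] .
  let ?C = "(\<lambda>x. lcos x Q) ` P"
  let ?F = "{C \<in> ?C. \<forall>g\<in>Q. (\<lambda>y. g * y) ` C = C}"
  have c: "card ?C * card Q = card P" by (rule card_lcos_set[OF sP Q(1,2)])
  have "card ?C \<noteq> 1" using c card_subset_eq[OF fP Q(2)] Q(3) by auto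
  moreover have "card ?C dvd card P" using c by (metis dvd_triv_left)
  then obtain j where "card ?C = p ^ j" using P p by (metis pgp_def divides_primepow_nat)
  ultimately have "p dvd card ?C" by (rule prime_power_ne_one_dvd[rotated])
  then have "p dvd card ?F" using cong_dvd_iff[OF lcos_fixed[OF p pQ Q(2) sP Q(1,2)]] by blast
  have one: "lcos 1 Q \<in> ?F" using Q(1) sP by (auto simp: lcos_fixed_iff cj_one sgrpD)
  have fF: "finite ?F" using fP by simp
  have "card ?F > 0" using one fF card_gt_0_iff by blast
  with \<open>p dvd card ?F\<close> have "p \<le> card ?F" by (rule dvd_imp_le)
  then have "card ?F > 1" using prime_gt_1_nat[OF p] by linarith
  moreover have "card ?F \<le> card {lcos 1 Q}" if "?F \<subseteq> {lcos 1 Q}" using that by (intro card_mono) auto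
  ultimately have "\<not> ?F \<subseteq> {lcos 1 Q}" by auto
  then obtain x where x: "x \<in> P" "lcos x Q \<noteq> lcos 1 Q" "\<forall>g\<in>Q. (\<lambda>y. g * y) ` lcos x Q = lcos x Q" by auto
  have "Q \<subseteq> cj x ` Q" using x(3) by (auto simp: lcos_fixed_iff[OF Q(1)])
  then have "cj x ` Q = Q" using Q(1) by (metis card_cj card_subset_eq finite_imageI sgrpD(1))
  moreover have "x \<notin> Q" using x(2) lcos_eq_iff[OF Q(1), of 1 x] by (auto simp: inv_one)
  ultimately show ?thesis using that x(1) by blast
qed

lemma pgp_centre:
  assumes p: "prime p" and P: "pgp p P" "P \<noteq> {1}" shows "Cz P P \<noteq> {1}"
proof
  assume C: "Cz P P = {1}"
  have sP: "sgrp P" using P by (simp add: pgp_def)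
  have "[card P = card {x \<in> P. \<forall>g\<in>P. cj g x = x}] (mod p)"
    by (rule pgp_fixed_points[OF p P(1)]) (auto simp: sgrpD[OF sP] cj_in[OF sP] cj_cj cj_one)
  also have "{x \<in> P. \<forall>g\<in>P. cj g x = x} = Cz P P" by (auto simp: Cz_def cj_fix_iff)
  finally have "[card P = 1] (mod p)" using C by simp
  moreover have "p dvd card P" using P sgrp_card_1[OF sP] prime_power_ne_one_dvd by (metis pgp_def)
  ultimately have "p dvd 1" by (metis cong_dvd_iff)
  then show False using p by simp
qed

section \<open>Elements of prime power order\<close>

lemma pow_coprime_one:
  fixes x :: "'a::mgroup"
  assumes "x ^ a = 1" "x ^ b = 1" "coprime a b" "a > 0" shows "x = 1"
proof -
  obtain u v where "a * u = b * v + 1" using assms(3,4) bezout_nat[of a b] by auto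
  then have "x ^ (a * u) = x ^ (b * v) * x" by (simp del: power_Suc add: power_Suc2)
  then show ?thesis using assms(1,2) by (simp add: power_mult)
qed

text \<open>The p-elements, with the exponent left open so that no order function is required. The
  identity is a p-element for every p.\<close>

definition pel :: "nat \<Rightarrow> 'a::mgroup \<Rightarrow> bool" where
  "pel p x \<longleftrightarrow> (\<exists>k. x ^ (p ^ k) = 1)"

lemma pel_one: "pel p 1" by (simp add: pel_def)

lemma pel_cj: "pel p (cj g x) \<longleftrightarrow> pel p x"
  by (simp add: pel_def cj_pow[symmetric] cj_one_iff)

lemma pgp_pel: "pgp p P \<Longrightarrow> x \<in> P \<Longrightarrow> pel p x"
  using pow_card by (fastforce simp: pgp_def pel_def)

lemma pel_pow: "pel p x \<Longrightarrow> pel p (x ^ n)"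
  unfolding pel_def by (metis mult.commute power_mult power_one)

lemma pel_order_coprime: "pel p x \<Longrightarrow> prime p \<Longrightarrow> x ^ n = 1 \<Longrightarrow> \<not> p dvd n \<Longrightarrow> x = 1"
  unfolding pel_def
  by (metis coprime_power_left_iff pow_coprime_one prime_gt_0_nat prime_imp_coprime zero_less_power)

lemma pel_two:
  assumes "pel p x" "pel q x" "prime p" "prime q" "p \<noteq> q" shows "x = 1"
proof -
  obtain k where "x ^ (q ^ k) = 1" using assms(2) by (auto simp: pel_def)
  moreover have "\<not> p dvd q ^ k"
  proof
    assume "p dvd q ^ k"
    then have "p dvd q" by (rule prime_dvd_power[OF assms(3)])
    then show False using primes_dvd_imp_eq[OF assms(3,4)] assms(5) by blast
  qed
  ultimately show ?thesis using pel_order_coprime[OF assms(1,3)] by blast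
qed

lemma pel_prime_pow:
  assumes "pel p x" "x \<noteq> 1" obtains n where "x ^ n \<noteq> 1" "(x ^ n) ^ p = 1"
proof -
  define k where "k = (LEAST k. x ^ (p ^ k) = 1)"
  have k: "x ^ (p ^ k) = 1" unfolding k_def by (rule LeastI_ex) (use assms(1) in \<open>simp add: pel_def\<close>)
  then have "k \<noteq> 0" using assms(2) by (intro notI) simp
  then obtain j where j: "k = Suc j" by (cases k) auto
  have "x ^ (p ^ j) \<noteq> 1" using j not_less_Least[of j "\<lambda>k. x ^ (p ^ k) = 1"] by (simp add: k_def)
  moreover have "(x ^ (p ^ j)) ^ p = 1" using k j by (simp add: power_mult[symmetric] mult.commute)
  ultimately show ?thesis using that by blast
qed

lemma sgrp_nontrivial: "sgrp H \<Longrightarrow> H \<noteq> {1} \<Longrightarrow> \<exists>x\<in>H. x \<noteq> 1"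
  using sgrpD(2) by blast

lemma cauchy:
  assumes "prime p" "sgrp H" "p dvd card H" obtains x where "x \<in> H" "x \<noteq> 1" "x ^ p = 1"
proof -
  obtain S where S: "syl p S H" using syl_exists[OF assms(1,2)] .
  have "multiplicity p (card H) > 0"
    using assms sgrp_card_pos[OF assms(2)] by (simp add: prime_multiplicity_gt_zero_iff)
  then have "card S \<noteq> 1" using sylD(4)[OF S] assms(1) by (simp add: prime_nat_iff)
  then have "S \<noteq> {1}" by auto
  then obtain x where x: "x \<in> S" "x \<noteq> 1" using sgrp_nontrivial[OF sylD(1)[OF S]] by blast
  obtain n where "x ^ n \<noteq> 1" "(x ^ n) ^ p = 1"
    using pel_prime_pow[OF pgp_pel[OF sylD(3)[OF S] x(1)] x(2)] .
  then show ?thesis using that[of "x ^ n"] x(1) sylD[OF S] sgrp_pow by blast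
qed

lemma sgrp_prime_dvd: "sgrp H \<Longrightarrow> H \<noteq> {1} \<Longrightarrow> \<exists>p. prime p \<and> p dvd card H"
  by (metis prime_factor_nat sgrp_card_1)

text \<open>By Cauchy's theorem a second prime divisor of the order would give a nontrivial element
  whose order is that prime, and it would not be a p-element.\<close>

lemma pgpI:
  assumes "prime p" "sgrp H" "\<And>x. x \<in> H \<Longrightarrow> pel p x" shows "pgp p H"
proof -
  have "q = p" if q: "prime q" "q dvd card H" for q
  proof -
    obtain x where x: "x \<in> H" "x \<noteq> 1" "x ^ q = 1" using cauchy[OF q(1) assms(2) q(2)] .
    then show "q = p" using assms(3)[OF x(1)] pel_order_coprime[of p x q] assms(1) q(1)
      by (metis primes_dvd_imp_eq)
  qed
  then have "prime_factors (card H) \<subseteq> {p}" by (auto simp: prime_factors_dvd)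
  then have "card H = p ^ multiplicity p (card H)"
    using prime_factorization_nat[of "card H"] sgrp_card_pos[OF assms(2)]
    by (cases "prime_factors (card H) = {}") (auto simp: subset_singleton_iff prime_factorization_empty_iff multiplicity_unit_left)
  then show ?thesis using assms(2) by (auto simp: pgp_def)
qed

lemma gen_single:
  assumes "sgrp G" "x \<in> G" shows "gen {x} = range (\<lambda>n::nat. x ^ n)"
proof
  have "inverse (x ^ n) \<in> range (\<lambda>n::nat. x ^ n)" for n
  proof -
    have c: "x ^ n \<in> G" using assms by (simp add: sgrp_pow)
    have "x ^ n * (x ^ n) ^ (card G - 1) = 1"
      using pow_card[OF assms(1) c] sgrp_card_pos[OF assms(1)] by (metis power_eq_if neq0_conv)
    then have "inverse (x ^ n) = (x ^ n) ^ (card G - 1)"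
      by (metis inv_cancel_left mult_1_right)
    then show ?thesis by (metis power_mult rangeI)
  qed
  moreover have "finite (range (\<lambda>n::nat. x ^ n))"
    using assms by (intro finite_subset[OF _ sgrpD(1)[OF assms(1)]]) (auto simp: sgrp_pow)
  moreover have "1 \<in> range (\<lambda>n::nat. x ^ n)" by (metis power_0 rangeI)
  ultimately have "sgrp (range (\<lambda>n::nat. x ^ n))"
    unfolding sgrp_def by (auto simp: power_add[symmetric])
  moreover have "{x} \<subseteq> range (\<lambda>n::nat. x ^ n)" using rangeI[of "\<lambda>n::nat. x ^ n" 1] by simp
  ultimately show "gen {x} \<subseteq> range (\<lambda>n::nat. x ^ n)" by (rule gen_least)
  have "sgrp (gen {x})" using sgrp_gen[OF assms(1)] assms(2) by blast
  then show "range (\<lambda>n::nat. x ^ n) \<subseteq> gen {x}" using gen_sup[of "{x}"] by (auto simp: sgrp_pow)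
qed

lemma pgp_gen:
  assumes "prime p" "sgrp G" "x \<in> G" "pel p x" shows "pgp p (gen {x})"
proof (rule pgpI[OF assms(1)])
  show "sgrp (gen {x})" using sgrp_gen[OF assms(2)] assms(3) by blast
  fix y assume "y \<in> gen {x}"
  then show "pel p y" using assms(4) gen_single[OF assms(2,3)] pel_pow by auto
qed

lemma pel_in_syl_conj:
  assumes "prime p" "sgrp G" "syl p S G" "x \<in> G" "pel p x" obtains g where "g \<in> G" "x \<in> cj g ` S"
proof -
  have "pgp p (gen {x})" "gen {x} \<subseteq> G" using assms by (auto simp: pgp_gen gen_least)
  then obtain g where "g \<in> G" "gen {x} \<subseteq> cj g ` S" using syl_conj_sub[OF assms(1-3)] by metis
  then show ?thesis using that gen_sup[of "{x}"] by blast
qed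

section \<open>Nilpotent groups\<close>

text \<open>For finite groups the following is equivalent to nilpotency.\<close>

definition nil :: "'a::mgroup set \<Rightarrow> bool" where
  "nil H \<longleftrightarrow> (\<forall>p q x y. prime p \<longrightarrow> prime q \<longrightarrow> p \<noteq> q \<longrightarrow> x \<in> H \<longrightarrow> y \<in> H \<longrightarrow> pel p x \<longrightarrow> pel q y \<longrightarrow> x * y = y * x)"

definition prt :: "nat \<Rightarrow> 'a::mgroup set \<Rightarrow> 'a set" where
  "prt p H = {x \<in> H. pel p x}"

lemma prt_sub: "prt p H \<subseteq> H" by (auto simp: prt_def)

lemma prt_pel: "x \<in> prt p H \<Longrightarrow> pel p x" by (auto simp: prt_def)

lemma prt_cj: assumes "cj g ` H = H" shows "cj g ` prt p H = prt p H"
proof -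
  have "x \<in> cj g ` prt p H \<longleftrightarrow> x \<in> prt p H" for x
  proof -
    have "cj (inverse g) x \<in> H \<longleftrightarrow> x \<in> H" using assms in_cj_image by metis
    then show ?thesis by (simp add: in_cj_image prt_def pel_cj)
  qed
  then show ?thesis by blast
qed

lemma nil_sub: "nil H \<Longrightarrow> K \<subseteq> H \<Longrightarrow> nil K"
  unfolding nil_def by blast

lemma nil_cj: assumes "nil H" shows "nil (cj g ` H)"
  unfolding nil_def
proof (intro allI impI)
  fix p q x y assume *: "prime p" "prime q" "p \<noteq> q" "x \<in> cj g ` H" "y \<in> cj g ` H" "pel p x" "pel q y"
  then obtain u v where "u \<in> H" "v \<in> H" "x = cj g u" "y = cj g v" by auto
  then show "x * y = y * x" using assms * unfolding nil_def by (metis cj_mult pel_cj)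
qed

text \<open>A Sylow p-subgroup is normalized by itself and centralized by the Sylow subgroups for
  all other primes, so it is normal. Every p-element is conjugate into it and therefore lies in
  it.\<close>

lemma prt_syl:
  assumes p: "prime p" and H: "sgrp H" "nil H" shows "syl p (prt p H) H"
proof -
  obtain S where S: "syl p S H" using syl_exists[OF p H(1)] .
  have "Nz H S = H"
  proof (rule syl_subset_all[OF sgrp_Nz[OF H(1)] H(1) Nz_sub])
    fix q :: nat assume q: "prime q"
    show "\<exists>Q. syl q Q H \<and> Q \<subseteq> Nz H S"
    proof (cases "q = p")
      case True
      have "S \<subseteq> Nz H S" using sylD(1,2)[OF S] cj_image_self unfolding Nz_def by blast
      then show ?thesis using S True by (intro exI[of _ S]) simp
    next
      case False
      obtain Q where Q: "syl q Q H" using syl_exists[OF q H(1)] .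
      have "Q \<subseteq> Cz H S"
        using H(2) p q False sylD(2)[OF Q] sylD(2)[OF S] pgp_pel[OF sylD(3)[OF Q]] pgp_pel[OF sylD(3)[OF S]]
        unfolding nil_def Cz_def by blast
      then show ?thesis using Q Cz_sub_Nz by blast
    qed
  qed
  then have n: "cj g ` S = S" if "g \<in> H" for g using that by (auto simp: Nz_def)
  have "x \<in> S" if x: "x \<in> H" "pel p x" for x
    using pel_in_syl_conj[OF p H(1) S x] n by metis
  then have "prt p H = S" using sylD(2)[OF S] pgp_pel[OF sylD(3)[OF S]] by (auto simp: prt_def)
  then show ?thesis using S by simp
qed

lemma sgrp_prt: "prime p \<Longrightarrow> sgrp H \<Longrightarrow> nil H \<Longrightarrow> sgrp (prt p H)"
  using prt_syl sylD(1) by blast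

lemma pgp_prt: "prime p \<Longrightarrow> sgrp H \<Longrightarrow> nil H \<Longrightarrow> pgp p (prt p H)"
  using prt_syl sylD(3) by blast

lemma nrml_prt:
  assumes "prime p" "nil H" "nrml H G" shows "nrml (prt p H) G"
  using assms prt_sub[of p H] by (auto simp: nrml_def sgrp_prt prt_cj)

lemma prt_subset_all:
  assumes "sgrp K" "sgrp H" "nil H" "K \<subseteq> H" "\<And>p. prime p \<Longrightarrow> prt p H \<subseteq> K" shows "K = H"
  using assms by (intro syl_subset_all) (auto intro: prt_syl)

lemma prt_nontrivial:
  assumes "prime p" "sgrp H" "p dvd card H" shows "prt p H \<noteq> {1}"
proof -
  obtain x where "x \<in> H" "x \<noteq> 1" "x ^ p = 1" using cauchy[OF assms] .
  then have "x \<in> prt p H" by (auto simp: prt_def pel_def intro: exI[of _ 1])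
  then show ?thesis using \<open>x \<noteq> 1\<close> by auto
qed

lemma prt_trivial:
  assumes "prime p" "sgrp H" "\<not> p dvd card H" shows "prt p H = {1}"
  using assms pel_order_coprime[OF _ assms(1) pow_card[OF assms(2)]] by (auto simp: prt_def sgrpD pel_one)

text \<open>Two nested reductions to primary parts leave elements belonging to single primes.
  Different primes are covered by \<open>nil\<close>, and for equal primes one of the two parts is
  trivial because the orders are coprime.\<close>

lemma nil_coprime_commute:
  assumes H: "nil H" and X: "sgrp X" "X \<subseteq> H" and Y: "sgrp Y" "Y \<subseteq> H"
    and c: "coprime (card X) (card Y)" and xy: "x \<in> X" "y \<in> Y"
  shows "x * y = y * x"
proof -
  have "Cz Y X = Y"
  proof (rule prt_subset_all[OF sgrp_Cz[OF Y(1)] Y(1) nil_sub[OF H Y(2)] Cz_sub])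
    fix q :: nat assume q: "prime q"
    have "u * v = v * u" if v: "v \<in> prt q Y" and u: "u \<in> X" for u v
    proof -
      have "Cz X {v} = X"
      proof (rule prt_subset_all[OF sgrp_Cz[OF X(1)] X(1) nil_sub[OF H X(2)] Cz_sub])
        fix r :: nat assume r: "prime r"
        show "prt r X \<subseteq> Cz X {v}"
        proof (cases "r = q")
          case False
          have "a * v = v * a" if "a \<in> prt r X" for a
            using H X Y v that r q False unfolding nil_def prt_def by blast
          then show ?thesis using prt_sub by (auto simp: Cz_def)
        next
          case True
          have "\<not> q dvd card X \<or> \<not> q dvd card Y"
            using c q by (meson coprime_common_divisor not_prime_unit)
          then have "prt q X = {1} \<or> prt q Y = {1}" using prt_trivial[OF q X(1)] prt_trivial[OF q Y(1)] by auto
          then show ?thesis using True v prt_sub by (fastforce simp: Cz_def)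
        qed
      qed
      then show ?thesis using u by (auto simp: Cz_def)
    qed
    then show "prt q Y \<subseteq> Cz Y X" using prt_sub by (fastforce simp: Cz_def)
  qed
  then have "y \<in> Cz Y X" using xy by simp
  then show ?thesis using xy by (auto simp: Cz_def)
qed

text \<open>An element of the centre of the p-part also commutes with all other primary parts, hence
  is central in \<open>H\<close>. A suitable power of it has order p.\<close>

lemma nil_centre:
  assumes p: "prime p" and H: "sgrp H" "nil H" "p dvd card H"
  obtains z where "z \<in> Cz H H" "z \<noteq> 1" "z ^ p = 1"
proof -
  let ?P = "prt p H"
  have P: "pgp p ?P" using pgp_prt p H by blast
  have "Cz ?P ?P \<noteq> {1}" using pgp_centre[OF p P prt_nontrivial[OF p H(1,3)]] .
  moreover have sP: "sgrp ?P" using P by (simp add: pgp_def)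
  ultimately obtain x where x: "x \<in> Cz ?P ?P" "x \<noteq> 1"
    using sgrp_nontrivial[OF sgrp_Cz] by metis
  have xP: "x \<in> ?P" using x Cz_sub by blast
  obtain n where n: "x ^ n \<noteq> 1" "(x ^ n) ^ p = 1" using pel_prime_pow[OF prt_pel[OF xP] x(2)] .
  let ?z = "x ^ n"
  have z: "?z \<in> Cz ?P ?P" using x sgrp_pow[OF sgrp_Cz[OF sP]] by blast
  then have zH: "?z \<in> H" and zp: "pel p ?z" using Cz_sub prt_sub prt_pel by blast+
  have "Cz H {?z} = H"
  proof (rule prt_subset_all[OF sgrp_Cz[OF H(1)] H(1,2) Cz_sub])
    fix q :: nat assume q: "prime q"
    show "prt q H \<subseteq> Cz H {?z}"
    proof (cases "q = p")
      case True then show ?thesis using z by (auto simp: Cz_def prt_def)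
    next
      case False then show ?thesis using H(2) p q zH zp unfolding nil_def Cz_def prt_def by blast
    qed
  qed
  then have "h * ?z = ?z * h" if "h \<in> H" for h using that by (auto simp: Cz_def)
  then have "?z \<in> Cz H H" using zH by (auto simp: Cz_def)
  then show ?thesis using that n by blast
qed

text \<open>For a prime t whose part of \<open>H\<close> is not contained in \<open>D\<close>,
  normalizers grow inside that part. The new element commutes with the other parts of
  \<open>D\<close>, so it normalizes all of \<open>D\<close>.\<close>

lemma nil_normalizer_grows:
  assumes H: "sgrp H" "nil H" and D: "sgrp D" "D \<subseteq> H" "D \<noteq> H"
  obtains x where "x \<in> H" "x \<notin> D" "cj x ` D = D"
proof -
  obtain t where t: "prime t" "\<not> prt t H \<subseteq> D" using prt_subset_all[OF D(1) H D(2)] D(3) by blast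
  let ?P = "prt t H"
  have P: "pgp t ?P" "sgrp ?P" using pgp_prt[OF t(1) H] sgrp_prt[OF t(1) H] .
  have nD: "nil D" using nil_sub H D by blast
  have e: "prt t D = ?P \<inter> D" using D(2) by (auto simp: prt_def)
  obtain x where x: "x \<in> ?P" "x \<notin> prt t D" "cj x ` prt t D = prt t D"
    using pgp_normalizer_grows[OF t(1) P(1) sgrp_prt[OF t(1) D(1) nD]] t(2) e by (metis inf_le1 inf.absorb_iff1)
  have eq: "D \<inter> cj (inverse x) ` D = D"
  proof (rule prt_subset_all[OF sgrp_Int[OF D(1) sgrp_cj[OF D(1)]] D(1) nD])
    fix q :: nat assume q: "prime q"
    have "cj x y \<in> D" if y: "y \<in> prt q D" for y
    proof (cases "q = t")
      case True
      then have "cj x y \<in> cj x ` prt t D" using y by simp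
      then show ?thesis using x(3) prt_sub by auto
    next
      case False
      then have "x * y = y * x" using H(2) x(1) y D(2) t(1) q unfolding nil_def prt_def by blast
      then have "cj x y = y" by (simp add: cj_fix_iff)
      then show ?thesis using y prt_sub by auto
    qed
    then show "prt q D \<subseteq> D \<inter> cj (inverse x) ` D" using prt_sub[of q D] by (auto simp: in_cj_image inv_inv)
  qed simp
  have "cj x d \<in> D" if "d \<in> D" for d
  proof -
    have "d \<in> cj (inverse x) ` D" using that eq by blast
    then show ?thesis by (simp add: in_cj_image inv_inv)
  qed
  then have "cj x ` D = D" using D(1) by (intro cj_image_eqI) (auto simp: sgrpD)
  moreover have "x \<in> H" "x \<notin> D" using x e prt_sub by blast+
  ultimately show ?thesis using that by blast
qed

section \<open>Homomorphisms\<close>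

definition hom_on :: "('a::mgroup \<Rightarrow> 'b::mgroup) \<Rightarrow> 'a set \<Rightarrow> bool" where
  "hom_on f H \<longleftrightarrow> (\<forall>x\<in>H. \<forall>y\<in>H. f (x * y) = f x * f y)"

lemma hom_on_sub: "hom_on f H \<Longrightarrow> K \<subseteq> H \<Longrightarrow> hom_on f K"
  unfolding hom_on_def by blast

lemma hom_on_mult: "hom_on f H \<Longrightarrow> x \<in> H \<Longrightarrow> y \<in> H \<Longrightarrow> f (x * y) = f x * f y"
  by (simp add: hom_on_def)

lemma hom_on_one: assumes "hom_on f H" "sgrp H" shows "f 1 = 1"
proof -
  have "f 1 * f 1 = f 1 * 1" using hom_on_mult[OF assms(1), of 1 1] sgrpD(2)[OF assms(2)] by simp
  then show ?thesis by (simp only: mul_left_cancel)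
qed

lemma hom_on_inv: assumes "hom_on f H" "sgrp H" "x \<in> H" shows "f (inverse x) = inverse (f x)"
proof -
  have "f x * f (inverse x) = f x * inverse (f x)"
    using hom_on_mult[OF assms(1), of x "inverse x"] assms hom_on_one[OF assms(1,2)]
    by (simp add: sgrpD right_inv)
  then show ?thesis by (simp only: mul_left_cancel)
qed

lemma hom_on_pow: assumes "hom_on f H" "sgrp H" "x \<in> H" shows "f (x ^ n) = f x ^ n"
  by (induction n) (simp_all add: hom_on_one[OF assms(1,2)] hom_on_mult[OF assms(1)] sgrp_pow assms)

lemma sgrp_image:
  assumes "hom_on f H" "sgrp H" shows "sgrp (f ` H)"
  unfolding sgrp_def
proof (intro conjI ballI)
  show "finite (f ` H)" "1 \<in> f ` H"
    using assms hom_on_one[OF assms] by (auto simp: sgrpD image_iff intro!: bexI[of _ 1])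
  fix x assume "x \<in> f ` H"
  then obtain u where u: "u \<in> H" "x = f u" by auto
  then have "inverse x = f (inverse u)" by (simp add: hom_on_inv[OF assms])
  then show "inverse x \<in> f ` H" using u assms(2) by (simp add: sgrpD)
  fix y assume "y \<in> f ` H"
  then obtain v where v: "v \<in> H" "y = f v" by auto
  then have "x * y = f (u * v)" using u by (simp add: hom_on_mult[OF assms(1)])
  then show "x * y \<in> f ` H" using u v assms(2) by (simp add: sgrpD)
qed

lemma sgrp_vimage:
  assumes "hom_on f H" "sgrp H" "sgrp L" shows "sgrp {x \<in> H. f x \<in> L}"
  unfolding sgrp_def
  using assms hom_on_one[OF assms(1,2)] hom_on_inv[OF assms(1,2)] hom_on_mult[OF assms(1)]
  by (auto simp: sgrpD)

lemma hom_on_cj: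
  assumes "hom_on f H" "sgrp H" "g \<in> H" "x \<in> H" shows "f (cj g x) = cj (f g) (f x)"
  using assms by (simp add: cj_def hom_on_mult[OF assms(1)] hom_on_inv[OF assms(1,2)] sgrpD)

lemma gen_image:
  assumes f: "hom_on f H" "sgrp H" and X: "X \<subseteq> H" shows "f ` gen X = gen (f ` X)"
proof
  have gX: "sgrp (gen X)" "gen X \<subseteq> H" using sgrp_gen[OF f(2) X] gen_least[OF f(2) X] by auto
  have s: "sgrp (f ` gen X)" using sgrp_image[OF hom_on_sub[OF f(1) gX(2)] gX(1)] .
  show "gen (f ` X) \<subseteq> f ` gen X" using gen_sup[of X] by (intro gen_least[OF s]) blast
  have "sgrp (gen (f ` X))" using X by (intro sgrp_gen[OF sgrp_image[OF f]]) auto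
  then have "gen X \<subseteq> {x \<in> H. f x \<in> gen (f ` X)}"
    using X gen_sup[of "f ` X"] by (intro gen_least[OF sgrp_vimage[OF f]]) auto
  then show "f ` gen X \<subseteq> gen (f ` X)" by auto
qed

text \<open>A p-element of the image has a preimage that is a p-element: raise any preimage to a
  multiple of the p'-part of the order of \<open>H\<close> that is congruent to 1 modulo the p-power
  killing the image. Commutation is then inherited from the preimages.\<close>

lemma nil_image:
  assumes f: "hom_on f H" "sgrp H" and n: "nil H" shows "nil (f ` H)"
proof -
  have lift: "\<exists>u\<in>H. pel p u \<and> f u = x" if p: "prime p" and x: "x \<in> f ` H" "pel p x" for p x
  proof -
    obtain h where h: "h \<in> H" "x = f h" using x by auto
    obtain k where k: "x ^ (p ^ k) = 1" using x(2) by (auto simp: pel_def)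
    define a where "a = multiplicity p (card H)"
    obtain m where m: "card H = p ^ a * m" "\<not> p dvd m"
      using multiplicity_decompose'[of "card H" p] p sgrp_card_pos[OF f(2)]
      by (metis a_def not_prime_unit less_numeral_extra(3))
    have "coprime m (p ^ k)" using m(2) p by (metis coprime_commute coprime_power_left_iff prime_imp_coprime)
    moreover have "m \<noteq> 0" using m(1) sgrp_card_pos[OF f(2)] by auto
    ultimately obtain i j where ij: "m * i = p ^ k * j + 1"
      using bezout_nat[of m "p ^ k"] by auto
    let ?u = "h ^ (m * i)"
    have "?u ^ (p ^ a) = (h ^ card H) ^ i" unfolding m(1)
      by (simp add: power_mult[symmetric] ac_simps)
    then have "pel p ?u" using pow_card[OF f(2) h(1)] by (auto simp: pel_def)
    moreover have "f ?u = x ^ (m * i)" using hom_on_pow[OF f h(1)] h(2) by simp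
    then have "f ?u = (x ^ (p ^ k)) ^ j * x" unfolding ij
      by (simp del: power_Suc add: power_Suc2 power_mult)
    then have "f ?u = x" using k by simp
    ultimately show ?thesis using sgrp_pow[OF f(2) h(1)] by blast
  qed
  show ?thesis unfolding nil_def
  proof (intro allI impI)
    fix p q x y assume *: "prime p" "prime q" "p \<noteq> q" "x \<in> f ` H" "y \<in> f ` H" "pel p x" "pel q y"
    obtain u v where "u \<in> H" "pel p u" "f u = x" "v \<in> H" "pel q v" "f v = y"
      using lift[OF *(1,4,6)] lift[OF *(2,5,7)] by blast
    moreover from this have "u * v = v * u" using n *(1-3) unfolding nil_def by blast
    ultimately show "x * y = y * x" using hom_on_mult[OF f(1)] by metis
  qed
qed

section \<open>Solvable groups\<close>

definition comms :: "'a::mgroup set \<Rightarrow> 'a set" where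
  "comms K = (\<lambda>(x, y). x * y * inverse x * inverse y) ` (K \<times> K)"

definition der :: "'a::mgroup set \<Rightarrow> 'a set" where
  "der K = gen (comms K)"

lemma comms_sub: "sgrp K \<Longrightarrow> comms K \<subseteq> K"
  by (auto simp: comms_def sgrpD)

lemma comms_in: "x \<in> K \<Longrightarrow> y \<in> K \<Longrightarrow> x * y * inverse x * inverse y \<in> comms K"
  by (auto simp: comms_def)

lemma sgrp_der: "sgrp K \<Longrightarrow> sgrp (der K)"
  unfolding der_def using sgrp_gen comms_sub by blast

lemma der_sub: "sgrp K \<Longrightarrow> der K \<subseteq> K"
  unfolding der_def using gen_least comms_sub by blast

lemma comms_image:
  assumes "hom_on f H" "sgrp H" "K \<subseteq> H" shows "f ` comms K = comms (f ` K)"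
proof -
  have e: "f (x * y * inverse x * inverse y) = f x * f y * inverse (f x) * inverse (f y)"
    if "x \<in> K" "y \<in> K" for x y
    using that assms by (simp add: subset_iff hom_on_mult[OF assms(1)] hom_on_inv[OF assms(1,2)] sgrpD)
  have "f ` comms K = (\<lambda>(x, y). f x * f y * inverse (f x) * inverse (f y)) ` (K \<times> K)"
    unfolding comms_def image_image using e by (intro image_cong) auto
  also have "\<dots> = comms (f ` K)" unfolding comms_def by force
  finally show ?thesis .
qed

lemma der_image:
  assumes "hom_on f H" "sgrp H" "sgrp K" "K \<subseteq> H" shows "f ` der K = der (f ` K)"
proof -
  have "comms K \<subseteq> H" using comms_sub[OF assms(3)] assms(4) by blast
  from gen_image[OF assms(1,2) this] show ?thesis
    unfolding der_def comms_image[OF assms(1,2,4)] .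
qed

lemma hom_on_conj: "hom_on (cj g) H"
  by (simp add: hom_on_def cj_mult)

lemma der_cj: assumes "sgrp K" shows "cj g ` der K = der (cj g ` K)"
  using der_image[OF hom_on_conj assms assms] by blast

lemma nrml_der: "nrml K G \<Longrightarrow> nrml (der K) G"
  using der_sub[of K] by (auto simp: nrml_def sgrp_der der_cj)

text \<open>For finite groups the following is equivalent to solvability.\<close>

definition solv :: "'a::mgroup set \<Rightarrow> bool" where
  "solv H \<longleftrightarrow> (\<forall>K. sgrp K \<longrightarrow> K \<subseteq> H \<longrightarrow> der K = K \<longrightarrow> K = {1})"

lemma solv_sub: "solv H \<Longrightarrow> K \<subseteq> H \<Longrightarrow> solv K"
  unfolding solv_def by blast

lemma solvD: "solv H \<Longrightarrow> sgrp K \<Longrightarrow> K \<subseteq> H \<Longrightarrow> der K = K \<Longrightarrow> K = {1}"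
  unfolding solv_def by blast

lemma solv_extension:
  assumes f: "hom_on f G" "sgrp G" "solv (f ` G)" and ker: "\<And>x. x \<in> G \<Longrightarrow> f x = 1 \<Longrightarrow> x \<in> N" and N: "solv N"
  shows "solv G"
  unfolding solv_def
proof (intro allI impI)
  fix K assume K: "sgrp K" "K \<subseteq> G" "der K = K"
  have "der (f ` K) = f ` K" using der_image[OF f(1,2) K(1,2)] K(3) by simp
  moreover have "sgrp (f ` K)" using sgrp_image[OF hom_on_sub[OF f(1) K(2)] K(1)] .
  ultimately have "f ` K = {1}" using solvD[OF f(3)] K(2) by blast
  then have "K \<subseteq> N" using ker K(2) by blast
  then show "K = {1}" using solvD[OF N K(1) _ K(3)] by blast
qed

section \<open>A homomorphism from a nilpotent group to a cyclic group of prime order\<close>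

text \<open>A maximal proper subgroup over \<open>Z\<close> is normal because normalizers grow, and
  the quotient is cyclic of prime order. \<phi> is the exponent of a generator of this quotient,
  kept as a natural number modulo p so that the transfer can later be written as a sum.\<close>

lemma nil_hom_prime:
  assumes K: "sgrp K" "nil K" and Z: "sgrp Z" "Z \<subseteq> K" "Z \<noteq> K"
  obtains p and \<phi> :: "'a::mgroup \<Rightarrow> nat" where "prime p"
    "\<forall>x\<in>K. \<forall>y\<in>K. [\<phi> (x * y) = \<phi> x + \<phi> y] (mod p)"
    "\<forall>z\<in>Z. p dvd \<phi> z" "\<exists>x\<in>K. \<not> p dvd \<phi> x"
proof -
  define F where "F = {N. sgrp N \<and> Z \<subseteq> N \<and> N \<subset> K}"
  have "F \<subseteq> Pow K" by (auto simp: F_def)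
  then have "finite F" using K(1) by (meson finite_Pow_iff finite_subset sgrpD(1))
  moreover have "Z \<in> F" using Z by (auto simp: F_def)
  ultimately obtain N where NF: "N \<in> F" and max: "\<And>L. L \<in> F \<Longrightarrow> card L \<le> card N"
    using Max_in[of "card ` F"] Max_ge[of "card ` F"] by (metis (no_types, lifting) empty_iff finite_imageI image_iff)
  then have N: "sgrp N" "Z \<subseteq> N" "N \<subseteq> K" "N \<noteq> K" by (auto simp: F_def)
  have maxi: "L = N \<or> L = K" if L: "sgrp L" "N \<subseteq> L" "L \<subseteq> K" for L
  proof (cases "L = K")
    case False
    then have "card L \<le> card N" using L N(2) by (intro max) (auto simp: F_def)
    then show ?thesis using L card_seteq[OF sgrpD(1)[OF L(1)]] by blast
  qed simp
  obtain x where x: "x \<in> K" "x \<notin> N" "cj x ` N = N"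
    using nil_normalizer_grows[OF K N(1,3,4)] .
  have "N \<subseteq> Nz K N" using nrmlD(2)[OF nrml_Nz[OF K(1) N(1,3)]] .
  moreover have "x \<in> Nz K N" using x by (simp add: Nz_def)
  ultimately have "Nz K N = K" using maxi[OF sgrp_Nz[OF K(1)] _ Nz_sub, of N] x(2) by blast
  then have nN: "cj g ` N = N" if "g \<in> K" for g using that by (auto simp: Nz_def)
  define L where "L d = sprod (gen {x ^ d}) N" for d :: nat
  have xd: "x ^ d \<in> K" for d using sgrp_pow[OF K(1) x(1)] .
  have gx: "sgrp (gen {x ^ d})" "gen {x ^ d} \<subseteq> K" for d
    using sgrp_gen[OF K(1), of "{x ^ d}"] gen_least[OF K(1), of "{x ^ d}"] xd by auto
  have Lsg: "sgrp (L d)" for d unfolding L_def by (rule sgrp_sprod[OF gx(1) N(1)]) (use nN gx(2) in blast)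
  have Lsub: "L d \<subseteq> K" for d unfolding L_def by (rule sprod_sub[OF K(1) gx(2) N(3)])
  have NL: "N \<subseteq> L d" for d unfolding L_def by (rule sprod_right[OF sgrpD(2)[OF gx(1)]])
  have xL: "x ^ d \<in> L d" for d
    unfolding L_def using sprod_left[OF sgrpD(2)[OF N(1)], of "gen {x ^ d}"] gen_sup[of "{x ^ d}"] by blast
  have Lel: "\<exists>i. \<exists>n\<in>N. y = x ^ (d * i) * n" if y: "y \<in> L d" for y d
  proof -
    obtain h n where "y = h * n" "h \<in> gen {x ^ d}" "n \<in> N" using y unfolding L_def by (metis sprodE)
    then show ?thesis using gen_single[OF K(1) xd[of d]] by (auto simp: power_mult)
  qed
  define m where "m = (LEAST m. 0 < m \<and> x ^ m \<in> N)"
  have "0 < card K \<and> x ^ card K \<in> N" using pow_card[OF K(1) x(1)] sgrp_card_pos[OF K(1)] sgrpD(2)[OF N(1)] by simp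
  then have m: "0 < m" "x ^ m \<in> N" unfolding m_def using LeastI[of "\<lambda>m. 0 < m \<and> x ^ m \<in> N"] by blast+
  have mdvd: "x ^ j \<in> N \<longleftrightarrow> m dvd j" for j
  proof
    assume j: "x ^ j \<in> N"
    have "x ^ j = (x ^ m) ^ (j div m) * x ^ (j mod m)"
      by (simp add: power_mult[symmetric] power_add[symmetric])
    then have "x ^ (j mod m) \<in> N" using j sgrp_mult_iff(1)[OF N(1) sgrp_pow[OF N(1) m(2)]] by metis
    then have "\<not> 0 < j mod m" using not_less_Least[of "j mod m" "\<lambda>m. 0 < m \<and> x ^ m \<in> N"] m(1)
      unfolding m_def[symmetric] by auto
    then show "m dvd j" by auto
  next
    assume "m dvd j"
    then show "x ^ j \<in> N" using sgrp_pow[OF N(1) m(2)] by (auto simp: power_mult elim!: dvdE)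
  qed
  have "m \<noteq> 1" using m(2) x(2) by auto
  then obtain p where p: "prime p" "p dvd m" using prime_factor_nat by blast
  \<comment> \<open>For a prime p dividing m, the subgroup generated by \<open>N\<close> and
    \<open>x ^ p\<close> misses x. By maximality it equals \<open>N\<close>, so m divides p and the
    quotient has order p.\<close>
  have "x \<notin> L p"
  proof
    assume "x \<in> L p"
    then obtain h n where hn: "x = h * n" "h \<in> gen {x ^ p}" "n \<in> N" unfolding L_def by (metis sprodE)
    have "inverse h \<in> gen {x ^ p}" using hn(2) sgrpD(4)[OF gx(1)] by blast
    then obtain i where i: "inverse h = (x ^ p) ^ i" using gen_single[OF K(1) xd[of p]] by auto
    have "n = inverse h * x" using hn(1) by (metis inv_cancel_left)
    then have "x ^ (p * i + 1) \<in> N" using hn(3) unfolding i by (simp del: power_Suc add: power_Suc2 power_mult)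
    then have "p dvd p * i + 1" using mdvd p(2) dvd_trans by blast
    then show False using p(1) by (metis dvd_add_right_iff dvd_triv_left not_prime_unit)
  qed
  then have "L p = N" using maxi[OF Lsg NL Lsub, of p] x(1) by blast
  then have "m dvd p" using xL[of p] mdvd by blast
  then have mp: "m = p" using p(2) by (rule dvd_antisym)
  have "L 1 = K" using maxi[OF Lsg NL Lsub, of 1] xL[of 1] x(2) by auto
  then have rep: "\<exists>i. \<exists>n\<in>N. y = x ^ i * n" if "y \<in> K" for y using Lel[of y 1] that \<open>L 1 = K\<close> by simp
  have le: "[i = j] (mod p)" if ij: "i \<le> j" "x ^ i * n = x ^ j * n'" "n \<in> N" "n' \<in> N" for i j n n'
  proof -
    have "x ^ j = x ^ i * x ^ (j - i)" using ij(1) by (simp add: power_add[symmetric])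
    then have "x ^ i * n = x ^ i * (x ^ (j - i) * n')" using ij(2) by (simp add: mult.assoc)
    then have "n = x ^ (j - i) * n'" by (simp only: mul_left_cancel)
    then have "x ^ (j - i) \<in> N" using ij(3,4) sgrp_mult_iff(2)[OF N(1)] by blast
    then have "p dvd j - i" using mdvd mp by simp
    then show ?thesis using ij(1) by (metis cong_altdef_nat cong_sym)
  qed
  have uni: "[i = j] (mod p)" if "x ^ i * n = x ^ j * n'" "n \<in> N" "n' \<in> N" for i j n n'
    using le[of i j n n'] le[of j i n' n] that by (metis cong_sym nat_le_linear)
  define \<phi> where "\<phi> y = (SOME i. \<exists>n\<in>N. y = x ^ i * n)" for y
  have phi: "\<exists>n\<in>N. y = x ^ \<phi> y * n" if "y \<in> K" for y
    unfolding \<phi>_def by (rule someI_ex[OF rep[OF that]])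
  have phi_eq: "[\<phi> y = i] (mod p)" if "y \<in> K" "y = x ^ i * n" "n \<in> N" for y i n
    using phi[OF that(1)] uni that(2,3) by metis
  show ?thesis
  proof (rule that[OF p(1)]; (intro ballI)?)
    fix y z assume yz: "y \<in> K" "z \<in> K"
    obtain n n' where n: "n \<in> N" "y = x ^ \<phi> y * n" "n' \<in> N" "z = x ^ \<phi> z * n'" using phi yz by meson
    have "cj (inverse (x ^ \<phi> z)) n \<in> N" using nN[OF sgrpD(4)[OF K(1) xd]] n(1) by blast
    then have c: "cj (inverse (x ^ \<phi> z)) n * n' \<in> N" using n(3) sgrpD(3)[OF N(1)] by blast
    have "y * z = (x ^ \<phi> y * n) * (x ^ \<phi> z * n')" using n(2,4) by simp
    also have "\<dots> = x ^ (\<phi> y + \<phi> z) * (cj (inverse (x ^ \<phi> z)) n * n')"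
      by (simp add: power_add cj_def grp)
    finally show "[\<phi> (y * z) = \<phi> y + \<phi> z] (mod p)"
      using phi_eq[OF sgrpD(3)[OF K(1) yz] _ c] by blast
  next
    fix z assume z: "z \<in> Z"
    then have "z \<in> N" "z = x ^ 0 * z" using N by auto
    then have "[\<phi> z = 0] (mod p)" using N(3) by (intro phi_eq) auto
    then show "p dvd \<phi> z" by (simp add: cong_0_iff)
  next
    have "x = x ^ 1 * 1" by simp
    then have "[\<phi> x = 1] (mod p)" by (rule phi_eq[OF x(1) _ sgrpD(2)[OF N(1)]])
    then have "\<not> p dvd \<phi> x" using p(1) by (auto simp: cong_dvd_iff)
    then show "\<exists>x\<in>K. \<not> p dvd \<phi> x" using x(1) by blast
  qed
qed

lemma nil_imp_solv: assumes "nil H" shows "solv H"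
  unfolding solv_def
proof (intro allI impI)
  fix K assume K: "sgrp K" "K \<subseteq> H" "der K = K"
  show "K = {1}"
  proof (rule ccontr)
    assume "K \<noteq> {1}"
    then have ne: "{1} \<noteq> K" by simp
    have sub: "{1} \<subseteq> K" using sgrpD(2)[OF K(1)] by simp
    obtain p and \<phi> :: "'a \<Rightarrow> nat" where p1: "prime p"
      and p2': "\<forall>x\<in>K. \<forall>y\<in>K. [\<phi> (x * y) = \<phi> x + \<phi> y] (mod p)"
      and p3': "\<forall>z\<in>{1}. p dvd \<phi> z" and p4: "\<exists>x\<in>K. \<not> p dvd \<phi> x"
      using nil_hom_prime[OF K(1) nil_sub[OF assms K(2)] sgrp_one sub ne] .
    note p2 = p2'[rule_format] and p3 = p3'[rule_format]
    let ?N = "{x \<in> K. p dvd \<phi> x}"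
    have dv: "p dvd \<phi> (x * y) \<longleftrightarrow> p dvd \<phi> x + \<phi> y" if "x \<in> K" "y \<in> K" for x y
      using p2[OF that] cong_dvd_iff by blast
    have iv: "p dvd \<phi> x + \<phi> (inverse x)" if "x \<in> K" for x
      using dv[OF that sgrpD(4)[OF K(1) that]] p3 by (simp add: right_inv)
    have "p dvd \<phi> (inverse x)" if "x \<in> ?N" for x
      using iv[of x] that by (simp add: dvd_add_right_iff)
    then have "sgrp ?N" unfolding sgrp_def using K(1) p3 dv by (auto simp: sgrpD)
    moreover have "comms K \<subseteq> ?N"
    proof
      fix c assume "c \<in> comms K"
      then obtain x y where xy: "x \<in> K" "y \<in> K" "c = x * y * inverse x * inverse y" by (auto simp: comms_def)
      have i: "inverse x \<in> K" "inverse y \<in> K" "x * y \<in> K" "x * y * inverse x \<in> K"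
        using xy sgrpD(3,4)[OF K(1)] by blast+
      have "[\<phi> c = \<phi> x + \<phi> y + \<phi> (inverse x) + \<phi> (inverse y)] (mod p)"
        unfolding xy(3) using p2[OF i(4,2)] p2[OF i(3,1)] p2[OF xy(1,2)]
        by (meson cong_add_rcancel_nat cong_trans)
      also have "\<phi> x + \<phi> y + \<phi> (inverse x) + \<phi> (inverse y) = (\<phi> x + \<phi> (inverse x)) + (\<phi> y + \<phi> (inverse y))" by simp
      finally have "p dvd \<phi> c" using iv[OF xy(1)] iv[OF xy(2)] by (metis cong_dvd_iff dvd_add)
      moreover have "c \<in> K" using xy i sgrpD(3)[OF K(1)] by blast
      ultimately show "c \<in> ?N" by simp
    qed
    ultimately have "der K \<subseteq> ?N" unfolding der_def by (rule gen_least)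
    then show False using K(3) p4 by blast
  qed
qed

section \<open>A type containing all finite groups\<close>

typedef gperm = "{f :: nat \<Rightarrow> nat. bij f}"
  by (rule exI[of _ id]) simp

setup_lifting type_definition_gperm

instantiation gperm :: mgroup
begin
lift_definition one_gperm :: gperm is "\<lambda>n. n" by (simp add: bij_id[unfolded id_def])
lift_definition times_gperm :: "gperm \<Rightarrow> gperm \<Rightarrow> gperm" is "\<lambda>f g n. f (g n)"
  using bij_comp unfolding comp_def by blast
lift_definition inverse_gperm :: "gperm \<Rightarrow> gperm" is "\<lambda>f. inv_into UNIV f" by (rule bij_imp_bij_inv)
lift_definition divide_gperm :: "gperm \<Rightarrow> gperm \<Rightarrow> gperm" is "\<lambda>f g n. f (inv_into UNIV g n)"
  using bij_comp[OF bij_imp_bij_inv] unfolding comp_def by blast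
instance
  by standard (transfer; simp add: bij_is_inj)+
end

text \<open>The set is numbered by an initial segment of the natural numbers and permutations are
  extended by the identity. Functions on \<open>'s\<close> are arbitrary outside \<open>S\<close>,
  so both properties are restricted to bijections of \<open>S\<close> and to equality on
  \<open>S\<close>.\<close>

lemma perm_embedding:
  assumes "finite S"
  obtains emb :: "('s \<Rightarrow> 's) \<Rightarrow> gperm" where
    "\<forall>f g. bij_betw f S S \<longrightarrow> bij_betw g S S \<longrightarrow> emb (\<lambda>s. f (g s)) = emb f * emb g"
    "\<forall>f g. bij_betw f S S \<longrightarrow> bij_betw g S S \<longrightarrow> emb f = emb g \<longleftrightarrow> (\<forall>s\<in>S. f s = g s)"
proof -
  obtain e :: "'s \<Rightarrow> nat" and k where e: "bij_betw e S {..<k}"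
    using ex_bij_betw_finite_nat[OF assms] by (auto simp: atLeast0LessThan)
  define d where "d = inv_into S e"
  have d: "bij_betw d {..<k} S" unfolding d_def by (rule bij_betw_inv_into[OF e])
  have de: "d (e s) = s" if "s \<in> S" for s unfolding d_def using e that by (simp add: bij_betw_inv_into_left)
  have ed: "e (d n) = n" if "n < k" for n unfolding d_def using e that by (simp add: bij_betw_inv_into_right)
  have dS: "d n \<in> S" if "n < k" for n using d that by (auto dest: bij_betwE)
  have ek: "e s < k" if "s \<in> S" for s using e that by (auto dest: bij_betwE)
  define E where "E f n = (if n < k then e (f (d n)) else n)" for f and n :: nat
  have bij: "bij (E f)" if f: "bij_betw f S S" for f
  proof -
    have "bij_betw (e \<circ> (f \<circ> d)) {..<k} {..<k}"
      using bij_betw_trans[OF bij_betw_trans[OF d f] e] by (simp add: comp_assoc)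
    then have "bij_betw (E f) {..<k} {..<k}"
      by (rule bij_betw_cong[THEN iffD1, rotated]) (simp add: E_def)
    moreover have "bij_betw (E f) {k..} {k..}"
      by (rule bij_betw_cong[THEN iffD1, OF _ bij_betw_id[of "{k..}"]]) (simp add: E_def)
    ultimately have "bij_betw (E f) ({..<k} \<union> {k..}) ({..<k} \<union> {k..})"
      by (rule bij_betw_combine) auto
    moreover have "{..<k} \<union> {k..} = (UNIV :: nat set)" by auto
    ultimately show ?thesis by simp
  qed
  define emb where "emb f = Abs_gperm (E f)" for f
  have R: "Rep_gperm (emb f) = E f" if "bij_betw f S S" for f
    unfolding emb_def using bij[OF that] by (simp add: Abs_gperm_inverse)
  show ?thesis
  proof (rule that; intro allI impI)
    fix f g assume fg: "bij_betw f S S" "bij_betw g S S"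
    have c: "bij_betw (\<lambda>s. f (g s)) S S" using bij_betw_trans[OF fg(2,1)] by (simp add: comp_def)
    have gS: "g s \<in> S" if "s \<in> S" for s using fg(2) that by (auto dest: bij_betwE)
    have "Rep_gperm (emb (\<lambda>s. f (g s))) = Rep_gperm (emb f * emb g)"
      unfolding R[OF c] times_gperm.rep_eq R[OF fg(1)] R[OF fg(2)]
      by (rule ext) (simp add: E_def de dS gS ek)
    then show "emb (\<lambda>s. f (g s)) = emb f * emb g" by (simp add: Rep_gperm_inject)
    have "emb f = emb g \<longleftrightarrow> E f = E g" using R[OF fg(1)] R[OF fg(2)] Rep_gperm_inject by metis
    also have "\<dots> \<longleftrightarrow> (\<forall>s\<in>S. f s = g s)"
    proof
      assume a: "E f = E g"
      show "\<forall>s\<in>S. f s = g s"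
      proof
        fix s assume s: "s \<in> S"
        have "E f (e s) = E g (e s)" using a by simp
        then have "e (f s) = e (g s)" using s by (simp add: E_def ek de)
        moreover have "f s \<in> S" "g s \<in> S" using fg s by (auto dest: bij_betwE)
        ultimately show "f s = g s" using de by metis
      qed
    next
      assume "\<forall>s\<in>S. f s = g s"
      then show "E f = E g" by (intro ext) (simp add: E_def dS)
    qed
    finally show "emb f = emb g \<longleftrightarrow> (\<forall>s\<in>S. f s = g s)" .
  qed
qed

text \<open>\<open>G\<close> acts on the left cosets of \<open>N\<close> by left multiplication. The
  kernel is the intersection of the conjugates of \<open>N\<close>, which is \<open>N\<close>
  itself.\<close>

lemma quotient_hom:
  assumes G: "sgrp G" and N: "nrml N G"
  obtains f :: "'a::mgroup \<Rightarrow> gperm" where "hom_on f G" "\<forall>x\<in>G. f x = 1 \<longleftrightarrow> x \<in> N"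
proof -
  let ?S = "(\<lambda>x. lcos x N) ` G"
  have fin: "finite ?S" using G by (simp add: sgrpD)
  obtain emb :: "('a set \<Rightarrow> 'a set) \<Rightarrow> gperm" where
    e1': "\<forall>f g. bij_betw f ?S ?S \<longrightarrow> bij_betw g ?S ?S \<longrightarrow> emb (\<lambda>s. f (g s)) = emb f * emb g" and
    e2': "\<forall>f g. bij_betw f ?S ?S \<longrightarrow> bij_betw g ?S ?S \<longrightarrow> emb f = emb g \<longleftrightarrow> (\<forall>s\<in>?S. f s = g s)"
    using perm_embedding[OF fin] .
  note e1 = e1'[rule_format] and e2 = e2'[rule_format]
  let ?a = "\<lambda>(g::'a) C. (\<lambda>y. g * y) ` C"
  have bij: "bij_betw (?a g) ?S ?S" if g: "g \<in> G" for g
  proof (rule bij_betwI[where g = "?a (inverse g)"])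
    show "?a g \<in> ?S \<rightarrow> ?S" "?a (inverse g) \<in> ?S \<rightarrow> ?S"
      using g G by (auto simp: lcos_lcos sgrpD)
  qed (auto simp: image_image grp)
  have mult: "emb (?a (g * h)) = emb (?a g) * emb (?a h)" if "g \<in> G" "h \<in> G" for g h
    using e1[OF bij[OF that(1)] bij[OF that(2)]] by (simp add: image_image mult.assoc)
  have one: "?a 1 = (\<lambda>C. C)" by (rule ext) simp
  have hom: "hom_on (\<lambda>g. emb (?a g)) G" unfolding hom_on_def using mult by blast
  have "emb (?a 1) = 1" using hom_on_one[OF hom G] .
  then have A: "emb (?a g) = 1 \<longleftrightarrow> (\<forall>s\<in>?S. ?a g s = ?a 1 s)" if "g \<in> G" for g
    using e2[OF bij[OF that] bij[OF sgrpD(2)[OF G]]] by metis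
  have B: "(\<forall>s\<in>?S. ?a g s = ?a 1 s) \<longleftrightarrow> g \<in> N" if g: "g \<in> G" for g
  proof -
    have "(\<forall>s\<in>?S. ?a g s = ?a 1 s) \<longleftrightarrow> (\<forall>x\<in>G. g \<in> cj x ` N)"
      unfolding one by (simp add: lcos_fixed_iff[OF nrmlD(1)[OF N]])
    also have "\<dots> \<longleftrightarrow> g \<in> N" using nrmlD(3)[OF N] sgrpD(2)[OF G] by auto
    finally show ?thesis .
  qed
  have "\<forall>g\<in>G. emb (?a g) = 1 \<longleftrightarrow> g \<in> N" by (rule ballI) (simp only: A B)
  with hom show ?thesis by (rule that)
qed

section \<open>Simple groups factorised by nilpotent subgroups of coprime orders\<close>

lemma finite_max_exists:
  fixes f :: "'b \<Rightarrow> nat"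
  assumes "finite F" "x \<in> F" obtains M where "M \<in> F" "\<forall>L\<in>F. f L \<le> f M"
proof -
  have "Max (f ` F) \<in> f ` F" using assms by (intro Max_in) auto
  then obtain M where M: "M \<in> F" "Max (f ` F) = f M" by blast
  have "\<forall>L\<in>F. f L \<le> Max (f ` F)" using assms(1) by simp
  then show ?thesis using that[OF M(1)] M(2) by simp
qed

lemma nil_centre_prt:
  assumes p: "prime p" and H: "sgrp H" "nil H" shows "Cz (prt p H) (prt p H) \<subseteq> Cz H H"
proof
  fix z assume z: "z \<in> Cz (prt p H) (prt p H)"
  then have zH: "z \<in> H" "pel p z" using Cz_sub prt_sub prt_pel by blast+
  have "Cz H {z} = H"
  proof (rule prt_subset_all[OF sgrp_Cz[OF H(1)] H(1,2) Cz_sub])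
    fix q :: nat assume q: "prime q"
    show "prt q H \<subseteq> Cz H {z}"
    proof (cases "q = p")
      case True then show ?thesis using z by (auto simp: Cz_def prt_def)
    next
      case False then show ?thesis using H(2) p q zH unfolding nil_def Cz_def prt_def by blast
    qed
  qed
  then have "h * z = z * h" if "h \<in> H" for h using that by (auto simp: Cz_def)
  then show "z \<in> Cz H H" using zH by (auto simp: Cz_def)
qed

text \<open>The index k of \<open>A \<inter> T\<close> in \<open>T\<close> divides the order of
  \<open>T\<close>. It also divides m, because the order of \<open>sprod A T\<close> is k times that
  of \<open>A\<close> and divides the order of \<open>H\<close>.\<close>

lemma coprime_subset:
  assumes A: "sgrp A" and T: "sgrp T" and S: "sgrp (sprod A T)" "sgrp H" "sprod A T \<subseteq> H"
    and c: "card H = card A * m" "coprime (card T) m"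
  shows "T \<subseteq> A"
proof -
  have I: "sgrp (A \<inter> T)" using sgrp_Int A T .
  have "card (A \<inter> T) dvd card T" by (rule sgrp_card_dvd[OF I T]) simp
  then obtain k where k: "card T = card (A \<inter> T) * k" by (elim dvdE)
  have "card (sprod A T) * card (A \<inter> T) = (card A * k) * card (A \<inter> T)"
    using card_sprod[OF A T] k by (simp add: ac_simps)
  then have "card (sprod A T) = card A * k" using sgrp_card_pos[OF I] by simp
  then have "card A * k dvd card A * m" using sgrp_card_dvd[OF S] c(1) by simp
  then have "k dvd m" using sgrp_card_pos[OF A] by simp
  moreover have "k dvd card T" using k by simp
  ultimately have "k = 1" using c(2) coprime_common_divisor_nat by blast
  then have "A \<inter> T = T" using k T by (intro card_subset_eq) (auto simp: sgrpD)
  then show ?thesis by blast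
qed

lemma prime_order_power:
  assumes "sgrp H" "x \<in> H" "x \<noteq> 1"
  obtains n p where "prime p" "p dvd card H" "x ^ n \<noteq> 1" "(x ^ n) ^ p = 1" "x ^ n \<in> H"
proof -
  have g: "sgrp (gen {x})" "gen {x} \<subseteq> H" using sgrp_gen[OF assms(1)] gen_least[OF assms(1)] assms(2) by auto
  have "gen {x} \<noteq> {1}" using gen_sup[of "{x}"] assms(3) by auto
  then obtain p where p: "prime p" "p dvd card (gen {x})" using sgrp_prime_dvd[OF g(1)] by blast
  obtain y where y: "y \<in> gen {x}" "y \<noteq> 1" "y ^ p = 1" using cauchy[OF p(1) g(1) p(2)] .
  then obtain n where "y = x ^ n" using gen_single[OF assms(1,2)] by auto
  moreover have "p dvd card H" using p(2) sgrp_card_dvd[OF g(1) assms(1) g(2)] dvd_trans by blast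
  ultimately show ?thesis using that p(1) y g(2) by blast
qed

lemma prime_order_dvd:
  assumes "sgrp H" "x \<in> H" "x \<noteq> 1" "prime p" "x ^ p = 1" shows "p dvd card H"
proof (rule ccontr)
  assume "\<not> p dvd card H"
  moreover have "pel p x" using assms(5) by (auto simp: pel_def intro: exI[of _ 1])
  ultimately show False using pel_order_coprime[of p x "card H"] pow_card[OF assms(1,2)] assms(3,4) by blast
qed

lemma pel_prime_order: "x ^ p = 1 \<Longrightarrow> pel p x"
  by (auto simp: pel_def intro: exI[of _ 1])

lemma Cz_cj: "sgrp G \<Longrightarrow> g \<in> G \<Longrightarrow> Cz G {cj g x} = cj g ` Cz G {x}"
proof -
  assume G: "sgrp G" "g \<in> G"
  have e: "h \<in> Cz G {cj g x} \<longleftrightarrow> cj (inverse g) h \<in> Cz G {x}" for h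
  proof -
    have "cj (inverse g) h \<in> G \<longleftrightarrow> h \<in> G"
      using cj_image_self[OF G] in_cj_image[of h g G] by simp
    moreover have "cj h (cj g x) = cj g x \<longleftrightarrow> cj (cj (inverse g) h) x = x"
    proof -
      have "cj (cj (inverse g) h) x = cj (inverse g) (cj h (cj g x))" by (simp add: cj_def grp)
      then show ?thesis by (metis cj_cancel)
    qed
    ultimately show ?thesis by (simp add: Cz_fix)
  qed
  show ?thesis by (rule Set.set_eqI) (simp only: in_cj_image e)
qed

definition core :: "'a::mgroup set \<Rightarrow> 'a set \<Rightarrow> 'a set" where
  "core H X = {x \<in> H. \<forall>h\<in>H. cj h x \<in> X}"

lemma core_sub: assumes "sgrp H" shows "core H X \<subseteq> X"
proof
  fix x assume "x \<in> core H X"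
  then have "cj 1 x \<in> X" using sgrpD(2)[OF assms] unfolding core_def by blast
  then show "x \<in> X" by (simp add: cj_one)
qed

lemma nrml_core:
  assumes H: "sgrp H" and X: "sgrp X" shows "nrml (core H X) H"
proof (rule nrmlI)
  show "sgrp (core H X)" unfolding sgrp_def core_def
    using sgrpD[OF H] sgrpD[OF X] by (auto simp: cj_mult cj_inv cj_one)
  show "core H X \<subseteq> H" by (auto simp: core_def)
  fix g x assume "g \<in> H" "x \<in> core H X"
  then show "cj g x \<in> core H X" unfolding core_def by (auto simp: cj_cj cj_in[OF H] sgrpD[OF H])
qed

lemma core_greatest: "nrml T H \<Longrightarrow> T \<subseteq> X \<Longrightarrow> T \<subseteq> core H X"
  unfolding core_def using nrmlD by blast

lemma nrml_commute:
  assumes "nrml M G" "nrml N G" "M \<inter> N \<subseteq> {1}" "x \<in> M" "y \<in> N" shows "x * y = y * x"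
proof -
  have G: "x \<in> G" "y \<in> G" using assms nrmlD(2) by blast+
  have "cj x y * inverse y \<in> N" using nrmlD(4)[OF assms(2) G(1) assms(5)] nrmlD(1)[OF assms(2)] assms(5)
    by (simp add: sgrpD)
  moreover have "x * cj y (inverse x) \<in> M"
    using nrmlD(4)[OF assms(1) G(2), of "inverse x"] nrmlD(1)[OF assms(1)] assms(4) by (simp add: sgrpD)
  moreover have "x * cj y (inverse x) = cj x y * inverse y" by (simp add: cj_def grp)
  ultimately have "cj x y * inverse y = 1" using assms(3) by auto
  then have "cj x y * inverse y * y = y" by simp
  then have "cj x y = y" by (simp add: mult.assoc left_inv)
  then show ?thesis by (simp add: cj_fix_iff)
qed

text \<open>The configuration that a minimal counterexample leads to. \<open>fs\<close> is what
  minimality yields: a proper subgroup that is the product of its intersections with the factors is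
  solvable. The assumptions are symmetric in the factors, so that \<open>fac_swap\<close> transfers
  every result to the other one.\<close>

locale fac =
  fixes G A B :: "'a::mgroup set"
  assumes G: "sgrp G" and A: "sgrp A" "A \<subseteq> G" "nil A" and B: "sgrp B" "B \<subseteq> G" "nil B"
    and fact: "\<And>g. g \<in> G \<Longrightarrow> \<exists>a\<in>A. \<exists>b\<in>B. g = a * b"
    and cop: "coprime (card A) (card B)"
    and simple: "\<And>N. nrml N G \<Longrightarrow> N = {1} \<or> N = G"
    and neA: "A \<noteq> {1}" and neB: "B \<noteq> {1}"
    and fs: "\<And>H. sgrp H \<Longrightarrow> H \<subseteq> G \<Longrightarrow> H \<noteq> G \<Longrightarrow> \<forall>h\<in>H. \<exists>a\<in>A \<inter> H. \<exists>b\<in>B \<inter> H. h = a * b \<Longrightarrow> solv H"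
begin

lemma swap_fact:
  assumes H: "sgrp H" "\<forall>h\<in>H. \<exists>a\<in>X. \<exists>b\<in>Y. h = a * b" and X: "sgrp X" "sgrp Y" and h: "h \<in> H"
  shows "\<exists>b\<in>Y. \<exists>a\<in>X. h = b * a"
proof -
  obtain a b where ab: "a \<in> X" "b \<in> Y" "inverse h = a * b" using H sgrpD(4)[OF H(1) h] by blast
  have "h = inverse (inverse h)" by (simp add: inv_inv)
  also have "\<dots> = inverse b * inverse a" unfolding ab(3) by (simp add: inv_mult)
  finally show ?thesis using ab X sgrpD(4) by blast
qed

lemma fac_swap: "fac G B A"
proof
  show "\<exists>a\<in>B. \<exists>b\<in>A. g = a * b" if "g \<in> G" for g
    using swap_fact[OF G _ A(1) B(1) that] fact by blast
  show "coprime (card B) (card A)" using cop by (simp add: coprime_commute)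
  fix H assume H: "sgrp H" "H \<subseteq> G" "H \<noteq> G" "\<forall>h\<in>H. \<exists>a\<in>B \<inter> H. \<exists>b\<in>A \<inter> H. h = a * b"
  have "\<forall>h\<in>H. \<exists>a\<in>A \<inter> H. \<exists>b\<in>B \<inter> H. h = a * b"
    using swap_fact[OF H(1,4) sgrp_Int[OF B(1) H(1)] sgrp_Int[OF A(1) H(1)]] by blast
  then show "solv H" using fs[OF H(1-3)] by blast
qed (use G A B simple neA neB in auto)

definition facd :: "'a set \<Rightarrow> bool" where
  "facd H \<longleftrightarrow> sgrp H \<and> H \<subseteq> G \<and> (\<forall>h\<in>H. \<exists>a\<in>A \<inter> H. \<exists>b\<in>B \<inter> H. h = a * b)"

lemma facdD: "facd H \<Longrightarrow> sgrp H" "facd H \<Longrightarrow> H \<subseteq> G"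
  by (auto simp: facd_def)

lemma facd_solv: "facd H \<Longrightarrow> H \<noteq> G \<Longrightarrow> solv H"
  unfolding facd_def using fs by blast

lemma facd_swap: "facd H \<Longrightarrow> fac.facd G B A H"
  unfolding facd_def fac.facd_def[OF fac_swap]
  using swap_fact[OF _ _ sgrp_Int[OF A(1)] sgrp_Int[OF B(1)]] by blast

lemma facd_G: "facd G"
proof -
  have "A \<inter> G = A" "B \<inter> G = B" using A(2) B(2) by auto
  then show ?thesis unfolding facd_def using G fact by simp
qed

lemma AB_one: "x \<in> A \<Longrightarrow> x \<in> B \<Longrightarrow> x = 1"
  using pow_coprime_one[OF pow_card[OF A(1)] pow_card[OF B(1)] cop sgrp_card_pos[OF A(1)]] by blast

lemma facd_card:
  assumes "facd H" shows "card H = card (A \<inter> H) * card (B \<inter> H)"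
proof -
  have H: "sgrp H" using assms by (simp add: facd_def)
  have f: "\<forall>h\<in>H. \<exists>a\<in>A \<inter> H. \<exists>b\<in>B \<inter> H. h = a * b" using assms by (simp add: facd_def)
  have "H \<subseteq> sprod (A \<inter> H) (B \<inter> H)"
  proof
    fix h assume "h \<in> H"
    then obtain a b where "a \<in> A \<inter> H" "b \<in> B \<inter> H" "h = a * b" using f by blast
    then show "h \<in> sprod (A \<inter> H) (B \<inter> H)" using sprodI[of a "A \<inter> H" b] by simp
  qed
  moreover have "sprod (A \<inter> H) (B \<inter> H) \<subseteq> H" by (rule sprod_sub[OF H]) auto
  ultimately have e: "sprod (A \<inter> H) (B \<inter> H) = H" by blast
  have "(A \<inter> H) \<inter> (B \<inter> H) = {1}" using AB_one sgrpD(2)[OF A(1)] sgrpD(2)[OF B(1)] sgrpD(2)[OF H] by auto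
  then show ?thesis using card_sprod[OF sgrp_Int[OF A(1) H] sgrp_Int[OF B(1) H]] e by simp
qed

lemma card_G: "card G = card A * card B"
proof -
  have "A \<inter> G = A" "B \<inter> G = B" using A(2) B(2) by auto
  then show ?thesis using facd_card[OF facd_G] by simp
qed

lemma not_sub_A: "H \<subseteq> A \<Longrightarrow> H \<noteq> G"
  using AB_one B(2) neB sgrpD(2)[OF B(1)] by blast

lemma normalizer_proper:
  assumes "sgrp X" "X \<subseteq> G" "X \<noteq> {1}" "X \<noteq> G" shows "Nz G X \<noteq> G"
  using simple assms nrml_iff_Nz[OF assms(1,2)] by blast

lemma centre_G: "Cz G G = {1}"
proof (rule ccontr)
  assume "Cz G G \<noteq> {1}"
  then have "Cz G G = G" using simple[OF nrml_Cz[OF G nrml_self[OF G]]] by blast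
  then have "cj g x = x" if "g \<in> G" "x \<in> G" for g x using that by (auto simp: Cz_fix)
  then have "nrml A G" using A by (intro nrmlI) auto
  then show False using simple neA not_sub_A by blast
qed

text \<open>Since G = BA and z is central in \<open>A\<close>, every conjugate of z is a conjugate
  by an element of \<open>B\<close> and so stays in \<open>H\<close>. These conjugates generate a
  nontrivial normal subgroup, which is \<open>G\<close> by simplicity.\<close>

lemma normal_closure:
  assumes H: "sgrp H" "H \<subseteq> G" "B \<subseteq> H" and z: "z \<in> Cz A A" "z \<noteq> 1" "z \<in> H" shows "H = G"
proof -
  let ?X = "(\<lambda>g. cj g z) ` G"
  have zA: "z \<in> A" using z(1) Cz_sub by blast
  have XH: "?X \<subseteq> H"
  proof
    fix x assume "x \<in> ?X"
    then obtain g where g: "g \<in> G" "x = cj g z" by auto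
    obtain b a where ba: "b \<in> B" "a \<in> A" "g = b * a" using fac.fact[OF fac_swap g(1)] by blast
    have "cj a z = z" using z(1) ba(2) by (auto simp: Cz_def cj_fix_iff)
    then have "x = cj b z" unfolding g(2) ba(3) by (metis cj_cj)
    then show "x \<in> H" using cj_in[OF H(1)] ba(1) H(3) z(3) by blast
  qed
  have XG: "?X \<subseteq> G" using XH H(2) by blast
  have "cj h ` ?X = ?X" if h: "h \<in> G" for h
  proof (rule cj_image_eqI)
    show "finite ?X" using G by (simp add: sgrpD)
    fix x assume "x \<in> ?X"
    then show "cj h x \<in> ?X" using h sgrpD(3)[OF G] by (auto simp: cj_cj)
  qed
  then have "nrml (gen ?X) G" by (rule nrml_gen[OF G XG])
  moreover have "z \<in> gen ?X" using gen_sup[of ?X] sgrpD(2)[OF G] cj_one(2)[of z] by (metis image_eqI subsetD)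
  ultimately have "gen ?X = G" using simple z(2) by blast
  then show ?thesis using gen_least[OF H(1) XH] H(2) by blast
qed

lemma normal_closure':
  assumes "sgrp H" "H \<subseteq> G" "A \<subseteq> H" "w \<in> Cz B B" "w \<noteq> 1" "w \<in> H" shows "H = G"
  using fac.normal_closure[OF fac_swap assms] .

text \<open>\<open>A \<inter> H\<close> has index \<open>card (B \<inter> H)\<close> in
  \<open>H\<close>, which is coprime to the order of \<open>T\<close>, and its product with the
  normal subgroup \<open>T\<close> is a subgroup.\<close>

lemma normal_sub_A:
  assumes H: "facd H" and T: "nrml T H" and c: "coprime (card T) (card B)" shows "T \<subseteq> A"
proof -
  note sH = facdD(1)[OF H]
  have "T \<subseteq> A \<inter> H"
  proof (rule coprime_subset)
    show "sgrp (A \<inter> H)" "sgrp T" "sgrp H" using sgrp_Int A(1) sH nrmlD(1)[OF T] by blast+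
    then show "sgrp (sprod (A \<inter> H) T)" using nrmlD(3)[OF T] by (intro sgrp_sprod) auto
    show "sprod (A \<inter> H) T \<subseteq> H" using nrmlD(2)[OF T] by (intro sprod_sub[OF sH]) auto
    show "card H = card (A \<inter> H) * card (B \<inter> H)" by (rule facd_card[OF H])
    have "card (B \<inter> H) dvd card B" by (rule sgrp_card_dvd[OF sgrp_Int[OF B(1) sH] B(1)]) simp
    then show "coprime (card T) (card (B \<inter> H))" using c coprime_divisors[OF dvd_refl] by blast
  qed
  then show ?thesis by blast
qed

text \<open>The two cores generate the Fitting subgroup of \<open>H\<close>, which contains its centralizer.\<close>

lemma fitting:
  assumes H: "facd H" "solv H" and c: "c \<in> H"
    and cA: "\<And>x. x \<in> core H A \<Longrightarrow> c * x = x * c" and cB: "\<And>x. x \<in> core H B \<Longrightarrow> c * x = x * c"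
  shows "c \<in> sprod (core H A) (core H B)"
proof (rule ccontr)
  assume no: "c \<notin> sprod (core H A) (core H B)"
  let ?FA = "core H A" and ?FB = "core H B"
  let ?F = "sprod ?FA ?FB"
  note sH = facdD(1)[OF H(1)]
  have nA: "nrml ?FA H" and nB: "nrml ?FB H" using nrml_core[OF sH] A(1) B(1) by auto
  have sF: "sgrp ?F" using nrmlD(1,2)[OF nA] nrmlD(1,3)[OF nB] by (intro sgrp_sprod) auto
  have FH: "?F \<subseteq> H" using sprod_sub[OF sH nrmlD(2)[OF nA] nrmlD(2)[OF nB]] .
  have nF: "nrml ?F H"
  proof (rule nrmlI[OF sF FH])
    fix g x assume g: "g \<in> H" and x: "x \<in> ?F"
    obtain a b where "x = a * b" "a \<in> ?FA" "b \<in> ?FB" using x by (metis sprodE)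
    then show "cj g x \<in> ?F" using sprodI nrmlD(4)[OF nA g] nrmlD(4)[OF nB g] by (metis cj_mult)
  qed
  have FAF: "?FA \<subseteq> ?F" by (rule sprod_left[OF sgrpD(2)[OF nrmlD(1)[OF nB]]])
  have FBF: "?FB \<subseteq> ?F" by (rule sprod_right[OF sgrpD(2)[OF nrmlD(1)[OF nA]]])
  define C where "C = Cz H ?F"
  have nC: "nrml C H" unfolding C_def by (rule nrml_Cz[OF sH nF])
  have "c * x = x * c" if "x \<in> ?F" for x
  proof -
    obtain a b where ab: "x = a * b" "a \<in> ?FA" "b \<in> ?FB" using \<open>x \<in> ?F\<close> by (metis sprodE)
    have "c * (a * b) = a * (c * b)" using cA[OF ab(2)] by (metis mult.assoc)
    also have "\<dots> = (a * b) * c" using cB[OF ab(3)] by (simp add: mult.assoc)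
    finally show ?thesis using ab(1) by simp
  qed
  then have cC: "c \<in> C" using c by (simp add: C_def Cz_def)
  define \<T> where "\<T> = {T. nrml T H \<and> T \<subseteq> C \<and> \<not> T \<subseteq> ?F}"
  have CT: "C \<in> \<T>" using nC cC no by (auto simp: \<T>_def)
  \<comment> \<open>Of least order among the normal subgroups of \<open>H\<close> that centralize
    the Fitting subgroup without lying in it. Solvability makes \<open>der T\<close> smaller, so it
    lies in the Fitting subgroup and is centralized by \<open>T\<close>. Hence \<open>T\<close> is
    nilpotent, and its primary parts are forced into the cores.\<close>
  define T where "T = arg_min card (\<lambda>T. T \<in> \<T>)"
  have TT: "T \<in> \<T>" and Tmin: "card T \<le> card S" if "S \<in> \<T>" for S
    unfolding T_def using arg_min_nat_lemma[of "\<lambda>T. T \<in> \<T>", OF CT, of card] that by auto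
  have T: "nrml T H" "T \<subseteq> C" "\<not> T \<subseteq> ?F" using TT[OF CT] by (auto simp: \<T>_def)
  note sT = nrmlD(1)[OF T(1)]
  have "T \<noteq> {1}" using T(3) sgrpD(2)[OF sF] by auto
  then have dT: "der T \<noteq> T" using solvD[OF H(2) sT nrmlD(2)[OF T(1)]] by blast
  have "der T \<subseteq> ?F"
  proof (rule ccontr)
    assume "\<not> der T \<subseteq> ?F"
    then have "der T \<in> \<T>" using nrml_der[OF T(1)] der_sub[OF sT] T(2) by (auto simp: \<T>_def)
    then have "card T \<le> card (der T)" by (rule Tmin)
    then show False using dT der_sub[OF sT] card_seteq[OF sgrpD(1)[OF sT]] by blast
  qed
  have nilT: "nil T" unfolding nil_def
  proof (intro allI impI)
    fix p q x y assume *: "prime p" "prime q" "p \<noteq> q" "x \<in> T" "y \<in> T" "pel p x" "pel q y"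
    \<comment> \<open>This commutator is central in \<open>T\<close>, so taking commutators is
      multiplicative in each argument. Thus some p-power and some q-power of k are trivial, and k =
      1.\<close>
    define k where "k = x * y * inverse x * inverse y"
    have "k \<in> der T" unfolding k_def der_def using gen_sup comms_in[OF *(4,5)] by blast
    then have "k \<in> ?F" using \<open>der T \<subseteq> ?F\<close> by blast
    then have com: "t * k = k * t" if "t \<in> T" for t using that T(2) by (auto simp: C_def Cz_def)
    have xk: "x ^ n * k = k * x ^ n" and yk: "y ^ n * k = k * y ^ n" for n
      using com sgrp_pow[OF sT] *(4,5) by blast+
    have e: "cj x y = k * y" by (simp add: k_def cj_def grp)
    have e1: "cj (x ^ n) y = k ^ n * y" for n
    proof (induction n)
      case (Suc n)
      have "cj x (k ^ n) = k ^ n" using com[OF *(4)] by (metis cj_fix_iff cj_pow)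
      then have "cj (x ^ Suc n) y = k ^ n * (k * y)" using Suc e by (metis cj_cj cj_mult power_Suc)
      then show ?case by (simp add: mult.assoc[symmetric] power_commutes)
    qed (simp add: cj_one)
    have e2: "cj x (y ^ n) = k ^ n * y ^ n" for n
    proof (induction n)
      case (Suc n)
      have "cj x (y ^ Suc n) = (k * y) * (k ^ n * y ^ n)" using Suc e by (metis cj_mult power_Suc)
      also have "\<dots> = k * (y * k ^ n) * y ^ n" by (simp add: mult.assoc)
      also have "y * k ^ n = k ^ n * y" using com[OF *(5)] by (metis cj_fix_iff cj_pow)
      finally show ?case by (simp add: mult.assoc)
    qed (simp add: cj_one)
    obtain i j where ij: "x ^ (p ^ i) = 1" "y ^ (q ^ j) = 1" using *(6,7) by (auto simp: pel_def)
    have "k ^ (p ^ i) * y = 1 * y" using e1[of "p ^ i"] ij(1) by (simp add: cj_one)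
    then have "k ^ (p ^ i) = 1" by (simp only: mul_right_cancel)
    moreover have "k ^ (q ^ j) = 1" using e2[of "q ^ j"] ij(2) by (simp add: cj_one)
    ultimately have "k = 1" using pel_two[of p k q] *(1-3) by (auto simp: pel_def)
    then have "cj x y = y" using e by simp
    then show "x * y = y * x" by (simp add: cj_fix_iff)
  qed
  have "\<exists>t. prime t \<and> \<not> prt t T \<subseteq> ?F"
  proof (rule ccontr)
    assume "\<nexists>t. prime t \<and> \<not> prt t T \<subseteq> ?F"
    then have "T \<inter> ?F = T" using prt_sub[of _ T] by (intro prt_subset_all[OF sgrp_Int[OF sT sF] sT nilT]) auto
    then show False using T(3) by blast
  qed
  then obtain t where t: "prime t" "\<not> prt t T \<subseteq> ?F" by blast
  have nt: "nrml (prt t T) H" by (rule nrml_prt[OF t(1) nilT T(1)])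
  obtain k where k: "card (prt t T) = t ^ k" using pgp_prt[OF t(1) sT nilT] by (auto simp: pgp_def)
  have "\<not> t dvd card A \<or> \<not> t dvd card B"
    using cop t(1) by (meson coprime_common_divisor not_prime_unit)
  then show False
  proof
    assume "\<not> t dvd card B"
    then have "coprime (card (prt t T)) (card B)" unfolding k
      using prime_imp_coprime[OF t(1)] by (simp add: coprime_power_left_iff)
    then have "prt t T \<subseteq> ?FA" using core_greatest[OF nt normal_sub_A[OF H(1) nt]] by blast
    then show False using t(2) FAF by blast
  next
    assume "\<not> t dvd card A"
    then have "coprime (card (prt t T)) (card A)" unfolding k
      using prime_imp_coprime[OF t(1)] by (simp add: coprime_power_left_iff)
    then have "prt t T \<subseteq> ?FB"
      using core_greatest[OF nt fac.normal_sub_A[OF fac_swap facd_swap[OF H(1)] nt]] by blast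
    then show False using t(2) FBF by blast
  qed
qed

lemma facd_over_A:
  assumes "sgrp H" "H \<subseteq> G" "A \<subseteq> H" shows "facd H"
  unfolding facd_def
proof (intro conjI ballI assms(1,2))
  fix h assume h: "h \<in> H"
  obtain a b where ab: "a \<in> A" "b \<in> B" "h = a * b" using fact h assms(2) by blast
  then have "b \<in> H" using h sgrp_mult_iff(1)[OF assms(1)] assms(3) by blast
  then show "\<exists>a\<in>A \<inter> H. \<exists>b\<in>B \<inter> H. h = a * b" using ab assms(3) by blast
qed

text \<open>The normalizer of this core contains \<open>A\<close>, because the core is normal in
  \<open>H\<close>, and the centre of \<open>B\<close>, because the core lies in \<open>B\<close>.
  By \<open>normal_closure'\<close> it is all of \<open>G\<close>, against simplicity.\<close>

lemma core_B_trivial: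
  assumes H: "sgrp H" "H \<subseteq> G" "A \<subseteq> H" "H \<noteq> G" shows "core H B = {1}"
proof (rule ccontr)
  assume ne: "core H B \<noteq> {1}"
  have n: "nrml (core H B) H" by (rule nrml_core[OF H(1) B(1)])
  obtain p where p: "prime p" "p dvd card B" using sgrp_prime_dvd[OF B(1) neB] by blast
  obtain w where w: "w \<in> Cz B B" "w \<noteq> 1" using nil_centre[OF p(1) B(1,3) p(2)] by blast
  have sub: "core H B \<subseteq> B" by (rule core_sub[OF H(1)])
  have "A \<subseteq> Nz G (core H B)" using H(3) nrmlD(3)[OF n] A(2) unfolding Nz_def by blast
  moreover have "w \<in> Cz G (core H B)" using w(1) sub B(2) unfolding Cz_def by blast
  then have "w \<in> Nz G (core H B)" using Cz_sub_Nz by blast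
  ultimately have "Nz G (core H B) = G" using normal_closure'[OF sgrp_Nz[OF G] Nz_sub _ w] by blast
  moreover have "core H B \<noteq> G" by (rule fac.not_sub_A[OF fac_swap sub])
  ultimately show False using normalizer_proper[OF nrmlD(1)[OF n]] sub B(2) ne by blast
qed

lemma fitting_over_A:
  assumes H: "sgrp H" "H \<subseteq> G" "A \<subseteq> H" "H \<noteq> G" and c: "c \<in> H" "\<And>x. x \<in> core H A \<Longrightarrow> c * x = x * c"
  shows "c \<in> core H A"
proof -
  have f: "facd H" using facd_over_A H by blast
  have "c \<in> sprod (core H A) (core H B)"
    by (rule fitting[OF f facd_solv[OF f H(4)] c]) (simp_all add: core_B_trivial[OF H])
  then show ?thesis unfolding core_B_trivial[OF H] by (auto elim: sprodE)
qed

lemma centre_in_core: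
  assumes H: "sgrp H" "H \<subseteq> G" "A \<subseteq> H" "H \<noteq> G" shows "Cz A A \<subseteq> core H A"
proof
  fix z assume z: "z \<in> Cz A A"
  show "z \<in> core H A"
  proof (rule fitting_over_A[OF H])
    show "z \<in> H" using z H(3) Cz_sub by blast
    show "z * x = x * z" if "x \<in> core H A" for x using that z core_sub[OF H(1)] unfolding Cz_def by blast
  qed
qed

lemma prt_A_syl: "prime p \<Longrightarrow> p dvd card A \<Longrightarrow> syl p (prt p A) G"
proof -
  assume p: "prime p" "p dvd card A"
  have "\<not> p dvd card B" using cop p by (meson coprime_common_divisor not_prime_unit)
  then have "multiplicity p (card G) = multiplicity p (card A)"
    using sgrp_card_pos[OF A(1)] sgrp_card_pos[OF B(1)] p(1) unfolding card_G
    by (subst prime_elem_multiplicity_mult_distrib) (auto simp: not_dvd_imp_multiplicity_0)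
  then show ?thesis using prt_syl[OF p(1) A(1,3)] A(2) by (auto simp: syl_def)
qed

text \<open>A Frattini argument: \<open>S\<close> and its conjugate by g are Sylow subgroups of the
  same centralizer, so g can be corrected by an element centralizing \<open>X\<close> until it
  normalizes \<open>S\<close>.\<close>

lemma syl_conj_Cz:
  assumes p: "prime p" and S: "syl p S G" "g \<in> G" "S \<subseteq> Cz G X" "cj g ` S \<subseteq> Cz G X"
  obtains c where "c \<in> Cz G X" "inverse c * g \<in> Nz G S"
proof -
  let ?C = "Cz G X"
  have C: "sgrp ?C" "?C \<subseteq> G" using sgrp_Cz[OF G] Cz_sub by auto
  have "syl p S ?C" "syl p (cj g ` S) ?C"
    using syl_mono[OF _ C(1) G _ C(2) p] S syl_cj[OF G S(1,2)] by blast+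
  then obtain c where c: "c \<in> ?C" "cj g ` S = cj c ` S" using syl_conj[OF p C(1)] by metis
  have "cj (inverse c * g) ` S = cj (inverse c) ` (cj g ` S)" by (simp add: cj_image_cj)
  also have "\<dots> = S" unfolding c(2) by (simp add: cj_image_cj left_inv cj_image_one)
  finally have "inverse c * g \<in> Nz G S" using c(1) S(2) C(2) sgrpD(3,4)[OF G] by (auto simp: Nz_def)
  then show ?thesis using that c(1) by blast
qed

definition maxi :: "'a set \<Rightarrow> bool" where
  "maxi M \<longleftrightarrow> sgrp M \<and> A \<subseteq> M \<and> M \<subseteq> G \<and> M \<noteq> G \<and> (\<forall>H. sgrp H \<longrightarrow> M \<subseteq> H \<longrightarrow> H \<subseteq> G \<longrightarrow> H \<noteq> G \<longrightarrow> H = M)"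

lemma maxi_exists:
  assumes H: "sgrp H" "A \<subseteq> H" "H \<subseteq> G" "H \<noteq> G" obtains M where "maxi M" "H \<subseteq> M"
proof -
  define F where "F = {M. sgrp M \<and> H \<subseteq> M \<and> M \<subset> G}"
  have "F \<subseteq> Pow G" by (auto simp: F_def)
  then have fF: "finite F" using G by (meson finite_Pow_iff finite_subset sgrpD(1))
  have HF: "H \<in> F" using H by (auto simp: F_def)
  obtain M where MF: "M \<in> F" and max: "\<forall>L\<in>F. card L \<le> card M"
    using finite_max_exists[OF fF HF] .
  have "L = M" if "sgrp L" "M \<subseteq> L" "L \<subseteq> G" "L \<noteq> G" for L
  proof -
    have "L \<in> F" using that MF by (auto simp: F_def)
    then have "card L \<le> card M" using max by blast
    then show ?thesis using that card_seteq[OF sgrpD(1)[OF that(1)]] by blast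
  qed
  then have "maxi M" "H \<subseteq> M" using MF H(2) unfolding maxi_def F_def by blast+
  then show ?thesis using that by blast
qed

lemma maxi_normalizer:
  assumes M: "maxi M" and X: "nrml X M" "X \<noteq> {1}" "X \<noteq> G" shows "Nz G X = M"
proof -
  have M': "M \<subseteq> G" using M by (simp add: maxi_def)
  then have XG: "sgrp X" "X \<subseteq> G" using nrmlD(1,2)[OF X(1)] by auto
  have "M \<subseteq> Nz G X" using nrmlD(3)[OF X(1)] M' unfolding Nz_def by blast
  then show ?thesis
    using M normalizer_proper[OF XG X(2,3)] sgrp_Nz[OF G, of X] Nz_sub[of G X] unfolding maxi_def by blast
qed

text \<open>\<open>M1\<close> is a maximal subgroup over the normalizer of the centre of the Sylow
  subgroup \<open>prt p A\<close>. Its core in \<open>A\<close> has a nontrivial q-part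
  \<open>?Q1\<close>, whose normalizer is \<open>M1\<close>. For any other maximal subgroup M over
  \<open>A\<close>, Sylow's theorem in suitable centralizers shows that M normalizes
  \<open>?Q1\<close>, so that M lies in \<open>M1\<close>.\<close>

lemma unique_maximal:
  assumes pq: "prime p" "prime q" "p \<noteq> q" "p dvd card A" "q dvd card A"
  shows "\<exists>M. sgrp M \<and> A \<subseteq> M \<and> M \<subseteq> G \<and> M \<noteq> G \<and>
    (\<forall>H. sgrp H \<longrightarrow> A \<subseteq> H \<longrightarrow> H \<subseteq> G \<longrightarrow> H \<noteq> G \<longrightarrow> H \<subseteq> M)"
proof -
  let ?P = "prt p A" and ?Q = "prt q A"
  let ?Z = "Cz ?P ?P"
  have sP: "sgrp ?P" "pgp p ?P" "?P \<noteq> {1}" using sgrp_prt pgp_prt prt_nontrivial pq A by blast+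
  have sQ: "syl q ?Q G" and sP': "syl p ?P G" using prt_A_syl pq by auto
  have Zne: "?Z \<noteq> {1}" by (rule pgp_centre[OF pq(1) sP(2,3)])
  have sZ: "sgrp ?Z" by (rule sgrp_Cz[OF sP(1)])
  have ZA: "?Z \<subseteq> Cz A A" by (rule nil_centre_prt[OF pq(1) A(1,3)])
  have Zsub: "?Z \<subseteq> ?P" "?Z \<subseteq> A" using Cz_sub prt_sub by blast+
  have NPZ: "Nz G ?P \<subseteq> Nz G ?Z"
  proof
    fix g assume g: "g \<in> Nz G ?P"
    have "cj g z \<in> ?Z" if z: "z \<in> ?Z" for z
    proof -
      have gP: "cj g ` ?P = ?P" using g by (simp add: Nz_def)
      have "cj (cj g z) y = y" if y: "y \<in> ?P" for y
      proof -
        have "cj (inverse g) y \<in> ?P" using gP y in_cj_image by metis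
        then have "cj z (cj (inverse g) y) = cj (inverse g) y" using z by (simp add: Cz_fix)
        then have "cj g (cj z (cj (inverse g) y)) = y" by (metis cj_cancel(2))
        then show ?thesis by (simp add: cj_cj) (simp add: cj_def grp)
      qed
      moreover have "cj g z \<in> ?P" using z gP Zsub(1) by blast
      ultimately show ?thesis by (simp add: Cz_fix)
    qed
    then have "cj g ` ?Z = ?Z" using sgrpD(1)[OF sZ] by (intro cj_image_eqI)
    then show "g \<in> Nz G ?Z" using g by (simp add: Nz_def)
  qed
  have "A \<subseteq> Nz G ?P"
  proof
    fix a assume a: "a \<in> A"
    then have "cj a ` ?P = ?P" using prt_cj[OF cj_image_self[OF A(1)]] by blast
    then show "a \<in> Nz G ?P" using a A(2) by (auto simp: Nz_def)
  qed
  then have ANZ: "A \<subseteq> Nz G ?Z" using NPZ by blast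
  have ZG: "?Z \<subseteq> G" using Zsub(2) A(2) by blast
  have "Nz G ?Z \<noteq> G" using normalizer_proper[OF sZ ZG Zne not_sub_A[OF Zsub(2)]] .
  then obtain M1 where M1: "maxi M1" "Nz G ?Z \<subseteq> M1" using maxi_exists[OF sgrp_Nz[OF G] ANZ Nz_sub] by blast
  have M1': "sgrp M1" "A \<subseteq> M1" "M1 \<subseteq> G" "M1 \<noteq> G" using M1(1) by (auto simp: maxi_def)
  let ?Q1 = "prt q (core M1 A)"
  have c1: "core M1 A \<subseteq> A" "nrml (core M1 A) M1" using core_sub nrml_core M1'(1) A(1) by auto
  have nQ1: "nrml ?Q1 M1" by (rule nrml_prt[OF pq(2) nil_sub[OF A(3) c1(1)] c1(2)])
  have Q1A: "?Q1 \<subseteq> ?Q" using c1(1) unfolding prt_def by blast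
  obtain zq where zq: "zq \<in> Cz A A" "zq \<noteq> 1" "zq ^ q = 1" using nil_centre[OF pq(2) A(1,3) pq(5)] .
  have "zq \<in> ?Q1" using centre_in_core[OF M1'(1,3,2,4)] zq pel_prime_order[OF zq(3)] unfolding prt_def by blast
  then have Q1ne: "?Q1 \<noteq> {1}" using zq(2) by blast
  have NQ1: "Nz G ?Q1 = M1"
    by (rule maxi_normalizer[OF M1(1) nQ1 Q1ne not_sub_A]) (use Q1A prt_sub in blast)
  have commPQ: "x * y = y * x" if "x \<in> ?P" "y \<in> ?Q" for x y
    using A(3) pq that unfolding nil_def prt_def by blast
  have uniq: "M = M1" if M: "maxi M" for M
  proof -
    have M': "sgrp M" "A \<subseteq> M" "M \<subseteq> G" "M \<noteq> G" using M by (auto simp: maxi_def)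
    let ?PM = "prt p (core M A)"
    have cM: "core M A \<subseteq> A" "nrml (core M A) M" using core_sub nrml_core M'(1) A(1) by auto
    have nPM: "nrml ?PM M" by (rule nrml_prt[OF pq(1) nil_sub[OF A(3) cM(1)] cM(2)])
    have ZPM: "?Z \<subseteq> ?PM" using centre_in_core[OF M'(1,3,2,4)] ZA Zsub(1) unfolding prt_def by blast
    have PMP: "?PM \<subseteq> ?P" using cM(1) unfolding prt_def by blast
    have "?PM \<noteq> {1}" using ZPM Zne sgrpD(2)[OF sZ] by blast
    then have NPM: "Nz G ?PM = M"
      by (rule maxi_normalizer[OF M nPM _ not_sub_A]) (use PMP prt_sub in blast)
    let ?K = "Cz G ?PM"
    have sK: "sgrp ?K" "?K \<subseteq> G" using sgrp_Cz[OF G] Cz_sub by auto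
    have KM: "?K \<subseteq> M" using Cz_sub_Nz NPM by blast
    then have "?K = Cz M ?PM" using M'(3) by (auto simp: Cz_def)
    then have nK: "nrml ?K M" using nrml_Cz[OF M'(1) nPM] by simp
    have "?K \<subseteq> Cz G ?Z" using ZPM by (auto simp: Cz_def)
    then have KM1: "?K \<subseteq> M1" using Cz_sub_Nz[of G ?Z] M1(2) by blast
    have QK: "?Q \<subseteq> ?K" using commPQ PMP prt_sub[of q A] A(2) unfolding Cz_def by (blast intro: sym)
    have sQK: "syl q ?Q ?K" by (rule syl_mono[OF sQ sK(1) G QK sK(2) pq(2)])
    \<comment> \<open>The conjugates of \<open>?Q\<close> under \<open>M\<close> are Sylow in
      \<open>?K\<close>, hence conjugate to \<open>?Q\<close> under \<open>?K\<close>. As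
      \<open>?K\<close> lies in \<open>M1\<close>, it normalizes \<open>?Q1\<close>, so every one of
      these conjugates contains \<open>?Q1\<close>.\<close>
    have Q1F: "x \<in> core M A" if x: "x \<in> ?Q1" for x
    proof -
      have "cj m x \<in> A" if m: "m \<in> M" for m
      proof -
        let ?m = "inverse m"
        have mM: "?m \<in> M" using m M'(1) by (simp add: sgrpD)
        have "cj ?m ` ?Q \<subseteq> ?K" using QK nrmlD(3)[OF nK mM] by blast
        then have "syl q (cj ?m ` ?Q) ?K"
          using syl_mono[OF syl_cj[OF G sQ] sK(1) G _ sK(2) pq(2)] mM M'(3) by blast
        then obtain k where k: "k \<in> ?K" "cj ?m ` ?Q = cj k ` ?Q" using syl_conj[OF pq(2) sK(1) sQK] by metis
        have "cj k ` ?Q1 = ?Q1" using nrmlD(3)[OF nQ1] k(1) KM1 by blast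
        then have "x \<in> cj ?m ` ?Q" using x Q1A k(2) by blast
        then show ?thesis using prt_sub by (auto simp: in_cj_image inv_inv)
      qed
      moreover have "x \<in> M" using x Q1A M'(2) prt_sub by blast
      ultimately show ?thesis by (simp add: core_def)
    qed
    \<comment> \<open>Both \<open>?P\<close> and its conjugate by m centralize the conjugate of
      \<open>?Q1\<close> by m. After a correction in that centralizer, m normalizes
      \<open>?P\<close>, hence lies in \<open>M1\<close> and normalizes \<open>?Q1\<close>. So the
      conjugate is \<open>?Q1\<close> itself.\<close>
    have "m \<in> M1" if m: "m \<in> M" for m
    proof -
      let ?X = "cj m ` ?Q1"
      have mG: "m \<in> G" using m M'(3) by blast
      have "?X \<subseteq> core M A" using Q1F nrmlD(4)[OF cM(2) m] by blast
      then have XA: "?X \<subseteq> ?Q" using cM(1) prt_pel unfolding prt_def by (auto simp: pel_cj)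
      then have "?P \<subseteq> Cz G ?X" using commPQ prt_sub[of p A] A(2) unfolding Cz_def by blast
      moreover have "cj m ` ?P \<subseteq> Cz G ?X"
      proof
        fix y assume "y \<in> cj m ` ?P"
        then obtain u where u: "u \<in> ?P" "y = cj m u" by blast
        have "y * x = x * y" if "x \<in> ?X" for x
        proof -
          obtain v where "v \<in> ?Q1" "x = cj m v" using \<open>x \<in> ?X\<close> by blast
          then show ?thesis using commPQ[OF u(1)] Q1A u(2) by (metis cj_mult subsetD)
        qed
        moreover have "y \<in> G" using u mG prt_sub A(2) cj_in[OF G] by blast
        ultimately show "y \<in> Cz G ?X" by (simp add: Cz_def)
      qed
      ultimately obtain c where c: "c \<in> Cz G ?X" "inverse c * m \<in> Nz G ?P"
        using syl_conj_Cz[OF pq(1) sP' mG] by blast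
      have "inverse c * m \<in> M1" using c(2) NPZ M1(2) by blast
      then have "cj (inverse c * m) ` ?Q1 = ?Q1" using nrmlD(3)[OF nQ1] by blast
      then have "cj (inverse c) ` ?X = ?Q1" by (simp add: cj_image_cj)
      moreover have "inverse c \<in> Cz G ?X" using c(1) sgrpD(4)[OF sgrp_Cz[OF G]] by blast
      then have "inverse c \<in> Nz G ?X" using Cz_sub_Nz by blast
      then have "cj (inverse c) ` ?X = ?X" by (simp add: Nz_def)
      ultimately have "m \<in> Nz G ?Q1" using mG by (simp add: Nz_def)
      then show ?thesis using NQ1 by blast
    qed
    then have MM: "M \<subseteq> M1" by blast
    have "\<forall>H. sgrp H \<longrightarrow> M \<subseteq> H \<longrightarrow> H \<subseteq> G \<longrightarrow> H \<noteq> G \<longrightarrow> H = M" using M by (simp add: maxi_def)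
    then show ?thesis using M1'(1,3,4) MM by metis
  qed
  have "H \<subseteq> M1" if H: "sgrp H" "A \<subseteq> H" "H \<subseteq> G" "H \<noteq> G" for H
  proof -
    obtain M where "maxi M" "H \<subseteq> M" using maxi_exists[OF H] .
    then show ?thesis using uniq by blast
  qed
  then show ?thesis using M1' by blast
qed

end

lemma pow_mult_normal:
  assumes N: "sgrp N" and x: "cj x ` N = N" and n: "n \<in> N"
  shows "inverse (x ^ k) * (x * n) ^ k \<in> N"
proof (induction k)
  case (Suc k)
  have "cj (inverse x) (inverse (x ^ k) * (x * n) ^ k) \<in> N" using Suc cj_image_inv[OF x] by blast
  then have "cj (inverse x) (inverse (x ^ k) * (x * n) ^ k) * n \<in> N" using sgrpD(3)[OF N] n by blast
  also have "cj (inverse x) (inverse (x ^ k) * (x * n) ^ k) * n = inverse (x ^ Suc k) * (x * n) ^ Suc k"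
    by (simp only: power_Suc2) (simp add: power_commutes[symmetric] cj_def grp)
  finally show ?case .
qed (simp add: inv_one sgrpD[OF N])

context fac
begin

text \<open>If g = ab normalizes the generated group, its conjugates by b and by the inverse of a
  coincide. One contains \<open>Y\<close> and the other \<open>X\<close>, so this conjugate contains
  the generated group and equals it by finiteness. Hence a and b normalize it separately.\<close>

lemma facd_normalizer:
  assumes X: "X \<subseteq> G" "\<And>a. a \<in> A \<Longrightarrow> cj a ` X = X" and Y: "Y \<subseteq> G" "\<And>b. b \<in> B \<Longrightarrow> cj b ` Y = Y"
  shows "facd (Nz G (gen (X \<union> Y)))"
  unfolding facd_def
proof (intro conjI ballI)
  let ?U = "gen (X \<union> Y)"
  have XY: "X \<union> Y \<subseteq> G" using X(1) Y(1) by blast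
  have sU: "sgrp ?U" by (rule sgrp_gen[OF G XY])
  show "sgrp (Nz G ?U)" by (rule sgrp_Nz[OF G])
  show "Nz G ?U \<subseteq> G" by (rule Nz_sub)
  fix g assume g: "g \<in> Nz G ?U"
  then have gU: "g \<in> G" "cj g ` ?U = ?U" by (auto simp: Nz_def)
  obtain a b where ab: "a \<in> A" "b \<in> B" "g = a * b" using fact[OF gU(1)] by blast
  have "cj b ` ?U = cj (inverse a) ` cj g ` ?U" unfolding ab(3) by (simp add: cj_image_cj inv_cancel_left)
  then have e: "cj b ` ?U = cj (inverse a) ` ?U" using gU(2) by simp
  have "cj b ` Y \<subseteq> cj b ` ?U" "cj (inverse a) ` X \<subseteq> cj (inverse a) ` ?U" using gen_sup[of "X \<union> Y"] by blast+
  then have "X \<union> Y \<subseteq> cj b ` ?U" using e Y(2)[OF ab(2)] X(2)[OF sgrpD(4)[OF A(1) ab(1)]] by simp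
  then have "?U \<subseteq> cj b ` ?U" by (rule gen_least[OF sgrp_cj[OF sU]])
  then have bU: "cj b ` ?U = ?U"
    using card_subset_eq[of "cj b ` ?U" ?U] sgrpD(1)[OF sU] by (simp add: card_cj)
  then have "cj (inverse a) ` ?U = ?U" using e by simp
  then have "cj a ` ?U = ?U" using cj_image_inv[of "inverse a"] by (simp add: inv_inv)
  then show "\<exists>a\<in>A \<inter> Nz G ?U. \<exists>b\<in>B \<inter> Nz G ?U. g = a * b"
    using ab bU A(2) B(2) unfolding Nz_def by blast
qed

text \<open>The commutator of \<open>z\<close> and \<open>w\<close> lies in the Fitting subgroup, hence \<open>z\<close> and \<open>cj w z\<close> agree up
  to elements of the two cores; Sylow's theorem removes the second one.\<close>

lemma conj_into_A:
  assumes H: "facd H" "solv H" and p: "prime p"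
    and z: "z \<in> A" "z \<in> H" "z \<noteq> 1" "z ^ p = 1" "\<And>x. x \<in> core H A \<Longrightarrow> z * x = x * z"
    and w: "w \<in> H" "\<And>x. x \<in> core H B \<Longrightarrow> w * x = x * w"
  obtains g f where "g \<in> core H B" "f \<in> core H A" "cj (g * w) z = z * f"
proof -
  let ?FA = "core H A" and ?FB = "core H B"
  note sH = facdD(1)[OF H(1)]
  have nA: "nrml ?FA H" and nB: "nrml ?FB H" using nrml_core[OF sH] A(1) B(1) by auto
  have subA: "?FA \<subseteq> A" and subB: "?FB \<subseteq> B" using core_sub[OF sH] by auto
  \<comment> \<open>Up to order and inverses this is the commutator of z and w. It centralizes the
    A-core because z does, and the B-core because w does, both centralizers being normal in
    \<open>H\<close>.\<close>
  define k where "k = inverse z * cj w z"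
  have kH: "k \<in> H" unfolding k_def using z(2) w(1) sgrpD(3,4)[OF sH] cj_in[OF sH] by blast
  have zC: "z \<in> Cz H ?FA" and wC: "w \<in> Cz H ?FB" using z(2,5) w by (auto simp: Cz_def)
  have nCA: "nrml (Cz H ?FA) H" and nCB: "nrml (Cz H ?FB) H" using nrml_Cz[OF sH] nA nB by auto
  have "cj w z \<in> Cz H ?FA" using nrmlD(4)[OF nCA w(1) zC] .
  then have kA: "k \<in> Cz H ?FA" unfolding k_def using zC sgrpD(3,4)[OF nrmlD(1)[OF nCA]] by blast
  have "cj (inverse z) w \<in> Cz H ?FB" using nrmlD(4)[OF nCB sgrpD(4)[OF sH z(2)] wC] .
  then have "cj (inverse z) w * inverse w \<in> Cz H ?FB" using wC sgrpD(3,4)[OF nrmlD(1)[OF nCB]] by blast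
  also have "cj (inverse z) w * inverse w = k" by (simp add: k_def cj_def grp)
  finally have kB: "k \<in> Cz H ?FB" .
  have "k \<in> sprod ?FA ?FB"
    by (rule fitting[OF H kH]) (use kA kB in \<open>auto simp: Cz_def\<close>)
  then obtain f v where fv: "f \<in> ?FA" "v \<in> ?FB" "k = f * v" by (metis sprodE)
  define x where "x = z * f"
  have xv: "cj w z = x * v" using fv(3) by (simp add: k_def x_def mult.assoc) (metis cancel_inv_left)
  have xH: "x \<in> H" unfolding x_def using z(2) fv(1) nrmlD(2)[OF nA] sgrpD(3)[OF sH] by blast
  have xA: "x \<in> A" unfolding x_def using z(1) fv(1) subA sgrpD(3)[OF A(1)] by blast
  have sFB: "sgrp ?FB" using nrmlD(1)[OF nB] .
  have xp1: "(x * v) ^ p = 1" using z(4) by (simp add: xv[symmetric] cj_pow[symmetric] cj_one)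
  then have "inverse (x ^ p) \<in> ?FB" using pow_mult_normal[OF sFB nrmlD(3)[OF nB xH] fv(2), of p] by simp
  then have "x ^ p \<in> ?FB" using sgrp_inv_iff[OF sFB] by blast
  then have xp: "x ^ p = 1" using AB_one sgrp_pow[OF A(1) xA] subB by blast
  \<comment> \<open>The order of \<open>?FB\<close> is prime to p, so the p-group \<open>?X\<close>
    is a Sylow subgroup of \<open>?K\<close>, and the p-element \<open>x * v\<close> is conjugate
    into it. The part of the conjugating element in \<open>?X\<close> can be absorbed.\<close>
  let ?X = "gen {x}" and ?K = "sprod (gen {x}) ?FB"
  have sX: "sgrp ?X" "?X \<subseteq> A" "?X \<subseteq> H"
    using sgrp_gen[OF A(1)] gen_least[OF A(1)] gen_least[OF sH] xA xH by auto
  have pX: "pgp p ?X" by (rule pgp_gen[OF p A(1) xA pel_prime_order[OF xp]])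
  have sK: "sgrp ?K" by (rule sgrp_sprod[OF sX(1) sFB]) (use nrmlD(3)[OF nB] sX(3) in blast)
  have XK: "?X \<subseteq> ?K" by (rule sprod_left[OF sgrpD(2)[OF sFB]])
  have "?X \<inter> ?FB = {1}" using AB_one sX(2) subB sgrpD(2)[OF sX(1)] sgrpD(2)[OF sFB] by blast
  then have cK: "card ?K = card ?X * card ?FB" using card_sprod[OF sX(1) sFB] by simp
  have "p dvd card A" using prime_order_dvd[OF A(1) z(1,3) p z(4)] .
  then have "\<not> p dvd card B" using cop p by (meson coprime_common_divisor not_prime_unit)
  then have ndv: "\<not> p dvd card ?FB" using sgrp_card_dvd[OF sFB B(1) subB] dvd_trans by blast
  obtain j where j: "card ?X = p ^ j" using pX by (auto simp: pgp_def)
  have "multiplicity p (card ?K) = j"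
    unfolding cK j using p ndv sgrp_card_pos[OF sFB]
    by (subst prime_elem_multiplicity_mult_distrib) (auto simp: not_dvd_imp_multiplicity_0)
  then have syX: "syl p ?X ?K" using sX(1) XK j by (simp add: syl_def)
  have xvK: "x * v \<in> ?K" using sprodI[of x ?X v ?FB] gen_sup[of "{x}"] fv(2) by blast
  obtain c where c: "c \<in> ?K" "x * v \<in> cj c ` ?X"
    using pel_in_syl_conj[OF p sK syX xvK pel_prime_order[OF xp1]] .
  obtain h n where hn: "c = h * n" "h \<in> ?X" "n \<in> ?FB" using c(1) by (metis sprodE)
  have hH: "h \<in> H" using hn(2) sX(3) by blast
  let ?n = "cj h n"
  have nF: "?n \<in> ?FB" using nrmlD(4)[OF nB hH hn(3)] .
  have "c = ?n * h" using hn(1) by (simp add: cj_def grp)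
  then have "cj c ` ?X = cj ?n ` cj h ` ?X" by (simp add: cj_image_cj)
  also have "cj h ` ?X = ?X" by (rule cj_image_self[OF sX(1) hn(2)])
  finally obtain y where y: "y \<in> ?X" "x * v = cj ?n y" using c(2) by blast
  then have y2: "y = cj (inverse ?n) (x * v)" by (simp add: cj_cancel)
  \<comment> \<open>Conjugation by elements of \<open>?FB\<close> changes nothing modulo
    \<open>?FB\<close>, so x and y differ by an element of \<open>B\<close>. They also lie in
    \<open>A\<close>, and the factors meet trivially.\<close>
  have "inverse x * y = cj (inverse x) (inverse ?n) * (v * ?n)" unfolding y2 by (simp add: cj_def grp)
  moreover have "cj (inverse x) (inverse ?n) * (v * ?n) \<in> ?FB"
    using nrmlD(4)[OF nB sgrpD(4)[OF sH xH] sgrpD(4)[OF sFB nF]] sgrpD(3)[OF sFB] fv(2) nF by blast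
  ultimately have "inverse x * y \<in> B" using subB by auto
  moreover have "inverse x * y \<in> A" using y(1) sX(2) xA sgrpD(3,4)[OF A(1)] by blast
  ultimately have "inverse x * y = 1" using AB_one by blast
  then have "y = x" by (metis cancel_inv_left mult_1_right)
  then have "cj (inverse ?n * w) z = z * f"
    using y2 xv by (simp add: cj_cj[symmetric] x_def)
  then show ?thesis using that sgrpD(4)[OF sFB nF] fv(1) by blast
qed

end

section \<open>Both orders with two prime divisors: centralizers and fusion\<close>

locale fac2 = fac +
  fixes M L
  assumes twoA: "\<exists>p q. prime p \<and> prime q \<and> p \<noteq> q \<and> p dvd card A \<and> q dvd card A"
    and twoB: "\<exists>p q. prime p \<and> prime q \<and> p \<noteq> q \<and> p dvd card B \<and> q dvd card B"
    and M: "sgrp M" "A \<subseteq> M" "M \<subseteq> G" "M \<noteq> G"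
    and Mmax: "\<And>H. sgrp H \<Longrightarrow> A \<subseteq> H \<Longrightarrow> H \<subseteq> G \<Longrightarrow> H \<noteq> G \<Longrightarrow> H \<subseteq> M"
    and L: "sgrp L" "B \<subseteq> L" "L \<subseteq> G" "L \<noteq> G"
    and Lmax: "\<And>H. sgrp H \<Longrightarrow> B \<subseteq> H \<Longrightarrow> H \<subseteq> G \<Longrightarrow> H \<noteq> G \<Longrightarrow> H \<subseteq> L"
begin

lemma fac2_swap: "fac2 G B A L M"
  by (intro fac2.intro fac_swap fac2_axioms.intro twoA twoB M L Mmax Lmax)

lemma other_prime: "\<exists>q. prime q \<and> q \<noteq> p \<and> q dvd card A"
  using twoA by metis

lemma M_no_central: "w \<in> Cz B B \<Longrightarrow> w \<noteq> 1 \<Longrightarrow> w \<notin> M"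
  using normal_closure'[OF M(1,3,2)] M(4) by blast

lemma Cz_centre_A: assumes "z \<in> Cz A A" "z \<noteq> 1" shows "Cz G {z} \<subseteq> M" "A \<subseteq> Cz G {z}"
proof -
  show A': "A \<subseteq> Cz G {z}" using assms(1) A(2) by (auto simp: Cz_def)
  have "Cz G {z} \<noteq> G"
  proof
    assume e: "Cz G {z} = G"
    have "z \<in> Cz G G"
    proof -
      have "g * z = z * g" if "g \<in> G" for g using that e by (auto simp: Cz_def)
      moreover have "z \<in> G" using assms(1) Cz_sub A(2) by blast
      ultimately show ?thesis by (auto simp: Cz_def)
    qed
    then show False using centre_G assms(2) by blast
  qed
  then show "Cz G {z} \<subseteq> M" using Mmax[OF sgrp_Cz[OF G] A' Cz_sub] by blast
qed

text \<open>After passing to a power of z of prime order p, take the Sylow subgroup of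
  \<open>A\<close> for another prime. It and its conjugate by g centralize \<open>cj g z\<close>, so
  g = c n with n normalizing it and c centralizing \<open>cj g z\<close>. Then n lies in
  \<open>M\<close>, and so does the conjugate of c by the inverse of g, which centralizes z.
  Together they give g.\<close>

lemma conj_centre_in_M:
  assumes z: "z \<in> Cz A A" "z \<noteq> 1" and g: "g \<in> G" "cj g z \<in> A" shows "g \<in> M"
proof -
  have sZ: "sgrp (Cz A A)" by (rule sgrp_Cz[OF A(1)])
  obtain n p where u: "prime p" "z ^ n \<noteq> 1" "(z ^ n) ^ p = 1" "z ^ n \<in> Cz A A"
    using prime_order_power[OF sZ z] by blast
  let ?z = "z ^ n"
  have gz: "cj g ?z \<in> A" using sgrp_pow[OF A(1) g(2)] by (simp add: cj_pow)
  obtain q where q: "prime q" "q \<noteq> p" "q dvd card A" using other_prime by blast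
  let ?Q = "prt q A"
  have sQ: "syl q ?Q G" by (rule prt_A_syl[OF q(1,3)])
  have "pel p (cj g ?z)" using pel_prime_order[OF u(3)] by (simp add: pel_cj)
  then have "x * cj g ?z = cj g ?z * x" if "x \<in> ?Q" for x
    using A(3) q(1,2) u(1) gz that unfolding nil_def prt_def by blast
  then have QC: "?Q \<subseteq> Cz G {cj g ?z}" using prt_sub[of q A] A(2) by (auto simp: Cz_def)
  have "?Q \<subseteq> Cz G {?z}" using Cz_centre_A(2)[OF u(4,2)] prt_sub[of q A] by blast
  then have "cj g ` ?Q \<subseteq> Cz G {cj g ?z}" unfolding Cz_cj[OF G g(1)] by blast
  with QC obtain c where c: "c \<in> Cz G {cj g ?z}" "inverse c * g \<in> Nz G ?Q"
    using syl_conj_Cz[OF q(1) sQ g(1)] by blast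
  have "A \<subseteq> Nz G ?Q"
  proof
    fix a assume a: "a \<in> A"
    then have "cj a ` ?Q = ?Q" using prt_cj[OF cj_image_self[OF A(1)]] by blast
    then show "a \<in> Nz G ?Q" using a A(2) by (auto simp: Nz_def)
  qed
  moreover have "Nz G ?Q \<noteq> G"
    by (rule normalizer_proper[OF sylD(1,2)[OF sQ] prt_nontrivial[OF q(1) A(1) q(3)] not_sub_A[OF prt_sub]])
  ultimately have "Nz G ?Q \<subseteq> M" using Mmax[OF sgrp_Nz[OF G] _ Nz_sub] by blast
  then have n: "inverse c * g \<in> M" using c(2) by blast
  have "cj (inverse g) c \<in> Cz G {?z}" using c(1) unfolding Cz_cj[OF G g(1)] by (simp add: in_cj_image)
  then have d: "cj (inverse g) c \<in> M" using Cz_centre_A(1)[OF u(4,2)] by blast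
  have "(inverse c * g) * cj (inverse g) c = inverse c * (c * g)" by (simp add: cj_def grp)
  also have "\<dots> = g" by (simp add: grp)
  finally show ?thesis using sgrpD(3)[OF M(1) n d] by simp
qed

text \<open>Otherwise the normalizer of the generated group is a proper factorized subgroup. Its
  B-core turns out to have order prime to r, and \<open>conj_into_A\<close> then puts a product of a
  central r-element w of \<open>B\<close> and an element of that core into \<open>M\<close>. This
  forces w into \<open>M\<close>, which is impossible.\<close>

lemma gen_central_sylow:
  assumes p: "prime p" and z: "z \<in> Cz A A" "z \<noteq> 1" "z ^ p = 1" and r: "prime r" "r dvd card B"
  shows "gen ({z} \<union> prt r B) = G"
proof (rule ccontr)
  let ?Y = "prt r B" and ?U = "gen ({z} \<union> prt r B)"
  assume ne: "?U \<noteq> G"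
  have zA: "z \<in> A" using z(1) Cz_sub by blast
  have YB: "?Y \<subseteq> B" by (rule prt_sub)
  have XY: "{z} \<union> ?Y \<subseteq> G" using zA A(2) YB B(2) by blast
  let ?N = "Nz G ?U"
  have za: "cj a ` {z} = {z}" if "a \<in> A" for a using that z(1) by (auto simp: Cz_def cj_fix_iff)
  have Yb: "cj b ` ?Y = ?Y" if "b \<in> B" for b using prt_cj[OF cj_image_self[OF B(1) that]] .
  have N: "facd ?N" by (rule facd_normalizer) (use za Yb XY in auto)
  have sU: "sgrp ?U" "?U \<subseteq> G" using sgrp_gen[OF G XY] gen_least[OF G XY] by auto
  have UN: "?U \<subseteq> ?N" using nrmlD(2)[OF nrml_Nz[OF G sU]] .
  have "?U \<noteq> {1}" using gen_sup[of "{z} \<union> ?Y"] z(2) by auto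
  then have NG: "?N \<noteq> G" by (rule normalizer_proper[OF sU _ ne])
  note sN = facdD(1)[OF N]
  have zN: "z \<in> ?N" and YN: "?Y \<subseteq> ?N" using UN gen_sup[of "{z} \<union> ?Y"] by auto
  let ?FB = "core ?N B"
  have nFB: "nrml ?FB ?N" by (rule nrml_core[OF sN B(1)])
  have FBB: "?FB \<subseteq> B" by (rule core_sub[OF sN])
  let ?R = "prt r ?FB"
  have nR: "nrml ?R ?N" by (rule nrml_prt[OF r(1) nil_sub[OF B(3) FBB] nFB])
  have RB: "?R \<subseteq> B" "?R \<subseteq> G" using prt_sub FBB B(2) by blast+
  have sR: "sgrp ?R" using nrmlD(1)[OF nR] .
  \<comment> \<open>The r-part of \<open>B\<close> lies in \<open>?N\<close> and so normalizes
    \<open>?R\<close>; the other parts commute with the r-group \<open>?R\<close>. As z normalizes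
    \<open>?R\<close> too, \<open>normal_closure\<close> makes \<open>?R\<close> trivial.\<close>
  have "Nz B ?R = B"
  proof (rule prt_subset_all[OF sgrp_Nz[OF B(1)] B(1,3) Nz_sub])
    fix s :: nat assume s: "prime s"
    show "prt s B \<subseteq> Nz B ?R"
    proof (cases "s = r")
      case True
      then show ?thesis using YN nrmlD(3)[OF nR] YB unfolding Nz_def by blast
    next
      case False
      have "x * y = y * x" if "x \<in> prt s B" "y \<in> ?R" for x y
        using B(3) False r(1) s that FBB unfolding nil_def prt_def by blast
      then have "prt s B \<subseteq> Cz B ?R" using prt_sub[of s B] by (auto simp: Cz_def)
      then show ?thesis using Cz_sub_Nz by blast
    qed
  qed
  then have "B \<subseteq> Nz G ?R" using B(2) by (auto simp: Nz_def)
  moreover have "z \<in> Nz G ?R" using zN nrmlD(3)[OF nR zN] zA A(2) by (simp add: Nz_def subset_iff)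
  ultimately have "Nz G ?R = G" using normal_closure[OF sgrp_Nz[OF G] Nz_sub _ z(1,2)] by blast
  then have R1: "?R = {1}" using normalizer_proper[OF sR RB(2)] fac.not_sub_A[OF fac_swap RB(1)] by blast
  then have ndv: "\<not> r dvd card ?FB" using prt_nontrivial[OF r(1) nrmlD(1)[OF nFB]] by blast
  have copr: "coprime (card ?Y) (card ?FB)"
  proof -
    obtain k where "card ?Y = r ^ k" using pgp_prt[OF r(1) B(1,3)] by (auto simp: pgp_def)
    then show ?thesis using prime_imp_coprime[OF r(1) ndv] by (simp add: coprime_power_left_iff)
  qed
  have sY: "sgrp ?Y" by (rule sgrp_prt[OF r(1) B(1,3)])
  have comm: "x * y = y * x" if "x \<in> ?Y" "y \<in> ?FB" for x y
    by (rule nil_coprime_commute[OF B(3) sY YB nrmlD(1)[OF nFB] FBB copr that])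
  obtain w where w: "w \<in> Cz B B" "w \<noteq> 1" "w ^ r = 1" using nil_centre[OF r(1) B(1,3) r(2)] .
  have wY: "w \<in> ?Y" using w(1) Cz_sub pel_prime_order[OF w(3)] by (auto simp: prt_def Cz_def)
  have wN: "w \<in> ?N" using wY YN by blast
  have zc: "z * x = x * z" if "x \<in> core ?N A" for x
    using that z(1) core_sub[OF sN, of A] by (auto simp: Cz_def)
  obtain g f where gf: "g \<in> ?FB" "f \<in> core ?N A" "cj (g * w) z = z * f"
    using conj_into_A[OF N facd_solv[OF N NG] p zA zN z(2,3) zc wN comm[OF wY]] by blast
  have gG: "g \<in> G" "w \<in> G" using gf(1) FBB B(2) wY YB by blast+
  have "cj (g * w) z \<in> A" unfolding gf(3) using gf(2) core_sub[OF sN, of A] zA sgrpD(3)[OF A(1)] by blast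
  then have gwM: "g * w \<in> M" using conj_centre_in_M[OF z(1,2) sgrpD(3)[OF G gG]] by blast
  \<comment> \<open>This exponent kills g, which commutes with w, and it is prime to the order r of
    w. So w is a power of an element of \<open>M\<close>.\<close>
  let ?m = "card ?FB"
  have "(g * w) ^ k = g ^ k * w ^ k" for k
  proof (induction k)
    case (Suc k)
    have "(g * w) ^ Suc k = g * (w * g ^ k) * w ^ k" using Suc by (simp add: mult.assoc)
    also have "w * g ^ k = g ^ k * w" using comm[OF wY sgrp_pow[OF nrmlD(1)[OF nFB] gf(1)]] .
    finally show ?case by (simp add: mult.assoc)
  qed simp
  then have "(g * w) ^ ?m = w ^ ?m" using pow_card[OF nrmlD(1)[OF nFB] gf(1)] by simp
  then have wm: "w ^ ?m \<in> M" using sgrp_pow[OF M(1) gwM] by metis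
  have "coprime r ?m" using prime_imp_coprime[OF r(1) ndv] .
  then have cm: "coprime ?m r" by (simp add: coprime_commute)
  have m0: "?m \<noteq> 0" using sgrp_card_pos[OF nrmlD(1)[OF nFB]] by simp
  obtain i j where "?m * i = r * j + 1" using bezout_nat[OF m0, of r] cm by auto
  then have "(w ^ ?m) ^ i = (w ^ r) ^ j * w"
    by (simp del: power_Suc add: power_mult[symmetric] power_Suc2)
  then have "w \<in> M" using w(3) sgrp_pow[OF M(1) wm, of i] by simp
  then show False using M_no_central[OF w(1,2)] by blast
qed

text \<open>An element of \<open>B\<close> of prime order s that commutes with z also commutes with
  the r-part of \<open>B\<close> for any prime r other than s. These generate \<open>G\<close>, so
  it would be central in \<open>G\<close>.\<close>

lemma centralizer_in_B_trivial:
  assumes z: "z \<in> Cz A A" "z \<noteq> 1" shows "Cz B {z} = {1}"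
proof (rule ccontr)
  assume ne: "Cz B {z} \<noteq> {1}"
  obtain n p where u: "prime p" "z ^ n \<noteq> 1" "(z ^ n) ^ p = 1" "z ^ n \<in> Cz A A"
    using prime_order_power[OF sgrp_Cz[OF A(1)] z] by blast
  have sC: "sgrp (Cz B {z})" by (rule sgrp_Cz[OF B(1)])
  obtain y where y: "y \<in> Cz B {z}" "y \<noteq> 1" using sgrp_nontrivial[OF sC ne] by blast
  obtain m s where x: "prime s" "y ^ m \<noteq> 1" "(y ^ m) ^ s = 1" "y ^ m \<in> Cz B {z}"
    using prime_order_power[OF sC y] by blast
  let ?x = "y ^ m" and ?z = "z ^ n"
  have xB: "?x \<in> B" using x(4) Cz_sub by blast
  obtain r where r: "prime r" "r \<noteq> s" "r dvd card B" using fac2.other_prime[OF fac2_swap] by blast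
  have "?x * z = z * ?x" using x(4) by (simp add: Cz_def)
  then have "cj ?x z = z" by (simp add: cj_fix_iff)
  then have "cj ?x ?z = ?z" by (simp add: cj_pow)
  then have xz: "?x * ?z = ?z * ?x" by (simp add: cj_fix_iff)
  have xr: "?x * v = v * ?x" if "v \<in> prt r B" for v
    using B(3) r(1,2) x(1) xB that pel_prime_order[OF x(3)] unfolding nil_def prt_def by blast
  have sub: "{?z} \<union> prt r B \<subseteq> G" using u(4) Cz_sub A(2) prt_sub B(2) by blast
  have "?x * g = g * ?x" if "g \<in> G" for g
  proof (rule gen_commute[OF G sub])
    show "?x * v = v * ?x" if "v \<in> {?z} \<union> prt r B" for v using that xz xr by blast
    show "?x \<in> G" using xB B(2) by blast
    show "g \<in> gen ({?z} \<union> prt r B)" using gen_central_sylow[OF u(1,4,2,3) r(1,3)] \<open>g \<in> G\<close> by simp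
  qed
  then have "?x \<in> Cz G G" using xB B(2) by (auto simp: Cz_def)
  then show False using centre_G x(2) by blast
qed

lemma centralizer_central: assumes z: "z \<in> Cz A A" "z \<noteq> 1" shows "Cz G {z} = A"
proof
  show "A \<subseteq> Cz G {z}" by (rule Cz_centre_A(2)[OF z])
  show "Cz G {z} \<subseteq> A"
  proof
    fix g assume g: "g \<in> Cz G {z}"
    then obtain a b where ab: "a \<in> A" "b \<in> B" "g = a * b" using fact Cz_sub by blast
    have "a \<in> Cz G {z}" using Cz_centre_A(2)[OF z] ab(1) by blast
    then have "b \<in> Cz G {z}" using g ab(3) sgrp_mult_iff(1)[OF sgrp_Cz[OF G]] by blast
    then have "b \<in> Cz B {z}" using ab(2) by (simp add: Cz_def)
    then show "g \<in> A" using centralizer_in_B_trivial[OF z] ab by auto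
  qed
qed

text \<open>For each prime q take a central z in \<open>A\<close> of a different prime order. It
  lies in the core of \<open>M\<close>, so \<open>cj m z\<close> is in \<open>A\<close> and commutes
  with the q-part. The centralizer of \<open>cj m z\<close> is the conjugate of \<open>A\<close>,
  which thus contains the q-part of \<open>A\<close>.\<close>

lemma A_normal: "nrml A M"
proof -
  have "cj m ` A = A" if m: "m \<in> M" for m
  proof -
    have mG: "m \<in> G" using m M(3) by blast
    have sm: "sgrp (cj m ` A)" by (rule sgrp_cj[OF A(1)])
    have "A \<inter> cj m ` A = A"
    proof (rule prt_subset_all[OF sgrp_Int[OF A(1) sm] A(1,3)])
      fix q :: nat assume q: "prime q"
      obtain p where p: "prime p" "p \<noteq> q" "p dvd card A" using other_prime by blast
      obtain z where z: "z \<in> Cz A A" "z \<noteq> 1" "z ^ p = 1" using nil_centre[OF p(1) A(1,3) p(3)] .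
      have "z \<in> core M A" using centre_in_core[OF M(1,3,2,4)] z(1) by blast
      then have mz: "cj m z \<in> A" using m by (simp add: core_def)
      have "pel p (cj m z)" using pel_prime_order[OF z(3)] by (simp add: pel_cj)
      then have "x * cj m z = cj m z * x" if "x \<in> prt q A" for x
        using A(3) p(1,2) q mz that unfolding nil_def prt_def by blast
      then have "prt q A \<subseteq> Cz G {cj m z}" using prt_sub[of q A] A(2) by (auto simp: Cz_def)
      then have "prt q A \<subseteq> cj m ` A" unfolding Cz_cj[OF G mG] centralizer_central[OF z(1,2)] .
      then show "prt q A \<subseteq> A \<inter> cj m ` A" using prt_sub[of q A] by blast
    qed simp
    then have "A \<subseteq> cj m ` A" by blast
    then show ?thesis using card_subset_eq[of "cj m ` A" A] sgrpD(1)[OF A(1)] by (simp add: card_cj)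
  qed
  then show ?thesis using A(1) M(2) by (simp add: nrml_def)
qed

lemma coprime_sub_M:
  assumes T: "sgrp T" "T \<subseteq> M" and c: "coprime (card T) (card B)" shows "T \<subseteq> A"
proof -
  have MA: "sgrp (sprod T A)" by (rule sgrp_sprod[OF T(1) A(1)]) (use nrmlD(3)[OF A_normal] T(2) in blast)
  have "sprod A T \<subseteq> sprod T A"
  proof
    fix x assume "x \<in> sprod A T"
    then obtain a t where at: "x = a * t" "a \<in> A" "t \<in> T" by (metis sprodE)
    have "cj (inverse t) a \<in> A" using nrmlD(4)[OF A_normal] at(2,3) T sgrpD(4) by blast
    then have "t * cj (inverse t) a \<in> sprod T A" using sprodI at(3) by blast
    then show "x \<in> sprod T A" unfolding at(1) by (simp add: cj_def grp)
  qed
  moreover have "sprod T A \<subseteq> sprod A T"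
  proof
    fix x assume "x \<in> sprod T A"
    then obtain a t where at: "x = t * a" "a \<in> A" "t \<in> T" by (metis sprodE)
    have "cj t a \<in> A" using nrmlD(4)[OF A_normal] at(2,3) T by blast
    then have "cj t a * t \<in> sprod A T" using sprodI at(3) by blast
    then show "x \<in> sprod A T" unfolding at(1) by (simp add: cj_def grp)
  qed
  ultimately have "sgrp (sprod A T)" using MA by simp
  moreover have "sprod A T \<subseteq> G" using sprod_sub[OF G A(2)] T(2) M(3) by blast
  ultimately show ?thesis using coprime_subset[OF A(1) T(1) _ G _ card_G c] by blast
qed

text \<open>Sharpens \<open>conj_centre_in_M\<close> from \<open>A\<close> to \<open>M\<close>: the
  cyclic group generated by the conjugate has order coprime to that of \<open>B\<close>, and such
  subgroups of \<open>M\<close> lie in \<open>A\<close>.\<close>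

lemma central_conj_M:
  assumes z: "z \<in> Cz A A" "z \<noteq> 1" and g: "g \<in> G" "cj g z \<in> M" shows "g \<in> M"
proof (rule conj_centre_in_M[OF z g(1)])
  have zA: "z \<in> A" using z(1) Cz_sub by blast
  let ?T = "cj g ` gen {z}"
  have gz: "sgrp (gen {z})" "gen {z} \<subseteq> A" using sgrp_gen[OF A(1)] gen_least[OF A(1)] zA by auto
  have "?T = gen (cj g ` {z})" by (rule gen_image[OF hom_on_conj A(1)]) (use zA in simp)
  then have "?T \<subseteq> M" using gen_least[OF M(1), of "{cj g z}"] g(2) by simp
  moreover have "coprime (card ?T) (card B)"
    using cop sgrp_card_dvd[OF gz(1) A(1) gz(2)] coprime_divisors[OF _ dvd_refl] by (simp add: card_cj)
  ultimately have "?T \<subseteq> A" using coprime_sub_M sgrp_cj[OF gz(1)] by blast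
  then show "cj g z \<in> A" using gen_sup[of "{z}"] by blast
qed

lemma core_no_centre:
  assumes N: "sgrp N" "N \<subseteq> G" and w: "w \<in> Cz B B" "w \<noteq> 1" "w \<in> N" and x: "x \<in> core N A" "x \<in> Cz A A"
  shows "x = 1"
proof (rule ccontr)
  assume "x \<noteq> 1"
  have "cj w x \<in> A" using x(1) w(3) by (simp add: core_def)
  then have "w \<in> M" using conj_centre_in_M[OF x(2) \<open>x \<noteq> 1\<close>] w(3) N(2) by blast
  then show False using M_no_central w(1,2) by blast
qed

text \<open>In a proper normalizer, \<open>conj_into_A\<close> gives \<open>g * w\<close> in
  \<open>M\<close>, which normalizes \<open>A\<close> and hence its centre. So f is central in
  \<open>A\<close> and, lying in the core, trivial. Then \<open>g * w\<close> is an element of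
  \<open>B\<close> centralizing z, hence trivial, which puts w into the B-core, against the mirror
  image of \<open>core_no_centre\<close>.\<close>

lemma gen_central_central:
  assumes p: "prime p" and z: "z \<in> Cz A A" "z \<noteq> 1" "z ^ p = 1" and w: "w \<in> Cz B B" "w \<noteq> 1"
  shows "gen ({z} \<union> {w}) = G"
proof (rule ccontr)
  let ?U = "gen ({z} \<union> {w})"
  assume ne: "?U \<noteq> G"
  have zA: "z \<in> A" and wB: "w \<in> B" using z(1) w(1) Cz_sub by blast+
  have XY: "{z} \<union> {w} \<subseteq> G" using zA A(2) wB B(2) by blast
  let ?N = "Nz G ?U"
  have za: "cj a ` {z} = {z}" if "a \<in> A" for a using that z(1) by (auto simp: Cz_def cj_fix_iff)
  have wb: "cj b ` {w} = {w}" if "b \<in> B" for b using that w(1) by (auto simp: Cz_def cj_fix_iff)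
  have N: "facd ?N" by (rule facd_normalizer) (use za wb XY in auto)
  have sU: "sgrp ?U" "?U \<subseteq> G" using sgrp_gen[OF G XY] gen_least[OF G XY] by auto
  have UN: "?U \<subseteq> ?N" using nrmlD(2)[OF nrml_Nz[OF G sU]] .
  have "?U \<noteq> {1}" using gen_sup[of "{z} \<union> {w}"] z(2) by auto
  then have NG: "?N \<noteq> G" by (rule normalizer_proper[OF sU _ ne])
  note sN = facdD[OF N]
  have zN: "z \<in> ?N" and wN: "w \<in> ?N" using UN gen_sup[of "{z} \<union> {w}"] by auto
  have zc: "z * x = x * z" if "x \<in> core ?N A" for x
    using that z(1) core_sub[OF sN(1), of A] by (auto simp: Cz_def)
  have wc: "w * x = x * w" if "x \<in> core ?N B" for x
    using that w(1) core_sub[OF sN(1), of B] by (auto simp: Cz_def)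
  obtain g f where gf: "g \<in> core ?N B" "f \<in> core ?N A" "cj (g * w) z = z * f"
    using conj_into_A[OF N facd_solv[OF N NG] p zA zN z(2,3) zc wN wc] by blast
  have gB: "g \<in> B" and fA: "f \<in> A" using gf(1,2) core_sub[OF sN(1)] by blast+
  have gwB: "g * w \<in> B" using gB wB sgrpD(3)[OF B(1)] by blast
  have "cj (g * w) z \<in> A" unfolding gf(3) using fA zA sgrpD(3)[OF A(1)] by blast
  then have gwM: "g * w \<in> M" using conj_centre_in_M[OF z(1,2)] gwB B(2) by blast
  have "cj m y \<in> Cz A A" if m: "m \<in> M" and y: "y \<in> Cz A A" for m y
  proof -
    have "nrml (Cz M A) M" by (rule nrml_Cz[OF M(1) A_normal])
    moreover have "y \<in> Cz M A" using y M(2) by (auto simp: Cz_def)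
    ultimately have "cj m y \<in> Cz M A" using nrmlD(4) m by blast
    moreover have "cj m y \<in> A" using nrmlD(4)[OF A_normal m] y Cz_sub by blast
    ultimately show ?thesis by (simp add: Cz_def)
  qed
  then have "z * f \<in> Cz A A" using gwM z(1) gf(3) by metis
  then have "f \<in> Cz A A" using sgrp_mult_iff(1)[OF sgrp_Cz[OF A(1)] z(1)] by blast
  then have "f = 1" using core_no_centre[OF sN w wN gf(2)] by blast
  then have "cj (g * w) z = z" using gf(3) by simp
  then have "g * w \<in> Cz B {z}" using gwB by (simp add: Cz_fix)
  then have "g * w = 1" using centralizer_in_B_trivial[OF z(1,2)] by blast
  then have "w = inverse g" by (metis inv_cancel_left mult_1_right)
  then have "w \<in> core ?N B" using gf(1) sgrpD(4)[OF nrmlD(1)[OF nrml_core[OF sN(1) B(1)]]] by blast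
  then have "w = 1" using fac2.core_no_centre[OF fac2_swap sN z(1,2) zN _ w(1)] by blast
  then show False using w(2) by blast
qed

text \<open>\<open>R\<close> lies in the conjugate of the r-part of \<open>B\<close> by some h = ab,
  so the conjugate of a central w of \<open>B\<close> by h, which is its conjugate by a, centralizes
  \<open>R\<close>. As a fixes z, the normalizer of \<open>R\<close> contains the conjugate by a of
  the group generated by z and w, which is \<open>G\<close>.\<close>

lemma no_normalized_subgroup:
  assumes p: "prime p" and z: "z \<in> Cz A A" "z \<noteq> 1" "z ^ p = 1"
    and r: "prime r" "r dvd card B" and R: "pgp r R" "R \<subseteq> G" "z \<in> Nz G R"
  shows "R = {1}"
proof -
  have sR: "sgrp R" using R(1) by (simp add: pgp_def)
  have zA: "z \<in> A" using z(1) Cz_sub by blast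
  have sB: "syl r (prt r B) G" by (rule fac.prt_A_syl[OF fac_swap r])
  obtain h where h: "h \<in> G" "R \<subseteq> cj h ` prt r B" using syl_conj_sub[OF r(1) G sB R(1,2)] .
  obtain a b where ab: "a \<in> A" "b \<in> B" "h = a * b" using fact[OF h(1)] by blast
  obtain w where w: "w \<in> Cz B B" "w \<noteq> 1" using nil_centre[OF r(1) B(1,3) r(2)] by blast
  have wB: "w \<in> B" using w(1) Cz_sub by blast
  have bw: "cj b w = w" using w(1) ab(2) by (auto simp: Cz_def cj_fix_iff)
  then have haw: "cj h w = cj a w" unfolding ab(3) by (metis cj_cj)
  have "cj h w \<in> Cz G R"
  proof -
    have "cj h w * x = x * cj h w" if x: "x \<in> R" for x
    proof -
      obtain y where y: "y \<in> prt r B" "x = cj h y" using h(2) x by blast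
      then have "w * y = y * w" using w(1) prt_sub[of r B] by (auto simp: Cz_def)
      then show ?thesis unfolding y(2) cj_mult[symmetric] by simp
    qed
    then show ?thesis using cj_in[OF G h(1)] wB B(2) by (auto simp: Cz_def)
  qed
  then have wN: "cj a w \<in> Nz G R" using Cz_sub_Nz haw by auto
  have sN: "sgrp (Nz G R)" by (rule sgrp_Nz[OF G])
  have sN': "sgrp (cj (inverse a) ` Nz G R)" by (rule sgrp_cj[OF sN])
  have az: "cj a z = z" using z(1) ab(1) by (auto simp: Cz_def cj_fix_iff)
  have "{z} \<union> {w} \<subseteq> cj (inverse a) ` Nz G R"
    using wN az R(3) by (auto simp: in_cj_image inv_inv)
  then have "G \<subseteq> cj (inverse a) ` Nz G R"
    using gen_least[OF sN'] gen_central_central[OF p z w] by blast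
  then have "card G \<le> card (Nz G R)" using card_mono[OF sgrpD(1)[OF sN']] by (metis card_cj)
  then have "Nz G R = G" using card_seteq[OF sgrpD(1)[OF G] Nz_sub] by blast
  moreover have "R \<noteq> G"
  proof
    assume "R = G"
    then have "pel r z" using pgp_pel[OF R(1)] zA A(2) by blast
    then have "r = p" using pel_two[OF _ pel_prime_order[OF z(3)] r(1) p] z(2) by blast
    then show False using prime_order_dvd[OF A(1) zA z(2) p z(3)] r cop
      by (meson coprime_common_divisor not_prime_unit)
  qed
  ultimately show ?thesis using normalizer_proper[OF sR R(2)] by blast
qed

text \<open>The centralizer is factorized and solvable. Its B-core is trivial, since z normalizes
  the primary parts of that core. So its Fitting subgroup lies in \<open>A\<close> and contains the
  central element z, and \<open>conj_centre_in_M\<close> applies to all its elements.\<close>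

lemma centralizer_mixed:
  assumes a: "a \<in> A" "a \<in> L" "a \<noteq> 1" shows "Cz G {a} \<subseteq> M"
proof -
  let ?H = "Cz G {a}"
  have nB: "nrml B L" by (rule fac2.A_normal[OF fac2_swap])
  have sH: "sgrp ?H" "?H \<subseteq> G" using sgrp_Cz[OF G] Cz_sub by auto
  have aG: "a \<in> G" using a(1) A(2) by blast
  have H: "facd ?H" unfolding facd_def
  proof (intro conjI ballI sH)
    fix g assume g: "g \<in> ?H"
    obtain u b where ub: "u \<in> A" "b \<in> B" "g = u * b" using fact g sH(2) by blast
    have ga: "cj g a = a" using g by (auto simp: Cz_fix)
    have e: "cj b a = cj (inverse u) a" using ga unfolding ub(3) by (metis cj_cj cj_cancel(1))
    \<comment> \<open>As \<open>B\<close> is normal in \<open>L\<close>, the commutator of a and b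
      lies in \<open>B\<close>. The equation for \<open>cj b a\<close> shows that it also lies in
      \<open>A\<close>, so it is trivial and both factors of g centralize a.\<close>
    have "cj (inverse a) b \<in> B" using nrmlD(4)[OF nB sgrpD(4)[OF L(1) a(2)] ub(2)] .
    then have "cj (inverse a) b * inverse b \<in> B" using ub(2) sgrpD(3,4)[OF B(1)] by blast
    moreover have "cj (inverse a) b * inverse b = inverse a * cj b a" by (simp add: cj_def grp)
    moreover have "inverse a * cj b a \<in> A"
      unfolding e using cj_in[OF A(1) sgrpD(4)[OF A(1) ub(1)] a(1)] sgrpD(3,4)[OF A(1)] a(1) by blast
    ultimately have "inverse a * cj b a = 1" using AB_one by metis
    then have ba: "cj b a = a" by (metis cancel_inv_left mult_1_right)
    then have "cj u a = a" using ga unfolding ub(3) by (metis cj_cj)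
    then show "\<exists>a'\<in>A \<inter> ?H. \<exists>b'\<in>B \<inter> ?H. g = a' * b'"
      using ub ba A(2) B(2) unfolding Cz_fix by blast
  qed
  have "?H \<noteq> G"
  proof
    assume e: "?H = G"
    have "a * g = g * a" if g: "g \<in> G" for g
    proof -
      have "g \<in> ?H" using g e by simp
      then show ?thesis by (simp add: Cz_def)
    qed
    then have "a \<in> Cz G G" using aG by (simp add: Cz_def)
    then show False using centre_G a(3) by blast
  qed
  then have solH: "solv ?H" using facd_solv[OF H] by blast
  obtain p where p: "prime p" "p dvd card A" using sgrp_prime_dvd[OF A(1) neA] by blast
  obtain z where z: "z \<in> Cz A A" "z \<noteq> 1" "z ^ p = 1" using nil_centre[OF p(1) A(1,3) p(2)] .
  have zH: "z \<in> ?H" using z(1) a(1) A(2) by (auto simp: Cz_def)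
  let ?FB = "core ?H B"
  have nFB: "nrml ?FB ?H" by (rule nrml_core[OF sH(1) B(1)])
  have FBB: "?FB \<subseteq> B" by (rule core_sub[OF sH(1)])
  have nilFB: "nil ?FB" by (rule nil_sub[OF B(3) FBB])
  have "{1} = ?FB"
  proof (rule prt_subset_all[OF sgrp_one nrmlD(1)[OF nFB] nilFB])
    show "{1} \<subseteq> ?FB" using sgrpD(2)[OF nrmlD(1)[OF nFB]] by simp
    fix r :: nat assume r: "prime r"
    let ?R = "prt r ?FB"
    show "?R \<subseteq> {1}"
    proof (cases "r dvd card B")
      case True
      have nR: "nrml ?R ?H" by (rule nrml_prt[OF r nilFB nFB])
      have "?R = {1}"
      proof (rule no_normalized_subgroup[OF p(1) z r True])
        show "pgp r ?R" by (rule pgp_prt[OF r nrmlD(1)[OF nFB] nilFB])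
        show "?R \<subseteq> G" using prt_sub FBB B(2) by blast
        show "z \<in> Nz G ?R" using nrmlD(3)[OF nR zH] zH sH(2) by (simp add: Nz_def subset_iff)
      qed
      then show ?thesis by simp
    next
      case False
      then have "\<not> r dvd card ?FB" using sgrp_card_dvd[OF nrmlD(1)[OF nFB] B(1) FBB] dvd_trans by blast
      then show ?thesis using prt_trivial[OF r nrmlD(1)[OF nFB]] by simp
    qed
  qed
  then have FB1: "?FB = {1}" by simp
  have "z \<in> sprod (core ?H A) ?FB"
  proof (rule fitting[OF H solH zH])
    show "z * x = x * z" if "x \<in> core ?H A" for x
      using that z(1) core_sub[OF sH(1), of A] by (auto simp: Cz_def)
  qed (simp add: FB1)
  then have zF: "z \<in> core ?H A" unfolding FB1 by (auto elim: sprodE)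
  show ?thesis
  proof
    fix h assume h: "h \<in> ?H"
    then have "cj h z \<in> A" using zF by (simp add: core_def)
    then show "h \<in> M" using conj_centre_in_M[OF z(1,2)] h sH(2) by blast
  qed
qed

end

lemma not_coprime_prime:
  assumes "\<not> coprime (a::nat) b" obtains r where "prime r" "r dvd a" "r dvd b"
proof -
  have "gcd a b \<noteq> 1" using assms by (simp add: coprime_iff_gcd_eq_1)
  then obtain r where r: "prime r" "r dvd gcd a b" using prime_factor_nat by blast
  then have "r dvd a" "r dvd b" by simp_all
  then show ?thesis using that r(1) by blast
qed

section \<open>Transfer\<close>

text \<open>The representatives \<open>t g\<close> of the left cosets are chosen compatibly with the double cosets of \<open>Y\<close>.
  By the intersection condition every summand of the transfer of an element of \<open>Y\<close> except the one of
  the trivial coset then comes from \<open>Z\<close>.\<close>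

lemma transfer_mod:
  fixes \<phi> :: "'a::mgroup \<Rightarrow> nat"
  assumes C: "sgrp C" and Y: "sgrp Y" "Y \<subseteq> C" and Z: "sgrp Z" "Z \<subseteq> Y"
    and central: "\<And>z g. z \<in> Z \<Longrightarrow> g \<in> C \<Longrightarrow> z * g = g * z"
    and TI: "\<And>c. c \<in> C \<Longrightarrow> c \<notin> Y \<Longrightarrow> Y \<inter> cj c ` Y \<subseteq> Z"
    and hom: "\<And>x y. x \<in> Y \<Longrightarrow> y \<in> Y \<Longrightarrow> [\<phi> (x * y) = \<phi> x + \<phi> y] (mod p)"
    and phiZ: "\<And>z. z \<in> Z \<Longrightarrow> p dvd \<phi> z"
  obtains V :: "'a \<Rightarrow> nat" where "\<forall>g\<in>C. \<forall>h\<in>C. [V (g * h) = V g + V h] (mod p)"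
    "\<forall>y\<in>Y. [V y = \<phi> y] (mod p)"
proof -
  note C' = sgrpD[OF C] and Y' = sgrpD[OF Y(1)]
  define dc where "dc g = (\<lambda>(y, y'). y * g * y') ` (Y \<times> Y)" for g
  have dcI: "y * g * y' \<in> dc g" if "y \<in> Y" "y' \<in> Y" for y g y' using that by (auto simp: dc_def)
  have dcE: "\<exists>y\<in>Y. \<exists>y'\<in>Y. x = y * g * y'" if "x \<in> dc g" for x g using that by (auto simp: dc_def)
  have dc_sub: "dc (y * g * y') \<subseteq> dc g" if y: "y \<in> Y" "y' \<in> Y" for y g y'
  proof
    fix x assume "x \<in> dc (y * g * y')"
    then obtain u u' where u: "u \<in> Y" "u' \<in> Y" "x = u * (y * g * y') * u'" using dcE by blast
    have "(u * y) * g * (y' * u') \<in> dc g" by (rule dcI) (use u y Y'(3) in blast)+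
    then show "x \<in> dc g" unfolding u(3) by (simp add: mult.assoc)
  qed
  have dc_eq: "dc (y * g * y') = dc g" if y: "y \<in> Y" "y' \<in> Y" for y g y'
  proof
    show "dc (y * g * y') \<subseteq> dc g" by (rule dc_sub[OF y])
    have "dc (inverse y * (y * g * y') * inverse y') \<subseteq> dc (y * g * y')"
      by (rule dc_sub) (use y Y'(4) in blast)+
    then show "dc g \<subseteq> dc (y * g * y')" by (simp add: grp)
  qed
  define d where "d g = (SOME x. x \<in> dc g)" for g
  have d_in: "d g \<in> dc g" for g
    unfolding d_def by (rule someI[of _ "1 * g * 1"]) (use dcI Y'(2) in blast)
  have d_eq: "d (y * g * y') = d g" if "y \<in> Y" "y' \<in> Y" for y g y'
    unfolding d_def dc_eq[OF that] ..
  \<comment> \<open>The choice 1 on \<open>Y\<close> makes the trivial coset contribute exactly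
    \<phi> y. Outside \<open>Y\<close>, all cosets in one double coset get representatives
    \<open>y * d g\<close> with the same \<open>d g\<close>.\<close>
  define t where "t g = (if g \<in> Y then 1 else SOME x. x \<in> lcos g Y \<and> (\<exists>y\<in>Y. x = y * d g))" for g
  have t_ex: "t g \<in> lcos g Y \<and> (\<exists>y\<in>Y. t g = y * d g)" if "g \<notin> Y" for g
  proof -
    obtain y y' where y: "y \<in> Y" "y' \<in> Y" "d g = y * g * y'" using dcE d_in by blast
    have "inverse y * d g = g * y'" unfolding y(3) by (simp add: grp)
    then have "inverse y * d g \<in> lcos g Y" using y(2) by (simp add: in_lcos inv_cancel_left)
    moreover have "\<exists>u\<in>Y. inverse y * d g = u * d g" using Y'(4)[OF y(1)] by (rule bexI[rotated]) simp
    ultimately have "\<exists>x. x \<in> lcos g Y \<and> (\<exists>u\<in>Y. x = u * d g)" by (intro exI conjI)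
    from someI_ex[OF this] show ?thesis unfolding t_def if_not_P[OF that] .
  qed
  have t_in: "inverse g * t g \<in> Y" if "g \<in> C" for g
  proof (cases "g \<in> Y")
    case True then show ?thesis using Y'(4) by (simp add: t_def)
  next
    case False then show ?thesis using t_ex[OF False] by (simp add: in_lcos)
  qed
  have tC: "t g \<in> C" if "g \<in> C" for g
  proof -
    have "g * (inverse g * t g) \<in> C" using t_in[OF that] Y(2) that C'(3) by blast
    then show ?thesis by (simp add: grp)
  qed
  have t_const: "t (g * v) = t g" if "v \<in> Y" for g v
  proof -
    have "g * v \<in> Y \<longleftrightarrow> g \<in> Y" by (rule sgrp_mult_iff(2)[OF Y(1) that])
    moreover have "lcos (g * v) Y = lcos g Y"
      using lcos_eq_iff[OF Y(1), of g "g * v"] that by (simp add: inv_cancel_left)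
    moreover have "d (g * v) = d g" using d_eq[OF Y'(2) that, of g] by simp
    ultimately show ?thesis by (simp add: t_def)
  qed
  have t_t: "t (g * t h) = t (g * h)" if "h \<in> C" for g h
  proof -
    have "g * t h = (g * h) * (inverse h * t h)" by (simp add: grp)
    then show ?thesis using t_const[OF t_in[OF that], of "g * h"] by simp
  qed
  define R where "R = t ` C"
  have fR: "finite R" using C'(1) by (simp add: R_def)
  have RC: "x \<in> C" if "x \<in> R" for x using that tC by (auto simp: R_def)
  have tR: "t x = x" if x: "x \<in> R" for x
  proof -
    obtain g where "g \<in> C" "x = t g" using x by (auto simp: R_def)
    then show ?thesis using t_t[of g 1] by simp
  qed
  \<comment> \<open>The element of \<open>Y\<close> by which g fails to map representatives to
    representatives. It satisfies the cocycle identity \<open>ueq\<close>, which makes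
    \<open>V\<close> additive modulo p.\<close>
  define u where "u g x = inverse (t (g * x)) * (g * x)" for g x
  have uY: "u g x \<in> Y" if "g \<in> C" "x \<in> C" for g x
  proof -
    have "inverse (inverse (g * x) * t (g * x)) \<in> Y" using t_in[OF C'(3)[OF that]] Y'(4) by blast
    then show ?thesis by (simp add: u_def grp)
  qed
  define V where "V g = (\<Sum>x\<in>R. \<phi> (u g x))" for g
  have V_hom: "[V (g * h) = V g + V h] (mod p)" if gh: "g \<in> C" "h \<in> C" for g h
  proof -
    have ueq: "u (g * h) x = u g (t (h * x)) * u h x" if "x \<in> C" for x
    proof -
      have "t (g * t (h * x)) = t (g * h * x)" using t_t[OF C'(3)[OF gh(2) that], of g] by (simp add: mult.assoc)
      then show ?thesis unfolding u_def by (simp add: grp)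
    qed
    have b: "bij_betw (\<lambda>x. t (h * x)) R R"
    proof (rule bij_betwI[where g = "\<lambda>x. t (inverse h * x)"])
      show "(\<lambda>x. t (h * x)) \<in> R \<rightarrow> R" "(\<lambda>x. t (inverse h * x)) \<in> R \<rightarrow> R"
        using RC gh(2) C'(3,4) by (auto simp: R_def tC)
      fix x assume x: "x \<in> R"
      show "t (inverse h * t (h * x)) = x"
        using t_t[OF C'(3)[OF gh(2) RC[OF x]], of "inverse h"] tR[OF x] by (simp add: grp)
      show "t (h * t (inverse h * x)) = x"
        using t_t[OF C'(3)[OF C'(4)[OF gh(2)] RC[OF x]], of h] tR[OF x] by (simp add: grp)
    qed
    have "[V (g * h) = (\<Sum>x\<in>R. \<phi> (u g (t (h * x))) + \<phi> (u h x))] (mod p)"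
      unfolding V_def
    proof (rule cong_sum)
      fix x assume x: "x \<in> R"
      have "u g (t (h * x)) \<in> Y" using uY[OF gh(1) tC[OF C'(3)[OF gh(2) RC[OF x]]]] .
      then show "[\<phi> (u (g * h) x) = \<phi> (u g (t (h * x))) + \<phi> (u h x)] (mod p)"
        unfolding ueq[OF RC[OF x]] using uY[OF gh(2) RC[OF x]] by (rule hom)
    qed
    also have "(\<Sum>x\<in>R. \<phi> (u g (t (h * x))) + \<phi> (u h x)) = V g + V h"
      unfolding V_def sum.distrib using sum.reindex_bij_betw[OF b, of "\<lambda>x. \<phi> (u g x)"] by simp
    finally show ?thesis .
  qed
  have V_eq: "[V y = \<phi> y] (mod p)" if y: "y \<in> Y" for y
  proof -
    have one: "t 1 = 1" using Y'(2) by (simp add: t_def)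
    then have R1: "1 \<in> R" using C'(2) unfolding R_def by (metis image_eqI)
    have u1: "u y 1 = y" using y by (simp add: u_def t_def inv_one)
    have dv: "p dvd \<phi> (u y x)" if x: "x \<in> R" "x \<noteq> 1" for x
    proof -
      have xY: "x \<notin> Y" using tR[OF x(1)] x(2) by (auto simp: t_def)
      then obtain y0 where y0: "y0 \<in> Y" "x = y0 * d x" using t_ex[OF xY] tR[OF x(1)] by auto
      have "inverse y0 * x = d x" using y0(2) by (metis inv_cancel_left)
      then have dC: "d x \<in> C" using y0(1) Y(2) Y'(4) C'(3) RC[OF x(1)] by (metis subsetD)
      have dY: "d x \<notin> Y" using y0 xY Y'(3) by metis
      have yx: "y * x \<notin> Y" using xY sgrp_mult_iff(1)[OF Y(1) y] by blast
      have "d (y * x) = d x" using d_eq[OF y Y'(2), of x] by simp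
      then obtain y1 where y1: "y1 \<in> Y" "t (y * x) = y1 * d x" using t_ex[OF yx] by auto
      \<comment> \<open>The representatives of x and \<open>y * x\<close> share the double coset
        representative \<open>d x\<close>, so the transfer factor is, up to inversion, the conjugate
        of \<open>?u\<close> by the inverse of \<open>d x\<close>. Hence \<open>?u\<close> lies in
        \<open>Y\<close> and in its conjugate by \<open>d x\<close>, and therefore in the central
        subgroup \<open>Z\<close>.\<close>
      let ?u = "inverse y0 * (inverse y * y1)"
      have uin: "?u \<in> Y" using y0(1) y y1(1) Y'(3,4) by blast
      have "inverse (y * x) * t (y * x) = inverse (d x) * (inverse y0 * (inverse y * (y1 * d x)))"
        by (subst y0(2)) (simp add: y1(2) grp)
      also have "\<dots> = cj (inverse (d x)) ?u" by (simp add: cj_def grp)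
      finally have e: "inverse (y * x) * t (y * x) = cj (inverse (d x)) ?u" .
      moreover have "inverse (y * x) * t (y * x) \<in> Y" using t_in C'(3) y Y(2) RC[OF x(1)] by blast
      ultimately have "?u \<in> cj (d x) ` Y" by (simp add: in_cj_image)
      then have uZ: "?u \<in> Z" using TI[OF dC dY] uin by blast
      have "?u * inverse (d x) = inverse (d x) * ?u" using central[OF uZ C'(4)[OF dC]] .
      then have "cj (inverse (d x)) ?u = ?u" by (simp add: cj_fix_iff)
      then have "inverse (inverse (y * x) * t (y * x)) \<in> Z" using e uZ sgrpD(4)[OF Z(1)] by simp
      then have "u y x \<in> Z" by (simp add: u_def grp)
      then show ?thesis by (rule phiZ)
    qed
    have "V y = \<phi> y + (\<Sum>x\<in>R - {1}. \<phi> (u y x))"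
      unfolding V_def using sum.remove[OF fR R1, of "\<lambda>x. \<phi> (u y x)"] u1 by simp
    moreover have "p dvd (\<Sum>x\<in>R - {1}. \<phi> (u y x))" using dv by (intro dvd_sum) auto
    ultimately show ?thesis by (auto simp: cong_def elim!: dvdE)
  qed
  show ?thesis by (rule that) (use V_hom V_eq in auto)
qed

section \<open>Comparing the orders of the two factors\<close>

context fac2
begin

lemma coprime_prime_A: "prime r \<Longrightarrow> r dvd card B \<Longrightarrow> \<not> r dvd card A"
  using cop by (meson coprime_common_divisor not_prime_unit)

text \<open>If \<open>A\<close> were larger, it would meet all its conjugates. In the centralizer of
  a largest such intersection \<open>D\<close>, the transfer shows that the subgroup
  \<open>K\<close> generated by the elements of primary order for primes of \<open>card B\<close>
  meets \<open>A\<close> only centrally. Counting the Sylow subgroups of \<open>K\<close> then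
  produces one normalized by a central element of \<open>A\<close>, which
  \<open>no_normalized_subgroup\<close> forbids.\<close>

lemma card_B_ge: "card A \<le> card B"
proof (rule ccontr)
  assume "\<not> card A \<le> card B"
  then have AB: "card B < card A" by simp
  note A' = sgrpD[OF A(1)]
  define I where "I g = A \<inter> cj g ` A" for g
  have sI: "sgrp (I g)" for g unfolding I_def by (rule sgrp_Int[OF A(1) sgrp_cj[OF A(1)]])
  \<comment> \<open>Otherwise the product of \<open>A\<close> with its conjugate would have more
    than \<open>card A * card B\<close> elements.\<close>
  have Ine: "I g \<noteq> {1}" if g: "g \<in> G" for g
  proof
    assume "I g = {1}"
    then have "card (sprod A (cj g ` A)) = card A * card A"
      using card_sprod[OF A(1) sgrp_cj[OF A(1)], of g] by (simp add: I_def card_cj)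
    moreover have "sprod A (cj g ` A) \<subseteq> G" using cj_in[OF G g] A(2) by (intro sprod_sub[OF G]) auto
    then have "card (sprod A (cj g ` A)) \<le> card A * card B"
      using card_mono[OF sgrpD(1)[OF G]] card_G by metis
    ultimately show False using AB sgrp_card_pos[OF A(1)] by simp
  qed
  obtain g0 where "g0 \<in> G" "g0 \<notin> M" using M(3,4) by blast
  then have "g0 \<in> G - M" by simp
  then obtain g where g: "g \<in> G - M" and max: "\<forall>h\<in>G - M. card (I h) \<le> card (I g)"
    using finite_max_exists[of "G - M" g0 "\<lambda>h. card (I h)"] sgrpD(1)[OF G] by blast
  \<comment> \<open>By the choice of g, any conjugate of \<open>A\<close> by an element outside
    \<open>M\<close> that contains \<open>D\<close> meets \<open>A\<close> exactly in
    \<open>D\<close>.\<close>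
  define D where "D = I g"
  have gG: "g \<in> G" "g \<notin> M" using g by auto
  have sD: "sgrp D" and Dne: "D \<noteq> {1}" and DA: "D \<subseteq> A" and DgA: "D \<subseteq> cj g ` A"
    using sI Ine[OF gG(1)] by (auto simp: D_def I_def)
  have ID: "I h = D" if h: "h \<in> G" "h \<notin> M" "D \<subseteq> cj h ` A" for h
  proof -
    have "D \<subseteq> I h" using DA h(3) by (simp add: I_def)
    moreover have "card (I h) \<le> card D" using max h(1,2) by (simp add: D_def)
    ultimately show ?thesis using card_seteq[OF sgrpD(1)[OF sI]] by metis
  qed
  have inM: "h \<in> M" if "h \<in> G" "z \<in> Cz A A" "z \<noteq> 1" "cj h z \<in> A" for h z
    using conj_centre_in_M that by blast
  have ZD: "z \<notin> D" if z: "z \<in> Cz A A" "z \<noteq> 1" for z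
  proof
    assume "z \<in> D"
    then have "cj (inverse g) z \<in> A" using DgA by (auto simp: in_cj_image cj_cancel)
    then have "inverse g \<in> M" using inM[OF sgrpD(4)[OF G gG(1)] z] by blast
    then show False using gG(2) sgrp_inv_iff[OF M(1)] by blast
  qed
  define C where "C = Cz G D"
  have sC: "sgrp C" "C \<subseteq> G" unfolding C_def using sgrp_Cz[OF G] Cz_sub by auto
  define Y where "Y = C \<inter> M"
  have sY: "sgrp Y" "Y \<subseteq> C" "Y \<subseteq> M" unfolding Y_def using sgrp_Int[OF sC(1) M(1)] by auto
  obtain p0 where p0: "prime p0" "p0 dvd card A" using sgrp_prime_dvd[OF A(1) neA] by blast
  obtain z0 where z0: "z0 \<in> Cz A A" "z0 \<noteq> 1" using nil_centre[OF p0(1) A(1,3) p0(2)] by blast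
  have gz0: "cj g z0 \<notin> M" using central_conj_M[OF z0 gG(1)] gG(2) by blast
  \<comment> \<open>An element of \<open>Y\<close> of prime order dividing \<open>card B\<close> is
    conjugate within \<open>M\<close> into \<open>B \<inter> M\<close>, so its conjugate has its
    centralizer in \<open>L\<close>. The corresponding conjugate of an element of \<open>D\<close>
    then lies in \<open>A \<inter> L\<close>, and its centralizer in \<open>M\<close>. But that
    centralizer contains a conjugate, under \<open>M\<close>, of \<open>cj g z0\<close>, which is
    outside \<open>M\<close>.\<close>
  have YA: "Y \<subseteq> A"
  proof (rule coprime_sub_M[OF sY(1,3)], rule ccontr)
    assume "\<not> coprime (card Y) (card B)"
    then obtain r where r: "prime r" "r dvd card Y" "r dvd card B"
      by (rule not_coprime_prime)
    obtain x where x: "x \<in> Y" "x \<noteq> 1" "x ^ r = 1" using cauchy[OF r(1) sY(1) r(2)] .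
    have xM: "x \<in> M" and xC: "x \<in> C" using x(1) by (auto simp: Y_def)
    have sBM: "sgrp (B \<inter> M)" by (rule sgrp_Int[OF B(1) M(1)])
    have AM: "A \<inter> M = A" using M(2) by blast
    have cM: "card M = card A * card (B \<inter> M)" using facd_card[OF facd_over_A[OF M(1,3,2)]] AM by simp
    let ?S = "prt r (B \<inter> M)"
    have "multiplicity r (card M) = multiplicity r (card (B \<inter> M))"
      unfolding cM using r(1) coprime_prime_A[OF r(1,3)] sgrp_card_pos[OF A(1)] sgrp_card_pos[OF sBM]
      by (subst prime_elem_multiplicity_mult_distrib) (auto simp: not_dvd_imp_multiplicity_0)
    moreover have "syl r ?S (B \<inter> M)" by (rule prt_syl[OF r(1) sBM nil_sub[OF B(3)]]) simp
    ultimately have "syl r ?S M" by (auto simp: syl_def)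
    then obtain m where m: "m \<in> M" "x \<in> cj m ` ?S"
      using pel_in_syl_conj[OF r(1) M(1) _ xM pel_prime_order[OF x(3)]] by blast
    let ?x = "cj (inverse m) x"
    have xB: "?x \<in> B" "?x \<in> M" using m(2) prt_sub by (auto simp: in_cj_image prt_def)
    have x1: "?x \<noteq> 1" using x(2) by (simp add: cj_one_iff)
    have CL: "Cz G {?x} \<subseteq> L" by (rule fac2.centralizer_mixed[OF fac2_swap xB x1])
    obtain e where e: "e \<in> D" "e \<noteq> 1" using sgrp_nontrivial[OF sD Dne] by blast
    let ?e = "cj (inverse m) e"
    have mM: "inverse m \<in> M" using m(1) sgrpD(4)[OF M(1)] by blast
    have mG: "inverse m \<in> G" "m \<in> G" using mM m(1) M(3) by auto
    have eA: "?e \<in> A" using nrmlD(4)[OF A_normal mM] e(1) DA by blast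
    have "x * e = e * x" using xC e(1) by (simp add: C_def Cz_def)
    then have "?x * ?e = ?e * ?x" by (metis cj_mult)
    then have "?e \<in> Cz G {?x}" using eA A(2) by (auto simp: Cz_def)
    then have eL: "?e \<in> L" using CL by blast
    have "?e \<noteq> 1" using e(2) by (simp add: cj_one_iff)
    then have CM: "Cz G {?e} \<subseteq> M" using centralizer_mixed[OF eA eL] by blast
    have "cj g z0 * e = e * cj g z0"
    proof -
      obtain a where a: "a \<in> A" "e = cj g a" using e(1) DgA by blast
      have "z0 * a = a * z0" using z0(1) a(1) by (auto simp: Cz_def)
      then show ?thesis unfolding a(2) by (metis cj_mult)
    qed
    then have "cj (inverse m) (cj g z0) * ?e = ?e * cj (inverse m) (cj g z0)" by (metis cj_mult)
    moreover have "cj (inverse m) (cj g z0) \<in> G"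
      using cj_in[OF G mG(1) cj_in[OF G gG(1)]] z0(1) Cz_sub A(2) by blast
    ultimately have "cj (inverse m) (cj g z0) \<in> M" using CM by (auto simp: Cz_def)
    then have "cj m (cj (inverse m) (cj g z0)) \<in> M" using cj_in[OF M(1) m(1)] by blast
    then show False using gz0 by (simp add: cj_cancel)
  qed
  define Z where "Z = D \<inter> C"
  have sZ: "sgrp Z" unfolding Z_def by (rule sgrp_Int[OF sD sC(1)])
  have Zc: "z * c = c * z" if "z \<in> Z" "c \<in> C" for z c using that by (auto simp: Z_def C_def Cz_def)
  have TI: "Y \<inter> cj c ` Y \<subseteq> Z" if c: "c \<in> C" "c \<notin> M" for c
  proof
    fix x assume x: "x \<in> Y \<inter> cj c ` Y"
    have cD: "cj c ` D = D" using c(1) Cz_sub_Nz[of G D] by (auto simp: C_def Nz_def)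
    then have "D \<subseteq> cj c ` A" using DA by blast
    then have "I c = D" using ID c sC(2) by blast
    moreover have "x \<in> I c" using x YA by (auto simp: I_def)
    ultimately show "x \<in> Z" using x sY(2) by (auto simp: Z_def)
  qed
  have central: "\<exists>z. z \<in> Cz A A \<and> z \<noteq> 1 \<and> z ^ t = 1" if "prime t" "t dvd card A" for t
    using nil_centre[OF that(1) A(1,3) that(2)] by metis
  have ZAY: "z \<in> Y" if "z \<in> Cz A A" for z
  proof -
    have "z \<in> C" using that DA A(2) by (auto simp: C_def Cz_def)
    moreover have "z \<in> M" using that Cz_sub M(2) by blast
    ultimately show ?thesis by (simp add: Y_def)
  qed
  have nilY: "nil Y" by (rule nil_sub[OF A(3) YA])
  \<comment> \<open>Whatever normalizes \<open>prt t Y\<close> conjugates a central element of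
    \<open>A\<close> into \<open>A\<close>, hence lies in \<open>M\<close>. So the normalizer of
    \<open>prt t Y\<close> in a larger t-subgroup of \<open>C\<close> cannot grow.\<close>
  have SylC: "syl t (prt t Y) C" if t: "prime t" "t dvd card A" for t
  proof -
    let ?S = "prt t Y"
    have sS: "sgrp ?S" "pgp t ?S" "?S \<subseteq> C" using sgrp_prt pgp_prt t(1) sY nilY prt_sub by blast+
    obtain S0 where S0: "syl t S0 C" using syl_exists[OF t(1) sC(1)] .
    obtain c where c: "c \<in> C" "?S \<subseteq> cj c ` S0" using syl_conj_sub[OF t(1) sC(1) S0 sS(2,3)] .
    have S1: "syl t (cj c ` S0) C" by (rule syl_cj[OF sC(1) S0 c(1)])
    have "?S = cj c ` S0"
    proof (rule ccontr)
      assume ne: "?S \<noteq> cj c ` S0"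
      obtain n where n: "n \<in> cj c ` S0" "n \<notin> ?S" "cj n ` ?S = ?S"
        using pgp_normalizer_grows[OF t(1) sylD(3)[OF S1] sS(1) c(2) ne] .
      have nC: "n \<in> C" using n(1) sylD(2)[OF S1] by blast
      obtain z where z: "z \<in> Cz A A" "z \<noteq> 1" "z ^ t = 1" using central[OF t] by blast
      have "z \<in> ?S" using ZAY[OF z(1)] pel_prime_order[OF z(3)] by (simp add: prt_def)
      then have "cj n z \<in> ?S" using n(3) by blast
      then have "cj n z \<in> A" using YA prt_sub by blast
      then have "n \<in> M" using inM[OF _ z(1,2)] nC sC(2) by blast
      then have "n \<in> Y" using nC by (simp add: Y_def)
      moreover have "pel t n" using pgp_pel[OF sylD(3)[OF S1] n(1)] .
      ultimately show False using n(2) by (simp add: prt_def)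
    qed
    then show ?thesis using S1 by simp
  qed
  have DneA: "D \<noteq> cj g ` A"
  proof
    assume "D = cj g ` A"
    then have "cj g z0 \<in> A" using z0(1) Cz_sub DA by blast
    then show False using gz0 M(2) by blast
  qed
  \<comment> \<open>Normalizers grow in the conjugate of \<open>A\<close>. The element found is
    outside \<open>M\<close>, since inside \<open>M\<close> it would lie in \<open>A\<close> and
    thus in \<open>D\<close>.\<close>
  obtain x where x: "x \<in> cj g ` A" "x \<notin> D" "cj x ` D = D"
    using nil_normalizer_grows[OF sgrp_cj[OF A(1)] nil_cj[OF A(3)] sD DgA DneA] .
  have xG: "x \<in> G" using x(1) cj_in[OF G gG(1)] A(2) by blast
  have xM: "x \<notin> M"
  proof
    assume xM: "x \<in> M"
    have gx: "sgrp (gen {x})" by (rule sgrp_gen[OF M(1)]) (simp add: xM)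
    have gx2: "gen {x} \<subseteq> M" by (rule gen_least[OF M(1)]) (simp add: xM)
    have gx3: "gen {x} \<subseteq> cj g ` A" by (rule gen_least[OF sgrp_cj[OF A(1)]]) (simp add: x(1))
    have "card (gen {x}) dvd card A" using sgrp_card_dvd[OF gx sgrp_cj[OF A(1)] gx3] by (simp add: card_cj)
    then have "coprime (card (gen {x})) (card B)" using cop coprime_divisors[OF _ dvd_refl] by blast
    then have "x \<in> A" using coprime_sub_M[OF gx gx2] gen_sup[of "{x}"] by blast
    then have "x \<in> D" using x(1) by (simp add: D_def I_def)
    then show False using x(2) by blast
  qed
  \<comment> \<open>Frattini argument: x normalizes \<open>C\<close>, and after a correction c from
    \<open>C\<close> it normalizes a Sylow subgroup \<open>prt p0 Y\<close>, hence lies in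
    \<open>M\<close>. Since x is outside \<open>M\<close>, so is c.\<close>
  have "\<exists>c\<in>C. c \<notin> M"
  proof -
    let ?S = "prt p0 Y"
    have S: "syl p0 ?S C" by (rule SylC[OF p0])
    have xC: "cj x ` C = C"
    proof (rule cj_image_eqI[OF sgrpD(1)[OF sC(1)]])
      fix c assume c: "c \<in> C"
      have "cj (cj x c) y = y" if y: "y \<in> D" for y
      proof -
        have "cj (inverse x) y \<in> D" using cj_image_inv[OF x(3)] y by blast
        then have "cj c (cj (inverse x) y) = cj (inverse x) y" using c by (simp add: C_def Cz_fix)
        then have "cj x (cj c (cj (inverse x) y)) = y" by (simp add: cj_cancel)
        then show ?thesis by (simp add: cj_cj) (simp add: cj_def grp)
      qed
      moreover have "cj x c \<in> G" using cj_in[OF G xG] c sC(2) by blast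
      ultimately show "cj x c \<in> C" by (simp add: C_def Cz_fix)
    qed
    have "cj x ` ?S \<subseteq> C" using sylD(2)[OF S] xC by blast
    then have "syl p0 (cj x ` ?S) C" using S by (auto simp: syl_def sgrp_cj card_cj)
    then obtain c where c: "c \<in> C" "cj x ` ?S = cj c ` ?S" using syl_conj[OF p0(1) sC(1) S] by metis
    have "cj (inverse c * x) ` ?S = cj (inverse c) ` cj x ` ?S" by (simp add: cj_image_cj)
    also have "\<dots> = ?S" unfolding c(2) by (simp add: cj_image_cj left_inv cj_image_one)
    finally have e: "cj (inverse c * x) ` ?S = ?S" .
    obtain z where z: "z \<in> Cz A A" "z \<noteq> 1" "z ^ p0 = 1" using central[OF p0] by blast
    have "z \<in> ?S" using ZAY[OF z(1)] pel_prime_order[OF z(3)] by (simp add: prt_def)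
    then have "cj (inverse c * x) z \<in> A" using e YA prt_sub by blast
    moreover have cxG: "inverse c * x \<in> G" using c(1) sC(2) xG sgrpD(3,4)[OF G] by blast
    ultimately have cx: "inverse c * x \<in> M" using inM[OF _ z(1,2)] by blast
    have "c \<notin> M"
    proof
      assume "c \<in> M"
      then have "c * (inverse c * x) \<in> M" using cx sgrpD(3)[OF M(1)] by blast
      then show False using xM by (simp add: grp)
    qed
    then show ?thesis using c(1) by blast
  qed
  then have YC: "Y \<noteq> C" by (auto simp: Y_def)
  have "\<exists>r. prime r \<and> r dvd card C \<and> \<not> r dvd card A"
  proof (rule ccontr)
    assume no: "\<nexists>r. prime r \<and> r dvd card C \<and> \<not> r dvd card A"
    have "Y = C"
    proof (rule syl_subset_all[OF sY(1) sC(1) sY(2)])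
      fix t :: nat assume t: "prime t"
      show "\<exists>S. syl t S C \<and> S \<subseteq> Y"
      proof (cases "t dvd card A")
        case True then show ?thesis using SylC[OF t] prt_sub by blast
      next
        case False
        then have "\<not> t dvd card C" using no t by blast
        then have "syl t {1} C" using sgrp_one sgrpD(2)[OF sC(1)] by (simp add: syl_def not_dvd_imp_multiplicity_0)
        then show ?thesis using sgrpD(2)[OF sY(1)] by blast
      qed
    qed
    then show False using YC by blast
  qed
  then obtain r where r: "prime r" "r dvd card C" "\<not> r dvd card A" by blast
  have "card C dvd card G" by (rule sgrp_card_dvd[OF sC(1) G sC(2)])
  then have rB: "r dvd card B" using r dvd_trans prime_dvd_mult_iff[OF r(1)] unfolding card_G by blast
  \<comment> \<open>The primes here do not divide \<open>card A\<close>, so the subgroup generated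
    by \<open>X\<close> has no nontrivial homomorphism to a group of prime order p when p divides
    \<open>card A\<close>.\<close>
  define X where "X = {x \<in> C. \<exists>s. prime s \<and> s dvd card B \<and> pel s x}"
  have XC: "X \<subseteq> C" by (auto simp: X_def)
  define K where "K = gen X"
  have sK: "sgrp K" "K \<subseteq> C" unfolding K_def using sgrp_gen[OF sC(1) XC] gen_least[OF sC(1) XC] by auto
  have nK: "cj c ` K = K" if c: "c \<in> C" for c
  proof -
    have "cj c ` X = X"
    proof (rule cj_image_eqI)
      show "finite X" using XC sgrpD(1)[OF sC(1)] finite_subset by blast
      show "cj c x \<in> X" if "x \<in> X" for x using that cj_in[OF sC(1) c] by (auto simp: X_def pel_cj)
    qed
    then show ?thesis unfolding K_def by (rule gen_cj[OF sC(1) XC])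
  qed
  \<comment> \<open>Otherwise the nilpotent group \<open>K \<inter> Y\<close> has a nontrivial
    homomorphism to a cyclic group of prime order that vanishes on the central part, and the
    transfer extends it to \<open>K\<close>, which its generators forbid.\<close>
  have KY: "K \<inter> Y \<subseteq> Z"
  proof (rule ccontr)
    assume no: "\<not> K \<inter> Y \<subseteq> Z"
    have s1: "sgrp (K \<inter> Y)" "sgrp (K \<inter> Y \<inter> Z)" using sgrp_Int sK(1) sY(1) sZ by blast+
    have s2: "K \<inter> Y \<inter> Z \<subseteq> K \<inter> Y" "K \<inter> Y \<inter> Z \<noteq> K \<inter> Y" using no by auto
    have nKY: "nil (K \<inter> Y)" by (rule nil_sub[OF nilY]) simp
    obtain p and \<phi> :: "'a \<Rightarrow> nat" where p: "prime p"
      and ph: "\<forall>x\<in>K \<inter> Y. \<forall>y\<in>K \<inter> Y. [\<phi> (x * y) = \<phi> x + \<phi> y] (mod p)"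
      and pz: "\<forall>z\<in>K \<inter> Y \<inter> Z. p dvd \<phi> z" and px: "\<exists>x\<in>K \<inter> Y. \<not> p dvd \<phi> x"
      using nil_hom_prime[OF s1(1) nKY s1(2) s2] .
    obtain V :: "'a \<Rightarrow> nat" where V: "\<forall>g\<in>K. \<forall>h\<in>K. [V (g * h) = V g + V h] (mod p)"
      "\<forall>y\<in>K \<inter> Y. [V y = \<phi> y] (mod p)"
    proof (rule transfer_mod[OF sK(1) s1(1) _ s1(2) s2(1)])
      show "K \<inter> Y \<subseteq> K" by simp
      show "z * g = g * z" if "z \<in> K \<inter> Y \<inter> Z" "g \<in> K" for z g using Zc that sK(2) by blast
      show "K \<inter> Y \<inter> cj c ` (K \<inter> Y) \<subseteq> K \<inter> Y \<inter> Z" if c: "c \<in> K" "c \<notin> K \<inter> Y" for c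
      proof -
        have "c \<in> C" "c \<notin> M" using c sK(2) by (auto simp: Y_def)
        then show ?thesis using TI[of c] by auto
      qed
      show "[\<phi> (x * y) = \<phi> x + \<phi> y] (mod p)" if "x \<in> K \<inter> Y" "y \<in> K \<inter> Y" for x y using ph that by blast
      show "p dvd \<phi> z" if "z \<in> K \<inter> Y \<inter> Z" for z using pz that by blast
    qed
    have V1: "p dvd V 1"
    proof -
      have "[V 1 + V 1 = V 1 + 0] (mod p)" using V(1) sgrpD(2)[OF sK(1)] by (metis add_0_right cong_sym mult_1)
      then have "[V 1 = 0] (mod p)" by (simp only: cong_add_lcancel_nat)
      then show ?thesis by (simp add: cong_0_iff)
    qed
    have Vpow: "[V (x ^ k) = k * V x] (mod p)" if "x \<in> K" for x k
    proof (induction k)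
      case 0 then show ?case using V1 by (simp add: cong_0_iff)
    next
      case (Suc k)
      have "[V (x * x ^ k) = V x + V (x ^ k)] (mod p)" using V(1) that sgrp_pow[OF sK(1) that] by blast
      also have "[V x + V (x ^ k) = V x + k * V x] (mod p)" using Suc by (simp only: cong_add_lcancel_nat)
      finally show ?case by simp
    qed
    have pA: "p dvd card A"
    proof -
      obtain x where x: "x \<in> K \<inter> Y" "\<not> p dvd \<phi> x" using px by blast
      then have nx: "\<not> p dvd V x" using V(2) cong_dvd_iff by blast
      have "x ^ card A = 1" using pow_card[OF A(1)] x(1) YA by blast
      then have "[V 1 = card A * V x] (mod p)" using Vpow[of x "card A"] x(1) by simp
      then have "p dvd card A * V x" using V1 cong_dvd_iff by blast
      then show ?thesis using p nx prime_dvd_mult_iff by blast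
    qed
    define W where "W = {x \<in> K. p dvd V x}"
    have sW: "sgrp W" unfolding sgrp_def
    proof (intro conjI ballI)
      show "finite W" "1 \<in> W" using sgrpD(1,2)[OF sK(1)] V1 by (auto simp: W_def)
      fix x assume x: "x \<in> W"
      show "x * y \<in> W" if y: "y \<in> W" for y
      proof -
        have "[V (x * y) = V x + V y] (mod p)" using V(1) x y by (simp add: W_def)
        moreover have "p dvd V x + V y" using x y by (simp add: W_def)
        ultimately have "p dvd V (x * y)" using cong_dvd_iff by blast
        then show ?thesis using x y sgrpD(3)[OF sK(1)] by (simp add: W_def)
      qed
      have xK: "x \<in> K" "inverse x \<in> K" using x sgrpD(4)[OF sK(1)] by (auto simp: W_def)
      have "[V (x * inverse x) = V x + V (inverse x)] (mod p)" using V(1) xK by blast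
      then have "p dvd V x + V (inverse x)" using V1 cong_dvd_iff by (metis right_inv)
      then have "p dvd V (inverse x)" using x by (simp add: W_def dvd_add_right_iff)
      then show "inverse x \<in> W" using xK by (simp add: W_def)
    qed
    have "X \<subseteq> W"
    proof
      fix y assume y: "y \<in> X"
      then obtain s where s: "prime s" "s dvd card B" "pel s y" by (auto simp: X_def)
      have yK: "y \<in> K" using y gen_sup[of X] by (auto simp: K_def)
      obtain k where "y ^ (s ^ k) = 1" using s(3) by (auto simp: pel_def)
      then have "[V 1 = s ^ k * V y] (mod p)" using Vpow[OF yK, of "s ^ k"] by simp
      then have "p dvd s ^ k * V y" using V1 cong_dvd_iff by blast
      moreover have "\<not> p dvd s ^ k"
      proof
        assume "p dvd s ^ k"
        then have "p dvd s" by (rule prime_dvd_power[OF p])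
        then have "p = s" using primes_dvd_imp_eq[OF p s(1)] by blast
        then show False using pA coprime_prime_A[OF s(1,2)] by blast
      qed
      ultimately have "p dvd V y" using prime_dvd_mult_iff[OF p] by blast
      then show "y \<in> W" using yK by (simp add: W_def)
    qed
    then have "K \<subseteq> W" unfolding K_def by (rule gen_least[OF sW])
    then have "p dvd V x" if "x \<in> K \<inter> Y" for x using that by (auto simp: W_def)
    then show False using px V(2) cong_dvd_iff by blast
  qed
  obtain z where z: "z \<in> Cz A A" "z \<noteq> 1" "z ^ p0 = 1" using central[OF p0] by blast
  \<comment> \<open>A p0-element of \<open>K\<close> is conjugate under \<open>C\<close> into
    \<open>K \<inter> Y\<close>, hence into \<open>Z\<close>. Elements of \<open>Z\<close> are
    central in \<open>C\<close>, so it was in \<open>Z\<close> already.\<close>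
  have p0K: "x \<in> Z" if x: "x \<in> K" "pel p0 x" for x
  proof -
    have "x \<in> C" using x(1) sK(2) by blast
    then obtain c where c: "c \<in> C" "x \<in> cj c ` prt p0 Y"
      using pel_in_syl_conj[OF p0(1) sC(1) SylC[OF p0] _ x(2)] by blast
    have ic: "inverse c \<in> C" using c(1) sgrpD(4)[OF sC(1)] by blast
    have "cj (inverse c) x \<in> Y" using c(2) by (auto simp: in_cj_image prt_def)
    moreover have "cj (inverse c) x \<in> K" using nK[OF ic] x(1) by blast
    ultimately have xz: "cj (inverse c) x \<in> Z" using KY by blast
    then have "cj c (cj (inverse c) x) = cj (inverse c) x" using Zc[OF _ c(1)] by (simp add: cj_fix_iff)
    then have "x = cj (inverse c) x" by (simp add: cj_cancel)
    then show ?thesis using xz by simp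
  qed
  obtain y where y: "y \<in> C" "y \<noteq> 1" "y ^ r = 1" using cauchy[OF r(1) sC(1) r(2)] .
  have "y \<in> X" using y(1) r(1) rB pel_prime_order[OF y(3)] by (auto simp: X_def)
  then have "y \<in> K" using gen_sup[of X] by (auto simp: K_def)
  then have rK: "r dvd card K" using prime_order_dvd[OF sK(1) _ y(2) r(1) y(3)] by blast
  obtain R where R: "syl r R K" using syl_exists[OF r(1) sK(1)] .
  define Sy where "Sy = (\<lambda>g. cj g ` R) ` K"
  have Sy_iff: "S \<in> Sy \<longleftrightarrow> syl r S K" for S
    using syl_conj[OF r(1) sK(1) R, of S] syl_cj[OF sK(1) R] unfolding Sy_def by blast
  have "card K = card Sy * card {g \<in> K. cj g ` R = R}"
    unfolding Sy_def by (rule orbit_card[OF sK(1)]) (simp_all add: cj_image_cj cj_image_one)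
  then have cSy: "card K = card Sy * card (Nz K R)" by (simp add: Nz_def)
  \<comment> \<open>The Sylow p0-subgroup of \<open>K\<close> is central, so it normalizes
    \<open>R\<close>, and the whole p0-part of \<open>card K\<close> divides the order of that
    normalizer.\<close>
  have nSy: "\<not> p0 dvd card Sy"
  proof
    assume dv: "p0 dvd card Sy"
    obtain T where T: "syl p0 T K" using syl_exists[OF p0(1) sK(1)] .
    have RK: "R \<subseteq> K" using sylD(2)[OF R] .
    have "T \<subseteq> Nz K R"
    proof
      fix x assume x: "x \<in> T"
      then have xK: "x \<in> K" "pel p0 x" using sylD(2)[OF T] pgp_pel[OF sylD(3)[OF T]] by auto
      then have "x * y = y * x" if "y \<in> R" for y using Zc[OF p0K] that RK sK(2) by blast
      then have "x \<in> Cz K R" using xK(1) by (simp add: Cz_def)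
      then show "x \<in> Nz K R" using Cz_sub_Nz by blast
    qed
    then have "card T dvd card (Nz K R)" using sgrp_card_dvd[OF sylD(1)[OF T] sgrp_Nz[OF sK(1)]] by blast
    then have "p0 * card T dvd card Sy * card (Nz K R)" using dv mult_dvd_mono by blast
    then have "p0 ^ Suc (multiplicity p0 (card K)) dvd card K" using cSy sylD(4)[OF T] by simp
    then have "Suc (multiplicity p0 (card K)) \<le> multiplicity p0 (card K)"
      using p0(1) sgrp_card_pos[OF sK(1)] by (intro multiplicity_geI) (auto simp: prime_gt_1_nat)
    then show False by simp
  qed
  have zA: "z \<in> A" and zC: "z \<in> C" using z(1) Cz_sub ZAY[OF z(1)] sY(2) by blast+
  let ?P = "gen {z}"
  have P: "pgp p0 ?P" by (rule pgp_gen[OF p0(1) A(1) zA pel_prime_order[OF z(3)]])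
  have PC: "?P \<subseteq> C" using gen_least[OF sC(1)] zC by simp
  \<comment> \<open>The p0-group generated by z permutes the Sylow r-subgroups of \<open>K\<close>.
    Their number is prime to p0, so one of them is normalized by z.\<close>
  have "[card Sy = card {S \<in> Sy. \<forall>g\<in>?P. cj g ` S = S}] (mod p0)"
  proof (rule pgp_fixed_points[OF p0(1) P])
    show "finite Sy" using sgrpD(1)[OF sK(1)] by (simp add: Sy_def)
    fix g S assume g: "g \<in> ?P" and S: "S \<in> Sy"
    have "cj g ` S \<subseteq> K" using nK g PC S Sy_iff sylD(2) by blast
    then show "cj g ` S \<in> Sy" using S unfolding Sy_iff by (auto simp: syl_def sgrp_cj card_cj)
  qed (simp_all add: cj_image_cj cj_image_one)
  then have "card {S \<in> Sy. \<forall>g\<in>?P. cj g ` S = S} \<noteq> 0" using nSy by (metis cong_0_iff)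
  then have "{S \<in> Sy. \<forall>g\<in>?P. cj g ` S = S} \<noteq> {}" by (metis card.empty)
  then obtain S where S: "S \<in> Sy" "\<forall>g\<in>?P. cj g ` S = S" by blast
  then have SK: "syl r S K" by (simp add: Sy_iff)
  have "z \<in> ?P" using gen_sup[of "{z}"] by blast
  then have zN: "z \<in> Nz G S" using S(2) zA A(2) by (auto simp: Nz_def)
  have SG: "S \<subseteq> G" using sylD(2)[OF SK] sK(2) sC(2) by blast
  have "S = {1}" by (rule no_normalized_subgroup[OF p0(1) z r(1) rB sylD(3)[OF SK] SG zN])
  then have "r ^ multiplicity r (card K) = 1" using sylD(4)[OF SK] by simp
  moreover have "multiplicity r (card K) > 0"
    using rK r(1) sgrp_card_pos[OF sK(1)] by (simp add: prime_multiplicity_gt_zero_iff)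
  ultimately have "r = 1" by simp
  then show False using r(1) by simp
qed

lemma fac2_False: False
proof -
  have "card A = card B" using card_B_ge fac2.card_B_ge[OF fac2_swap] by simp
  then have "card A = 1" using cop by simp
  then show False using sgrp_card_1[OF A(1)] neA by blast
qed

end

section \<open>Traces of powers of a complex matrix\<close>

lemma trace_mult_comm:
  fixes X Y :: "'a::comm_ring_1 mat"
  assumes "X \<in> carrier_mat n n" "Y \<in> carrier_mat n n"
  shows "(\<Sum>i<n. (X * Y) $$ (i, i)) = (\<Sum>i<n. (Y * X) $$ (i, i))"
proof -
  have "(\<Sum>i<n. (X * Y) $$ (i, i)) = (\<Sum>i<n. \<Sum>j<n. X $$ (i, j) * Y $$ (j, i))"
    using assms by (intro sum.cong) (auto simp: scalar_prod_def lessThan_atLeast0)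
  also have "\<dots> = (\<Sum>j<n. \<Sum>i<n. Y $$ (j, i) * X $$ (i, j))"
    by (subst sum.swap) (simp add: mult.commute)
  also have "\<dots> = (\<Sum>i<n. (Y * X) $$ (i, i))"
    using assms by (intro sum.cong) (auto simp: scalar_prod_def lessThan_atLeast0)
  finally show ?thesis .
qed

lemma upper_triangular_pow:
  fixes B :: "'a::comm_ring_1 mat"
  assumes B: "B \<in> carrier_mat n n" "upper_triangular B"
  shows "upper_triangular (B ^\<^sub>m k) \<and> (\<forall>i<n. (B ^\<^sub>m k) $$ (i, i) = (B $$ (i, i)) ^ k)"
proof (induction k)
  case 0 then show ?case using B by auto
next
  case (Suc k)
  have C: "B ^\<^sub>m k \<in> carrier_mat n n" using B(1) by simp
  have e: "(B ^\<^sub>m Suc k) $$ (i, j) = (\<Sum>l<n. (B ^\<^sub>m k) $$ (i, l) * B $$ (l, j))" if "i < n" "j < n" for i j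
    using that B(1) C by (simp add: scalar_prod_def lessThan_atLeast0)
  have z: "(B ^\<^sub>m k) $$ (i, l) * B $$ (l, j) = 0" if "i < n" "l < n" "l < i \<or> j < l" for i l j
    using that Suc upper_triangularD[OF B(2)] upper_triangularD[of "B ^\<^sub>m k"] B(1) C by auto
  have "upper_triangular (B ^\<^sub>m Suc k)"
  proof
    fix i j assume ij: "j < i" "i < dim_row (B ^\<^sub>m Suc k)"
    then have "i < n" "j < n" using B(1) by auto
    then show "(B ^\<^sub>m Suc k) $$ (i, j) = 0" unfolding e[OF \<open>i < n\<close> \<open>j < n\<close>]
      using ij(1) by (intro sum.neutral) (auto intro!: z)
  qed
  moreover have "(B ^\<^sub>m Suc k) $$ (i, i) = (B $$ (i, i)) ^ Suc k" if i: "i < n" for i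
  proof -
    have "(B ^\<^sub>m Suc k) $$ (i, i) = (\<Sum>l\<in>{i}. (B ^\<^sub>m k) $$ (i, l) * B $$ (l, i))"
      unfolding e[OF i i] using i by (intro sum.mono_neutral_right) (auto intro!: z)
    then show ?thesis using Suc i by (simp add: mult.commute)
  qed
  ultimately show ?case by blast
qed

text \<open>In Schur triangular form the k-th power has the k-th powers of the eigenvalues on its
  diagonal, in the multiplicities of the characteristic polynomial.\<close>

lemma trace_pow:
  fixes A :: "complex mat"
  assumes A: "A \<in> carrier_mat n n" and es: "char_poly A = (\<Prod>e\<leftarrow>es. [:- e, 1:])"
  shows "(\<Sum>i<n. (A ^\<^sub>m k) $$ (i, i)) = (\<Sum>e\<leftarrow>es. e ^ k)"
proof -
  obtain B P Q where d: "schur_decomposition A es = (B, P, Q)" by (cases "schur_decomposition A es") auto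
  from schur_decomposition[OF A es d]
  have w: "similar_mat_wit A B P Q" and ut: "upper_triangular B" and dg: "diag_mat B = es" by auto
  from similar_mat_witD2[OF A w] have c: "B \<in> carrier_mat n n" "P \<in> carrier_mat n n" "Q \<in> carrier_mat n n"
    and QP: "Q * P = 1\<^sub>m n" by auto
  have Bk: "B ^\<^sub>m k \<in> carrier_mat n n" using c(1) by simp
  have BQ: "B ^\<^sub>m k * Q \<in> carrier_mat n n" using Bk c(3) by simp
  have e1: "A ^\<^sub>m k = P * (B ^\<^sub>m k * Q)"
    using similar_mat_wit_pow_id[OF w, of k] assoc_mult_mat[OF c(2) Bk c(3)] by simp
  have e2: "(B ^\<^sub>m k * Q) * P = B ^\<^sub>m k"
    using assoc_mult_mat[OF Bk c(3,2)] right_mult_one_mat[OF Bk] QP by simp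
  have "(\<Sum>i<n. (A ^\<^sub>m k) $$ (i, i)) = (\<Sum>i<n. (B ^\<^sub>m k) $$ (i, i))"
    using trace_mult_comm[OF c(2) BQ] unfolding e1 e2 .
  also have "(\<Sum>i<n. (B ^\<^sub>m k) $$ (i, i)) = (\<Sum>i<n. (B $$ (i, i)) ^ k)"
    using upper_triangular_pow[OF c(1) ut] by simp
  also have "\<dots> = (\<Sum>e\<leftarrow>es. e ^ k)"
    unfolding dg[symmetric] diag_mat_def using c(1)
    by (simp add: comp_def lessThan_atLeast0 interv_sum_list_conv_sum_set_nat)
  finally show ?thesis .
qed

text \<open>Matrices are functions on an arbitrary index set, so that group elements index rows and
  columns without a numbering.\<close>

definition fmul :: "'i set \<Rightarrow> ('i \<Rightarrow> 'i \<Rightarrow> complex) \<Rightarrow> ('i \<Rightarrow> 'i \<Rightarrow> complex) \<Rightarrow> 'i \<Rightarrow> 'i \<Rightarrow> complex" where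
  "fmul I F H = (\<lambda>x y. \<Sum>w\<in>I. F x w * H w y)"

primrec fpow :: "'i set \<Rightarrow> ('i \<Rightarrow> 'i \<Rightarrow> complex) \<Rightarrow> nat \<Rightarrow> 'i \<Rightarrow> 'i \<Rightarrow> complex" where
  "fpow I F 0 = (\<lambda>x y. if x = y then 1 else 0)"
| "fpow I F (Suc k) = fmul I (fpow I F k) F"

lemma fpow_Suc2: "finite I \<Longrightarrow> x \<in> I \<Longrightarrow> y \<in> I \<Longrightarrow> fpow I F (Suc k) x y = (\<Sum>w\<in>I. F x w * fpow I F k w y)"
proof (induction k arbitrary: x y)
  case 0
  then show ?case by (simp add: fmul_def if_distrib if_distribR sum.delta cong: if_cong)
next
  case (Suc k)
  have "fpow I F (Suc (Suc k)) x y = (\<Sum>w\<in>I. (\<Sum>v\<in>I. F x v * fpow I F k v w) * F w y)"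
    using Suc by (subst fpow.simps(2), subst fmul_def) (intro sum.cong; simp)
  also have "\<dots> = (\<Sum>v\<in>I. \<Sum>w\<in>I. F x v * fpow I F k v w * F w y)"
    by (subst sum.swap) (simp add: sum_distrib_right)
  also have "\<dots> = (\<Sum>v\<in>I. F x v * fpow I F (Suc k) v y)"
    by (simp add: fmul_def sum_distrib_left mult.assoc)
  finally show ?case .
qed

text \<open>The list carries algebraic multiplicities, fixed through the power traces, and its
  members are exactly the eigenvalues. In this form later arguments can use it without the
  characteristic polynomial.\<close>

definition eigs :: "'i set \<Rightarrow> ('i \<Rightarrow> 'i \<Rightarrow> complex) \<Rightarrow> complex list \<Rightarrow> bool" where
  "eigs I F es \<longleftrightarrow> (\<forall>k. (\<Sum>x\<in>I. fpow I F k x x) = (\<Sum>e\<leftarrow>es. e ^ k)) \<and>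
     (\<forall>e. e \<in> set es \<longleftrightarrow> (\<exists>v. (\<exists>x\<in>I. v x \<noteq> 0) \<and> (\<forall>x\<in>I. (\<Sum>w\<in>I. F x w * v w) = e * v x)))"

lemma eigs_exists:
  assumes "finite I"
  obtains es where "eigs I F es"
    "(\<forall>x\<in>I. \<forall>y\<in>I. F x y \<in> \<int>) \<longrightarrow> (\<exists>c::int poly. map_poly of_int c = (\<Prod>e\<leftarrow>es. [:- e, 1:]))"
proof -
  obtain h and n :: nat where h: "bij_betw h {..<n} I"
    using ex_bij_betw_nat_finite[OF assms] by (auto simp: atLeast0LessThan)
  define A where "A = mat n n (\<lambda>(i, j). F (h i) (h j))"
  have A: "A \<in> carrier_mat n n" by (simp add: A_def)
  obtain es where es: "char_poly A = (\<Prod>e\<leftarrow>es. [:- e, 1:])" using char_poly_factorized[OF A] by auto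
  have hI: "h i \<in> I" if "i < n" for i using h that by (auto dest: bij_betwE)
  have sumh: "(\<Sum>i<n. f (h i)) = (\<Sum>x\<in>I. f x)" for f :: "'a \<Rightarrow> complex"
    by (rule sum.reindex_bij_betw[OF h])
  have hinj: "h i = h j \<longleftrightarrow> i = j" if "i < n" "j < n" for i j
    using h that by (auto simp: bij_betw_def inj_on_def)
  have P: "(A ^\<^sub>m k) $$ (i, j) = fpow I F k (h i) (h j)" if "i < n" "j < n" for i j k
    using that
  proof (induction k arbitrary: i j)
    case 0 then show ?case using A hinj by auto
  next
    case (Suc k)
    have Ak: "A ^\<^sub>m k \<in> carrier_mat n n" using A by simp
    have "(A ^\<^sub>m Suc k) $$ (i, j) = (\<Sum>l<n. (A ^\<^sub>m k) $$ (i, l) * A $$ (l, j))"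
      using Suc.prems A Ak by (simp add: scalar_prod_def lessThan_atLeast0)
    also have "\<dots> = (\<Sum>l<n. fpow I F k (h i) (h l) * F (h l) (h j))"
      using Suc by (intro sum.cong) (auto simp: A_def)
    also have "\<dots> = fpow I F (Suc k) (h i) (h j)"
      using sumh[of "\<lambda>w. fpow I F k (h i) w * F w (h j)"] by (simp add: fmul_def)
    finally show ?case .
  qed
  have tr: "(\<Sum>x\<in>I. fpow I F k x x) = (\<Sum>e\<leftarrow>es. e ^ k)" for k
    using trace_pow[OF A es, of k] P by (simp add: sumh[of "\<lambda>x. fpow I F k x x"])
  have ev: "\<exists>v. (\<exists>x\<in>I. v x \<noteq> 0) \<and> (\<forall>x\<in>I. (\<Sum>w\<in>I. F x w * v w) = e * v x)" if e: "e \<in> set es" for e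
  proof -
    have "poly (char_poly A) e = 0" unfolding es using e by (induction es) auto
    then obtain u where u: "eigenvector A u e" using eigenvalue_root_char_poly[OF A] by (auto simp: eigenvalue_def)
    have u': "u \<in> carrier_vec n" "u \<noteq> 0\<^sub>v n" "A *\<^sub>v u = e \<cdot>\<^sub>v u" using u A by (auto simp: eigenvector_def)
    define g where "g = inv_into {..<n} h"
    have gh: "g (h i) = i" if "i < n" for i unfolding g_def using h that by (simp add: bij_betw_inv_into_left)
    have "\<exists>i<n. u $ i \<noteq> 0"
    proof (rule ccontr)
      assume "\<not> (\<exists>i<n. u $ i \<noteq> 0)"
      then have "u = 0\<^sub>v n" using u'(1) by (intro eq_vecI) auto
      then show False using u'(2) by blast
    qed
    then obtain i where "i < n" "u $ i \<noteq> 0" by blast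
    then have nz: "\<exists>x\<in>I. u $ g x \<noteq> 0" using hI gh by (intro bexI[of _ "h i"]) auto
    have "(\<Sum>w\<in>I. F x w * u $ g w) = e * u $ g x" if x: "x \<in> I" for x
    proof -
      obtain j where j: "j < n" "x = h j" using h x by (auto simp: bij_betw_def)
      have "(\<Sum>w\<in>I. F x w * u $ g w) = (\<Sum>l<n. F x (h l) * u $ g (h l))"
        using sumh[of "\<lambda>w. F x w * u $ g w"] by simp
      also have "\<dots> = (\<Sum>l<n. A $$ (j, l) * u $ l)" using j by (intro sum.cong) (auto simp: A_def gh)
      also have "\<dots> = (A *\<^sub>v u) $ j" using A j(1) u'(1) by (simp add: scalar_prod_def lessThan_atLeast0)
      also have "\<dots> = e * u $ g x" using u'(1,3) j by (simp add: gh)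
      finally show ?thesis .
    qed
    then show ?thesis using nz by (intro exI[of _ "\<lambda>x. u $ g x"] conjI ballI)
  qed
  have ve: "e \<in> set es" if v: "x0 \<in> I" "v x0 \<noteq> 0" "\<forall>x\<in>I. (\<Sum>w\<in>I. F x w * v w) = e * v x" for e v x0
  proof -
    define u where "u = vec n (\<lambda>i. v (h i))"
    have "A *\<^sub>v u = e \<cdot>\<^sub>v u"
    proof (rule eq_vecI)
      fix i assume "i < dim_vec (e \<cdot>\<^sub>v u)"
      then have i: "i < n" by (simp add: u_def)
      have "(A *\<^sub>v u) $ i = (\<Sum>l<n. F (h i) (h l) * v (h l))"
        using i by (simp add: A_def u_def scalar_prod_def lessThan_atLeast0)
      also have "\<dots> = e * v (h i)" using sumh[of "\<lambda>w. F (h i) w * v w"] v(3) hI[OF i] by simp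
      finally show "(A *\<^sub>v u) $ i = (e \<cdot>\<^sub>v u) $ i" using i by (simp add: u_def)
    qed (use A in \<open>simp add: u_def\<close>)
    moreover have "u \<noteq> 0\<^sub>v n"
    proof
      assume u0: "u = 0\<^sub>v n"
      obtain i where "i < n" "h i = x0" using h v(1) by (auto simp: bij_betw_def)
      then have "v x0 = u $ i" by (simp add: u_def)
      then show False using u0 \<open>i < n\<close> v(2) by simp
    qed
    ultimately have "eigenvector A u e" using A by (auto simp: eigenvector_def u_def)
    then have "poly (char_poly A) e = 0" using eigenvalue_root_char_poly[OF A] by (auto simp: eigenvalue_def)
    then show ?thesis unfolding es by (induction es) auto
  qed
  have int: "\<exists>c::int poly. map_poly of_int c = (\<Prod>e\<leftarrow>es. [:- e, 1:])" if Z: "\<forall>x\<in>I. \<forall>y\<in>I. F x y \<in> \<int>"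
  proof -
    define M where "M = mat n n (\<lambda>(i, j). \<lfloor>Re (F (h i) (h j))\<rfloor>)"
    have M: "M \<in> carrier_mat n n" by (simp add: M_def)
    have "map_mat of_int M = A"
    proof (rule eq_matI)
      fix i j assume "i < dim_row A" "j < dim_col A"
      then have ij: "i < n" "j < n" using A by auto
      have "F (h i) (h j) \<in> \<int>" using Z hI ij by blast
      then obtain z where "F (h i) (h j) = of_int z" by (elim Ints_cases)
      then show "map_mat of_int M $$ (i, j) = A $$ (i, j)" using ij by (simp add: M_def A_def)
    qed (simp_all add: A_def M_def)
    then have "map_poly of_int (char_poly M) = char_poly A" using of_int_hom.char_poly_hom[OF M] by metis
    then show ?thesis using es by auto
  qed
  have "eigs I F es" unfolding eigs_def using tr ev ve by blast
  then show ?thesis by (rule that) (use int in blast)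
qed

section \<open>Algebraic integers\<close>

text \<open>The module criterion for integrality: x is an eigenvalue of an integer matrix, hence a
  root of its monic characteristic polynomial.\<close>

lemma algebraic_int_module:
  fixes x :: complex and b :: "'i \<Rightarrow> complex"
  assumes I: "finite I" "i0 \<in> I" "b i0 \<noteq> 0"
    and m: "\<And>i. i \<in> I \<Longrightarrow> x * b i = (\<Sum>j\<in>I. of_int (m i j) * b j)"
  shows "algebraic_int x"
proof -
  obtain h and n :: nat where h: "bij_betw h {..<n} I"
    using ex_bij_betw_nat_finite[OF I(1)] by (auto simp: atLeast0LessThan)
  define M where "M = mat n n (\<lambda>(i, j). m (h i) (h j))"
  define A where "A = map_mat (of_int :: int \<Rightarrow> complex) M"
  have M: "M \<in> carrier_mat n n" and A: "A \<in> carrier_mat n n" by (simp_all add: M_def A_def)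
  define v where "v = vec n (\<lambda>i. b (h i))"
  have hI: "h i \<in> I" if "i < n" for i using h that by (auto dest: bij_betwE)
  have "A *\<^sub>v v = x \<cdot>\<^sub>v v"
  proof (rule eq_vecI)
    fix i assume "i < dim_vec (x \<cdot>\<^sub>v v)"
    then have i: "i < n" by (simp add: v_def)
    have "(A *\<^sub>v v) $ i = (\<Sum>j<n. of_int (m (h i) (h j)) * b (h j))"
      using i by (simp add: A_def M_def v_def scalar_prod_def lessThan_atLeast0)
    also have "\<dots> = x * b (h i)" unfolding m[OF hI[OF i]]
      by (rule sum.reindex_bij_betw[OF h, of "\<lambda>j. of_int (m (h i) j) * b j"])
    finally show "(A *\<^sub>v v) $ i = (x \<cdot>\<^sub>v v) $ i" using i by (simp add: v_def)
  qed (use A in \<open>simp add: v_def A_def M_def\<close>)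
  moreover have "v \<noteq> 0\<^sub>v n"
  proof
    assume v0: "v = 0\<^sub>v n"
    obtain i where "i < n" "h i = i0" using h I(2) by (auto simp: bij_betw_def)
    then have "b i0 = v $ i" by (simp add: v_def)
    then show False using v0 \<open>i < n\<close> I(3) by simp
  qed
  ultimately have "eigenvector A v x" using A by (auto simp: eigenvector_def v_def)
  then have "poly (char_poly A) x = 0" using eigenvalue_root_char_poly[OF A] by (auto simp: eigenvalue_def)
  then have "poly (map_poly of_int (char_poly M)) x = 0"
    unfolding A_def of_int_hom.char_poly_hom[OF M] .
  moreover have "lead_coeff (char_poly M) = 1" using degree_monic_char_poly[OF M] by simp
  ultimately show ?thesis unfolding algebraic_int_altdef_ipoly by blast
qed

lemma algebraic_int_gen:
  fixes x :: complex
  assumes "algebraic_int x"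
  obtains n and m :: "nat \<Rightarrow> nat \<Rightarrow> int" where "n > 0"
    "\<forall>i<n. x * x ^ i = (\<Sum>j<n. of_int (m i j) * x ^ j)"
proof -
  obtain p where p: "poly (map_poly of_int p) x = 0" "lead_coeff p = 1"
    using assms unfolding algebraic_int_altdef_ipoly by blast
  let ?n = "degree p"
  have n: "?n > 0"
  proof (rule ccontr)
    assume "\<not> 0 < ?n"
    then obtain a where a: "p = [:a:]" by (metis degree_eq_zeroE gr0I)
    then have "p = 1" using p(2) by simp
    then show False using p(1) by simp
  qed
  have "0 = (\<Sum>i\<le>?n. of_int (coeff p i) * x ^ i)"
    using p(1) by (simp add: poly_altdef coeff_map_poly)
  also have "\<dots> = (\<Sum>i<?n. of_int (coeff p i) * x ^ i) + x ^ ?n"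
    using p(2) by (simp add: lessThan_Suc_atMost[symmetric])
  finally have top: "x ^ ?n = (\<Sum>i<?n. of_int (- coeff p i) * x ^ i)"
    by (simp add: sum_negf eq_neg_iff_add_eq_0 add.commute)
  \<comment> \<open>The companion matrix of \<open>p\<close>, describing multiplication by x on the
    powers of x below the degree.\<close>
  define m where "m i j = (if Suc i < ?n then (if j = Suc i then 1 else 0) else - coeff p j)" for i j
  have "x * x ^ i = (\<Sum>j<?n. of_int (m i j) * x ^ j)" if i: "i < ?n" for i
  proof (cases "Suc i < ?n")
    case True
    have "(\<Sum>j<?n. of_int (m i j) * x ^ j) = (\<Sum>j<?n. if j = Suc i then x ^ j else 0)"
      using True by (intro sum.cong) (auto simp: m_def)
    also have "\<dots> = x ^ Suc i" using True by (simp add: sum.delta)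
    finally show ?thesis by simp
  next
    case False
    then have "Suc i = ?n" using i by simp
    then show ?thesis using top False by (simp add: m_def flip: power_Suc)
  qed
  then show ?thesis using that n by blast
qed

lemma algebraic_int_add_mult:
  fixes x y :: complex
  assumes "algebraic_int x" "algebraic_int y"
  shows "algebraic_int (x + y)" "algebraic_int (x * y)"
proof -
  obtain n and m :: "nat \<Rightarrow> nat \<Rightarrow> int" where n: "n > 0"
    and m: "\<forall>i<n. x * x ^ i = (\<Sum>j<n. of_int (m i j) * x ^ j)" using algebraic_int_gen[OF assms(1)] .
  obtain k and l :: "nat \<Rightarrow> nat \<Rightarrow> int" where k: "k > 0"
    and l: "\<forall>i<k. y * y ^ i = (\<Sum>j<k. of_int (l i j) * y ^ j)" using algebraic_int_gen[OF assms(2)] .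
  let ?I = "{..<n} \<times> {..<k}" and ?b = "\<lambda>(i, j). x ^ i * y ^ j"
  have I: "finite ?I" "(0, 0) \<in> ?I" "?b (0, 0) \<noteq> 0" using n k by auto
  show "algebraic_int (x * y)"
  proof (rule algebraic_int_module[of ?I "(0, 0)" ?b _ "\<lambda>(i, j) (i', j'). m i i' * l j j'", OF I])
    fix a assume "a \<in> ?I"
    then obtain i j where a: "a = (i, j)" "i < n" "j < k" by auto
    have "x * y * ?b a = (x * x ^ i) * (y * y ^ j)" by (simp add: a(1))
    also have "\<dots> = (\<Sum>i'<n. \<Sum>j'<k. of_int (m i i') * x ^ i' * (of_int (l j j') * y ^ j'))"
      using m l a(2,3) by (simp add: sum_product)
    also have "\<dots> = (\<Sum>c\<in>?I. of_int ((\<lambda>(i, j) (i', j'). m i i' * l j j') a c) * ?b c)"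
      unfolding sum.cartesian_product a(1) by (intro sum.cong) (auto simp: ac_simps)
    finally show "x * y * ?b a = (\<Sum>c\<in>?I. of_int ((\<lambda>(i, j) (i', j'). m i i' * l j j') a c) * ?b c)" .
  qed
  \<comment> \<open>The Kronecker sum of the two matrices. For the product above it was the
    Kronecker product.\<close>
  let ?m = "\<lambda>(i, j) (i', j'). (if j' = j then m i i' else 0) + (if i' = i then l j j' else 0)"
  show "algebraic_int (x + y)"
  proof (rule algebraic_int_module[of ?I "(0, 0)" ?b _ ?m, OF I])
    fix a assume "a \<in> ?I"
    then obtain i j where a: "a = (i, j)" "i < n" "j < k" by auto
    have "(\<Sum>c\<in>?I. of_int (?m a c) * ?b c) = (\<Sum>i'<n. \<Sum>j'<k. of_int (?m a (i', j')) * (x ^ i' * y ^ j'))"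
      unfolding sum.cartesian_product by (intro sum.cong) auto
    also have "\<dots> = (\<Sum>i'<n. \<Sum>j'<k. if j' = j then of_int (m i i') * x ^ i' * y ^ j' else 0) +
        (\<Sum>i'<n. \<Sum>j'<k. if i' = i then of_int (l j j') * x ^ i' * y ^ j' else 0)"
      unfolding sum.distrib[symmetric] a(1) by (intro sum.cong) (auto simp: algebra_simps)
    also have "(\<Sum>i'<n. \<Sum>j'<k. if j' = j then of_int (m i i') * x ^ i' * y ^ j' else 0) =
        (\<Sum>i'<n. of_int (m i i') * x ^ i') * y ^ j"
      using a(3) by (simp add: sum.delta sum_distrib_right)
    also have "(\<Sum>i'<n. \<Sum>j'<k. if i' = i then of_int (l j j') * x ^ i' * y ^ j' else 0) =
        x ^ i * (\<Sum>j'<k. of_int (l j j') * y ^ j')"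
      using a(2) by (subst sum.swap) (simp add: sum.delta sum_distrib_left ac_simps)
    also have "(\<Sum>i'<n. of_int (m i i') * x ^ i') * y ^ j + x ^ i * (\<Sum>j'<k. of_int (l j j') * y ^ j') = (x + y) * ?b a"
    proof -
      have "(\<Sum>i'<n. of_int (m i i') * x ^ i') = x * x ^ i" "(\<Sum>j'<k. of_int (l j j') * y ^ j') = y * y ^ j"
        using m l a(2,3) by simp_all
      then show ?thesis by (simp add: a(1) algebra_simps)
    qed
    finally show "(x + y) * ?b a = (\<Sum>c\<in>?I. of_int (?m a c) * ?b c)" by simp
  qed
qed

lemma algebraic_int_sum: "(\<And>i. i \<in> S \<Longrightarrow> algebraic_int (f i :: complex)) \<Longrightarrow> algebraic_int (sum f S)"
  by (induction S rule: infinite_finite_induct) (auto intro: algebraic_int_add_mult)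

lemma algebraic_int_prod_list: "(\<And>i. i \<in> set es \<Longrightarrow> algebraic_int (i :: complex)) \<Longrightarrow> algebraic_int (prod_list es)"
  by (induction es) (auto intro: algebraic_int_add_mult)

lemma algebraic_int_power_imp:
  fixes x :: complex
  assumes "algebraic_int (x ^ n)" "n > 0" shows "algebraic_int x"
  by (rule algebraic_int_root[OF assms(1), of "Polynomial.monom 1 n"]) (use assms(2) in \<open>auto simp: poly_monom degree_monom_eq\<close>)

text \<open>Every conjugate of \<open>x\<close> is a root of \<open>c\<close>, so the constant coefficient of the minimal polynomial
  of \<open>x\<close> is a nonzero integer of absolute value less than one.\<close>

lemma algebraic_int_small_conjugates:
  fixes x :: complex and c :: "rat poly"
  assumes x: "algebraic_int x" "x \<noteq> 0" "norm x < 1"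
    and c: "c \<noteq> 0" "poly (map_poly of_rat c) x = 0"
    and roots: "\<And>z. poly (map_poly of_rat c) z = 0 \<Longrightarrow> norm (z :: complex) \<le> 1"
  shows False
proof -
  let ?r = "map_poly of_rat :: rat poly \<Rightarrow> complex poly"
  interpret r: map_poly_comm_ring_hom "of_rat :: rat \<Rightarrow> complex" ..
  \<comment> \<open>The minimal polynomial of x over the rationals, up to a scalar. It divides both
    \<open>c\<close> and the monic integral polynomial of x, so its roots are algebraic integers in
    the closed unit disc.\<close>
  define g where "g = arg_min degree (\<lambda>g::rat poly. g \<noteq> 0 \<and> poly (?r g) x = 0)"
  have g: "g \<noteq> 0" "poly (?r g) x = 0" and
    gmin: "\<And>h. h \<noteq> 0 \<Longrightarrow> poly (?r h) x = 0 \<Longrightarrow> degree g \<le> degree h"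
    using arg_min_nat_lemma[of "\<lambda>g. g \<noteq> 0 \<and> poly (?r g) x = 0" c degree] c unfolding g_def by blast+
  have dvd: "g dvd h" if h: "poly (?r h) x = 0" for h
  proof (rule ccontr)
    assume "\<not> g dvd h"
    then have ne: "h mod g \<noteq> 0" by (simp add: mod_eq_0_iff_dvd)
    have "h = g * (h div g) + h mod g" by simp
    then have "?r h = ?r g * ?r (h div g) + ?r (h mod g)" by (metis r.hom_add r.hom_mult)
    then have "poly (?r (h mod g)) x = 0" using h g(2) by simp
    then have "degree g \<le> degree (h mod g)" using gmin ne by blast
    then show False using degree_mod_less[OF g(1), of h] ne by simp
  qed
  obtain p where p: "poly (map_poly of_int p) x = 0" "lead_coeff p = 1"
    using x(1) unfolding algebraic_int_altdef_ipoly by blast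
  have pr: "?r (map_poly of_int p) = map_poly of_int p" by (simp add: map_poly_map_poly comp_def)
  have gp: "g dvd map_poly of_int p" by (rule dvd) (simp add: pr p(1))
  have gc: "g dvd c" by (rule dvd[OF c(2)])
  have rootp: "poly (map_poly of_int p) z = 0" if z: "poly (?r g) z = 0" for z
  proof -
    obtain k where "map_poly of_int p = g * k" using gp by (elim dvdE)
    then have "?r (map_poly of_int p) = ?r g * ?r k" by (metis r.hom_mult)
    then have "poly (?r (map_poly of_int p)) z = 0" using z by simp
    then show ?thesis unfolding pr .
  qed
  have rootc: "poly (?r c) z = 0" if z: "poly (?r g) z = 0" for z
  proof -
    obtain k where "c = g * k" using gc by (elim dvdE)
    then have "?r c = ?r g * ?r k" by (metis r.hom_mult)
    then show ?thesis using z by simp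
  qed
  have g0: "coeff g 0 \<noteq> 0"
  proof
    assume "coeff g 0 = 0"
    then have "[:0, 1:] dvd g" using poly_0_coeff_0[of g] by (simp add: dvd_iff_poly_eq_0)
    then obtain k where k: "g = [:0, 1:] * k" by (elim dvdE)
    then have k0: "k \<noteq> 0" using g(1) by auto
    have "?r g = ?r [:0, 1:] * ?r k" unfolding k by (rule r.hom_mult)
    then have "poly (?r k) x = 0" using g(2) x(2) by simp
    then have "degree g \<le> degree k" using gmin k0 by blast
    moreover have "degree g = Suc (degree k)" unfolding k using k0 by (subst degree_mult_eq) auto
    ultimately show False by simp
  qed
  obtain bs where bs: "Polynomial.smult (coeff (?r g) (degree (?r g))) (\<Prod>b\<leftarrow>bs. [:- b, 1:]) = ?r g"
    using fundamental_theorem_algebra_factorized[of "?r g"] by blast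
  let ?l = "coeff (?r g) (degree (?r g))"
  have l0: "?l \<noteq> 0" using g(1) by simp
  have broot: "poly (?r g) z = 0 \<longleftrightarrow> z \<in> set bs" for z
  proof -
    have "poly (\<Prod>b\<leftarrow>bs. [:- b, 1:]) z = 0 \<longleftrightarrow> z \<in> set bs" by (induction bs) auto
    then show ?thesis using l0 by (subst bs[symmetric]) simp
  qed
  have "poly (?r g) 0 = ?l * poly (\<Prod>b\<leftarrow>bs. [:- b, 1:]) 0" by (subst bs[symmetric]) simp
  also have "poly (\<Prod>b\<leftarrow>bs. [:- b, 1:]) 0 = (-1) ^ length bs * prod_list bs" by (induction bs) auto
  finally have e: "of_rat (coeff g 0) = ?l * ((-1) ^ length bs * prod_list bs)"
    by (simp add: poly_0_coeff_0 coeff_map_poly)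
  have "?l = of_rat (coeff g (degree g))" by (simp add: coeff_map_poly)
  then have "prod_list bs = of_rat (coeff g 0 / coeff g (degree g) * (-1) ^ length bs)"
    using e l0 by (simp add: of_rat_mult of_rat_divide of_rat_power of_rat_minus field_simps flip: power_mult_distrib)
  then have "prod_list bs \<in> \<rat>" by simp
  moreover have "algebraic_int (prod_list bs)"
  proof (rule algebraic_int_prod_list)
    fix b assume "b \<in> set bs"
    then have "poly (map_poly of_int p) b = 0" using rootp broot by blast
    then show "algebraic_int b" unfolding algebraic_int_altdef_ipoly using p(2) by blast
  qed
  ultimately have int: "prod_list bs \<in> \<int>" by (rule rational_algebraic_int_is_int[rotated])
  have ne: "prod_list bs \<noteq> 0"
  proof
    assume "prod_list bs = 0"
    then have "(of_rat (coeff g 0) :: complex) = 0" unfolding e by (simp del: of_rat_eq_0_iff)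
    then show False using g0 by simp
  qed
  have "norm (prod_list bs) \<ge> 1"
  proof -
    obtain k where k: "prod_list bs = of_int k" using int by (elim Ints_cases)
    then have "k \<noteq> 0" using ne by auto
    then show ?thesis unfolding k by (simp del: of_int_abs add: of_int_abs[symmetric])
  qed
  moreover have "norm (prod_list bs) < 1"
  proof -
    have b1: "norm b \<le> 1" if "b \<in> set bs" for b using roots rootc broot that by blast
    have xb: "x \<in> set bs" using broot g(2) by blast
    have le: "norm (prod_list cs) \<le> 1" if "\<forall>b\<in>set cs. norm b \<le> 1" for cs :: "complex list"
      using that by (induction cs) (auto simp: norm_mult mult_le_one)
    obtain us vs where "bs = us @ x # vs" using xb by (metis split_list)
    then have "norm (prod_list bs) = norm (prod_list us) * norm (prod_list vs) * norm x"
      by (simp add: norm_mult)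
    also have "norm (prod_list us) * norm (prod_list vs) \<le> 1"
      using b1 \<open>bs = us @ x # vs\<close> by (intro mult_le_one le) auto
    then have "norm (prod_list us) * norm (prod_list vs) * norm x \<le> 1 * norm x" by (intro mult_right_mono) auto
    finally show ?thesis using x(3) by simp
  qed
  ultimately show False by simp
qed

text \<open>A linear combination of the hypotheses tests the weights against the polynomial that
  vanishes at all other points of \<open>S\<close>, which isolates \<open>a m\<close>.\<close>

lemma power_sums_independent:
  fixes a :: "complex \<Rightarrow> complex"
  assumes S: "finite S" and z: "\<And>k. (\<Sum>e\<in>S. a e * e ^ k) = 0" and m: "m \<in> S"
  shows "a m = 0"
proof -
  define q where "q = (\<Prod>e\<in>S - {m}. [:- e, 1:])"
  have "0 = (\<Sum>i\<le>degree q. coeff q i * (\<Sum>e\<in>S. a e * e ^ i))" using z by simp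
  also have "\<dots> = (\<Sum>e\<in>S. a e * poly q e)"
    unfolding poly_altdef sum_distrib_left by (subst sum.swap) (simp add: ac_simps)
  also have "\<dots> = (\<Sum>e\<in>{m}. a e * poly q e)"
    using S m by (intro sum.mono_neutral_right) (auto simp: q_def poly_prod)
  finally have "a m * poly q m = 0" by simp
  moreover have "poly q m \<noteq> 0" using S by (auto simp: q_def poly_prod)
  ultimately show ?thesis by simp
qed

lemma sum_list_group:
  fixes f :: "complex \<Rightarrow> complex"
  assumes "finite S" "set es \<subseteq> S"
  shows "(\<Sum>e\<leftarrow>es. f e) = (\<Sum>e\<in>S. of_nat (count_list es e) * f e)"
  using assms(2)
proof (induction es)
  case (Cons a es)
  have "(\<Sum>e\<in>S. of_nat (count_list (a # es) e) * f e) =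
      (\<Sum>e\<in>S. of_nat (count_list es e) * f e + (if e = a then f e else 0))"
    by (intro sum.cong) (auto simp: algebra_simps)
  also have "\<dots> = (\<Sum>e\<leftarrow>es. f e) + f a" using Cons assms(1) by (simp add: sum.distrib sum.delta)
  finally show ?case by simp
qed simp

lemma primitive_root_of_unity:
  assumes "m > 0" obtains w :: complex where "w ^ m = 1" "\<forall>i. 0 < i \<longrightarrow> i < m \<longrightarrow> w ^ i \<noteq> 1"
proof -
  define w where "w = cis (2 * pi / m)"
  have p: "w ^ i = cis (2 * pi * i / m)" for i
    unfolding w_def DeMoivre by (simp add: field_simps)
  have "w ^ i \<noteq> 1" if i: "0 < i" "i < m" for i
  proof
    assume "w ^ i = 1"
    then have "w ^ i = w ^ 0" by simp
    then have "i = 0" using bij_betw_roots_unity[OF assms] i assms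
      unfolding bij_betw_def inj_on_def p by auto
    then show False using i by simp
  qed
  moreover have "w ^ m = 1" unfolding p using assms by simp
  ultimately show ?thesis using that by blast
qed

lemma power_commutes_pow: "((x::complex) ^ i) ^ m = (x ^ m) ^ i"
  by (simp add: power_mult[symmetric] mult.commute)

lemma root_of_unity_sum:
  fixes q :: complex assumes "q ^ m = 1" "q \<noteq> 1" shows "(\<Sum>a<m. q ^ a) = 0"
  using assms by (simp add: geometric_sum)

lemma sum_mod_shift:
  fixes f :: "nat \<Rightarrow> complex"
  assumes f: "\<And>i. f (i + m) = f i"
  shows "(\<Sum>i<m. f (i + s)) = (\<Sum>i<m. f i)"
proof (induction s)
  case (Suc s)
  have "(\<Sum>i<Suc m. f (i + s)) = f s + (\<Sum>i<m. f (i + Suc s))" by (subst sum.lessThan_Suc_shift) simp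
  moreover have "(\<Sum>i<Suc m. f (i + s)) = (\<Sum>i<m. f (i + s)) + f s" using f[of s] by (simp add: add.commute)
  ultimately show ?case using Suc by (simp del: sum.lessThan_Suc)
qed simp

lemma fpow_invariant:
  assumes I: "finite I" and th: "bij_betw \<theta> I I" and F: "\<And>x y. x \<in> I \<Longrightarrow> y \<in> I \<Longrightarrow> F (\<theta> x) (\<theta> y) = F x y"
  shows "x \<in> I \<Longrightarrow> y \<in> I \<Longrightarrow> fpow I F k (\<theta> x) (\<theta> y) = fpow I F k x y"
proof (induction k arbitrary: x y)
  case 0 then show ?case using th by (auto simp: bij_betw_def inj_on_def)
next
  case (Suc k)
  have "fpow I F (Suc k) (\<theta> x) (\<theta> y) = (\<Sum>w\<in>I. fpow I F k (\<theta> x) (\<theta> w) * F (\<theta> w) (\<theta> y))"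
    unfolding fpow.simps fmul_def by (rule sum.reindex_bij_betw[OF th, symmetric])
  then show ?case using Suc F by (simp add: fmul_def)
qed

text \<open>The symmetry \<open>\<theta>\<close> commutes with \<open>F\<close>. Its \<open>m\<close> spectral projections split \<open>F\<close> into the
  matrices \<open>H a\<close>, and \<open>\<beta> e\<close> times the multiplicity of \<open>e\<close> is the sum of the \<open>w ^ a\<close> weighted with
  the multiplicities of \<open>e\<close> in \<open>H a\<close>.\<close>

lemma eigs_twisted_trace:
  fixes F :: "'i \<Rightarrow> 'i \<Rightarrow> complex"
  assumes I: "finite I" and th: "bij_betw \<theta> I I" "\<And>x. x \<in> I \<Longrightarrow> (\<theta> ^^ m) x = x" and m: "m > 1"
    and F: "\<And>x y. x \<in> I \<Longrightarrow> y \<in> I \<Longrightarrow> F (\<theta> x) (\<theta> y) = F x y"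
    and es: "eigs I F es"
    and tr: "\<And>j. (\<Sum>x\<in>I. fpow I F (Suc j) (\<theta> x) x) = (\<Sum>e\<leftarrow>es. \<beta> e * e ^ Suc j)"
    and e: "e \<in> set es" "e \<noteq> 0"
  shows "algebraic_int (of_nat (count_list es e) * \<beta> e)"
proof -
  obtain w :: complex where w: "w ^ m = 1" "\<forall>i. 0 < i \<longrightarrow> i < m \<longrightarrow> w ^ i \<noteq> 1"
    using primitive_root_of_unity[of m] m by auto
  have w0: "w \<noteq> 0" using w(1) m by (intro notI) (simp add: power_0_left)
  define u where "u = inverse w"
  have wu: "w ^ i * u ^ i = 1" for i using w0 by (simp add: u_def flip: power_mult_distrib)
  have um: "u ^ m = 1" using w(1) by (simp add: u_def power_inverse)
  \<comment> \<open>The average over the powers of \<theta>, weighted by a character of the cyclic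
    group of order m: \<open>F\<close> composed with one spectral projection of \<theta>.\<close>
  define H where "H a x y = (\<Sum>i<m. u ^ (a * i) * F ((\<theta> ^^ i) x) y) / of_nat m" for a x y
  have thI: "(\<theta> ^^ i) x \<in> I" if "x \<in> I" for i x
    using that th(1) by (induction i) (auto simp: bij_betw_def)
  have thb: "bij_betw (\<theta> ^^ i) I I" for i by (rule bij_betw_funpow[OF th(1)])
  have Fi: "F ((\<theta> ^^ i) x) ((\<theta> ^^ i) y) = F x y" if "x \<in> I" "y \<in> I" for i x y
    using that by (induction i) (simp_all add: F thI)
  have P: "fpow I (H a) (Suc j) x y = (\<Sum>i<m. u ^ (a * i) * fpow I F (Suc j) ((\<theta> ^^ i) x) y) / of_nat m"
    if "x \<in> I" "y \<in> I" for a j x y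
    using that
  proof (induction j arbitrary: x y)
    case 0
    have one: "fpow I K (Suc 0) x y = K x y" if "x \<in> I" for K x y
      using that I by (simp add: fmul_def if_distribR if_distrib sum.delta cong: if_cong)
    show ?case using 0 by (simp only: one thI) (simp add: H_def)
  next
    case (Suc j)
    have in1: "(\<Sum>v\<in>I. fpow I F (Suc j) ((\<theta> ^^ i) x) v * F ((\<theta> ^^ l) v) y) = fpow I F (Suc (Suc j)) ((\<theta> ^^ (i + l)) x) y" for i l
    proof -
      have "(\<Sum>v\<in>I. fpow I F (Suc j) ((\<theta> ^^ i) x) v * F ((\<theta> ^^ l) v) y) =
          (\<Sum>v\<in>I. fpow I F (Suc j) ((\<theta> ^^ l) ((\<theta> ^^ i) x)) ((\<theta> ^^ l) v) * F ((\<theta> ^^ l) v) y)"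
        using fpow_invariant[OF I thb[of l], of F] Fi[of _ _ l] thI[OF Suc.prems(1)]
        by (intro sum.cong refl arg_cong2[of _ _ _ _ "(*)"]) (simp del: fpow.simps)
      also have "\<dots> = (\<Sum>v\<in>I. fpow I F (Suc j) ((\<theta> ^^ l) ((\<theta> ^^ i) x)) v * F v y)"
        by (rule sum.reindex_bij_betw[OF thb])
      finally show ?thesis by (subst fpow.simps(2), subst fmul_def) (simp add: funpow_add add.commute[of i l] del: fpow.simps)
    qed
    have "fpow I (H a) (Suc (Suc j)) x y = (\<Sum>v\<in>I. ((\<Sum>i<m. u ^ (a * i) * fpow I F (Suc j) ((\<theta> ^^ i) x) v) / of_nat m) *
        ((\<Sum>l<m. u ^ (a * l) * F ((\<theta> ^^ l) v) y) / of_nat m))"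
      by (subst fpow.simps(2), subst fmul_def) (intro sum.cong refl arg_cong2[of _ _ _ _ "(*)"] Suc.IH Suc.prems(1) H_def)
    also have "\<dots> = (\<Sum>v\<in>I. \<Sum>l<m. \<Sum>i<m. u ^ (a * (i + l)) * (fpow I F (Suc j) ((\<theta> ^^ i) x) v * F ((\<theta> ^^ l) v) y)) / (of_nat m * of_nat m)"
      by (subst sum.swap[of _ "{..<m}" "{..<m}"])
        (simp only: times_divide_times_eq sum_product sum_divide_distrib, simp add: power_add distrib_left ac_simps del: fpow.simps)
    also have "(\<Sum>v\<in>I. \<Sum>l<m. \<Sum>i<m. u ^ (a * (i + l)) * (fpow I F (Suc j) ((\<theta> ^^ i) x) v * F ((\<theta> ^^ l) v) y)) =
        (\<Sum>l<m. \<Sum>i<m. u ^ (a * (i + l)) * fpow I F (Suc (Suc j)) ((\<theta> ^^ (i + l)) x) y)"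
      unfolding in1[symmetric] sum_distrib_left by (subst sum.swap) (intro sum.cong refl sum.swap)
    also have "\<dots> = (\<Sum>l<m. \<Sum>i<m. u ^ (a * i) * fpow I F (Suc (Suc j)) ((\<theta> ^^ i) x) y)"
    proof (rule sum.cong[OF refl], rule sum_mod_shift)
      fix i show "u ^ (a * (i + m)) * fpow I F (Suc (Suc j)) ((\<theta> ^^ (i + m)) x) y = u ^ (a * i) * fpow I F (Suc (Suc j)) ((\<theta> ^^ i) x) y"
        using th(2) Suc.prems um by (simp del: fpow.simps add: funpow_add power_add distrib_left power_mult[of u m] mult.commute[of a m])
    qed
    finally show ?case using m by (simp del: fpow.simps)
  qed
  have "\<exists>es'. eigs I (H a) es'" for a using eigs_exists[OF I, of "H a"] by blast
  then obtain E where E: "eigs I (H a) (E a)" for a by metis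
  \<comment> \<open>Orthogonality of the characters of a cyclic group. It recovers from the traces
    of the \<open>H a\<close> the trace twisted by the first power of \<theta>.\<close>
  have orth: "(\<Sum>a<m. w ^ a * u ^ (a * i)) = (if i = 1 then of_nat m else 0)" if i: "i < m" for i
  proof -
    have q: "w ^ a * u ^ (a * i) = (w * u ^ i) ^ a" for a by (simp add: power_mult_distrib power_mult[symmetric] mult.commute[of i a])
    show ?thesis
    proof (cases "i = 1")
      case True
      then show ?thesis using wu by (simp add: q power_mult_distrib)
    next
      case False
      have "w * u ^ i \<noteq> 1"
      proof
        assume a: "w * u ^ i = 1"
        show False
        proof (cases i)
          case 0
          then have "w ^ 1 = 1" using a by simp
          then show False using w(2)[rule_format, of 1] m by simp
        next
          case (Suc k)
          have "w * u = 1" using wu[of 1] by simp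
          then have "u ^ k = 1" using a Suc by (simp flip: mult.assoc)
          then have "w ^ k = 1" using wu[of k] by simp
          moreover have "0 < k" "k < m" using i Suc False by auto
          ultimately show False using w(2) by blast
        qed
      qed
      moreover have "(u ^ i) ^ m = 1" by (subst power_commutes_pow) (simp add: um)
      then have "(w * u ^ i) ^ m = 1" using w(1) by (simp add: power_mult_distrib)
      ultimately show ?thesis using False root_of_unity_sum by (simp add: q)
    qed
  qed
  have T: "(\<Sum>a<m. w ^ a * (\<Sum>e\<leftarrow>E a. e ^ Suc j)) = (\<Sum>e\<leftarrow>es. \<beta> e * e ^ Suc j)" for j
  proof -
    have "(\<Sum>a<m. w ^ a * (\<Sum>e\<leftarrow>E a. e ^ Suc j)) = (\<Sum>a<m. w ^ a * (\<Sum>x\<in>I. fpow I (H a) (Suc j) x x))"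
      using E by (simp only: eigs_def)
    also have "\<dots> = (\<Sum>a<m. w ^ a * (\<Sum>x\<in>I. (\<Sum>i<m. u ^ (a * i) * fpow I F (Suc j) ((\<theta> ^^ i) x) x) / of_nat m))"
      using P by (intro sum.cong refl arg_cong2[of _ _ _ _ "(*)"])
    also have "\<dots> = (\<Sum>a<m. \<Sum>x\<in>I. \<Sum>i<m. w ^ a * u ^ (a * i) * (fpow I F (Suc j) ((\<theta> ^^ i) x) x / of_nat m))"
      by (simp only: sum_distrib_left sum_divide_distrib times_divide_eq_right mult.assoc)
    also have "\<dots> = (\<Sum>x\<in>I. \<Sum>i<m. \<Sum>a<m. w ^ a * u ^ (a * i) * (fpow I F (Suc j) ((\<theta> ^^ i) x) x / of_nat m))"
      by (subst sum.swap) (intro sum.cong refl sum.swap)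
    also have "\<dots> = (\<Sum>x\<in>I. \<Sum>i<m. if i = 1 then fpow I F (Suc j) ((\<theta> ^^ i) x) x else 0)"
    proof (intro sum.cong refl)
      fix x i assume "i \<in> {..<m}"
      then show "(\<Sum>a<m. w ^ a * u ^ (a * i) * (fpow I F (Suc j) ((\<theta> ^^ i) x) x / of_nat m)) =
          (if i = 1 then fpow I F (Suc j) ((\<theta> ^^ i) x) x else 0)"
        using orth[of i] m by (simp only: sum_distrib_right[symmetric]) simp
    qed
    also have "\<dots> = (\<Sum>x\<in>I. fpow I F (Suc j) (\<theta> x) x)" using m by (simp add: sum.delta)
    finally show ?thesis unfolding tr .
  qed
  define S where "S = set es \<union> (\<Union>a<m. set (E a))"
  have S: "finite S" by (simp add: S_def)
  define c where "c e = (\<Sum>a<m. w ^ a * of_nat (count_list (E a) e)) - of_nat (count_list es e) * \<beta> e" for e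
  \<comment> \<open>The formula for powers of \<open>H a\<close> holds for positive exponents only,
    since the zeroth power is the identity and not the projection. Hence the factor e in the
    weights, and the assumption that e is nonzero.\<close>
  have z: "(\<Sum>e\<in>S. (c e * e) * e ^ j) = 0" for j
  proof -
    have 1: "(\<Sum>e\<leftarrow>E a. e ^ Suc j) = (\<Sum>e\<in>S. of_nat (count_list (E a) e) * e ^ Suc j)" if "a < m" for a
      by (rule sum_list_group[OF S]) (use that in \<open>auto simp: S_def\<close>)
    have 2: "(\<Sum>e\<leftarrow>es. \<beta> e * e ^ Suc j) = (\<Sum>e\<in>S. of_nat (count_list es e) * (\<beta> e * e ^ Suc j))"
      by (rule sum_list_group[OF S]) (auto simp: S_def)
    have 3: "(\<Sum>e\<in>S. \<Sum>a<m. w ^ a * (of_nat (count_list (E a) e) * e ^ Suc j)) =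
        (\<Sum>a<m. w ^ a * (\<Sum>e\<leftarrow>E a. e ^ Suc j))"
      by (subst sum.swap, rule sum.cong[OF refl]) (simp only: 1 lessThan_iff sum_distrib_left)
    have "(\<Sum>e\<in>S. (c e * e) * e ^ j) = (\<Sum>e\<in>S. (\<Sum>a<m. w ^ a * (of_nat (count_list (E a) e) * e ^ Suc j)) -
        of_nat (count_list es e) * (\<beta> e * e ^ Suc j))"
      by (intro sum.cong refl) (simp add: c_def algebra_simps sum_distrib_left)
    also have "\<dots> = (\<Sum>a<m. w ^ a * (\<Sum>e\<leftarrow>E a. e ^ Suc j)) - (\<Sum>e\<leftarrow>es. \<beta> e * e ^ Suc j)"
      unfolding 2 sum_subtractf 3 ..
    finally show ?thesis using T[of j] by (simp del: power_Suc)
  qed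
  have "c e * e = 0" by (rule power_sums_independent[OF S z]) (use e in \<open>simp add: S_def\<close>)
  then have "of_nat (count_list es e) * \<beta> e = (\<Sum>a<m. w ^ a * of_nat (count_list (E a) e))"
    using e(2) by (simp add: c_def)
  moreover have "algebraic_int (\<Sum>a<m. w ^ a * of_nat (count_list (E a) e))"
  proof (intro algebraic_int_sum algebraic_int_add_mult(2))
    fix a have "(w ^ a) ^ m = 1" by (subst power_commutes_pow) (simp add: w(1))
    then show "algebraic_int (w ^ a)" using m algebraic_int_power_imp[of "w ^ a" m] by (simp del: power_mult)
  qed simp
  ultimately show ?thesis by simp
qed

text \<open>Equality in the triangle inequality: after rotation by the direction of the sum, every
  real part must attain the bound \<open>M\<close>, which leaves no room for an imaginary
  part.\<close>

lemma norm_sum_max: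
  fixes f :: "'b \<Rightarrow> complex"
  assumes C: "finite C" and f: "\<And>u. u \<in> C \<Longrightarrow> norm (f u) \<le> M" and s: "norm (sum f C) \<ge> real (card C) * M" and M: "M > 0"
    and uw: "u \<in> C" "w \<in> C"
  shows "f u = f w" "norm (f u) = M"
proof -
  define s where "s = sum f C"
  have s0: "s \<noteq> 0"
  proof
    assume "s = 0"
    then have "real (card C) * M \<le> 0" using s by (simp add: s_def)
    moreover have "card C > 0" using C uw(1) by (auto simp: card_gt_0_iff)
    ultimately show False using M by (simp add: mult_le_0_iff)
  qed
  define d where "d = s / of_real (norm s)"
  have d1: "norm d = 1" using s0 by (simp add: d_def norm_divide)
  then have d: "norm d = 1" "d * cnj d = 1" using complex_norm_square[of d] by simp_all
  have le: "Re (f v * cnj d) \<le> M" if "v \<in> C" for v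
    using complex_Re_le_cmod[of "f v * cnj d"] f[OF that] d by (simp add: norm_mult)
  have "s * cnj d = of_real (norm s)" using s0 complex_norm_square[of s]
    by (simp add: d_def power2_eq_square field_simps)
  moreover have "(\<Sum>v\<in>C. Re (f v * cnj d)) = Re (s * cnj d)" by (simp only: s_def sum_distrib_right Re_sum)
  ultimately have "(\<Sum>v\<in>C. Re (f v * cnj d)) = norm s" by simp
  then have "(\<Sum>v\<in>C. M - Re (f v * cnj d)) \<le> 0" using s by (simp add: sum_subtractf s_def)
  then have "(\<Sum>v\<in>C. M - Re (f v * cnj d)) = 0" using le by (intro antisym sum_nonneg) auto
  then have eq: "Re (f v * cnj d) = M" if "v \<in> C" for v
    using sum_nonneg_eq_0_iff[OF C, of "\<lambda>v. M - Re (f v * cnj d)"] le that by auto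
  have val: "f v = of_real M * d \<and> norm (f v) = M" if v: "v \<in> C" for v
  proof -
    let ?z = "f v * cnj d"
    have n: "norm ?z \<le> M" using f[OF v] d by (simp add: norm_mult)
    then have "norm ?z = M" using eq[OF v] complex_Re_le_cmod[of ?z] by simp
    then have "(Im ?z)\<^sup>2 = 0" using eq[OF v] cmod_power2[of ?z] by simp
    then have "?z = of_real M" using eq[OF v] by (simp add: complex_eq_iff)
    then have "?z * d = of_real M * d" by simp
    then show ?thesis using d M \<open>norm ?z = M\<close> by (simp add: mult.assoc mult.commute[of "cnj d"] norm_mult)
  qed
  show "f u = f w" "norm (f u) = M" using val[OF uw(1)] val[OF uw(2)] by (metis, metis)
qed

section \<open>Conjugacy classes of prime power size\<close>

locale prime_power_class =
  fixes G :: "'a::mgroup set" and z :: 'a and r k :: nat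
  assumes G: "sgrp G" and simple: "\<And>N. nrml N G \<Longrightarrow> N = {1} \<or> N = G" and z: "z \<in> G" "z \<noteq> 1"
    and r: "prime r" and k: "k > 0" and card: "card ((\<lambda>g. cj g z) ` G) = r ^ k"
begin

definition C :: "'a set" where "C = (\<lambda>g. cj g z) ` G"

abbreviation c :: real where "c \<equiv> real (card C)"

lemma C_G: "C \<subseteq> G" using G z by (auto simp: C_def cj_in)

lemma finC: "finite C" using C_G G finite_subset by (auto simp: sgrp_def)

lemma cardC: "card C = r ^ k" using card by (simp add: C_def)

lemma card_gt: "card C > 1" unfolding cardC using r k by (metis one_less_power prime_gt_1_nat)

lemma cj_C: "g \<in> G \<Longrightarrow> cj g u \<in> C \<longleftrightarrow> u \<in> C"
proof -
  assume g: "g \<in> G"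
  have *: "cj h u \<in> C" if hu: "h \<in> G" "u \<in> C" for h u
  proof -
    obtain x where x: "x \<in> G" "u = cj x z" using hu(2) by (auto simp: C_def)
    then have "cj h u = cj (h * x) z" by (simp add: cj_cj)
    then show ?thesis using sgrpD(3)[OF G hu(1) x(1)] by (simp add: C_def)
  qed
  show ?thesis using *[of g u] *[of "inverse g" "cj g u"] g sgrpD(4)[OF G g] by (auto simp: cj_cancel)
qed

lemma C_ne_one: "u \<in> C \<Longrightarrow> u \<noteq> 1" using z by (auto simp: C_def cj_one_iff)

lemma z_C: "z \<in> C" using sgrpD(2)[OF G] cj_one(2)[of z] unfolding C_def by (metis image_eqI)

lemma bij_left: "g \<in> G \<Longrightarrow> bij_betw (\<lambda>x. g * x) G G"
  by (rule bij_betw_byWitness[where f' = "\<lambda>x. inverse g * x"]) (use G in \<open>auto simp: grp sgrpD\<close>)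

lemma bij_right: "g \<in> G \<Longrightarrow> bij_betw (\<lambda>x. x * g) G G"
  by (rule bij_betw_byWitness[where f' = "\<lambda>x. x * inverse g"]) (use G in \<open>auto simp: grp sgrpD\<close>)

lemma gen_G:
  assumes X: "X \<subseteq> G" "\<And>g x. g \<in> G \<Longrightarrow> x \<in> X \<Longrightarrow> cj g x \<in> X" and x: "x \<in> X" "x \<noteq> 1" and H: "sgrp H" "X \<subseteq> H"
  shows "G \<subseteq> H"
proof -
  have fin: "finite X" using X(1) G finite_subset by (auto simp: sgrp_def)
  have "nrml (gen X) G" by (rule nrml_gen[OF G X(1)]) (rule cj_image_eqI[OF fin X(2)])
  then have "gen X = {1} \<or> gen X = G" by (rule simple)
  moreover have "x \<in> gen X" using gen_sup x(1) by blast
  ultimately have "gen X = G" using x(2) by auto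
  then show ?thesis using gen_least[OF H] by simp
qed

text \<open>The matrix of multiplication by the class sum in the group algebra.\<close>

definition K :: "'a \<Rightarrow> 'a \<Rightarrow> complex" where
  "K x y = (if x * inverse y \<in> C then 1 else 0)"

lemma K_sum: "x \<in> G \<Longrightarrow> (\<Sum>w\<in>G. K x w * v w) = (\<Sum>u\<in>C. v (inverse u * x))"
proof -
  assume x: "x \<in> G"
  have "(\<Sum>w\<in>G. K x w * v w) = (\<Sum>w\<in>{w \<in> G. x * inverse w \<in> C}. v w)"
    using sgrpD(1)[OF G] by (intro sum.mono_neutral_cong_right) (auto simp: K_def)
  also have "\<dots> = (\<Sum>u\<in>C. v (inverse u * x))"
    by (rule sum.reindex_bij_witness[of _ "\<lambda>u. inverse u * x" "\<lambda>w. x * inverse w"])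
      (use G x C_G in \<open>auto simp: grp sgrpD subset_iff\<close>)
  finally show ?thesis .
qed

text \<open>A maximum principle. Where the norm of v is maximal, the eigenvalue equation is an
  equality in the triangle inequality, so v takes one value of maximal norm on all
  \<open>inverse u * x\<close> with u in \<open>C\<close>. The set of maximal points is thus
  invariant under the group generated by \<open>C\<close>, which is \<open>G\<close> by simplicity.
  Then v is invariant under all quotients of two elements of \<open>C\<close>, and these generate
  \<open>G\<close> as well.\<close>

lemma K_const:
  assumes v: "x0 \<in> G" "v x0 \<noteq> 0" "\<And>x. x \<in> G \<Longrightarrow> (\<Sum>w\<in>G. K x w * v w) = e * v x" and e: "norm e \<ge> c"
    and x: "x \<in> G"
  shows "v x = v 1"
proof -
  define M where "M = Max ((\<lambda>x. norm (v x)) ` G)"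
  have fin: "finite ((\<lambda>x. norm (v x)) ` G)" using sgrpD(1)[OF G] by simp
  have le: "norm (v x) \<le> M" if "x \<in> G" for x unfolding M_def using fin that by (intro Max_ge) auto
  have M: "M > 0" using le[OF v(1)] v(2) by (metis less_le_trans zero_less_norm_iff)
  define T where "T = {x \<in> G. norm (v x) = M}"
  have "M \<in> (\<lambda>x. norm (v x)) ` G" unfolding M_def using fin v(1) by (intro Max_in) auto
  then obtain x1 where x1: "x1 \<in> T" by (auto simp: T_def)
  have inG: "inverse u * x \<in> G" if "u \<in> C" "x \<in> G" for u x using that C_G G by (auto simp: sgrpD subset_iff)
  have step: "norm (v (inverse u * x)) = M \<and> v (inverse u * x) = v (inverse w * x)"
    if x: "x \<in> T" and u: "u \<in> C" "w \<in> C" for x u w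
  proof -
    have xG: "x \<in> G" "norm (v x) = M" using x by (auto simp: T_def)
    have "(\<Sum>u\<in>C. v (inverse u * x)) = e * v x" using v(3)[OF xG(1)] K_sum[OF xG(1)] by simp
    then have "norm (\<Sum>u\<in>C. v (inverse u * x)) \<ge> c * M" using xG(2) e M by (simp add: norm_mult)
    from norm_sum_max[OF finC _ this M u] le inG[OF _ xG(1)] norm_sum_max[OF finC _ this M u(1) u(1)]
    show ?thesis by blast
  qed
  have CT: "inverse u * x \<in> T" if "u \<in> C" "x \<in> T" for u x
    using step[OF that(2,1,1)] inG[OF that(1)] that(2) by (simp add: T_def)
  have finT: "finite T" using sgrpD(1)[OF G] by (simp add: T_def)
  define H where "H = {g \<in> G. \<forall>x. g * x \<in> T \<longleftrightarrow> x \<in> T}"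
  have H: "sgrp H" unfolding sgrp_def
  proof (intro conjI ballI)
    show "finite H" "1 \<in> H" using G by (auto simp: H_def sgrpD)
    fix a b assume "a \<in> H" "b \<in> H"
    then show "a * b \<in> H" using G by (simp add: H_def sgrpD mult.assoc)
  next
    fix a assume a: "a \<in> H"
    have "inverse a * x \<in> T \<longleftrightarrow> x \<in> T" for x
    proof -
      have "a * (inverse a * x) \<in> T \<longleftrightarrow> inverse a * x \<in> T" using a unfolding H_def by blast
      then show ?thesis by (simp add: grp)
    qed
    then show "inverse a \<in> H" using a G by (simp add: H_def sgrpD)
  qed
  have CH: "C \<subseteq> H"
  proof
    fix u assume u: "u \<in> C"
    have im: "(\<lambda>x. inverse u * x) ` T = T"
      by (rule card_subset_eq[OF finT])
        (use CT[OF u] in \<open>auto simp: card_image inj_on_def mul_left_cancel\<close>)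
    have "u * x \<in> T" if "x \<in> T" for x
    proof -
      have "x \<in> (\<lambda>x. inverse u * x) ` T" using that im by simp
      then obtain y where "y \<in> T" "x = inverse u * y" by blast
      then show ?thesis by (simp add: grp)
    qed
    moreover have "x \<in> T" if "u * x \<in> T" for x using CT[OF u that] by (simp add: grp)
    ultimately show "u \<in> H" using u C_G unfolding H_def by blast
  qed
  have GH: "G \<subseteq> H" by (rule gen_G[of C z, OF C_G _ z_C z(2) H CH]) (simp add: cj_C)
  have TG: "x \<in> T" if "x \<in> G" for x
  proof -
    have "x1 \<in> G" using x1 by (simp add: T_def)
    then have "x * inverse x1 \<in> H" using GH sgrpD(3)[OF G that sgrpD(4)[OF G]] by blast
    then have "x * inverse x1 * x1 \<in> T" using x1 unfolding H_def by blast
    then show ?thesis by (simp add: grp)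
  qed
  define N where "N = {g \<in> G. \<forall>x\<in>G. v (g * x) = v x}"
  have N: "sgrp N" unfolding sgrp_def
  proof (intro conjI ballI)
    show "finite N" "1 \<in> N" using G by (auto simp: N_def sgrpD)
    fix a b assume "a \<in> N" "b \<in> N"
    then show "a * b \<in> N" using G by (simp add: N_def sgrpD mult.assoc)
  next
    fix a assume a: "a \<in> N"
    then have aG: "inverse a \<in> G" using G by (simp add: N_def sgrpD)
    have "v (inverse a * x) = v x" if "x \<in> G" for x
    proof -
      have "v (a * (inverse a * x)) = v (inverse a * x)" using a sgrpD(3)[OF G aG that] unfolding N_def by blast
      then show ?thesis by (simp add: grp)
    qed
    then show "inverse a \<in> N" using aG by (simp add: N_def)
  qed
  let ?X = "(\<lambda>(u, w). inverse u * w) ` (C \<times> C)"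
  have XG: "?X \<subseteq> G" using C_G G by (auto simp: sgrpD subset_iff)
  have XN: "?X \<subseteq> N"
  proof
    fix g assume "g \<in> ?X"
    then obtain u w where uw: "u \<in> C" "w \<in> C" "g = inverse u * w" by auto
    have "v (g * y) = v y" if y: "y \<in> G" for y
    proof -
      have "w * y \<in> T" using TG C_G uw(2) y G by (auto simp: sgrpD subset_iff)
      then have "v (inverse u * (w * y)) = v (inverse w * (w * y))" using step uw(1,2) by blast
      then show ?thesis by (simp add: uw(3) grp)
    qed
    then show "g \<in> N" using XG \<open>g \<in> ?X\<close> by (auto simp: N_def)
  qed
  obtain u w where uw: "u \<in> C" "w \<in> C" "u \<noteq> w"
    using card_gt card_le_Suc0_iff_eq[OF finC] by (metis One_nat_def linorder_not_less)
  have "G \<subseteq> N"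
  proof (rule gen_G[of ?X "inverse u * w"])
    show "cj g x \<in> ?X" if g: "g \<in> G" and x: "x \<in> ?X" for g x
    proof -
      obtain u w where uw: "u \<in> C" "w \<in> C" "x = inverse u * w" using x by auto
      have "cj g x = inverse (cj g u) * cj g w" by (simp add: uw(3) cj_mult cj_inv)
      moreover have "cj g u \<in> C" "cj g w \<in> C" using g uw(1,2) cj_C by simp_all
      ultimately show ?thesis by auto
    qed
    show "inverse u * w \<in> ?X" using uw by auto
    show "inverse u * w \<noteq> 1"
    proof
      assume "inverse u * w = 1"
      then have "u * (inverse u * w) = u" by simp
      then show False using uw(3) by (simp add: grp)
    qed
  qed (fact XG N XN)+
  then have "v (x * 1) = v 1" using x sgrpD(2)[OF G] unfolding N_def by blast
  then show ?thesis by simp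
qed

text \<open>Subtracting a constant removes the eigenvalue \<open>c\<close> of the constant functions.\<close>

definition F :: "'a \<Rightarrow> 'a \<Rightarrow> complex" where
  "F x y = K x y - of_real (c / real (card G))"

lemma cardG: "card G > 0" by (rule sgrp_card_pos[OF G])

lemma F_left: "x \<in> G \<Longrightarrow> y \<in> G \<Longrightarrow> g \<in> G \<Longrightarrow> F (g * x) (g * y) = F x y"
proof -
  assume "x \<in> G" "y \<in> G" "g \<in> G"
  moreover have "g * x * inverse (g * y) = cj g (x * inverse y)" by (simp add: cj_def grp)
  ultimately show ?thesis using cj_C by (simp add: F_def K_def)
qed

lemma F_right: "F (x * g) (y * g) = F x y"
proof -
  have "x * g * inverse (y * g) = x * inverse y" by (simp add: grp)
  then show ?thesis by (simp add: F_def K_def)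
qed

abbreviation P :: "nat \<Rightarrow> 'a \<Rightarrow> 'a \<Rightarrow> complex" where "P j \<equiv> fpow G F j"

lemma P_left: "x \<in> G \<Longrightarrow> y \<in> G \<Longrightarrow> g \<in> G \<Longrightarrow> P j (g * x) (g * y) = P j x y"
  by (rule fpow_invariant[OF sgrpD(1)[OF G] bij_left]) (simp_all add: F_left)

lemma P_right: "x \<in> G \<Longrightarrow> y \<in> G \<Longrightarrow> g \<in> G \<Longrightarrow> P j (x * g) (y * g) = P j x y"
  by (rule fpow_invariant[OF sgrpD(1)[OF G] bij_right]) (simp_all add: F_right)

lemma F_col: assumes "y \<in> G" shows "(\<Sum>w\<in>G. F w y) = 0"
proof -
  have "(\<Sum>w\<in>G. K w y) = (\<Sum>w\<in>{w \<in> G. w * inverse y \<in> C}. 1)"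
    using sgrpD(1)[OF G] by (intro sum.mono_neutral_cong_right) (auto simp: K_def)
  also have "\<dots> = (\<Sum>u\<in>C. 1)"
    by (rule sum.reindex_bij_witness[of _ "\<lambda>u. u * y" "\<lambda>w. w * inverse y"])
      (use G assms C_G in \<open>auto simp: grp sgrpD subset_iff\<close>)
  finally have "(\<Sum>w\<in>G. K w y) = of_nat (card C)" by simp
  then show ?thesis using cardG by (simp add: F_def sum_subtractf)
qed

lemma P_col: assumes "y \<in> G" shows "(\<Sum>w\<in>G. P (Suc j) w y) = 0"
proof -
  have e: "P (Suc j) w y = (\<Sum>v\<in>G. F w v * P j v y)" if "w \<in> G" for w
    by (rule fpow_Suc2[OF sgrpD(1)[OF G] that assms])
  have "(\<Sum>w\<in>G. P (Suc j) w y) = (\<Sum>w\<in>G. \<Sum>v\<in>G. F w v * P j v y)"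
    using e by (intro sum.cong refl)
  also have "\<dots> = (\<Sum>v\<in>G. (\<Sum>w\<in>G. F w v) * P j v y)"
    by (subst sum.swap) (simp add: sum_distrib_right)
  also have "\<dots> = 0" using F_col by simp
  finally show ?thesis .
qed

text \<open>The constant subtracted in \<open>F\<close> contributes a multiple of a column sum of a
  positive power, and these sums vanish.\<close>

lemma P_Suc: assumes "x \<in> G" "y \<in> G" shows "P (Suc (Suc j)) x y = (\<Sum>u\<in>C. P (Suc j) (inverse u * x) y)"
proof -
  have "P (Suc (Suc j)) x y = (\<Sum>v\<in>G. F x v * P (Suc j) v y)"
    by (rule fpow_Suc2[OF sgrpD(1)[OF G] assms])
  also have "\<dots> = (\<Sum>v\<in>G. K x v * P (Suc j) v y) - of_real (c / real (card G)) * (\<Sum>v\<in>G. P (Suc j) v y)"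
    by (simp add: F_def left_diff_distrib sum_subtractf sum_distrib_left del: fpow.simps)
  also have "\<dots> = (\<Sum>u\<in>C. P (Suc j) (inverse u * x) y)"
    using P_col[OF assms(2)] K_sum[OF assms(1), of "\<lambda>v. P (Suc j) v y"] by (simp del: fpow.simps)
  finally show ?thesis .
qed

text \<open>One application of the class sum is a sum of translations by the elements of
  \<open>C\<close>. They are conjugate and the powers of \<open>F\<close> commute with left
  translations, so all have the same trace. The class sum can therefore be traded for the
  translation by \<open>inverse z\<close> with the factor c.\<close>

lemma twisted_trace:
  assumes h: "h \<in> G"
  shows "of_real c * (\<Sum>x\<in>G. P (Suc j) (inverse z * x * h) x) = (\<Sum>x\<in>G. P (Suc (Suc j)) (x * h) x)"
proof -
  note [simp del] = fpow.simps
  have same: "(\<Sum>x\<in>G. P (Suc j) (inverse u * x * h) x) = (\<Sum>x\<in>G. P (Suc j) (inverse z * x * h) x)" if u: "u \<in> C" for u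
  proof -
    obtain g where g: "g \<in> G" "u = cj g z" using u by (auto simp: C_def)
    have "(\<Sum>x\<in>G. P (Suc j) (inverse u * x * h) x) = (\<Sum>x\<in>G. P (Suc j) (inverse u * (g * x) * h) (g * x))"
      by (rule sum.reindex_bij_betw[OF bij_left[OF g(1)], symmetric])
    also have "\<dots> = (\<Sum>x\<in>G. P (Suc j) (g * (inverse z * x * h)) (g * x))"
      by (simp add: g(2) cj_def grp)
    also have "\<dots> = (\<Sum>x\<in>G. P (Suc j) (inverse z * x * h) x)"
      using g(1) z(1) h G by (intro sum.cong refl P_left) (simp_all add: sgrpD)
    finally show ?thesis .
  qed
  have "(\<Sum>x\<in>G. P (Suc (Suc j)) (x * h) x) = (\<Sum>x\<in>G. \<Sum>u\<in>C. P (Suc j) (inverse u * (x * h)) x)"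
    using h G by (intro sum.cong refl P_Suc) (simp_all add: sgrpD)
  also have "\<dots> = (\<Sum>u\<in>C. \<Sum>x\<in>G. P (Suc j) (inverse u * x * h) x)"
    by (subst sum.swap) (simp add: mult.assoc)
  also have "\<dots> = (\<Sum>u\<in>C. \<Sum>x\<in>G. P (Suc j) (inverse z * x * h) x)"
    by (rule sum.cong[OF refl same])
  finally show ?thesis by simp
qed

lemma twisted_trace_left:
  "of_real c * (\<Sum>x\<in>G. P (Suc j) (inverse z * x) x) = (\<Sum>x\<in>G. P (Suc (Suc j)) x x)"
  using twisted_trace[of 1 j] sgrpD(2)[OF G] by simp

lemma twisted_trace_both:
  "(of_real c)\<^sup>2 * (\<Sum>x\<in>G. P (Suc j) (inverse z * x * inverse z) x) = (\<Sum>x\<in>G. P (Suc (Suc (Suc j))) x x)"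
proof -
  note [simp del] = fpow.simps
  have iz: "inverse z \<in> G" using z G by (simp add: sgrpD)
  have "P (Suc (Suc j)) (x * inverse z) x = P (Suc (Suc j)) (inverse z * x) x" if x: "x \<in> G" for x
  proof -
    have "P (Suc (Suc j)) (x * inverse z) (x * 1) = P (Suc (Suc j)) (inverse z) 1"
      using x iz G by (intro P_left) (simp_all add: sgrpD)
    also have "\<dots> = P (Suc (Suc j)) (inverse z * x) (1 * x)"
      using x iz G by (intro P_right[symmetric]) (simp_all add: sgrpD)
    finally show ?thesis by simp
  qed
  then have "(\<Sum>x\<in>G. P (Suc (Suc j)) (x * inverse z) x) = (\<Sum>x\<in>G. P (Suc (Suc j)) (inverse z * x) x)"
    by (intro sum.cong refl)
  then show ?thesis using twisted_trace[OF iz, of j] twisted_trace_left[of "Suc j"]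
    by (simp add: power2_eq_square mult.assoc)
qed

text \<open>The column sums of \<open>F\<close> vanish, so an eigenvector for a nonzero eigenvalue
  has coordinate sum zero and is an eigenvector of \<open>K\<close> as well. If the eigenvalue had
  norm at least c, \<open>K_const\<close> would make it constant and hence zero.\<close>

lemma F_eigenvalue:
  assumes es: "eigs G F es" and e: "e \<in> set es" "e \<noteq> 0"
  shows "norm e < c" "\<exists>v. (\<exists>x\<in>G. v x \<noteq> 0) \<and> (\<forall>x\<in>G. (\<Sum>w\<in>G. K x w * v w) = e * v x)"
proof -
  obtain v where v: "\<exists>x\<in>G. v x \<noteq> 0" "\<forall>x\<in>G. (\<Sum>w\<in>G. F x w * v w) = e * v x"
    using es e(1) unfolding eigs_def by blast
  have "e * (\<Sum>x\<in>G. v x) = (\<Sum>x\<in>G. \<Sum>w\<in>G. F x w * v w)" using v(2) by (simp add: sum_distrib_left)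
  also have "\<dots> = (\<Sum>w\<in>G. (\<Sum>x\<in>G. F x w) * v w)" by (subst sum.swap) (simp add: sum_distrib_right)
  also have "\<dots> = 0" using F_col by simp
  finally have s0: "(\<Sum>x\<in>G. v x) = 0" using e(2) by simp
  have Kv: "(\<Sum>w\<in>G. K x w * v w) = e * v x" if "x \<in> G" for x
  proof -
    have "(\<Sum>w\<in>G. K x w * v w) = (\<Sum>w\<in>G. F x w * v w) + of_real (c / real (card G)) * (\<Sum>w\<in>G. v w)"
      by (simp add: F_def left_diff_distrib sum_subtractf sum_distrib_left)
    then show ?thesis using v(2) that s0 by simp
  qed
  then show "\<exists>v. (\<exists>x\<in>G. v x \<noteq> 0) \<and> (\<forall>x\<in>G. (\<Sum>w\<in>G. K x w * v w) = e * v x)" using v(1) by blast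
  show "norm e < c"
  proof (rule ccontr)
    assume "\<not> norm e < c"
    then have ge: "norm e \<ge> c" by simp
    obtain x0 where x0: "x0 \<in> G" "v x0 \<noteq> 0" using v(1) by blast
    have const: "v x = v 1" if "x \<in> G" for x by (rule K_const[OF x0 Kv ge that])
    then have "(\<Sum>x\<in>G. v x) = of_nat (card G) * v 1" by simp
    then have "v 1 = 0" using s0 cardG by simp
    then show False using const[OF x0(1)] x0(2) by simp
  qed
qed

text \<open>The diagonal of \<open>K\<close> vanishes because the class does not contain 1. In
  character terms this is the orthogonality of the column of z with that of 1, with the trivial
  character moved to the other side.\<close>

lemma trace_F:
  assumes es: "eigs G F es" shows "(\<Sum>e\<leftarrow>es. e) = - of_real c"
proof -
  have "P (Suc 0) x x = F x x" if "x \<in> G" for x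
    using that sgrpD(1)[OF G] by (simp add: fmul_def if_distribR if_distrib sum.delta cong: if_cong)
  then have "(\<Sum>x\<in>G. P (Suc 0) x x) = (\<Sum>x\<in>G. F x x)" by (rule sum.cong[OF refl])
  moreover have "(\<Sum>x\<in>G. P (Suc 0) x x) = (\<Sum>e\<leftarrow>es. e ^ Suc 0)" using es unfolding eigs_def by blast
  ultimately have t: "(\<Sum>e\<leftarrow>es. e) = (\<Sum>x\<in>G. F x x)" by (simp del: fpow.simps)
  have "1 \<notin> C" using C_ne_one by blast
  then have "F x x = - of_real (c / real (card G))" for x by (simp add: F_def K_def right_inv)
  then show ?thesis unfolding t using cardG by simp
qed

lemma integrality:
  assumes es: "eigs G F es" and e: "e \<in> set es" "e \<noteq> 0"
  shows "algebraic_int (of_nat (count_list es e) * (e / of_real c))"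
    "algebraic_int (of_nat (count_list es e) * (e / of_real c)\<^sup>2)"
proof -
  note [simp del] = fpow.simps
  have iz: "inverse z \<in> G" using z G by (simp add: sgrpD)
  have n1: "card G > 1"
  proof -
    have "card C \<le> card G" using C_G sgrpD(1)[OF G] card_mono by blast
    then show ?thesis using card_gt by simp
  qed
  have zn: "inverse z ^ card G = 1" by (rule pow_card[OF G iz])
  have c0: "(of_real c :: complex) \<noteq> 0" using card_gt by simp
  have tr: "(\<Sum>x\<in>G. P j x x) = (\<Sum>e\<leftarrow>es. e ^ j)" for j using es unfolding eigs_def by blast
  show "algebraic_int (of_nat (count_list es e) * (e / of_real c))"
  proof (rule eigs_twisted_trace[OF sgrpD(1)[OF G] bij_left[OF iz] _ n1 _ es _ e])
    fix x have "((\<lambda>x. inverse z * x) ^^ i) x = inverse z ^ i * x" for i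
      by (induction i) (simp_all add: mult.assoc)
    then show "((\<lambda>x. inverse z * x) ^^ card G) x = x" using zn by simp
  next
    fix x y assume "x \<in> G" "y \<in> G" then show "F (inverse z * x) (inverse z * y) = F x y" by (intro F_left iz)
  next
    fix j have "(\<Sum>x\<in>G. P (Suc j) (inverse z * x) x) = (\<Sum>e\<leftarrow>es. e ^ Suc (Suc j)) / of_real c"
      using twisted_trace_left[of j] c0 unfolding tr by (simp add: field_simps)
    also have "\<dots> = (\<Sum>e\<leftarrow>es. e / of_real c * e ^ Suc j)" by (induction es) (simp_all add: add_divide_distrib)
    finally show "(\<Sum>x\<in>G. P (Suc j) (inverse z * x) x) = (\<Sum>e\<leftarrow>es. e / of_real c * e ^ Suc j)" .
  qed
  show "algebraic_int (of_nat (count_list es e) * (e / of_real c)\<^sup>2)"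
  proof (rule eigs_twisted_trace[OF sgrpD(1)[OF G] _ _ n1 _ es _ e, where \<theta> = "\<lambda>x. inverse z * x * inverse z"])
    show "bij_betw (\<lambda>x. inverse z * x * inverse z) G G"
      using bij_betw_trans[OF bij_left[OF iz] bij_right[OF iz]] by (simp add: comp_def)
    fix x have "((\<lambda>x. inverse z * x * inverse z) ^^ i) x = inverse z ^ i * x * inverse z ^ i" for i
      by (induction i) (simp_all add: mult.assoc power_commutes)
    then show "((\<lambda>x. inverse z * x * inverse z) ^^ card G) x = x" using zn by simp
  next
    fix x y assume "x \<in> G" "y \<in> G"
    then show "F (inverse z * x * inverse z) (inverse z * y * inverse z) = F x y"
      unfolding F_right by (intro F_left iz)
  next
    fix j have "(\<Sum>x\<in>G. P (Suc j) (inverse z * x * inverse z) x) = (\<Sum>e\<leftarrow>es. e ^ Suc (Suc (Suc j))) / (of_real c)\<^sup>2"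
      using twisted_trace_both[of j] c0 unfolding tr by (simp add: field_simps)
    also have "\<dots> = (\<Sum>e\<leftarrow>es. (e / of_real c)\<^sup>2 * e ^ Suc j)"
      by (induction es) (simp_all add: add_divide_distrib power2_eq_square)
    finally show "(\<Sum>x\<in>G. P (Suc j) (inverse z * x * inverse z) x) = (\<Sum>e\<leftarrow>es. (e / of_real c)\<^sup>2 * e ^ Suc j)" .
  qed
qed

lemma K_int: "x \<in> G \<Longrightarrow> y \<in> G \<Longrightarrow> K x y \<in> \<int>" by (simp add: K_def)

lemma K_row: assumes "x \<in> G" shows "(\<Sum>w\<in>G. K x w) = of_real c"
  using K_sum[OF assms, of "\<lambda>_. 1"] by simp

lemma K_eigenvalue_le:
  assumes v: "x0 \<in> G" "v x0 \<noteq> 0" "\<And>x. x \<in> G \<Longrightarrow> (\<Sum>w\<in>G. K x w * v w) = e * v x"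
  shows "norm e \<le> c"
proof (rule ccontr)
  assume n: "\<not> norm e \<le> c"
  then have ge: "norm e \<ge> c" by simp
  have const: "v x = v 1" if "x \<in> G" for x by (rule K_const[OF v ge that])
  have one: "1 \<in> G" using G by (simp add: sgrpD)
  have "e * v 1 = (\<Sum>w\<in>G. K 1 w * v 1)" using v(3)[OF one] const by simp
  also have "\<dots> = of_real c * v 1" using K_row[OF one] by (simp flip: sum_distrib_right)
  finally have "e = of_real c" using const[OF v(1)] v(2) by simp
  then show False using n by simp
qed

lemma eigenvalue_algebraic_int:
  assumes "\<exists>x\<in>G. v x \<noteq> 0" "\<forall>x\<in>G. (\<Sum>w\<in>G. K x w * v w) = e * v x"
  shows "algebraic_int e"
proof -
  obtain x0 where x0: "x0 \<in> G" "v x0 \<noteq> 0" using assms(1) by blast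
  show ?thesis
  proof (rule algebraic_int_module[where I = G and ?i0.0 = x0 and b = v and m = "\<lambda>x y. if x * inverse y \<in> C then 1 else 0"])
    show "finite G" "x0 \<in> G" "v x0 \<noteq> 0" using x0 sgrpD(1)[OF G] by simp_all
    fix x assume x: "x \<in> G"
    have "(\<Sum>w\<in>G. K x w * v w) = (\<Sum>w\<in>G. of_int (if x * inverse w \<in> C then 1 else 0) * v w)"
      by (rule sum.cong) (simp_all add: K_def)
    then show "e * v x = (\<Sum>w\<in>G. of_int (if x * inverse w \<in> C then 1 else 0) * v w)" using assms(2) x by simp
  qed
qed

text \<open>Otherwise the multiplicity m is coprime to the class size, a power of r, and by Bezout e
  / c is an integral combination of m e / c and e, hence an algebraic integer. It is nonzero of norm
  below 1, and its conjugates, again eigenvalues of \<open>K\<close> divided by c, have norm at most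
  1.\<close>

lemma dvd_multiplicity:
  assumes es: "eigs G F es" and e: "e \<in> set es" "e \<noteq> 0"
  shows "r dvd count_list es e"
proof (rule ccontr)
  let ?N = "count_list es e" and ?a = "e / of_real c"
  assume "\<not> r dvd ?N"
  then have "coprime (int ?N) (int (r ^ k))"
    using r by (simp add: prime_imp_coprime coprime_commute)
  then obtain a b where ab: "a * int ?N + b * int (r ^ k) = 1" by (metis bezout_int coprime_iff_gcd_eq_1)
  have c0: "(of_real c :: complex) \<noteq> 0" using card_gt by simp
  have cr: "of_real c = (of_int (int (r ^ k)) :: complex)" by (simp add: cardC)
  obtain v where v: "\<exists>x\<in>G. v x \<noteq> 0" "\<forall>x\<in>G. (\<Sum>w\<in>G. K x w * v w) = e * v x"
    using F_eigenvalue(2)[OF es e] by blast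
  have "?a = of_int (a * int ?N + b * int (r ^ k)) * ?a" by (simp only: ab) simp
  also have "\<dots> = of_int a * (of_nat ?N * ?a) + of_int b * e"
    unfolding of_int_add of_int_mult[of b] cr[symmetric] using c0 by (simp add: distrib_right add_divide_distrib)
  finally have a: "?a = of_int a * (of_nat ?N * ?a) + of_int b * e" .
  have x: "algebraic_int ?a"
    by (subst a) (intro algebraic_int_add_mult integrality(1)[OF es e] eigenvalue_algebraic_int[OF v] algebraic_int_of_int)
  obtain eK where eK: "eigs G K eK"
    and ex: "(\<forall>x\<in>G. \<forall>y\<in>G. K x y \<in> \<int>) \<longrightarrow> (\<exists>q::int poly. map_poly of_int q = (\<Prod>e\<leftarrow>eK. [:- e, 1:]))"
    using eigs_exists[OF sgrpD(1)[OF G]] .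
  note ex
  moreover have "\<forall>x\<in>G. \<forall>y\<in>G. K x y \<in> \<int>" using K_int by blast
  ultimately have "\<exists>q::int poly. map_poly of_int q = (\<Prod>e\<leftarrow>eK. [:- e, 1:])" by (rule mp)
  then obtain q :: "int poly" where q: "map_poly of_int q = (\<Prod>e\<leftarrow>eK. [:- e, 1:])" by (elim exE)
  have qroot: "poly (map_poly of_int q) y = 0 \<longleftrightarrow> y \<in> set eK" for y :: complex
    unfolding q by (induction eK) auto
  \<comment> \<open>The characteristic polynomial of \<open>K\<close> with its variable scaled by
    the class size. Its roots are the eigenvalues of \<open>K\<close> divided by c.\<close>
  let ?q = "pcompose (map_poly of_int q) [:0, of_nat (card C):] :: rat poly"
  interpret rh: map_poly_comm_ring_hom "of_rat :: rat \<Rightarrow> complex" ..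
  have ml: "map_poly of_rat [:0, of_nat (card C):] = [:0, of_nat (card C) :: complex:]"
    by (rule poly_eqI) (simp add: coeff_map_poly coeff_pCons split: nat.split)
  have mq: "map_poly of_rat ?q = pcompose (map_poly of_int q) [:0, of_real c :: complex:]"
    unfolding of_rat_hom.map_poly_pcompose ml by (simp add: map_poly_map_poly comp_def)
  have pq: "poly (map_poly of_rat ?q) y = 0 \<longleftrightarrow> of_real c * y \<in> set eK" for y :: complex
    unfolding mq poly_pcompose using qroot[of "of_real c * y"] by (simp add: mult.commute)
  show False
  proof (rule algebraic_int_small_conjugates[OF x])
    show "?a \<noteq> 0" using e(2) c0 by simp
    show "norm ?a < 1" using F_eigenvalue(1)[OF es e] card_gt by (simp add: norm_divide)
    show "poly (map_poly of_rat ?q) ?a = 0" unfolding pq using eK v c0 unfolding eigs_def by auto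
    show "?q \<noteq> 0"
    proof
      assume "?q = 0"
      then have "poly (map_poly of_rat ?q) y = 0" for y :: complex by (simp only: map_poly_0) simp
      then have "of_nat n \<in> set eK" for n :: nat using pq[of "of_nat n / of_real c"] c0 by simp
      then have "range (of_nat :: nat \<Rightarrow> complex) \<subseteq> set eK" by (rule image_subsetI)
      then have "finite (range (of_nat :: nat \<Rightarrow> complex))" by (rule finite_subset) simp
      then show False using finite_imageD[of "of_nat :: nat \<Rightarrow> complex" UNIV] infinite_UNIV_nat by (simp add: inj_on_def)
    qed
    fix y :: complex assume "poly (map_poly of_rat ?q) y = 0"
    then have "of_real c * y \<in> set eK" using pq by blast
    then obtain v where v: "\<exists>x\<in>G. v x \<noteq> 0" and v': "\<forall>x\<in>G. (\<Sum>w\<in>G. K x w * v w) = of_real c * y * v x"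
      using eK unfolding eigs_def by blast
    obtain x0 where x0: "x0 \<in> G" "v x0 \<noteq> 0" using v by blast
    have "norm (of_real c * y) \<le> c"
      by (rule K_eigenvalue_le[where v = v and ?x0.0 = x0]) (use v' x0 in \<open>simp_all\<close>)
    then show "norm y \<le> 1" using card_gt by (simp add: norm_mult)
  qed
qed

lemma prime_power_class_False: False
proof -
  obtain es where es: "eigs G F es" using eigs_exists[OF sgrpD(1)[OF G], of F] by blast
  \<comment> \<open>The square of m e / c is m times the algebraic integer m (e / c)^2, and r
    divides m. So m e / c remains an algebraic integer after division by the square root of r, while
    the trace makes the sum of these quotients equal to -1 / s.\<close>
  define s :: complex where "s = of_real (sqrt (real r))"
  have s2: "s\<^sup>2 = of_nat r" by (simp add: s_def flip: of_real_power)
  have r0: "real r > 0" using prime_gt_0_nat[OF r] by simp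
  then have s0: "s \<noteq> 0" by (simp add: s_def)
  have c0: "(of_real c :: complex) \<noteq> 0" using card_gt by simp
  define g where "g e = of_nat (count_list es e) * (e / of_real c) / s" for e
  have gi: "algebraic_int (g e)" if e: "e \<in> set es" for e
  proof (cases "e = 0")
    case False
    obtain l where l: "count_list es e = r * l" using dvd_multiplicity[OF es e False] by (elim dvdE)
    have "(g e)\<^sup>2 = of_nat l * (of_nat (count_list es e) * (e / of_real c)\<^sup>2)"
      using s0 r0 unfolding g_def power_divide power_mult_distrib s2 by (simp add: l power2_eq_square)
    moreover have "algebraic_int (of_nat l * (of_nat (count_list es e) * (e / of_real c)\<^sup>2))"
      using algebraic_int_add_mult(2)[OF _ integrality(2)[OF es e False], of "of_nat l"] by simp
    ultimately show ?thesis using algebraic_int_power_imp[of "g e" 2] by simp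
  qed (simp add: g_def)
  have "(\<Sum>e\<in>set es. of_nat (count_list es e) * e) = - of_real c"
    using trace_F[OF es] sum_list_group[of "set es" es "\<lambda>e. e"] by simp
  then have "(\<Sum>e\<in>set es. g e) = - of_real c / of_real c / s"
    unfolding g_def by (simp add: sum_divide_distrib[symmetric] times_divide_eq_right)
  then have gs: "(\<Sum>e\<in>set es. g e) = - 1 / s" using c0 by simp
  have "algebraic_int (\<Sum>e\<in>set es. g e)" by (rule algebraic_int_sum[OF gi])
  then have a: "algebraic_int (- 1 / s)" unfolding gs .
  have "algebraic_int ((- 1 / s) * (- 1 / s))" by (rule algebraic_int_add_mult(2)[OF a a])
  moreover have "(- 1 / s) * (- 1 / s) = of_rat (1 / of_nat r)"
    using s2 by (simp add: power2_eq_square of_rat_divide)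
  ultimately have "algebraic_int (of_rat (1 / of_nat r) :: complex)" by simp
  then have "(of_rat (1 / of_nat r) :: complex) \<in> \<int>" by (rule rational_algebraic_int_is_int) simp
  then obtain a :: int where "(of_rat (1 / of_nat r) :: complex) = of_int a" by (elim Ints_cases)
  then have "of_int (a * int r) = (of_int 1 :: complex)" using r0 by (simp add: of_rat_divide field_simps)
  then have "a * int r = 1" unfolding of_int_eq_iff .
  then have "int r dvd 1" using dvd_triv_right[of "int r" a] by simp
  then show False using prime_gt_1_nat[OF r] by simp
qed

end

section \<open>Products of two nilpotent groups are solvable\<close>

lemma sgrp_closed:
  assumes G: "sgrp G" and H: "H \<subseteq> G" "1 \<in> H" "\<And>x y. x \<in> H \<Longrightarrow> y \<in> H \<Longrightarrow> x * y \<in> H"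
  shows "sgrp H"
  unfolding sgrp_def
proof (intro conjI ballI)
  show "finite H" using H(1) sgrpD(1)[OF G] finite_subset by blast
  fix x assume x: "x \<in> H"
  have p: "x ^ n \<in> H" for n by (induction n) (use H x in auto)
  have "x ^ card G = 1" using pow_card[OF G] x H(1) by blast
  moreover obtain m where m: "card G = Suc m" using sgrp_card_pos[OF G] by (cases "card G") auto
  ultimately have "inverse x * (x * x ^ m) = inverse x" by simp
  then have "inverse x = x ^ m" by (simp add: inv_cancel_left)
  then show "inverse x \<in> H" using p[of m] by simp
qed (use H in auto)

lemma sgrp_permuting_sprod:
  assumes G: "sgrp G" and H: "sgrp H" "H \<subseteq> G" and K: "sgrp K" "K \<subseteq> G"
    and p: "\<And>h k. h \<in> H \<Longrightarrow> k \<in> K \<Longrightarrow> h * k \<in> sprod K H"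
  shows "sgrp (sprod K H)"
proof (rule sgrp_closed[OF G sprod_sub[OF G K(2) H(2)]])
  show "1 \<in> sprod K H" using sprodI[of 1 K 1 H] K(1) H(1) by (simp add: sgrpD)
  fix x y assume x: "x \<in> sprod K H" and y: "y \<in> sprod K H"
  obtain k h where kh: "k \<in> K" "h \<in> H" "x = k * h" using x by (rule sprodE)
  obtain k' h' where kh': "k' \<in> K" "h' \<in> H" "y = k' * h'" using y by (rule sprodE)
  obtain k2 h2 where 2: "k2 \<in> K" "h2 \<in> H" "h * k' = k2 * h2" using p[OF kh(2) kh'(1)] by (rule sprodE)
  have "x * y = k * (h * k') * h'" by (simp add: kh(3) kh'(3) mult.assoc)
  also have "\<dots> = (k * k2) * (h2 * h')" by (simp only: 2(3) mult.assoc)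
  finally show "x * y \<in> sprod K H"
    using sprodI[OF sgrpD(3)[OF K(1) kh(1) 2(1)] sgrpD(3)[OF H(1) 2(2) kh'(2)]] by simp
qed

text \<open>It suffices to move generators past \<open>K\<close>: the elements that can be moved are
  closed under products, and in a finite group this already gives a subgroup.\<close>

lemma permuting_gen:
  assumes G: "sgrp G" and H: "sgrp H" "H \<subseteq> G" "H = gen X" and K: "K \<subseteq> G"
    and p: "\<And>x k. x \<in> X \<Longrightarrow> k \<in> K \<Longrightarrow> x * k \<in> sprod K H"
    and h: "h \<in> H" "k \<in> K"
  shows "h * k \<in> sprod K H"
proof -
  define T where "T = {h \<in> H. \<forall>k\<in>K. h * k \<in> sprod K H}"
  have "sgrp T"
  proof (rule sgrp_closed[OF H(1)])
    show "T \<subseteq> H" by (auto simp: T_def)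
    have "1 * k \<in> sprod K H" if "k \<in> K" for k using sprodI[OF that sgrpD(2)[OF H(1)]] by simp
    then show "1 \<in> T" using sgrpD(2)[OF H(1)] unfolding T_def by blast
    fix x y assume x: "x \<in> T" and y: "y \<in> T"
    have "x * y * k \<in> sprod K H" if k: "k \<in> K" for k
    proof -
      have "y * k \<in> sprod K H" using y k unfolding T_def by blast
      then obtain k1 h1 where 1: "k1 \<in> K" "h1 \<in> H" "y * k = k1 * h1" by (rule sprodE)
      have "x * k1 \<in> sprod K H" using x 1(1) unfolding T_def by blast
      then obtain k2 h2 where 2: "k2 \<in> K" "h2 \<in> H" "x * k1 = k2 * h2" by (rule sprodE)
      have "x * y * k = x * k1 * h1" by (simp only: mult.assoc 1(3))
      also have "\<dots> = k2 * (h2 * h1)" by (simp only: 2(3) mult.assoc)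
      finally show ?thesis using sprodI[OF 2(1) sgrpD(3)[OF H(1) 2(2) 1(2)]] by simp
    qed
    moreover have "x * y \<in> H" using x y sgrpD(3)[OF H(1)] unfolding T_def by blast
    ultimately show "x * y \<in> T" unfolding T_def by blast
  qed
  moreover have "X \<subseteq> T" using p gen_sup[of X] H(3) unfolding T_def by blast
  ultimately have "H \<subseteq> T" unfolding H(3) by (rule gen_least)
  then show ?thesis using h unfolding T_def by blast
qed

lemma pgp_sprod:
  assumes "prime p" "pgp p H" "pgp p K" "sgrp (sprod H K)" shows "pgp p (sprod H K)"
proof -
  obtain a b where ab: "card H = p ^ a" "card K = p ^ b" using assms(2,3) by (auto simp: pgp_def)
  have "card (sprod H K) * card (H \<inter> K) = p ^ (a + b)"
    using card_sprod[of H K] assms(2,3) ab by (simp add: pgp_def power_add)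
  then have "card (sprod H K) dvd p ^ (a + b)" by (metis dvd_triv_left)
  then show ?thesis using assms(1,4) by (metis divides_primepow_nat pgp_def)
qed

lemma solv_one: "solv {1}" by (auto simp: solv_def sgrp_def)

lemma pgp_nil: assumes "prime p" "pgp p H" shows "nil H"
  unfolding nil_def
proof (intro allI impI)
  fix q r x y assume *: "prime q" "prime r" "q \<noteq> r" "x \<in> H" "y \<in> H" "pel q x" "pel r y"
  have "x = 1 \<or> y = 1"
  proof (cases "q = p")
    case True
    then show ?thesis using pel_two[of p y r] pgp_pel[OF assms(2)] * assms(1) by blast
  next
    case False
    then show ?thesis using pel_two[of p x q] pgp_pel[OF assms(2)] * assms(1) by blast
  qed
  then show "x * y = y * x" by auto
qed

lemma prime_power_or_two_primes:
  assumes A: "sgrp A" "nil A" "A \<noteq> {1}"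
  shows "(\<exists>p. prime p \<and> pgp p A) \<or> (\<exists>p q. prime p \<and> prime q \<and> p \<noteq> q \<and> p dvd card A \<and> q dvd card A)"
proof -
  obtain p where p: "prime p" "p dvd card A" using sgrp_prime_dvd[OF A(1,3)] by blast
  show ?thesis
  proof (cases "\<exists>q. prime q \<and> p \<noteq> q \<and> q dvd card A")
    case True
    then show ?thesis using p by blast
  next
    case False
    have "prt p A = A"
    proof (rule prt_subset_all[OF sgrp_prt[OF p(1) A(1,2)] A(1,2) prt_sub])
      fix q :: nat assume q: "prime q"
      show "prt q A \<subseteq> prt p A"
      proof (cases "q = p")
        case False
        then have "prt q A = {1}" using prt_trivial[OF q A(1)] q \<open>\<not> (\<exists>q. _ q)\<close> by blast
        then show ?thesis using sgrpD(2)[OF sgrp_prt[OF p(1) A(1,2)]] by simp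
      qed simp
    qed
    then show ?thesis using pgp_prt[OF p(1) A(1,2)] p(1) by auto
  qed
qed

section \<open>Excluding simple groups with coprime nilpotent factors\<close>

context fac
begin

text \<open>For a nontrivial central z of \<open>A\<close>, the size of the conjugacy class divides
  the index of \<open>A\<close>, which is the order of \<open>B\<close>. So it is a power of r, and
  it is not 1 because the centre of \<open>G\<close> is trivial.\<close>

lemma not_pgp_B: assumes r: "prime r" "pgp r B" shows False
proof -
  obtain p where p: "prime p" "p dvd card A" using sgrp_prime_dvd[OF A(1) neA] by blast
  obtain z where z: "z \<in> Cz A A" "z \<noteq> 1" using nil_centre[OF p(1) A(1,3) p(2)] by blast
  have zA: "z \<in> A" "z \<in> G" using z(1) A(2) by (auto simp: Cz_def)
  have o: "card G = card ((\<lambda>g. cj g z) ` G) * card {g \<in> G. cj g z = z}"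
    by (rule orbit_card[OF G]) (simp_all add: cj_cj cj_one)
  have "{g \<in> G. cj g z = z} = Cz G {z}" by (auto simp: Cz_fix)
  then have sC: "sgrp {g \<in> G. cj g z = z}" using sgrp_Cz[OF G] by simp
  have "A \<subseteq> {g \<in> G. cj g z = z}" using z(1) A(2) by (auto simp: Cz_def cj_fix_iff)
  then obtain m where m: "card {g \<in> G. cj g z = z} = card A * m"
    using sgrp_card_dvd[OF A(1) sC] by (auto elim: dvdE)
  have "card A * card B = card A * (card ((\<lambda>g. cj g z) ` G) * m)"
    using o m card_G by (simp add: ac_simps)
  then have "card B = card ((\<lambda>g. cj g z) ` G) * m" using sgrp_card_pos[OF A(1)] by simp
  then have "card ((\<lambda>g. cj g z) ` G) dvd card B" by simp
  moreover obtain b where "card B = r ^ b" using r(2) by (auto simp: pgp_def)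
  ultimately obtain k where k: "card ((\<lambda>g. cj g z) ` G) = r ^ k" using r(1) by (metis divides_primepow_nat)
  have "k > 0"
  proof (rule ccontr)
    assume "\<not> k > 0"
    then have "card ((\<lambda>g. cj g z) ` G) = 1" using k by simp
    then obtain y where y: "(\<lambda>g. cj g z) ` G = {y}" by (auto simp: card_1_singleton_iff)
    have yz: "cj g z = y" if "g \<in> G" for g using y that by blast
    have "cj g z = z" if "g \<in> G" for g using yz[OF that] yz[OF sgrpD(2)[OF G]] by (simp add: cj_one)
    then have "z \<in> Cz G G" using zA(2) by (auto simp: Cz_def cj_fix_iff)
    then show False using centre_G z(2) by blast
  qed
  then interpret prime_power_class G z r k
    using G simple zA(2) z(2) r(1) k by unfold_locales
  show False by (rule prime_power_class_False)
qed

lemma fac_False: False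
proof -
  have B2: "\<exists>p q. prime p \<and> prime q \<and> p \<noteq> q \<and> p dvd card B \<and> q dvd card B"
    using prime_power_or_two_primes[OF B(1,3) neB] not_pgp_B by blast
  have A2: "\<exists>p q. prime p \<and> prime q \<and> p \<noteq> q \<and> p dvd card A \<and> q dvd card A"
    using prime_power_or_two_primes[OF A(1,3) neA] fac.not_pgp_B[OF fac_swap] by blast
  obtain p q where pq: "prime p" "prime q" "p \<noteq> q" "p dvd card A" "q dvd card A" using A2 by blast
  obtain M where M: "sgrp M \<and> A \<subseteq> M \<and> M \<subseteq> G \<and> M \<noteq> G \<and>
    (\<forall>H. sgrp H \<longrightarrow> A \<subseteq> H \<longrightarrow> H \<subseteq> G \<longrightarrow> H \<noteq> G \<longrightarrow> H \<subseteq> M)"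
    using unique_maximal[OF pq] by (elim exE)
  obtain r s where rs: "prime r" "prime s" "r \<noteq> s" "r dvd card B" "s dvd card B" using B2 by blast
  obtain L where L: "sgrp L \<and> B \<subseteq> L \<and> L \<subseteq> G \<and> L \<noteq> G \<and>
    (\<forall>H. sgrp H \<longrightarrow> B \<subseteq> H \<longrightarrow> H \<subseteq> G \<longrightarrow> H \<noteq> G \<longrightarrow> H \<subseteq> L)"
    using fac.unique_maximal[OF fac_swap rs] by (elim exE)
  have "fac2 G A B M L"
    by (intro fac2.intro fac_axioms fac2_axioms.intro A2 B2) (simp_all add: M L)
  then show False by (rule fac2.fac2_False)
qed

end

section \<open>Reduction of a minimal counterexample to the simple coprime case\<close>

locale kegel =
  fixes G A B :: "gperm set"
  assumes G: "sgrp G" and A: "sgrp A" "A \<subseteq> G" "nil A" and B: "sgrp B" "B \<subseteq> G" "nil B"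
    and fact: "\<And>g. g \<in> G \<Longrightarrow> \<exists>a\<in>A. \<exists>b\<in>B. g = a * b"
    and IH: "\<And>(H::gperm set) X Y. card H < card G \<Longrightarrow> sgrp H \<Longrightarrow> sgrp X \<Longrightarrow> X \<subseteq> H \<Longrightarrow> nil X \<Longrightarrow>
      sgrp Y \<Longrightarrow> Y \<subseteq> H \<Longrightarrow> nil Y \<Longrightarrow> \<forall>h\<in>H. \<exists>x\<in>X. \<exists>y\<in>Y. h = x * y \<Longrightarrow> solv H"
    and not_solv: "\<not> solv G"
begin

lemma facd_solv:
  assumes "sgrp H" "H \<subseteq> G" "H \<noteq> G" "\<forall>h\<in>H. \<exists>a\<in>A \<inter> H. \<exists>b\<in>B \<inter> H. h = a * b" shows "solv H"
proof (rule IH[of H "A \<inter> H" "B \<inter> H"])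
  show "card H < card G" using assms(2,3) sgrpD(1)[OF G] by (simp add: psubset_card_mono psubset_eq)
qed (use assms A B in \<open>auto intro: sgrp_Int nil_sub[of A] nil_sub[of B]\<close>)

text \<open>\<open>IH\<close> ranges over all finite subgroups of \<open>gperm\<close>, not only
  those inside \<open>G\<close>, and so applies to the image, which is again a product of nilpotent
  groups.\<close>

lemma quotient_solv:
  assumes N: "nrml N G" "N \<noteq> {1}" and f: "hom_on f G" "\<forall>x\<in>G. f x = 1 \<longleftrightarrow> x \<in> N"
  shows "solv (f ` G :: gperm set)"
proof (rule IH[of "f ` G" "f ` A" "f ` B"])
  have "card (f ` G) \<noteq> card G"
  proof
    assume "card (f ` G) = card G"
    then have inj: "inj_on f G" using sgrpD(1)[OF G] by (intro eq_card_imp_inj_on)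
    obtain x where x: "x \<in> N" "x \<noteq> 1" using sgrp_nontrivial[OF nrmlD(1)[OF N(1)] N(2)] by blast
    then have "x \<in> G" using nrmlD(2)[OF N(1)] by blast
    then have "f x = f 1" using f x(1) hom_on_one[OF f(1) G] by simp
    then show False using inj_onD[OF inj _ \<open>x \<in> G\<close> sgrpD(2)[OF G]] x(2) by blast
  qed
  then show "card (f ` G) < card G" using card_image_le[OF sgrpD(1)[OF G], of f] by simp
  show "\<forall>h\<in>f ` G. \<exists>x\<in>f ` A. \<exists>y\<in>f ` B. h = x * y"
  proof
    fix h assume "h \<in> f ` G"
    then obtain g where g: "g \<in> G" "h = f g" by blast
    obtain a b where ab: "a \<in> A" "b \<in> B" "g = a * b" using fact[OF g(1)] by blast
    have "f g = f a * f b" unfolding ab(3) using hom_on_mult[OF f(1)] ab(1,2) A(2) B(2) by blast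
    then show "\<exists>x\<in>f ` A. \<exists>y\<in>f ` B. h = x * y" using ab(1,2) g(2) by blast
  qed
  show "sgrp (f ` G)" by (rule sgrp_image[OF f(1) G])
  show "sgrp (f ` A)" by (rule sgrp_image[OF hom_on_sub[OF f(1) A(2)] A(1)])
  show "sgrp (f ` B)" by (rule sgrp_image[OF hom_on_sub[OF f(1) B(2)] B(1)])
  show "nil (f ` A)" by (rule nil_image[OF hom_on_sub[OF f(1) A(2)] A(1,3)])
  show "nil (f ` B)" by (rule nil_image[OF hom_on_sub[OF f(1) B(2)] B(1,3)])
qed (use A(2) B(2) in auto)

lemma not_solv_nrml:
  assumes N: "nrml N G" "N \<noteq> {1}" shows "\<not> solv N"
proof
  assume s: "solv N"
  obtain f :: "gperm \<Rightarrow> gperm" where f: "hom_on f G" "\<forall>x\<in>G. f x = 1 \<longleftrightarrow> x \<in> N" using quotient_hom[OF G N(1)] .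
  have "solv G" by (rule solv_extension[OF f(1) G quotient_solv[OF N f] _ s]) (use f(2) in blast)
  then show False using not_solv by blast
qed

lemma nrml_Int_nontrivial:
  assumes N: "nrml N G" "N \<noteq> {1}" and K: "nrml K G" "K \<noteq> {1}" shows "N \<inter> K \<noteq> {1}"
proof
  assume i: "N \<inter> K = {1}"
  obtain f :: "gperm \<Rightarrow> gperm" where f: "hom_on f G" "\<forall>x\<in>G. f x = 1 \<longleftrightarrow> x \<in> K" using quotient_hom[OF G K(1)] .
  have NG: "N \<subseteq> G" by (rule nrmlD(2)[OF N(1)])
  have "solv N"
  proof (rule solv_extension[OF hom_on_sub[OF f(1) NG] nrmlD(1)[OF N(1)] _ _ solv_one])
    show "solv (f ` N)" by (rule solv_sub[OF quotient_solv[OF K f] image_mono[OF NG]])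
    fix x assume "x \<in> N" "f x = 1" then show "x \<in> {1}" using f(2) NG i by blast
  qed
  then show False using not_solv_nrml[OF N] by blast
qed

lemma pgp_nrml_trivial: "prime p \<Longrightarrow> pgp p N \<Longrightarrow> nrml N G \<Longrightarrow> N = {1}"
  using not_solv_nrml nil_imp_solv pgp_nil by blast

text \<open>A nontrivial centralizer of \<open>N\<close> would be a normal subgroup meeting \<open>N\<close> in an abelian group.\<close>

lemma Cz_nrml_trivial:
  assumes N: "nrml N G" "N \<noteq> {1}" shows "Cz G N = {1}"
proof (rule ccontr)
  assume C: "Cz G N \<noteq> {1}"
  have n: "nrml (Cz G N) G" by (rule nrml_Cz[OF G N(1)])
  have "nil (N \<inter> Cz G N)"
    unfolding nil_def
  proof (intro allI impI)
    fix x y assume "x \<in> N \<inter> Cz G N" "y \<in> N \<inter> Cz G N"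
    then have "y * x = x * y" unfolding Cz_def by blast
    then show "x * y = y * x" by (rule sym)
  qed
  then have "solv (N \<inter> Cz G N)" by (rule nil_imp_solv)
  with not_solv_nrml[OF nrml_Int2[OF N(1) n] nrml_Int_nontrivial[OF N n C]] show False by (rule notE)
qed

lemma sprod_AB: "sprod A B = G"
proof
  show "sprod A B \<subseteq> G" by (rule sprod_sub[OF G A(2) B(2)])
  show "G \<subseteq> sprod A B"
  proof
    fix g assume "g \<in> G"
    then obtain a b where "a \<in> A" "b \<in> B" "g = a * b" using fact by blast
    then show "g \<in> sprod A B" using sprodI by blast
  qed
qed

text \<open>Since G = BA, conjugation by elements of the factors brings the p-parts of both factors
  into one Sylow subgroup \<open>T\<close> of \<open>G\<close> without changing them. Counting shows
  that their product is all of \<open>T\<close>. For g = a'b' only conjugation by a' matters, and it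
  fixes the p-part of \<open>A\<close>.\<close>

lemma syl_product:
  assumes p: "prime p" and g: "g \<in> G"
  shows "sgrp (sprod (prt p A) (cj g ` prt p B))"
proof -
  let ?X = "prt p A" and ?Y = "prt p B"
  have X: "syl p ?X A" "pgp p ?X" "sgrp ?X" "?X \<subseteq> G" and Y: "syl p ?Y B" "pgp p ?Y" "sgrp ?Y" "?Y \<subseteq> G"
    using prt_syl[OF p] pgp_prt[OF p] sgrp_prt[OF p] A B prt_sub by blast+
  obtain S0 where S0: "syl p S0 G" using syl_exists[OF p G] .
  obtain h where h: "h \<in> G" "?X \<subseteq> cj h ` S0" using syl_conj_sub[OF p G S0 X(2,4)] .
  define S where "S = cj h ` S0"
  have S: "syl p S G" unfolding S_def by (rule syl_cj[OF G S0 h(1)])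
  obtain k where k: "k \<in> G" "?Y \<subseteq> cj k ` S" using syl_conj_sub[OF p G S Y(2,4)] .
  obtain b a where ba: "b \<in> B" "a \<in> A" "k = b * a"
  proof -
    obtain a b where ab: "a \<in> A" "b \<in> B" "inverse k = a * b" using fact[OF sgrpD(4)[OF G k(1)]] by blast
    have "k = inverse (inverse k)" by (simp add: inv_inv)
    also have "\<dots> = inverse b * inverse a" unfolding ab(3) by (simp add: inv_mult)
    finally show ?thesis using that sgrpD(4)[OF A(1) ab(1)] sgrpD(4)[OF B(1) ab(2)] by blast
  qed
  have inv: "cj a ` ?X = ?X" if "a \<in> A" for a by (rule prt_cj[OF cj_image_self[OF A(1) that]])
  have invB: "cj b ` ?Y = ?Y" if "b \<in> B" for b by (rule prt_cj[OF cj_image_self[OF B(1) that]])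
  define T where "T = cj a ` S"
  have T: "syl p T G" unfolding T_def using syl_cj[OF G S] ba(2) A(2) by blast
  have XT: "?X \<subseteq> T" unfolding T_def using image_mono[OF h(2), of "cj a"] inv[OF ba(2)] by (simp add: S_def)
  have YT: "?Y \<subseteq> T"
  proof -
    have "cj (inverse b) ` ?Y \<subseteq> cj (inverse b) ` cj k ` S" using k(2) by (rule image_mono)
    then show ?thesis using invB[OF sgrpD(4)[OF B(1) ba(1)]] unfolding T_def cj_image_cj ba(3)
      by (simp add: inv_cancel_left)
  qed
  have XYT: "sprod ?X ?Y \<subseteq> T" by (rule sprod_sub[OF sylD(1)[OF T] XT YT])
  have finT: "finite T" using sylD(1)[OF T] by (simp add: sgrpD)
  have "card T \<le> card (sprod ?X ?Y)"
  proof -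
    let ?I = "A \<inter> B"
    have sI: "sgrp ?I" by (rule sgrp_Int[OF A(1) B(1)])
    have e1: "card (sprod ?X ?Y) * card (?X \<inter> ?Y) = card ?X * card ?Y" by (rule card_sprod[OF X(3) Y(3)])
    have e2: "card G * card ?I = card A * card B" using card_sprod[OF A(1) B(1)] by (simp add: sprod_AB)
    have m: "multiplicity p (card G) + multiplicity p (card ?I) = multiplicity p (card A) + multiplicity p (card B)"
      using arg_cong[OF e2, of "multiplicity p"] p sgrp_card_pos[OF G] sgrp_card_pos[OF A(1)]
        sgrp_card_pos[OF B(1)] sgrp_card_pos[OF sI] by (simp add: prime_elem_multiplicity_mult_distrib)
    have c: "card (?X \<inter> ?Y) dvd p ^ multiplicity p (card ?I)"
    proof (rule pgp_sub_card[OF p _ _ sI])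
      show "pgp p (?X \<inter> ?Y)" by (rule pgp_sub[OF p X(2) sgrp_Int[OF X(3) Y(3)]]) simp
      show "?X \<inter> ?Y \<subseteq> ?I" using prt_sub by blast
    qed
    have "card T * p ^ multiplicity p (card ?I) = card ?X * card ?Y"
      using sylD(4)[OF T] sylD(4)[OF X(1)] sylD(4)[OF Y(1)] m by (simp flip: power_add)
    also have "\<dots> = card (sprod ?X ?Y) * card (?X \<inter> ?Y)" using e1 by simp
    also have "\<dots> \<le> card (sprod ?X ?Y) * p ^ multiplicity p (card ?I)"
      using dvd_imp_le[OF c] prime_gt_0_nat[OF p] by simp
    finally show ?thesis using prime_gt_0_nat[OF p] by simp
  qed
  then have XYeq: "sprod ?X ?Y = T" using XYT finT by (simp add: card_seteq)
  obtain a' b' where ab': "a' \<in> A" "b' \<in> B" "g = a' * b'" using fact[OF g] by blast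
  have "cj g ` ?Y = cj a' ` ?Y" using invB[OF ab'(2)] by (simp add: ab'(3) cj_image_cj[symmetric])
  moreover have "cj a' ` sprod ?X ?Y = sprod (cj a' ` ?X) (cj a' ` ?Y)"
    unfolding sprod_def by (force simp: cj_mult)
  ultimately have "sprod ?X (cj g ` ?Y) = cj a' ` T" using inv[OF ab'(1)] XYeq by simp
  then show ?thesis using sgrp_cj[OF sylD(1)[OF T]] by simp
qed

text \<open>After conjugation by the inverse of g, the product in question is one of the subgroups
  of \<open>syl_product\<close>. Taking inverses in a subgroup of the form XY reverses the order of
  the factors.\<close>

lemma conj_permute:
  assumes p: "prime p" and g: "g \<in> G" "k \<in> G" and x: "x \<in> cj g ` prt p A" and y: "y \<in> cj k ` prt p B"
  shows "x * y \<in> sprod (cj k ` prt p B) (cj g ` prt p A)"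
proof -
  let ?h = "inverse g * k"
  have h: "?h \<in> G" using g G by (simp add: sgrpD)
  have W: "sgrp (sprod (prt p A) (cj ?h ` prt p B))" by (rule syl_product[OF p h])
  have x': "cj (inverse g) x \<in> prt p A" using x by (simp add: in_cj_image)
  have y': "cj (inverse g) y \<in> cj ?h ` prt p B" using y by (simp add: in_cj_image cj_cj grp)
  have "cj (inverse g) (x * y) \<in> sprod (prt p A) (cj ?h ` prt p B)"
    unfolding cj_mult by (rule sprodI[OF x' y'])
  then have "inverse (cj (inverse g) (x * y)) \<in> sprod (prt p A) (cj ?h ` prt p B)" by (rule sgrpD(4)[OF W])
  then obtain u v where uv: "u \<in> prt p A" "v \<in> cj ?h ` prt p B" "inverse (cj (inverse g) (x * y)) = u * v"
    by (rule sprodE)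
  have "inverse (inverse (cj (inverse g) (x * y))) = inverse v * inverse u" unfolding uv(3) by (rule inv_mult)
  then have "cj g (cj (inverse g) (x * y)) = cj g (inverse v * inverse u)" by (simp only: inv_inv)
  then have e: "x * y = cj g (inverse v) * cj g (inverse u)" by (simp only: cj_cancel cj_mult)
  have sA: "sgrp (prt p A)" by (rule sgrp_prt[OF p A(1,3)])
  have sB: "sgrp (cj ?h ` prt p B)" by (rule sgrp_cj[OF sgrp_prt[OF p B(1,3)]])
  have "cj g (inverse u) \<in> cj g ` prt p A" using sgrpD(4)[OF sA uv(1)] by blast
  moreover have "cj g (inverse v) \<in> cj k ` prt p B"
    using sgrpD(4)[OF sB uv(2)] by (simp add: in_cj_image cj_cj grp)
  ultimately show ?thesis unfolding e by (intro sprodI)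
qed

text \<open>\<open>H\<close> is a maximal \<open>p\<close>-subgroup among those generated by conjugates of \<open>prt p A\<close>. It permutes with
  every conjugate of \<open>prt p B\<close>, and by maximality is normalized by them.\<close>

lemma normalized_subgroup:
  assumes p: "prime p"
  obtains H where "pgp p H" "H \<subseteq> G" "card (prt p A) \<le> card H"
    "\<forall>k\<in>G. \<forall>y\<in>cj k ` prt p B. cj y ` H = H"
proof -
  let ?X = "prt p A" and ?Y = "prt p B"
  define U where "U H = \<Union>{cj g ` ?X | g. g \<in> G \<and> cj g ` ?X \<subseteq> H}" for H
  define Fam where "Fam = {H. pgp p H \<and> H \<subseteq> G \<and> H = gen (U H)}"
  have X: "pgp p ?X" "?X \<subseteq> G" "sgrp ?X" using pgp_prt[OF p A(1,3)] prt_sub A(2) sgrp_prt[OF p A(1,3)] by blast+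
  have Y: "pgp p ?Y" "?Y \<subseteq> G" "sgrp ?Y" using pgp_prt[OF p B(1,3)] prt_sub B(2) sgrp_prt[OF p B(1,3)] by blast+
  have U_sub: "U H \<subseteq> H" for H by (auto simp: U_def)
  have "?X \<subseteq> U ?X" unfolding U_def using sgrpD(2)[OF G] cj_image_one[of ?X] by blast
  then have "gen (U ?X) = ?X" using gen_least[OF X(3) U_sub] gen_sup[of "U ?X"] by blast
  then have XF: "?X \<in> Fam" using X by (simp add: Fam_def)
  have "finite Fam" by (rule finite_subset[of _ "Pow G"]) (use sgrpD(1)[OF G] in \<open>auto simp: Fam_def\<close>)
  then obtain H where H: "H \<in> Fam" and max: "\<forall>L\<in>Fam. card L \<le> card H"
    using finite_max_exists[of Fam ?X card] XF by blast
  have Hp: "pgp p H" "H \<subseteq> G" "H = gen (U H)" using H unfolding Fam_def by blast+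
  have sH: "sgrp H" using Hp(1) by (simp add: pgp_def)
  have norm: "cj y ` H = H" if k: "k \<in> G" and y: "y \<in> cj k ` ?Y" for k y
  proof -
    let ?Yk = "cj k ` ?Y"
    have Yk: "sgrp ?Yk" "pgp p ?Yk" "?Yk \<subseteq> G"
      using sgrp_cj[OF Y(3)] pgp_cj[OF Y(1)] Y(2) cj_image_self[OF G k] by blast+
    have perm: "h * v \<in> sprod ?Yk H" if "h \<in> H" "v \<in> ?Yk" for h v
    proof (rule permuting_gen[OF G sH Hp(2,3) Yk(3) _ that])
      fix x v assume x: "x \<in> U H" and v: "v \<in> ?Yk"
      obtain g where g: "g \<in> G" "cj g ` ?X \<subseteq> H" "x \<in> cj g ` ?X" using x by (auto simp: U_def)
      have "x * v \<in> sprod ?Yk (cj g ` ?X)" by (rule conj_permute[OF p g(1) k g(3) v])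
      then obtain a b where "a \<in> ?Yk" "b \<in> cj g ` ?X" "x * v = a * b" by (rule sprodE)
      then show "x * v \<in> sprod ?Yk H" using sprodI[of a ?Yk b H] g(2) by auto
    qed
    define W where "W = sprod ?Yk H"
    have sW: "sgrp W" unfolding W_def by (rule sgrp_permuting_sprod[OF G sH Hp(2) Yk(1,3) perm])
    have pW: "pgp p W" unfolding W_def by (rule pgp_sprod[OF p Yk(2) Hp(1) sW[unfolded W_def]])
    have WG: "W \<subseteq> G" unfolding W_def by (rule sprod_sub[OF G Yk(3) Hp(2)])
    have HW: "H \<subseteq> W" unfolding W_def by (rule sprod_right[OF sgrpD(2)[OF Yk(1)]])
    have YW: "?Yk \<subseteq> W" unfolding W_def by (rule sprod_left[OF sgrpD(2)[OF sH]])
    \<comment> \<open>Generated by all conjugates of \<open>?X\<close> inside the p-group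
      \<open>W\<close>, so it belongs to the family and contains \<open>H\<close>. By maximality it
      is \<open>H\<close>. Conjugation by y, an element of \<open>W\<close>, permutes these
      conjugates and therefore preserves \<open>H\<close>.\<close>
    define M where "M = gen (U W)"
    have sM: "sgrp M" unfolding M_def by (rule sgrp_gen[OF sW U_sub])
    have MW: "M \<subseteq> W" unfolding M_def by (rule gen_least[OF sW U_sub])
    have UWM: "U W \<subseteq> M" unfolding M_def by (rule gen_sup)
    have "U M = U W"
    proof
      show "U M \<subseteq> U W" unfolding U_def using MW by blast
      show "U W \<subseteq> U M"
      proof
        fix x assume "x \<in> U W"
        then obtain g where g: "g \<in> G" "cj g ` ?X \<subseteq> W" "x \<in> cj g ` ?X" by (auto simp: U_def)
        then have "cj g ` ?X \<subseteq> U W" unfolding U_def by blast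
        then have "cj g ` ?X \<subseteq> M" using UWM by blast
        then show "x \<in> U M" unfolding U_def using g by blast
      qed
    qed
    then have "M = gen (U M)" by (simp add: M_def)
    then have "M \<in> Fam" unfolding Fam_def using pgp_sub[OF p pW sM MW] MW WG by blast
    then have cM: "card M \<le> card H" using max by blast
    have "U H \<subseteq> U W" unfolding U_def using HW by blast
    then have "U H \<subseteq> M" using UWM by blast
    then have "gen (U H) \<subseteq> M" by (rule gen_least[OF sM])
    then have HM: "H = M" using cM Hp(3) sgrpD(1)[OF sM] by (simp add: card_seteq)
    have yG: "y \<in> G" using Yk(3) y by blast
    have "U H \<subseteq> cj (inverse y) ` M"
    proof
      fix x assume "x \<in> U H"
      then obtain g where g: "g \<in> G" "cj g ` ?X \<subseteq> H" "x \<in> cj g ` ?X" by (auto simp: U_def)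
      have "cj y ` cj g ` ?X \<subseteq> cj y ` W" using g(2) HW by blast
      also have "cj y ` W = W" using cj_image_self[OF sW] YW y by blast
      finally have "cj (y * g) ` ?X \<subseteq> W" by (simp add: cj_image_cj)
      then have "cj (y * g) ` ?X \<subseteq> U W" unfolding U_def using sgrpD(3)[OF G yG g(1)] by blast
      then have "cj y ` cj g ` ?X \<subseteq> M" using UWM by (simp add: cj_image_cj)
      then have "cj y x \<in> M" using g(3) by blast
      then show "x \<in> cj (inverse y) ` M" by (simp add: in_cj_image inv_inv)
    qed
    then have "gen (U H) \<subseteq> cj (inverse y) ` M" by (rule gen_least[OF sgrp_cj[OF sM]])
    then have sub: "H \<subseteq> cj (inverse y) ` H" using Hp(3) HM by simp
    show ?thesis
    proof (rule cj_image_eqI[OF sgrpD(1)[OF sH]])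
      fix x assume "x \<in> H"
      then have "x \<in> cj (inverse y) ` H" using sub by blast
      then show "cj y x \<in> H" by (simp add: in_cj_image inv_inv)
    qed
  qed
  then have "\<forall>k\<in>G. \<forall>y\<in>cj k ` ?Y. cj y ` H = H" by blast
  moreover have "card ?X \<le> card H" using max XF by blast
  ultimately show ?thesis using that Hp(1,2) by blast
qed

text \<open>Let N be the normal closure of the p-part of \<open>B\<close>; it normalizes the p-group
  H of \<open>normalized_subgroup\<close>. Every conjugate of H \<inter> N lies in one Sylow
  p-subgroup of N, so H \<inter> N lies in a normal p-subgroup of \<open>G\<close> and is trivial.
  Then H centralizes N and is trivial, although it is at least as large as the p-part of
  \<open>A\<close>.\<close>

lemma coprime_cards: "coprime (card A) (card B)"
proof (rule ccontr)
  assume "\<not> coprime (card A) (card B)"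
  then obtain p where p: "prime p" "p dvd card A" "p dvd card B" by (rule not_coprime_prime)
  let ?Y = "prt p B"
  obtain H where H: "pgp p H" "H \<subseteq> G" "card (prt p A) \<le> card H"
    and norm: "\<forall>k\<in>G. \<forall>y\<in>cj k ` ?Y. cj y ` H = H" using normalized_subgroup[OF p(1)] .
  have sH: "sgrp H" using H(1) by (simp add: pgp_def)
  have Y: "?Y \<subseteq> G" "?Y \<noteq> {1}" using prt_sub B(2) prt_nontrivial[OF p(1) B(1) p(3)] by blast+
  define V where "V = (\<Union>k\<in>G. cj k ` ?Y)"
  define N where "N = gen V"
  have VG: "V \<subseteq> G" unfolding V_def using Y(1) cj_image_self[OF G] by blast
  have finV: "finite V" using VG sgrpD(1)[OF G] finite_subset by blast
  have N: "nrml N G" unfolding N_def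
  proof (rule nrml_gen[OF G VG], rule cj_image_eqI[OF finV])
    fix g x assume g: "g \<in> G" and "x \<in> V"
    then obtain k where k: "k \<in> G" "x \<in> cj k ` ?Y" by (auto simp: V_def)
    have "cj g x \<in> cj (g * k) ` ?Y" using k(2) by (simp add: cj_image_cj[symmetric])
    then show "cj g x \<in> V" unfolding V_def using sgrpD(3)[OF G g k(1)] by blast
  qed
  have sN: "sgrp N" and NG: "N \<subseteq> G" using nrmlD[OF N] by blast+
  have "?Y \<subseteq> V" unfolding V_def using sgrpD(2)[OF G] cj_image_one[of ?Y] by blast
  then have "?Y \<subseteq> N" using gen_sup[of V] by (simp add: N_def)
  then have N1: "N \<noteq> {1}" using Y(2) sgrpD(2)[OF sgrp_prt[OF p(1) B(1,3)]] by blast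
  have "V \<subseteq> Nz G H" using norm VG unfolding V_def Nz_def by blast
  then have NN: "N \<subseteq> Nz G H" unfolding N_def by (rule gen_least[OF sgrp_Nz[OF G]])
  define Q where "Q = H \<inter> N"
  have sQ: "sgrp Q" unfolding Q_def by (rule sgrp_Int[OF sH sN])
  have pQ: "pgp p Q" by (rule pgp_sub[OF p(1) H(1) sQ]) (simp add: Q_def)
  have QN: "cj n ` Q = Q" if n: "n \<in> N" for n
  proof (rule cj_image_eqI[OF sgrpD(1)[OF sQ]])
    fix x assume x: "x \<in> Q"
    have "cj n ` H = H" using n NN by (auto simp: Nz_def)
    then have "cj n x \<in> H" using x by (auto simp: Q_def)
    then show "cj n x \<in> Q" using cj_in[OF sN n] x by (simp add: Q_def)
  qed
  obtain S where S: "syl p S N" using syl_exists[OF p(1) sN] .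
  have QS: "cj g ` Q \<subseteq> S" if g: "g \<in> G" for g
  proof -
    have gQ: "cj g ` Q \<subseteq> N" using nrmlD(4)[OF N g] by (auto simp: Q_def)
    obtain n where n: "n \<in> N" "cj g ` Q \<subseteq> cj n ` S" using syl_conj_sub[OF p(1) sN S pgp_cj[OF pQ] gQ] .
    let ?m = "cj (inverse g) (inverse n)"
    have m: "?m \<in> N" using nrmlD(4)[OF N sgrpD(4)[OF G g] sgrpD(4)[OF sN n(1)]] .
    have "inverse n * g = g * ?m" by (simp add: cj_def grp)
    then have "cj (inverse n) ` cj g ` Q = cj g ` cj ?m ` Q" by (simp only: cj_image_cj)
    then have "cj (inverse n) ` cj g ` Q = cj g ` Q" by (simp only: QN[OF m])
    moreover have "cj (inverse n) ` cj g ` Q \<subseteq> cj (inverse n) ` cj n ` S" by (rule image_mono[OF n(2)])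
    ultimately show ?thesis by (simp add: cj_image_cj left_inv cj_image_one)
  qed
  have "Q \<subseteq> core G S"
  proof
    fix x assume x: "x \<in> Q"
    have "cj g x \<in> S" if "g \<in> G" for g using QS[OF that] x by blast
    then show "x \<in> core G S" using x H(2) by (auto simp: core_def Q_def)
  qed
  moreover have "core G S = {1}"
  proof (rule pgp_nrml_trivial[OF p(1) _ nrml_core[OF G sylD(1)[OF S]]])
    show "pgp p (core G S)"
      by (rule pgp_sub[OF p(1) sylD(3)[OF S] nrmlD(1)[OF nrml_core[OF G sylD(1)[OF S]]] core_sub[OF G]])
  qed
  ultimately have Q1: "H \<inter> N \<subseteq> {1}" by (simp add: Q_def)
  have "nrml H (Nz G H)" by (rule nrml_Nz[OF G sH H(2)])
  moreover have "nrml N (Nz G H)" by (rule nrml_mono[OF N NN Nz_sub])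
  ultimately have "h * n = n * h" if "h \<in> H" "n \<in> N" for h n using nrml_commute Q1 that by blast
  then have "H \<subseteq> Cz G N" using H(2) unfolding Cz_def by blast
  then have "H \<subseteq> {1}" using Cz_nrml_trivial[OF N N1] by simp
  then have "card H \<le> 1" using card_mono[of "{1}" H] by simp
  then have "card (prt p A) = 1" using H(3) sgrp_card_pos[OF sgrp_prt[OF p(1) A(1,3)]] by linarith
  then show False using sgrp_card_1[OF sgrp_prt[OF p(1) A(1,3)]] prt_nontrivial[OF p(1) A(1) p(2)] by blast
qed

text \<open>A subgroup containing one factor is factorized, so if it were proper it would be
  solvable, and \<open>N\<close> with it.\<close>

lemma over_nrml:
  assumes N: "nrml N G" "N \<noteq> {1}" and H: "sgrp H" "H \<subseteq> G" "N \<subseteq> H" and AB: "A \<subseteq> H \<or> B \<subseteq> H"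
  shows "H = G"
proof (rule ccontr)
  assume ne: "H \<noteq> G"
  have "\<exists>a\<in>A \<inter> H. \<exists>b\<in>B \<inter> H. h = a * b" if h: "h \<in> H" for h
  proof -
    obtain a b where ab: "a \<in> A" "b \<in> B" "h = a * b" using fact h H(2) by blast
    have "a \<in> H \<or> b \<in> H" using AB ab(1,2) by blast
    then have "a \<in> H \<and> b \<in> H" using sgrp_mult_iff[OF H(1)] h unfolding ab(3) by blast
    then show ?thesis using ab by blast
  qed
  then have "solv H" using facd_solv[OF H(1,2) ne] by blast
  then have "solv N" by (rule solv_sub[OF _ H(3)])
  then show False using not_solv_nrml[OF N] by blast
qed

lemma card_dvd_of_over:
  assumes N: "nrml N G" and X: "sgrp X" "X \<subseteq> G" and XN: "sprod X N = G" and m: "card G = m * card N"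
  shows "m dvd card X"
proof -
  have "m * card (X \<inter> N) * card N = card X * card N"
    using card_sprod[OF X(1) nrmlD(1)[OF N]] m XN by (simp add: ac_simps)
  then have "card X = m * card (X \<inter> N)" using sgrp_card_pos[OF nrmlD(1)[OF N]] by simp
  then show ?thesis by simp
qed

text \<open>For a nontrivial normal N, both products AN and BN are \<open>G\<close>. So the index of
  N divides both coprime orders.\<close>

lemma simple: assumes N: "nrml N G" shows "N = {1} \<or> N = G"
proof (rule disjCI)
  assume ne: "N \<noteq> G"
  show "N = {1}"
  proof (rule ccontr)
    assume N1: "N \<noteq> {1}"
    note sN = nrmlD(1)[OF N] and NG = nrmlD(2)[OF N]
    have over: "sprod X N = G" if X: "sgrp X" "X \<subseteq> G" "X = A \<or> X = B" for X
    proof (rule over_nrml[OF N N1])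
      show "sgrp (sprod X N)" by (rule sgrp_sprod[OF X(1) sN]) (use nrmlD(3)[OF N] X(2) in blast)
      show "sprod X N \<subseteq> G" by (rule sprod_sub[OF G X(2) NG])
      show "N \<subseteq> sprod X N" by (rule sprod_right[OF sgrpD(2)[OF X(1)]])
      show "A \<subseteq> sprod X N \<or> B \<subseteq> sprod X N" using sprod_left[OF sgrpD(2)[OF sN], of X] X(3) by blast
    qed
    obtain m where m: "card G = card N * m" using sgrp_card_dvd[OF sN G NG] by (elim dvdE)
    then have m': "card G = m * card N" by simp
    have "m dvd card A" "m dvd card B"
      using card_dvd_of_over[OF N _ _ over m'] A(1,2) B(1,2) by blast+
    then have "m = 1" using coprime_cards by (metis coprime_common_divisor_nat)
    then have "N = G" using m card_subset_eq[OF sgrpD(1)[OF G] NG] by simp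
    then show False using ne by blast
  qed
qed

lemma kegel_False: False
proof -
  have ne: "X \<noteq> {1}" if X: "X = A \<and> Y = B \<or> X = B \<and> Y = A" for X Y
  proof
    assume x: "X = {1}"
    have "G \<subseteq> Y"
    proof
      fix g assume "g \<in> G"
      then obtain a b where "a \<in> A" "b \<in> B" "g = a * b" using fact by blast
      then show "g \<in> Y" using X x by auto
    qed
    moreover have "nil Y" using X A(3) B(3) by blast
    ultimately have "solv G" using nil_imp_solv nil_sub by blast
    then show False using not_solv by blast
  qed
  have "fac G A B"
    by (intro fac.intro G A B fact coprime_cards simple facd_solv ne[of A B] ne[of B A] disjI1 disjI2 conjI refl)
  then show False by (rule fac.fac_False)
qed

end

theorem kegel_wielandt:
  fixes G :: "gperm set"
  assumes "sgrp G" "sgrp A" "A \<subseteq> G" "nil A" "sgrp B" "B \<subseteq> G" "nil B" "\<forall>g\<in>G. \<exists>a\<in>A. \<exists>b\<in>B. g = a * b"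
  shows "solv G"
  using assms
proof (induction "card G" arbitrary: G A B rule: less_induct)
  case less
  show ?case
  proof (rule ccontr)
    assume "\<not> solv G"
    then have "kegel G A B" by (intro kegel.intro) (use less in blast)+
    then show False by (rule kegel.kegel_False)
  qed
qed

section \<open>Nilpotent groups by their lower central series\<close>

primrec lcs :: "'a::mgroup set \<Rightarrow> nat \<Rightarrow> 'a set" where
  "lcs H 0 = H"
| "lcs H (Suc n) = gen ((\<lambda>(x, y). x * y * inverse x * inverse y) ` (lcs H n \<times> H))"

lemma nrml_lcs: assumes H: "sgrp H" shows "nrml (lcs H n) H"
proof (induction n)
  case 0 then show ?case by (simp add: nrml_self[OF H])
next
  case (Suc n)
  let ?X = "(\<lambda>(x, y). x * y * inverse x * inverse y) ` (lcs H n \<times> H)"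
  have sub: "?X \<subseteq> H"
  proof
    fix c assume "c \<in> ?X"
    then obtain x y where xy: "x \<in> lcs H n" "y \<in> H" "c = x * y * inverse x * inverse y" by auto
    have "x \<in> H" using nrmlD(2)[OF Suc] xy(1) by blast
    then show "c \<in> H" unfolding xy(3) using H xy(2) by (simp add: sgrpD)
  qed
  have fin: "finite ?X" using finite_subset[OF sub] H by (simp add: sgrpD)
  show ?case unfolding lcs.simps
  proof (rule nrml_gen[OF H sub], rule cj_image_eqI[OF fin])
    fix g c assume g: "g \<in> H" and "c \<in> ?X"
    then obtain x y where xy: "x \<in> lcs H n" "y \<in> H" "c = x * y * inverse x * inverse y" by auto
    have "cj g c = cj g x * cj g y * inverse (cj g x) * inverse (cj g y)"
      by (simp add: xy(3) cj_mult cj_inv)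
    moreover have "(cj g x, cj g y) \<in> lcs H n \<times> H" using nrmlD(4)[OF Suc g xy(1)] cj_in[OF H g xy(2)] by simp
    ultimately show "cj g c \<in> ?X" by (metis (no_types, lifting) case_prod_conv image_eqI)
  qed
qed

lemma lcs_image:
  assumes f: "hom_on f H" and H: "sgrp H" shows "f ` lcs H n = lcs (f ` H) n"
proof (induction n)
  case (Suc n)
  let ?c = "\<lambda>(x, y). x * y * inverse x * inverse y"
  have LH: "lcs H n \<subseteq> H" by (rule nrmlD(2)[OF nrml_lcs[OF H]])
  have e: "f (x * y * inverse x * inverse y) = f x * f y * inverse (f x) * inverse (f y)"
    if "x \<in> H" "y \<in> H" for x y
    using that f H by (simp add: hom_on_mult hom_on_inv sgrpD)
  have "f ` ?c ` (lcs H n \<times> H) = ?c ` (f ` lcs H n \<times> f ` H)"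
  proof
    show "f ` ?c ` (lcs H n \<times> H) \<subseteq> ?c ` (f ` lcs H n \<times> f ` H)"
    proof
      fix z assume "z \<in> f ` ?c ` (lcs H n \<times> H)"
      then obtain x y where xy: "x \<in> lcs H n" "y \<in> H" "z = f (x * y * inverse x * inverse y)" by auto
      then have "z = ?c (f x, f y)" using e LH by auto
      then show "z \<in> ?c ` (f ` lcs H n \<times> f ` H)" using xy by blast
    qed
    show "?c ` (f ` lcs H n \<times> f ` H) \<subseteq> f ` ?c ` (lcs H n \<times> H)"
    proof
      fix z assume "z \<in> ?c ` (f ` lcs H n \<times> f ` H)"
      then obtain x y where xy: "x \<in> lcs H n" "y \<in> H" "z = ?c (f x, f y)" by auto
      then have "z = f (?c (x, y))" using e LH by auto
      then show "z \<in> f ` ?c ` (lcs H n \<times> H)" using xy by blast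
    qed
  qed
  moreover have "?c ` (lcs H n \<times> H) \<subseteq> H" using LH H by (auto simp: sgrpD subset_iff)
  ultimately show ?case unfolding lcs.simps Suc[symmetric] by (simp add: gen_image[OF f H])
qed simp

lemma pow_mult_commute: "(x::'a::mgroup) * y = y * x \<Longrightarrow> (x * y) ^ n = x ^ n * y ^ n"
proof (induction n)
  case (Suc n)
  have "y * x ^ n = x ^ n * y" using Suc.prems by (metis power_commuting_commutes)
  then have "x * y * (x ^ n * y ^ n) = x * x ^ n * (y * y ^ n)" by (metis mult.assoc)
  then show ?case using Suc by simp
qed simp

text \<open>The last nontrivial term of the series is central, and modulo it the claim holds by
  induction. So the commutator of a p-element and a q-element is central, and as in
  \<open>fitting\<close> both a p-power and a q-power of it are trivial.\<close>

lemma nil_of_lcs: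
  fixes H :: "gperm set"
  assumes "sgrp H" "lcs H n = {1}" shows "nil H"
  using assms
proof (induction n arbitrary: H)
  case 0
  then show ?case by (simp add: nil_def)
next
  case (Suc n)
  note H = Suc.prems(1)
  obtain f :: "gperm \<Rightarrow> gperm" where f: "hom_on f H" "\<forall>x\<in>H. f x = 1 \<longleftrightarrow> x \<in> lcs H n"
    using quotient_hom[OF H nrml_lcs[OF H]] .
  have LH: "lcs H n \<subseteq> H" by (rule nrmlD(2)[OF nrml_lcs[OF H]])
  have "f ` lcs H n = {1}" using f(2) LH sgrpD(2)[OF nrmlD(1)[OF nrml_lcs[OF H]]] by force
  then have nf: "nil (f ` H)" using Suc.IH[OF sgrp_image[OF f(1) H]] lcs_image[OF f(1) H] by simp
  have central: "c * y = y * c" if c: "c \<in> lcs H n" and y: "y \<in> H" for c y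
  proof -
    have "c * y * inverse c * inverse y \<in> lcs H (Suc n)"
      unfolding lcs.simps by (rule subsetD[OF gen_sup]) (use c y in force)
    then have "c * y * inverse c * inverse y * (y * c) = y * c" using Suc.prems(2) by simp
    then show ?thesis by (simp add: grp)
  qed
  show ?case unfolding nil_def
  proof (intro allI impI)
    fix p q x y
    assume pq: "prime p" "prime q" "p \<noteq> q" and xy: "x \<in> H" "y \<in> H" and pel: "pel p x" "pel q y"
    define c where "c = x * y * inverse x * inverse y"
    obtain i where i: "x ^ (p ^ i) = 1" using pel(1) by (auto simp: pel_def)
    obtain j where j: "y ^ (q ^ j) = 1" using pel(2) by (auto simp: pel_def)
    have fp: "f x ^ (p ^ i) = 1" "f y ^ (q ^ j) = 1"
      using hom_on_pow[OF f(1) H] xy i j hom_on_one[OF f(1) H] by metis+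
    then have "pel p (f x)" "pel q (f y)" by (auto simp: pel_def)
    then have "f x * f y = f y * f x" using nf pq xy unfolding nil_def by blast
    then have "f c = f y * f x * inverse (f x) * inverse (f y)"
      using f(1) H xy by (simp add: c_def hom_on_mult hom_on_inv sgrpD)
    then have "f c = 1" by (simp add: grp)
    moreover have "c \<in> H" using H xy by (simp add: c_def sgrpD)
    ultimately have cL: "c \<in> lcs H n" using f(2) by blast
    have "cj x y = c * y" by (simp add: c_def cj_def grp)
    then have "(c * y) ^ (q ^ j) = 1" by (metis cj_pow j cj_one(1))
    then have "pel q c" using pow_mult_commute[OF central[OF cL xy(2)]] j by (auto simp: pel_def)
    have ix: "inverse x ^ n * x ^ n = 1" for n
      using pow_mult_commute[of "inverse x" x n] by (simp add: left_inv right_inv)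
    then have ix1: "inverse x ^ (p ^ i) = 1" using i by (metis mult_1_right)
    have "cj y (inverse x) = inverse x * c" by (simp add: c_def cj_def grp)
    then have "(inverse x * c) ^ (p ^ i) = 1" by (metis cj_pow ix1 cj_one(1))
    moreover have "inverse x * c = c * inverse x" using central[OF cL sgrpD(4)[OF H xy(1)]] by simp
    ultimately have "pel p c" using pow_mult_commute[of "inverse x" c] ix1 by (auto simp: pel_def)
    then have "c = 1" using \<open>pel q c\<close> pel_two pq by blast
    then have "c * (y * x) = y * x" by simp
    then show "x * y = y * x" by (simp add: c_def grp)
  qed
qed

lemma hom_image_props:
  fixes H :: "('a, 'm) monoid_scheme" and h :: "'a \<Rightarrow> 'b::mgroup"
  assumes H: "group H" and h: "\<forall>x\<in>carrier H. \<forall>y\<in>carrier H. h (x \<otimes>\<^bsub>H\<^esub> y) = h x * h y"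
  shows "h \<one>\<^bsub>H\<^esub> = 1" "x \<in> carrier H \<Longrightarrow> h (inv\<^bsub>H\<^esub> x) = inverse (h x)"
    "finite (carrier H) \<Longrightarrow> subgroup I H \<Longrightarrow> sgrp (h ` I)"
    "{x \<in> carrier H. h x = 1} \<lhd> H"
proof -
  interpret group H by fact
  have "h \<one>\<^bsub>H\<^esub> * h \<one>\<^bsub>H\<^esub> = h \<one>\<^bsub>H\<^esub> * 1" using h one_closed by (metis mult_1_right r_one)
  then show one: "h \<one>\<^bsub>H\<^esub> = 1" by (simp only: mul_left_cancel)
  have i: "h (inv\<^bsub>H\<^esub> x) = inverse (h x)" if "x \<in> carrier H" for x
  proof -
    have "h (inv\<^bsub>H\<^esub> x) * h x = inverse (h x) * h x" using h that one by (metis inv_closed l_inv left_inv)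
    then show ?thesis by (simp only: mul_right_cancel)
  qed
  then show "x \<in> carrier H \<Longrightarrow> h (inv\<^bsub>H\<^esub> x) = inverse (h x)" .
  show "sgrp (h ` I)" if fin: "finite (carrier H)" and I: "subgroup I H"
    unfolding sgrp_def
  proof (intro conjI ballI)
    have IH: "I \<subseteq> carrier H" by (rule subgroup.subset[OF I])
    show "finite (h ` I)" using finite_subset[OF IH fin] by simp
    show "1 \<in> h ` I" using subgroup.one_closed[OF I] one by (metis image_eqI)
    fix a assume "a \<in> h ` I"
    then obtain x where x: "x \<in> I" "a = h x" by blast
    then have "inverse a = h (inv\<^bsub>H\<^esub> x)" using i IH by auto
    then show "inverse a \<in> h ` I" using subgroup.m_inv_closed[OF I x(1)] by blast
    fix b assume "b \<in> h ` I"
    then obtain y where y: "y \<in> I" "b = h y" by blast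
    have "x \<in> carrier H" "y \<in> carrier H" using x(1) y(1) IH by blast+
    then have "a * b = h (x \<otimes>\<^bsub>H\<^esub> y)" using h x(2) y(2) by simp
    then show "a * b \<in> h ` I" using subgroup.m_closed[OF I x(1) y(1)] by blast
  qed
  show "{x \<in> carrier H. h x = 1} \<lhd> H"
  proof (rule normal_invI)
    show "subgroup {x \<in> carrier H. h x = 1} H"
      by (rule subgroupI) (use one i h one_closed in \<open>auto simp: grp\<close>)
    fix x n assume x: "x \<in> carrier H" and n: "n \<in> {x \<in> carrier H. h x = 1}"
    then have "h (x \<otimes>\<^bsub>H\<^esub> n \<otimes>\<^bsub>H\<^esub> inv\<^bsub>H\<^esub> x) = h x * h n * h (inv\<^bsub>H\<^esub> x)" using h by simp
    also have "\<dots> = 1" using n i[OF x] by (simp add: right_inv)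
    finally show "x \<otimes>\<^bsub>H\<^esub> n \<otimes>\<^bsub>H\<^esub> inv\<^bsub>H\<^esub> x \<in> {x \<in> carrier H. h x = 1}" using x n by simp
  qed
qed

lemma nil_of_nilpotent_group:
  fixes h :: "'a \<Rightarrow> gperm"
  assumes H: "nilpotent_group H" "finite (carrier H)"
    and h: "\<forall>x\<in>carrier H. \<forall>y\<in>carrier H. h (x \<otimes>\<^bsub>H\<^esub> y) = h x * h y"
  shows "nil (h ` carrier H)"
proof -
  have gH: "group H" using H(1) by (simp add: nilpotent_group_def)
  interpret group H by fact
  note hp = hom_image_props[OF gH h]
  obtain n where n: "lower_central_series H n = {\<one>\<^bsub>H\<^esub>}" using H(1) by (auto simp: nilpotent_group_def)
  have sH: "sgrp (h ` carrier H)" using hp(3)[OF H(2) subgroup_self] .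
  have sub: "subgroup (lower_central_series H k) H \<and> lcs (h ` carrier H) k \<subseteq> h ` lower_central_series H k" for k
  proof (induction k)
    case 0 then show ?case by (simp add: subgroup_self)
  next
    case (Suc k)
    let ?L = "lower_central_series H k"
    let ?X = "\<Union>x\<in>?L. \<Union>y\<in>carrier H. {x \<otimes>\<^bsub>H\<^esub> y \<otimes>\<^bsub>H\<^esub> inv\<^bsub>H\<^esub> x \<otimes>\<^bsub>H\<^esub> inv\<^bsub>H\<^esub> y}"
    have LH: "?L \<subseteq> carrier H" using Suc subgroup.subset by blast
    have sX: "subgroup (generate H ?X) H" by (rule generate_is_subgroup) (use LH in auto)
    have "(\<lambda>(x, y). x * y * inverse x * inverse y) ` (lcs (h ` carrier H) k \<times> h ` carrier H) \<subseteq> h ` generate H ?X"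
    proof
      fix c assume "c \<in> (\<lambda>(x, y). x * y * inverse x * inverse y) ` (lcs (h ` carrier H) k \<times> h ` carrier H)"
      then obtain a b where ab: "a \<in> lcs (h ` carrier H) k" "b \<in> h ` carrier H" "c = a * b * inverse a * inverse b" by auto
      obtain x where x: "x \<in> ?L" "a = h x" using Suc ab(1) by blast
      obtain y where y: "y \<in> carrier H" "b = h y" using ab(2) by blast
      have xH: "x \<in> carrier H" using x(1) LH by blast
      have "c = h (x \<otimes>\<^bsub>H\<^esub> y \<otimes>\<^bsub>H\<^esub> inv\<^bsub>H\<^esub> x \<otimes>\<^bsub>H\<^esub> inv\<^bsub>H\<^esub> y)"
        using h hp(2) xH y by (simp add: ab(3) x(2))
      moreover have "x \<otimes>\<^bsub>H\<^esub> y \<otimes>\<^bsub>H\<^esub> inv\<^bsub>H\<^esub> x \<otimes>\<^bsub>H\<^esub> inv\<^bsub>H\<^esub> y \<in> generate H ?X"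
        by (rule generate.incl) (use x(1) y(1) in blast)
      ultimately show "c \<in> h ` generate H ?X" by blast
    qed
    then have "lcs (h ` carrier H) (Suc k) \<subseteq> h ` generate H ?X"
      unfolding lcs.simps by (rule gen_least[OF hp(3)[OF H(2) sX]])
    then show ?case using sX by simp
  qed
  have "lcs (h ` carrier H) n \<subseteq> {1}" using sub[of n] n hp(1) by simp
  then have "lcs (h ` carrier H) n = {1}" using sgrpD(2)[OF nrmlD(1)[OF nrml_lcs[OF sH]], of n] by blast
  then show ?thesis by (rule nil_of_lcs[OF sH])
qed

section \<open>Skew braces as permutation groups\<close>

lemma (in group) bij_left_mult: "b \<in> carrier G \<Longrightarrow> bij_betw (\<lambda>x. b \<otimes> x) (carrier G) (carrier G)"
  unfolding bij_betw_def using inj_on_cmult surj_const_mult by blast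

text \<open>The last identity is the brace axiom a(b + x) = (ab - a) + ax, read as an equation
  between permutations of the argument x.\<close>

lemma (in skew_brace) permutations:
  assumes fin: "finite (carrier B)"
  obtains t d :: "'a \<Rightarrow> gperm" where
    "\<forall>a\<in>carrier B. \<forall>b\<in>carrier B. t (a \<oplus> b) = t a * t b" "inj_on t (carrier B)"
    "\<forall>a\<in>carrier B. \<forall>b\<in>carrier B. d (a \<otimes> b) = d a * d b" "inj_on d (carrier B)"
    "\<forall>a\<in>carrier B. \<forall>b\<in>carrier B. d a * t b = t (a \<otimes> b) * inverse (t a) * d a"
proof -
  let ?S = "carrier B"
  obtain emb :: "('a \<Rightarrow> 'a) \<Rightarrow> gperm" where
    e1': "\<forall>f g. bij_betw f ?S ?S \<longrightarrow> bij_betw g ?S ?S \<longrightarrow> emb (\<lambda>s. f (g s)) = emb f * emb g" and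
    e2': "\<forall>f g. bij_betw f ?S ?S \<longrightarrow> bij_betw g ?S ?S \<longrightarrow> emb f = emb g \<longleftrightarrow> (\<forall>s\<in>?S. f s = g s)"
    using perm_embedding[OF fin] .
  note e1 = e1'[rule_format] and e2 = e2'[rule_format]
  define t where "t b = emb (\<lambda>x. b \<oplus> x)" for b
  define d where "d b = emb (\<lambda>x. b \<otimes> x)" for b
  have bt: "bij_betw (\<lambda>x. b \<oplus> x) ?S ?S" if "b \<in> ?S" for b using add.bij_left_mult[of b] that by simp
  have bd: "bij_betw (\<lambda>x. b \<otimes> x) ?S ?S" if "b \<in> ?S" for b using mult.bij_left_mult[of b] that by simp
  have ac: "a \<oplus> b \<in> ?S" if "a \<in> ?S" "b \<in> ?S" for a b using add.m_closed[of a b] that by simp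
  have mc: "a \<otimes> b \<in> ?S" if "a \<in> ?S" "b \<in> ?S" for a b using mult.m_closed[of a b] that by simp
  have nc: "\<ominus> a \<in> ?S" if "a \<in> ?S" for a using add.inv_closed[of a] that by (simp add: a_inv_def)
  have t: "t (a \<oplus> b) = t a * t b" if "a \<in> ?S" "b \<in> ?S" for a b
  proof -
    have "t (a \<oplus> b) = emb (\<lambda>x. a \<oplus> (b \<oplus> x))"
      unfolding t_def using that ac bt[OF ac[OF that]] bij_betw_trans[OF bt[OF that(2)] bt[OF that(1)]]
        add.m_assoc[of a b] by (intro e2[THEN iffD2]) (simp_all add: comp_def)
    then show ?thesis unfolding t_def using e1[OF bt[OF that(1)] bt[OF that(2)]] by simp
  qed
  have d: "d (a \<otimes> b) = d a * d b" if "a \<in> ?S" "b \<in> ?S" for a b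
  proof -
    have "d (a \<otimes> b) = emb (\<lambda>x. a \<otimes> (b \<otimes> x))"
      unfolding d_def using that mc bd[OF mc[OF that]] bij_betw_trans[OF bd[OF that(2)] bd[OF that(1)]]
        mult.m_assoc[of a b] by (intro e2[THEN iffD2]) (simp_all add: comp_def)
    then show ?thesis unfolding d_def using e1[OF bd[OF that(1)] bd[OF that(2)]] by simp
  qed
  have z: "\<zero> \<in> ?S" using add.one_closed by simp
  have it: "inj_on t ?S"
  proof (rule inj_onI)
    fix a b assume ab: "a \<in> ?S" "b \<in> ?S" "t a = t b"
    then have "a \<oplus> \<zero> = b \<oplus> \<zero>" using e2[OF bt[OF ab(1)] bt[OF ab(2)]] z by (simp add: t_def)
    then show "a = b" using add.r_one[of a] add.r_one[of b] ab by simp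
  qed
  have id: "inj_on d ?S"
  proof (rule inj_onI)
    fix a b assume ab: "a \<in> ?S" "b \<in> ?S" "d a = d b"
    then have "\<forall>s\<in>?S. a \<otimes> s = b \<otimes> s" using e2[OF bd[OF ab(1)] bd[OF ab(2)]] unfolding d_def by blast
    then have "a \<otimes> \<one> = b \<otimes> \<one>" using mult.one_closed by blast
    then show "a = b" using ab by simp
  qed
  have ti: "t (\<ominus> a) = inverse (t a)" if "a \<in> ?S" for a
    using hom_image_props(2)[of "add_monoid B" t a] t that add.group_axioms by (simp add: a_inv_def)
  have r: "d a * t b = t (a \<otimes> b) * inverse (t a) * d a" if "a \<in> ?S" "b \<in> ?S" for a b
  proof -
    let ?c = "(a \<otimes> b) \<oplus> (\<ominus> a)"
    have c: "?c \<in> ?S" by (rule ac[OF mc[OF that] nc[OF that(1)]])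
    have "emb (\<lambda>x. a \<otimes> (b \<oplus> x)) = emb (\<lambda>x. ?c \<oplus> (a \<otimes> x))"
      using bij_betw_trans[OF bt[OF that(2)] bd[OF that(1)]] bij_betw_trans[OF bd[OF that(1)] bt[OF c]]
        brace_distrib[OF that] by (intro e2[THEN iffD2]) (simp_all add: comp_def)
    then have "d a * t b = t ?c * d a"
      unfolding t_def d_def using e1[OF bd[OF that(1)] bt[OF that(2)]] e1[OF bt[OF c] bd[OF that(1)]] by simp
    then show ?thesis using t[OF mc[OF that] nc[OF that(1)]] ti[OF that(1)] by simp
  qed
  show ?thesis by (rule that[OF _ it _ id]) (intro ballI t d r; assumption)+
qed

section \<open>The permutation group of a simple skew brace\<close>

locale simple_nilpotent_brace = skew_brace B for B (structure) +
  fixes t d :: "'a \<Rightarrow> gperm"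
  assumes fin: "finite (carrier B)" and simple_B: "simple_skew_brace B" and nilpotent_B: "nilpotent_group B"
    and t_add: "\<And>a b. a \<in> carrier B \<Longrightarrow> b \<in> carrier B \<Longrightarrow> t (a \<oplus> b) = t a * t b"
    and t_inj: "inj_on t (carrier B)"
    and d_mult: "\<And>a b. a \<in> carrier B \<Longrightarrow> b \<in> carrier B \<Longrightarrow> d (a \<otimes> b) = d a * d b"
    and d_inj: "inj_on d (carrier B)"
    and d_t: "\<And>a b. a \<in> carrier B \<Longrightarrow> b \<in> carrier B \<Longrightarrow> d a * t b = t (a \<otimes> b) * inverse (t a) * d a"
begin

abbreviation "S \<equiv> carrier B"

definition l :: "'a \<Rightarrow> gperm" where "l a = inverse (t a) * d a"

definition A :: "gperm set" where "A = t ` S"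
definition D :: "gperm set" where "D = d ` S"
definition \<Lambda> :: "gperm set" where "\<Lambda> = l ` S"

lemma add_closed: "a \<in> S \<Longrightarrow> b \<in> S \<Longrightarrow> a \<oplus> b \<in> S" using add.m_closed[of a b] by simp
lemma neg_closed: "a \<in> S \<Longrightarrow> \<ominus> a \<in> S" using add.inv_closed[of a] by (simp add: a_inv_def)
lemma zero_closed: "\<zero> \<in> S" using add.one_closed by simp
lemma mult_closed: "a \<in> S \<Longrightarrow> b \<in> S \<Longrightarrow> a \<otimes> b \<in> S" by (rule mult.m_closed)

lemma t_neg: "a \<in> S \<Longrightarrow> t (\<ominus> a) = inverse (t a)"
  using hom_image_props(2)[of "add_monoid B" t a] t_add add.group_axioms by (simp add: a_inv_def)

lemma t_zero: "t \<zero> = 1"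
  using hom_image_props(1)[of "add_monoid B" t] t_add add.group_axioms by simp

lemma d_eq: "d a = t a * l a" by (simp add: l_def grp)

lemma lambda_closed: "a \<in> S \<Longrightarrow> b \<in> S \<Longrightarrow> brace_lambda B a b \<in> S"
  by (simp add: brace_lambda_def add_closed neg_closed mult_closed)

lemma t_lambda: "a \<in> S \<Longrightarrow> b \<in> S \<Longrightarrow> t (brace_lambda B a b) = cj (l a) (t b)"
proof -
  assume ab: "a \<in> S" "b \<in> S"
  have "cj (l a) (t b) = inverse (t a) * (d a * t b) * inverse (d a) * t a"
    by (simp add: cj_def l_def grp)
  also have "\<dots> = inverse (t a) * t (a \<otimes> b)" unfolding d_t[OF ab] by (simp add: grp)
  also have "\<dots> = t (brace_lambda B a b)"
    unfolding brace_lambda_def using ab by (simp add: t_add t_neg neg_closed mult_closed)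
  finally show ?thesis by simp
qed

lemma t_mult: "a \<in> S \<Longrightarrow> b \<in> S \<Longrightarrow> t (a \<otimes> b) = t a * cj (l a) (t b)"
proof -
  assume ab: "a \<in> S" "b \<in> S"
  have "t (brace_lambda B a b) = inverse (t a) * t (a \<otimes> b)"
    unfolding brace_lambda_def using ab by (simp add: t_add t_neg neg_closed mult_closed)
  then show ?thesis using t_lambda[OF ab] by (simp add: grp)
qed

lemma l_mult: "a \<in> S \<Longrightarrow> b \<in> S \<Longrightarrow> l (a \<otimes> b) = l a * l b"
proof -
  assume ab: "a \<in> S" "b \<in> S"
  have "l (a \<otimes> b) = inverse (cj (l a) (t b)) * inverse (t a) * d a * d b"
    unfolding l_def[of "a \<otimes> b"] t_mult[OF ab] d_mult[OF ab] by (simp add: grp)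
  also have "\<dots> = l a * inverse (t b) * inverse (l a) * l a * d b"
    by (simp add: cj_def l_def[of a] grp)
  also have "\<dots> = l a * l b" by (simp add: l_def[of b] grp)
  finally show ?thesis .
qed

lemma sA: "sgrp A"
  using hom_image_props(3)[of "add_monoid B" t S] t_add add.group_axioms fin add.subgroup_self by (simp add: A_def)

lemma sD: "sgrp D"
  using hom_image_props(3)[of B d S] d_mult mult.group_axioms fin mult.subgroup_self by (simp add: D_def)

lemma sL: "sgrp \<Lambda>"
  using hom_image_props(3)[of B l S] l_mult mult.group_axioms fin mult.subgroup_self by (simp add: \<Lambda>_def)

lemma nil_D: "nil D" unfolding D_def
  by (rule nil_of_nilpotent_group[OF nilpotent_B fin]) (simp add: d_mult)

lemma nil_L: "nil \<Lambda>" unfolding \<Lambda>_def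
  by (rule nil_of_nilpotent_group[OF nilpotent_B fin]) (simp add: l_mult)

lemma l_A: "b \<in> S \<Longrightarrow> cj (l b) ` A = A"
proof (rule cj_image_eqI[OF sgrpD(1)[OF sA]])
  fix x assume b: "b \<in> S" and "x \<in> A"
  then obtain a where a: "a \<in> S" "x = t a" by (auto simp: A_def)
  then have "cj (l b) x = t (brace_lambda B b a)" using t_lambda[OF b a(1)] by simp
  then show "cj (l b) x \<in> A" using lambda_closed[OF b a(1)] by (simp add: A_def)
qed

definition G :: "gperm set" where "G = sprod \<Lambda> A"

lemma sG: "sgrp G" unfolding G_def
proof (rule sgrp_sprod[OF sL sA])
  fix h assume "h \<in> \<Lambda>"
  then obtain b where "b \<in> S" "h = l b" by (auto simp: \<Lambda>_def)
  then show "cj h ` A = A" by (simp add: l_A)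
qed

lemma L_G: "\<Lambda> \<subseteq> G" unfolding G_def by (rule sprod_left[OF sgrpD(2)[OF sA]])
lemma A_G: "A \<subseteq> G" unfolding G_def by (rule sprod_right[OF sgrpD(2)[OF sL]])

lemma t_A: "a \<in> S \<Longrightarrow> t a \<in> A" by (simp add: A_def)
lemma l_L: "a \<in> S \<Longrightarrow> l a \<in> \<Lambda>" by (simp add: \<Lambda>_def)
lemma d_D: "a \<in> S \<Longrightarrow> d a \<in> D" by (simp add: D_def)

lemma D_G: "D \<subseteq> G"
proof
  fix x assume "x \<in> D"
  then obtain a where a: "a \<in> S" "x = t a * l a" by (auto simp: D_def d_eq)
  have "t a \<in> G" "l a \<in> G" using t_A[OF a(1)] l_L[OF a(1)] A_G L_G by blast+
  then show "x \<in> G" unfolding a(2) by (rule sgrpD(3)[OF sG])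
qed

lemma A_nrml: "nrml A G"
proof (rule nrmlI[OF sA A_G])
  fix g x assume g: "g \<in> G" and x: "x \<in> A"
  obtain u a where ua: "u \<in> \<Lambda>" "a \<in> A" "g = u * a" using g unfolding G_def by (rule sprodE)
  obtain b where b: "b \<in> S" "u = l b" using ua(1) by (auto simp: \<Lambda>_def)
  have "cj a x \<in> A" by (rule cj_in[OF sA ua(2) x])
  then have "cj u (cj a x) \<in> cj u ` A" by blast
  then show "cj g x \<in> A" using l_A[OF b(1)] by (simp add: ua(3) b(2) cj_cj)
qed

text \<open>Every product of an element of \<Lambda> and one of \<open>A\<close> can be rewritten
  with the translation first, and \<open>t e\<close> is \<open>d e\<close> times the inverse of
  \<open>l e\<close>. So \<open>G\<close> is the product of \<open>D\<close> and \<Lambda>, both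
  images of the nilpotent multiplicative group.\<close>

lemma solv_A: "solv A"
proof (rule solv_sub[OF kegel_wielandt[OF sG sD D_G nil_D sL L_G nil_L] A_G], rule ballI)
  fix g assume g: "g \<in> G"
  obtain u x where ux: "u \<in> \<Lambda>" "x \<in> A" "g = u * x" using g unfolding G_def by (rule sprodE)
  obtain b where b: "b \<in> S" "u = l b" using ux(1) by (auto simp: \<Lambda>_def)
  have "cj u x \<in> A" using l_A[OF b(1)] ux(2) b(2) by blast
  then obtain e where e: "e \<in> S" "cj u x = t e" by (auto simp: A_def)
  have "g = cj u x * u" by (simp add: ux(3) cj_def grp)
  also have "\<dots> = d e * (inverse (l e) * u)" unfolding e(2) by (simp add: d_eq grp)
  finally have "g = d e * (inverse (l e) * u)" .
  moreover have "inverse (l e) * u \<in> \<Lambda>" using sL l_L[OF e(1)] ux(1) by (simp add: sgrpD)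
  ultimately show "\<exists>a\<in>D. \<exists>b\<in>\<Lambda>. g = a * b" using d_D[OF e(1)] by blast
qed

lemma A_nontrivial: "A \<noteq> {1}"
proof
  assume "A = {1}"
  have "x = \<zero>" if "x \<in> S" for x
  proof -
    have "t x = 1" using t_A[OF that] \<open>A = {1}\<close> by simp
    then show ?thesis using inj_onD[OF t_inj _ that zero_closed] t_zero by simp
  qed
  then have "S = {\<zero>}" using zero_closed by blast
  then show False using simple_B by (simp add: simple_skew_brace_def)
qed

text \<open>The kernel of a map preserving both operations is an ideal. This is the form in which
  the simplicity of the brace is used.\<close>

lemma hom_injective_or_trivial:
  fixes \<phi> :: "'a \<Rightarrow> 'c::mgroup"
  assumes add: "\<forall>a\<in>S. \<forall>b\<in>S. \<phi> (a \<oplus> b) = \<phi> a * \<phi> b" and mult: "\<forall>a\<in>S. \<forall>b\<in>S. \<phi> (a \<otimes> b) = \<phi> a * \<phi> b"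
  shows "inj_on \<phi> S \<or> (\<forall>a\<in>S. \<phi> a = 1)"
proof -
  let ?I = "{x \<in> S. \<phi> x = 1}"
  have neg: "\<phi> (\<ominus> a) = inverse (\<phi> a)" if "a \<in> S" for a
    using hom_image_props(2)[of "add_monoid B" \<phi> a] add that add.group_axioms by (simp add: a_inv_def)
  have n1: "?I \<lhd> add_monoid B" using hom_image_props(4)[of "add_monoid B" \<phi>] add add.group_axioms by simp
  have n2: "?I \<lhd> B" using hom_image_props(4)[of B \<phi>] mult mult.group_axioms by simp
  have lam: "brace_lambda B b ` ?I = ?I" if b: "b \<in> S" for b
  proof (rule card_subset_eq)
    show "finite ?I" using fin by simp
    show "brace_lambda B b ` ?I \<subseteq> ?I"
    proof
      fix y assume "y \<in> brace_lambda B b ` ?I"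
      then obtain x where x: "x \<in> S" "\<phi> x = 1" "y = brace_lambda B b x" by blast
      have "\<phi> y = inverse (\<phi> b) * (\<phi> b * \<phi> x)"
        using add mult neg b x(1) by (simp add: x(3) brace_lambda_def neg_closed mult_closed)
      then show "y \<in> ?I" using x lambda_closed[OF b x(1)] by (simp add: grp)
    qed
    have "inj_on (brace_lambda B b) ?I"
    proof (rule inj_onI)
      fix x y assume xy: "x \<in> ?I" "y \<in> ?I" "brace_lambda B b x = brace_lambda B b y"
      then have "cj (l b) (t x) = cj (l b) (t y)" using t_lambda[OF b, of x] t_lambda[OF b, of y] by simp
      then show "x = y" using inj_onD[OF t_inj, of x y] xy by (simp add: cj_inj)
    qed
    then show "card (brace_lambda B b ` ?I) = card ?I" by (rule card_image)
  qed
  have "brace_ideal ?I B"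
    unfolding brace_ideal_def brace_left_ideal_def using n1 n2 lam normal_imp_subgroup[OF n1] by blast
  then have "?I = {\<zero>} \<or> ?I = S" using simple_B by (simp add: simple_skew_brace_def)
  then show ?thesis
  proof
    assume I: "?I = {\<zero>}"
    have "inj_on \<phi> S"
    proof (rule inj_onI)
      fix a b assume ab: "a \<in> S" "b \<in> S" "\<phi> a = \<phi> b"
      have "\<phi> (a \<oplus> (\<ominus> b)) = 1" using add neg ab neg_closed by (simp add: right_inv)
      then have "a \<oplus> (\<ominus> b) \<in> ?I" using add_closed neg_closed ab by simp
      then have "t (a \<oplus> (\<ominus> b)) = 1" using I t_zero by simp
      then have "t a * inverse (t b) * t b = t b" using t_add t_neg ab neg_closed by simp
      then have "t a = t b" by (simp add: grp)
      then show "a = b" using inj_onD[OF t_inj] ab by blast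
    qed
    then show ?thesis ..
  next
    assume "?I = S"
    then show ?thesis by blast
  qed
qed

text \<open>\<open>R\<close> is a maximal proper \<open>\<Lambda>\<close>-invariant subgroup of \<open>A\<close> containing \<open>der A\<close>, so \<open>A\<close> modulo \<open>R\<close> is an
  abelian \<open>q\<close>-group. The \<open>q'\<close>-part of \<open>D\<close> acts trivially on it because \<open>d b\<close> commutes with the \<open>q\<close>-elements
  of \<open>D\<close>, and the \<open>q\<close>-part has a nontrivial fixed point. By maximality the whole action is trivial.\<close>

lemma trivial_action:
  obtains f :: "gperm \<Rightarrow> gperm" where "hom_on f G"
    "\<forall>a\<in>S. \<forall>b\<in>S. cj (f (l b)) (f (t a)) = f (t a)" "\<forall>x\<in>A. \<forall>y\<in>A. f x * f y = f y * f x" "\<exists>x\<in>A. f x \<noteq> 1"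
proof -
  define Fam where "Fam = {R. sgrp R \<and> der A \<subseteq> R \<and> R \<subseteq> A \<and> R \<noteq> A \<and> (\<forall>b\<in>S. cj (l b) ` R = R)}"
  have "der A \<noteq> A" using solvD[OF solv_A sA] A_nontrivial by blast
  moreover have "\<forall>b\<in>S. cj (l b) ` der A = der A" using der_cj[OF sA] l_A by simp
  ultimately have "der A \<in> Fam" unfolding Fam_def using sgrp_der[OF sA] der_sub[OF sA] by blast
  moreover have "finite Fam"
    by (rule finite_subset[of _ "Pow A"]) (use sgrpD(1)[OF sA] in \<open>auto simp: Fam_def\<close>)
  ultimately obtain R where RF: "R \<in> Fam" and max: "\<forall>L\<in>Fam. card L \<le> card R"
    using finite_max_exists[of Fam "der A" card] by blast
  have R: "sgrp R" "der A \<subseteq> R" "R \<subseteq> A" "R \<noteq> A" and Rl: "\<And>b. b \<in> S \<Longrightarrow> cj (l b) ` R = R"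
    using RF unfolding Fam_def by blast+
  have Rmax: "W = A" if W: "sgrp W" "R \<subseteq> W" "W \<subseteq> A" "\<forall>b\<in>S. cj (l b) ` W = W" "x \<in> W" "x \<notin> R" for W x
  proof (rule ccontr)
    assume "W \<noteq> A"
    then have "W \<in> Fam" unfolding Fam_def using W(1-4) R(2) by blast
    then have "card W \<le> card R" using max by blast
    then have "R = W" using W(2) sgrpD(1)[OF W(1)] by (simp add: card_seteq)
    then show False using W(5,6) by blast
  qed
  have RG: "nrml R G"
  proof (rule nrmlI[OF R(1)])
    show "R \<subseteq> G" using R(3) A_G by blast
    fix g x assume g: "g \<in> G" and x: "x \<in> R"
    obtain u a where ua: "u \<in> \<Lambda>" "a \<in> A" "g = u * a" using g unfolding G_def by (rule sprodE)
    obtain b where b: "b \<in> S" "u = l b" using ua(1) by (auto simp: \<Lambda>_def)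
    have "a * x * inverse a * inverse x \<in> R"
      using comms_in[OF ua(2), of x] x R(2,3) gen_sup[of "comms A"] unfolding der_def by blast
    then have "a * x * inverse a * inverse x * x \<in> R" using sgrpD(3)[OF R(1)] x by blast
    then have "cj a x \<in> R" by (simp add: cj_def grp)
    then have "cj u (cj a x) \<in> cj u ` R" by blast
    then show "cj g x \<in> R" using Rl[OF b(1)] by (simp add: ua(3) b(2) cj_cj)
  qed
  obtain f :: "gperm \<Rightarrow> gperm" where f: "hom_on f G" and ker: "\<forall>x\<in>G. f x = 1 \<longleftrightarrow> x \<in> R"
    using quotient_hom[OF sG RG] .
  have fA: "hom_on f A" by (rule hom_on_sub[OF f A_G])
  have kerA: "f x = 1 \<longleftrightarrow> x \<in> R" if "x \<in> A" for x using ker A_G that by blast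
  have tG: "t a \<in> G" and lG: "l a \<in> G" and dG: "d a \<in> G" if "a \<in> S" for a
    using t_A l_L d_D A_G L_G D_G that by blast+
  define V where "V = f ` A"
  have sV: "sgrp V" unfolding V_def by (rule sgrp_image[OF fA sA])
  have comm: "f x * f y = f y * f x" if "x \<in> A" "y \<in> A" for x y
  proof -
    have c: "x * y * inverse x * inverse y \<in> R"
      using comms_in[OF that] R(2) gen_sup[of "comms A"] unfolding der_def by blast
    then have "f (x * y * inverse x * inverse y) = 1" using kerA R(3) by blast
    moreover have "f (x * y * inverse x * inverse y) = f x * f y * inverse (f x) * inverse (f y)"
      using fA that sA by (simp add: hom_on_mult hom_on_inv sgrpD)
    ultimately have "f x * f y * inverse (f x) * inverse (f y) * (f y * f x) = f y * f x" by simp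
    then show ?thesis by (simp add: grp)
  qed
  have nV: "nil V" unfolding nil_def
  proof (intro allI impI)
    fix x y assume "x \<in> V" "y \<in> V"
    then show "x * y = y * x" unfolding V_def using comm by auto
  qed
  obtain x0 where x0: "x0 \<in> A" "x0 \<notin> R" using R(3,4) by blast
  then have "V \<noteq> {1}" using kerA unfolding V_def by blast
  then obtain q where q: "prime q" "q dvd card V" using sgrp_prime_dvd[OF sV] by blast
  have sP: "sgrp (prt q V)" by (rule sgrp_prt[OF q(1) sV nV])
  have fcj: "f (cj g x) = cj (f g) (f x)" if "g \<in> G" "x \<in> G" for g x
    by (rule hom_on_cj[OF f sG that])
  have VG: "cj (f g) v \<in> V" if "g \<in> G" "v \<in> V" for g v
  proof -
    obtain x where x: "x \<in> A" "v = f x" using \<open>v \<in> V\<close> by (auto simp: V_def)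
    then have "x \<in> G" using A_G by blast
    then have "cj (f g) v = f (cj g x)" using fcj that(1) x(2) by simp
    then show ?thesis using nrmlD(4)[OF A_nrml that(1) x(1)] by (simp add: V_def)
  qed
  \<comment> \<open>Invariant under \<Lambda> and strictly larger than \<open>R\<close>, hence equal
    to \<open>A\<close> by maximality. So \<open>V\<close> is a q-group.\<close>
  define E where "E = {x \<in> A. f x \<in> prt q V}"
  have "E = A"
  proof -
    obtain v where v: "v \<in> prt q V" "v \<noteq> 1" using sgrp_nontrivial[OF sP prt_nontrivial[OF q(1) sV q(2)]] by blast
    then obtain x where x: "x \<in> A" "v = f x" unfolding prt_def V_def by blast
    show ?thesis
    proof (rule Rmax[of _ x])
      show "sgrp E" unfolding E_def by (rule sgrp_vimage[OF fA sA sP])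
      show "R \<subseteq> E"
      proof
        fix y assume y: "y \<in> R"
        then have "f y = 1" using kerA R(3) by blast
        then show "y \<in> E" using y R(3) sgrpD(2)[OF sP] by (auto simp: E_def)
      qed
      then have finE: "finite E" using sgrpD(1)[OF sA] by (simp add: E_def)
      show "\<forall>b\<in>S. cj (l b) ` E = E"
      proof (rule ballI, rule cj_image_eqI[OF finE])
        fix b y assume b: "b \<in> S" and y: "y \<in> E"
        then have yA: "y \<in> A" "f y \<in> V" "pel q (f y)" by (auto simp: E_def prt_def)
        have "y \<in> G" using yA(1) A_G by blast
        then have "f (cj (l b) y) = cj (f (l b)) (f y)" using fcj lG[OF b] by blast
        moreover have "cj (f (l b)) (f y) \<in> prt q V"
          using VG[OF lG[OF b] yA(2)] yA(3) by (simp add: prt_def pel_cj)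
        moreover have "cj (l b) y \<in> A" using l_A[OF b] yA(1) by blast
        ultimately show "cj (l b) y \<in> E" by (simp add: E_def)
      qed
      show "x \<in> E" "x \<notin> R" using x v kerA[OF x(1)] by (auto simp: E_def)
    qed (auto simp: E_def)
  qed
  then have "V \<subseteq> prt q V" unfolding V_def E_def by blast
  then have "prt q V = V" using prt_sub[of q V] by blast
  then have pV: "pgp q V" using pgp_prt[OF q(1) sV nV] by simp
  define RB where "RB = {b \<in> S. t b \<in> R}"
  have RBS: "RB \<subseteq> S" by (auto simp: RB_def)
  \<comment> \<open>\<open>R\<close> is \<Lambda>-invariant, so \<open>RB\<close> is also closed
    under the multiplication. Thus \<open>Z\<close> is a subgroup of \<open>D\<close>, of the same
    index as \<open>R\<close> in \<open>A\<close>.\<close>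
  define Z where "Z = d ` RB"
  have ZD: "Z \<subseteq> D" unfolding Z_def D_def using RBS by blast
  have sZ: "sgrp Z"
  proof (rule sgrp_closed[OF sD ZD])
    have "\<one> \<in> RB" using zero_closed t_zero sgrpD(2)[OF R(1)] one_eq_zero by (simp add: RB_def)
    moreover have "d \<one> = 1" using hom_image_props(1)[of B d] d_mult mult.group_axioms by simp
    ultimately show "1 \<in> Z" unfolding Z_def by (intro image_eqI[of _ _ "\<one>"]) simp_all
    fix x y assume "x \<in> Z" "y \<in> Z"
    then obtain a b where ab: "a \<in> RB" "b \<in> RB" "x = d a" "y = d b" by (auto simp: Z_def)
    then have S: "a \<in> S" "b \<in> S" and tR: "t a \<in> R" "t b \<in> R" by (auto simp: RB_def)
    have "cj (l a) (t b) \<in> R" using Rl[OF S(1)] tR(2) by blast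
    then have "t (a \<otimes> b) \<in> R" unfolding t_mult[OF S] by (rule sgrpD(3)[OF R(1) tR(1)])
    then have "a \<otimes> b \<in> RB" using mult_closed[OF S] by (simp add: RB_def)
    then show "x * y \<in> Z" unfolding Z_def ab(3,4) d_mult[OF S, symmetric] by blast
  qed
  have cardD: "card D = card V * card Z"
  proof -
    have "card A = card ((\<lambda>g. f g * 1) ` A) * card {g \<in> A. f g * 1 = 1}"
      by (rule orbit_card[OF sA]) (simp_all add: hom_on_mult[OF fA] hom_on_one[OF fA sA] mult.assoc)
    moreover have "{g \<in> A. f g * 1 = 1} = R" using kerA R(3) by auto
    ultimately have "card A = card V * card R" by (simp add: V_def)
    moreover have "card A = card S" "card D = card S" unfolding A_def D_def
      by (simp_all add: card_image[OF t_inj] card_image[OF d_inj])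
    moreover have "R = t ` RB" using R(3) by (auto simp: RB_def A_def)
    moreover have "card (t ` RB) = card RB" "card Z = card RB" unfolding Z_def
      by (simp_all add: card_image[OF inj_on_subset[OF t_inj RBS]] card_image[OF inj_on_subset[OF d_inj RBS]])
    ultimately show ?thesis by simp
  qed
  have nZ: "nil Z" by (rule nil_sub[OF nil_D ZD])
  \<comment> \<open>The index of \<open>Z\<close> in \<open>D\<close> is the order of
    \<open>V\<close>, a power of q, so the s-parts of the two nilpotent groups have the same
    order.\<close>
  have prt_Z: "prt s D \<subseteq> Z" if s: "prime s" "s \<noteq> q" for s
  proof -
    obtain k where k: "card V = q ^ k" using pV by (auto simp: pgp_def)
    have "\<not> s dvd q ^ k" using s q(1) by (metis prime_dvd_power primes_dvd_imp_eq)
    then have "multiplicity s (card D) = multiplicity s (card Z)"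
      unfolding cardD k using s(1) q(1) sgrp_card_pos[OF sZ] prime_gt_0_nat[OF q(1)]
      by (simp add: prime_elem_multiplicity_mult_distrib not_dvd_imp_multiplicity_0)
    then have "card (prt s Z) = card (prt s D)"
      using sylD(4)[OF prt_syl[OF s(1) sZ nZ]] sylD(4)[OF prt_syl[OF s(1) sD nil_D]] by simp
    moreover have "prt s Z \<subseteq> prt s D" using ZD by (auto simp: prt_def)
    moreover have "finite (prt s D)" using sgrpD(1)[OF sgrp_prt[OF s(1) sD nil_D]] .
    ultimately have "prt s Z = prt s D" by (intro card_subset_eq)
    then show ?thesis using prt_sub by blast
  qed
  have in_RB: "b \<in> RB" if b: "b \<in> S" "d b \<in> Z" for b
  proof -
    obtain a where a: "a \<in> RB" "d b = d a" using b(2) unfolding Z_def by blast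
    then have "b = a" using inj_onD[OF d_inj a(2) b(1)] RBS by blast
    then show ?thesis using a(1) by simp
  qed
  have f1: "f (t b) = 1" if "b \<in> RB" for b using that kerA[of "t b"] R(3) by (auto simp: RB_def)
  have ftm: "f (t (a \<otimes> b)) = f (t a) * cj (f (l a)) (f (t b))" if "a \<in> S" "b \<in> S" for a b
  proof -
    have "cj (l a) (t b) \<in> A" using l_A[OF that(1)] t_A[OF that(2)] by blast
    then show ?thesis using that fA by (simp add: t_mult hom_on_mult[OF fA] t_A fcj lG tG)
  qed
  have decomp: "\<exists>c\<in>S. pel q (d c) \<and> f (t x) = f (t c)" if x: "x \<in> S" for x
  proof -
    let ?K = "sprod Z (prt q D)"
    have sQ: "sgrp (prt q D)" by (rule sgrp_prt[OF q(1) sD nil_D])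
    have "?K = D"
    proof (rule prt_subset_all[OF _ sD nil_D])
      show "sgrp ?K"
      proof (rule sgrp_sprod[OF sZ sQ])
        fix h assume "h \<in> Z"
        then show "cj h ` prt q D = prt q D" using prt_cj[OF cj_image_self[OF sD]] ZD by blast
      qed
      show "?K \<subseteq> D" by (rule sprod_sub[OF sD ZD prt_sub])
      fix s :: nat assume s: "prime s"
      show "prt s D \<subseteq> ?K"
      proof (cases "s = q")
        case True
        then show ?thesis using sprod_right[OF sgrpD(2)[OF sZ]] by simp
      next
        case False
        then show ?thesis using prt_Z[OF s] sprod_left[OF sgrpD(2)[OF sQ]] by blast
      qed
    qed
    \<comment> \<open>The factor from \<open>Z\<close> must stand on the right, where it disappears
      under f, so it is the inverse of \<open>d x\<close> that is decomposed.\<close>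
    moreover have "inverse (d x) \<in> D" by (rule sgrpD(4)[OF sD d_D[OF x]])
    ultimately have "inverse (d x) \<in> ?K" by simp
    then obtain z c where zc: "z \<in> Z" "c \<in> prt q D" "inverse (d x) = z * c" by (rule sprodE)
    have "inverse (inverse (d x)) = inverse c * inverse z" unfolding zc(3) by (rule inv_mult)
    then have dx: "d x = inverse c * inverse z" by (simp only: inv_inv)
    have "inverse c \<in> prt q D" by (rule sgrpD(4)[OF sQ zc(2)])
    then obtain c' where c': "c' \<in> S" "inverse c = d c'" "pel q (d c')" by (auto simp: prt_def D_def)
    obtain z' where z': "z' \<in> RB" "inverse z = d z'" using sgrpD(4)[OF sZ zc(1)] by (auto simp: Z_def)
    have z'S: "z' \<in> S" using z'(1) RBS by blast
    have "d x = d (c' \<otimes> z')" unfolding dx c'(2) z'(2) d_mult[OF c'(1) z'S] ..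
    then have "x = c' \<otimes> z'" using inj_onD[OF d_inj _ x mult_closed[OF c'(1) z'S]] by blast
    then have "f (t x) = f (t c')" using ftm[OF c'(1) z'S] f1[OF z'(1)] by (simp add: cj_one)
    then show ?thesis using c' by blast
  qed
  \<comment> \<open>As b lies in \<open>RB\<close>, the translation \<open>t b\<close> vanishes
    under f and \<open>d b\<close> acts as \<open>l b\<close>. Modulo \<open>R\<close>, x may be
    replaced by c with \<open>d c\<close> a q-element. Then b and c commute multiplicatively, and
    comparing \<open>t (b \<otimes> c)\<close> with \<open>t (c \<otimes> b)\<close> modulo
    \<open>R\<close> shows that \<open>l b\<close> fixes the class of \<open>t c\<close>.\<close>
  have act1: "cj (f (d b)) (f (t x)) = f (t x)"
    if b: "b \<in> S" "pel s (d b)" and s: "prime s" "s \<noteq> q" and x: "x \<in> S" for b s x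
  proof -
    have "d b \<in> prt s D" unfolding prt_def using b(2) d_D[OF b(1)] by blast
    with prt_Z[OF s] have "d b \<in> Z" by (rule subsetD)
    then have bR: "b \<in> RB" by (rule in_RB[OF b(1)])
    have "f (d b) = f (t b * l b)" by (rule arg_cong[OF d_eq])
    also have "\<dots> = f (t b) * f (l b)" by (rule hom_on_mult[OF f tG[OF b(1)] lG[OF b(1)]])
    finally have "f (d b) = f (t b) * f (l b)" .
    then have fd: "f (d b) = f (l b)" by (simp only: f1[OF bR] mult_1_left)
    obtain c where c: "c \<in> S" "pel q (d c)" "f (t x) = f (t c)" using decomp[OF x] by blast
    have "d b * d c = d c * d b"
      using nil_D s q(1) d_D[OF b(1)] d_D[OF c(1)] b(2) c(2) unfolding nil_def by blast
    then have "d (b \<otimes> c) = d (c \<otimes> b)" by (simp add: d_mult b(1) c(1))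
    then have "b \<otimes> c = c \<otimes> b" using inj_onD[OF d_inj] mult_closed b(1) c(1) by blast
    then have "f (t (b \<otimes> c)) = f (t (c \<otimes> b))" by simp
    then have "cj (f (l b)) (f (t c)) = f (t c)"
      unfolding ftm[OF b(1) c(1)] ftm[OF c(1) b(1)] f1[OF bR] by (simp add: cj_one)
    then show ?thesis unfolding fd c(3) .
  qed
  obtain v where v: "v \<in> V" "v \<noteq> 1" "\<forall>g\<in>prt q D. cj (f g) v = v"
  proof -
    let ?P = "prt q D"
    have pP: "pgp q ?P" by (rule pgp_prt[OF q(1) sD nil_D])
    have PG: "?P \<subseteq> G" using prt_sub D_G by blast
    have c: "[card V = card {x \<in> V. \<forall>g\<in>?P. cj (f g) x = x}] (mod q)"
    proof (rule pgp_fixed_points[OF q(1) pP sgrpD(1)[OF sV]])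
      show "cj (f g) x \<in> V" if "g \<in> ?P" "x \<in> V" for g x using VG PG that by blast
      show "cj (f (g * h)) x = cj (f g) (cj (f h) x)" if gh: "g \<in> ?P" "h \<in> ?P" for g h x
      proof -
        have "f (g * h) = f g * f h" using hom_on_mult[OF f] gh PG by blast
        then show ?thesis by (simp add: cj_cj)
      qed
      show "cj (f 1) x = x" for x by (simp add: hom_on_one[OF f sG] cj_one)
    qed
    \<comment> \<open>A q-group acts on the nontrivial q-group \<open>V\<close>, so the number of
      fixed points is a multiple of q and the identity is not the only one.\<close>
    have dv: "q dvd card {x \<in> V. \<forall>g\<in>?P. cj (f g) x = x}" by (rule iffD1[OF cong_dvd_iff[OF c] q(2)])
    have "{x \<in> V. \<forall>g\<in>?P. cj (f g) x = x} \<noteq> {1}"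
    proof
      assume "{x \<in> V. \<forall>g\<in>?P. cj (f g) x = x} = {1}"
      then have "q dvd 1" using dv by simp
      then show False using q(1) by simp
    qed
    moreover have "1 \<in> {x \<in> V. \<forall>g\<in>?P. cj (f g) x = x}" using sgrpD(2)[OF sV] by (simp add: cj_one)
    ultimately have "\<exists>v\<in>V. v \<noteq> 1 \<and> (\<forall>g\<in>?P. cj (f g) v = v)" by blast
    then show ?thesis using that by blast
  qed
  obtain a0 where a0: "a0 \<in> S" "v = f (t a0)" using v(1) by (auto simp: V_def A_def)
  have fixD: "cj (f (d b)) v = v" if b: "b \<in> S" for b
  proof -
    define C where "C = {g \<in> D. cj (f g) v = v}"
    have "C = D"
    proof (rule prt_subset_all[OF _ sD nil_D])
      show "sgrp C"
      proof (rule sgrp_closed[OF sD])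
        show "1 \<in> C" using sgrpD(2)[OF sD] by (simp add: C_def hom_on_one[OF f sG] cj_one)
        fix g h assume gh: "g \<in> C" "h \<in> C"
        have gD: "g \<in> D" "h \<in> D" using gh by (auto simp: C_def)
        have "f (g * h) = f g * f h" using hom_on_mult[OF f] gD D_G by blast
        then have "cj (f (g * h)) v = cj (f g) (cj (f h) v)" by (simp add: cj_cj)
        then show "g * h \<in> C" using gh sgrpD(3)[OF sD gD] by (simp add: C_def)
      qed (auto simp: C_def)
      fix s :: nat assume s: "prime s"
      show "prt s D \<subseteq> C"
      proof
        fix g assume g: "g \<in> prt s D"
        show "g \<in> C"
        proof (cases "s = q")
          case True
          then show ?thesis using g v(3) prt_sub by (auto simp: C_def)
        next
          case False
          obtain b where b: "b \<in> S" "g = d b" "pel s (d b)" using g by (auto simp: prt_def D_def)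
          have "cj (f g) v = v" unfolding b(2) a0(2) by (rule act1[OF b(1,3) s False a0(1)])
          then show ?thesis using d_D[OF b(1)] by (simp add: C_def b(2))
        qed
      qed
    qed (auto simp: C_def)
    then show ?thesis using d_D[OF b] by (auto simp: C_def)
  qed
  \<comment> \<open>\<open>V\<close> is abelian, so the translation \<open>t b\<close> acts
    trivially on it, and \<open>l b\<close> acts as \<open>d b\<close> does.\<close>
  have fixl: "cj (f (l b)) v = v" if b: "b \<in> S" for b
  proof -
    have "f (d b) = f (t b * l b)" by (rule arg_cong[OF d_eq])
    also have "\<dots> = f (t b) * f (l b)" by (rule hom_on_mult[OF f tG[OF b] lG[OF b]])
    finally have "f (d b) = f (t b) * f (l b)" .
    then have "cj (f (t b)) (cj (f (l b)) v) = v" using fixD[OF b] by (simp add: cj_cj)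
    then have "cj (f (l b)) v = cj (inverse (f (t b))) v" by (metis cj_cancel(1))
    moreover have "cj (f (t b)) v = v" unfolding a0(2) cj_fix_iff using comm[OF t_A[OF b] t_A[OF a0(1)]] .
    then have "cj (inverse (f (t b))) v = v" by (metis cj_cancel(1))
    ultimately show ?thesis by simp
  qed
  define W where "W = {x \<in> A. \<forall>b\<in>S. cj (f (l b)) (f x) = f x}"
  have finW: "finite W" using sgrpD(1)[OF sA] by (simp add: W_def)
  have WA: "W = A"
  proof (rule Rmax[of _ "t a0"])
    show "sgrp W"
    proof (rule sgrp_closed[OF sA])
      show "1 \<in> W" using sgrpD(2)[OF sA] by (simp add: W_def hom_on_one[OF fA sA] cj_one)
      fix x y assume xy: "x \<in> W" "y \<in> W"
      then have xyA: "x \<in> A" "y \<in> A" by (auto simp: W_def)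
      have "cj (f (l b)) (f (x * y)) = f (x * y)" if "b \<in> S" for b
      proof -
        have "cj (f (l b)) (f x) = f x" "cj (f (l b)) (f y) = f y" using xy that unfolding W_def by blast+
        then show ?thesis by (simp add: hom_on_mult[OF fA xyA] cj_mult)
      qed
      then show "x * y \<in> W" using sgrpD(3)[OF sA xyA] by (simp add: W_def)
    qed (auto simp: W_def)
    show "R \<subseteq> W"
    proof
      fix x assume x: "x \<in> R"
      then have "f x = 1" "x \<in> A" using kerA R(3) by blast+
      then show "x \<in> W" by (simp add: W_def cj_one)
    qed
    show "\<forall>b\<in>S. cj (l b) ` W = W"
    proof (rule ballI, rule cj_image_eqI[OF finW])
      fix c x assume c: "c \<in> S" and x: "x \<in> W"
      then have xA: "x \<in> A" "cj (f (l c)) (f x) = f x" by (auto simp: W_def)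
      have "x \<in> G" using xA(1) A_G by blast
      then have "f (cj (l c) x) = f x" using fcj[OF lG[OF c]] xA(2) by simp
      moreover have "cj (l c) x \<in> A" using l_A[OF c] xA(1) by blast
      ultimately show "cj (l c) x \<in> W" using x by (simp add: W_def)
    qed
    show "t a0 \<in> W" using t_A[OF a0(1)] fixl unfolding W_def a0(2) by blast
    show "t a0 \<notin> R" using kerA[OF t_A[OF a0(1)]] v(2) a0(2) by simp
  qed (auto simp: W_def)
  have "\<forall>a\<in>S. \<forall>b\<in>S. cj (f (l b)) (f (t a)) = f (t a)"
  proof (intro ballI)
    fix a b assume ab: "a \<in> S" "b \<in> S"
    have "t a \<in> W" using t_A[OF ab(1)] WA by simp
    then show "cj (f (l b)) (f (t a)) = f (t a)" using ab(2) unfolding W_def by blast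
  qed
  moreover have "\<exists>x\<in>A. f x \<noteq> 1" using x0 kerA by blast
  ultimately show ?thesis using that[OF f] comm by blast
qed

text \<open>Since the action modulo \<open>R\<close> is trivial, f composed with t turns both
  operations into the same commutative product. It is not constantly 1, so it is injective, and the
  identities can be pulled back.\<close>

lemma mult_eq_add:
  assumes ab: "a \<in> S" "b \<in> S" shows "a \<otimes> b = a \<oplus> b" "a \<oplus> b = b \<oplus> a"
proof -
  obtain f :: "gperm \<Rightarrow> gperm" where f: "hom_on f G"
    and l: "\<forall>a\<in>S. \<forall>b\<in>S. cj (f (l b)) (f (t a)) = f (t a)"
    and comm: "\<forall>x\<in>A. \<forall>y\<in>A. f x * f y = f y * f x" and ne: "\<exists>x\<in>A. f x \<noteq> 1"
    using trivial_action .
  have tG: "t a \<in> G" and lG: "l a \<in> G" if "a \<in> S" for a using t_A l_L A_G L_G that by blast+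
  have add: "f (t (a \<oplus> b)) = f (t a) * f (t b)" if "a \<in> S" "b \<in> S" for a b
    using t_add[OF that] hom_on_mult[OF f tG[OF that(1)] tG[OF that(2)]] by simp
  have mul: "f (t (a \<otimes> b)) = f (t a) * f (t b)" if "a \<in> S" "b \<in> S" for a b
  proof -
    have "cj (l a) (t b) \<in> G" by (rule cj_in[OF sG lG[OF that(1)] tG[OF that(2)]])
    then have "f (t (a \<otimes> b)) = f (t a) * f (cj (l a) (t b))"
      unfolding t_mult[OF that] by (rule hom_on_mult[OF f tG[OF that(1)]])
    also have "f (cj (l a) (t b)) = f (t b)"
      using hom_on_cj[OF f sG lG[OF that(1)] tG[OF that(2)]] l that by simp
    finally show ?thesis .
  qed
  have "inj_on (\<lambda>a. f (t a)) S \<or> (\<forall>a\<in>S. f (t a) = 1)"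
    by (rule hom_injective_or_trivial) (simp_all add: add mul)
  then have inj: "inj_on (\<lambda>a. f (t a)) S" using ne by (auto simp: A_def)
  show "a \<otimes> b = a \<oplus> b" by (rule inj_onD[OF inj]) (simp_all add: add mul ab mult_closed add_closed)
  have "f (t a) * f (t b) = f (t b) * f (t a)" using comm t_A ab by blast
  then show "a \<oplus> b = b \<oplus> a" by (intro inj_onD[OF inj]) (simp_all add: add ab add_closed)
qed

text \<open>The subgroup generated by an element of prime order is normal because \<open>A\<close>
  is abelian. The two operations agree, so the quotient map respects both. It kills x and is not
  injective, hence it is trivial.\<close>

lemma A_cyclic: obtains p x where "prime p" "x \<noteq> 1" "x ^ p = 1" "A = range (\<lambda>n::nat. x ^ n)"
proof -
  obtain p where p: "prime p" "p dvd card A" using sgrp_prime_dvd[OF sA A_nontrivial] by blast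
  obtain x where x: "x \<in> A" "x \<noteq> 1" "x ^ p = 1" using cauchy[OF p(1) sA p(2)] .
  have sX: "sgrp (gen {x})" and XA: "gen {x} \<subseteq> A" using sgrp_gen[OF sA] gen_least[OF sA] x(1) by blast+
  have "nrml (gen {x}) A"
  proof (rule nrmlI[OF sX XA])
    fix g y assume g: "g \<in> A" and y: "y \<in> gen {x}"
    obtain a b where "a \<in> S" "b \<in> S" "g = t a" "y = t b" using g y XA by (auto simp: A_def)
    then have "g * y = y * g" using mult_eq_add(2)[of a b] by (simp add: t_add[symmetric])
    then have "cj g y = y" by (simp add: cj_fix_iff)
    then show "cj g y \<in> gen {x}" using y by simp
  qed
  then obtain h :: "gperm \<Rightarrow> gperm" where h: "hom_on h A" "\<forall>y\<in>A. h y = 1 \<longleftrightarrow> y \<in> gen {x}"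
    using quotient_hom[OF sA] by blast
  have "inj_on (\<lambda>a. h (t a)) S \<or> (\<forall>a\<in>S. h (t a) = 1)"
    by (rule hom_injective_or_trivial) (simp_all add: mult_eq_add(1) t_add hom_on_mult[OF h(1)] t_A)
  moreover have "\<not> inj_on (\<lambda>a. h (t a)) S"
  proof
    assume inj: "inj_on (\<lambda>a. h (t a)) S"
    obtain s where s: "s \<in> S" "x = t s" using x(1) by (auto simp: A_def)
    have "h (t s) = h (t \<zero>)" using h x(1) s(2) gen_sup[of "{x}"] t_zero hom_on_one[OF h(1) sA] by auto
    then have "s = \<zero>" using inj_onD[OF inj _ s(1) zero_closed] by blast
    then show False using s(2) t_zero x(2) by simp
  qed
  ultimately have "A \<subseteq> gen {x}" using h(2) by (auto simp: A_def)
  then have "A = gen {x}" using XA by blast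
  then show ?thesis using that[OF p(1) x(2,3)] gen_single[OF sA x(1)] by simp
qed

lemma isomorphic_cyclic:
  obtains p :: nat where "prime p" "brace_isomorphic B (Triv (integer_mod_group p))"
proof -
  obtain p x where p: "prime p" and x: "x \<noteq> 1" "x ^ p = 1" "A = range (\<lambda>n::nat. x ^ n)" using A_cyclic .
  have p0: "p > 0" by (rule prime_gt_0_nat[OF p])
  have xm: "x ^ (n mod p) = x ^ n" for n
  proof -
    have "x ^ n = x ^ (p * (n div p) + n mod p)" by simp
    also have "\<dots> = x ^ (n mod p)" by (simp only: power_add power_mult x(2) power_one mult_1_left)
    finally show ?thesis by simp
  qed
  have inj0: "i = j" if ij: "i \<le> j" "j < p" "x ^ i = x ^ j" for i j
  proof (rule ccontr)
    assume "i \<noteq> j"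
    then have k: "0 < j - i" "j - i < p" using ij by auto
    have "x ^ i * x ^ (j - i) = x ^ j" using ij(1) power_add[of x i "j - i"] by simp
    then have "x ^ i * x ^ (j - i) = x ^ i * 1" using ij(3) by simp
    then have "x ^ (j - i) = 1" by (simp only: mul_left_cancel)
    moreover have "coprime (j - i) p" using k p by (metis coprime_commute dvd_imp_le linorder_not_le prime_imp_coprime)
    ultimately show False using pow_coprime_one[of x "j - i" p] x(1,2) k(1) by blast
  qed
  have inj: "i = j" if "i < p" "j < p" "x ^ i = x ^ j" for i j
    using inj0[of i j] inj0[of j i] that by (cases "i \<le> j") auto
  have "\<forall>s\<in>S. \<exists>i<p. t s = x ^ i"
  proof
    fix s assume "s \<in> S"
    then have "t s \<in> range (\<lambda>n. x ^ n)" using t_A x(3) by simp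
    then obtain n where "t s = x ^ n" by (elim rangeE)
    then have "t s = x ^ (n mod p)" by (simp add: xm)
    then show "\<exists>i<p. t s = x ^ i" using p0 by (intro exI[of _ "n mod p"]) simp
  qed
  then obtain e where e: "\<forall>s\<in>S. e s < p \<and> t s = x ^ e s" using bchoice[of S "\<lambda>s i. i < p \<and> t s = x ^ i"] by blast
  define \<psi> where "\<psi> s = int (e s)" for s
  have bij: "bij_betw \<psi> S {0..<int p}"
    unfolding bij_betw_def
  proof
    show "inj_on \<psi> S"
    proof (rule inj_onI)
      fix a b assume ab: "a \<in> S" "b \<in> S" "\<psi> a = \<psi> b"
      then have "t a = t b" using e by (simp add: \<psi>_def)
      then show "a = b" using inj_onD[OF t_inj] ab by blast
    qed
    show "\<psi> ` S = {0..<int p}"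
    proof
      show "\<psi> ` S \<subseteq> {0..<int p}" using e by (auto simp: \<psi>_def)
      show "{0..<int p} \<subseteq> \<psi> ` S"
      proof
        fix i assume i: "i \<in> {0..<int p}"
        have "x ^ nat i \<in> A" using x(3) by blast
        then obtain s where s: "s \<in> S" "x ^ nat i = t s" by (auto simp: A_def)
        then have "e s = nat i" using inj[of "e s" "nat i"] e i by auto
        then have "\<psi> s = i" using i by (simp add: \<psi>_def)
        then show "i \<in> \<psi> ` S" using s(1) by blast
      qed
    qed
  qed
  have hom: "\<psi> (a \<oplus> b) = (\<psi> a + \<psi> b) mod int p" if ab: "a \<in> S" "b \<in> S" for a b
  proof -
    have "x ^ e (a \<oplus> b) = x ^ ((e a + e b) mod p)"
      using e ab add_closed[OF ab] t_add[OF ab] by (simp add: xm power_add)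
    then have "e (a \<oplus> b) = (e a + e b) mod p" using inj e add_closed[OF ab] p0 by simp
    then show ?thesis by (simp add: \<psi>_def zmod_int)
  qed
  have "\<psi> \<in> brace_iso B (Triv (integer_mod_group p))"
    unfolding brace_iso_def iso_def hom_def using bij hom p0
    by (auto simp: Triv_def integer_mod_group_def mult_eq_add(1) bij_betw_def)
  then show ?thesis using that[OF p] by (auto simp: brace_isomorphic_def)
qed

end

theorem corollary3p2:
  fixes B :: "('a, 'm) ring_scheme"
  assumes "finite (carrier B)"
    and "simple_skew_brace B"
    and "nilpotent_group B"
  shows "\<exists>p::nat. Factorial_Ring.prime p \<and> brace_isomorphic B (Triv (integer_mod_group p))"
proof -
  have sb: "skew_brace B" using assms(2) by (simp add: simple_skew_brace_def)
  obtain t d :: "'a \<Rightarrow> gperm" where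
    "\<forall>a\<in>carrier B. \<forall>b\<in>carrier B. t (a \<oplus>\<^bsub>B\<^esub> b) = t a * t b" "inj_on t (carrier B)"
    "\<forall>a\<in>carrier B. \<forall>b\<in>carrier B. d (a \<otimes>\<^bsub>B\<^esub> b) = d a * d b" "inj_on d (carrier B)"
    "\<forall>a\<in>carrier B. \<forall>b\<in>carrier B. d a * t b = t (a \<otimes>\<^bsub>B\<^esub> b) * inverse (t a) * d a"
    using skew_brace.permutations[OF sb assms(1)] .
  then have "simple_nilpotent_brace B t d"
    by (intro simple_nilpotent_brace.intro sb simple_nilpotent_brace_axioms.intro assms) simp_all
  then show ?thesis using simple_nilpotent_brace.isomorphic_cyclic by blast
qed

end
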